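(* Consider the $n$-server queueing systems under the NBRW-Po$d$ scheme described in the context, where the graph sequence $\{G^{(n)}\}_n$ is a $k$-regular $\theta$-expander sequence (for some constant $\theta<k$) such that, for some constant $\alpha>0$, the girth of $G^{(n)}$ is greater than $2\lceil \alpha\log_{k-1} n\rceil+1$ for all sufficiently large $n$. Consider the dynamical system $\mathbf{x}(t)=(x_i(t))_{i\ge 0}\in[0,1]^{\mathbb{Z}_+}$ described by $$\frac{\mathrm{d}x_i}{\mathrm{d}t}=\lambda\,(x_{i-1}^d-x_i^d)-(x_i-x_{i+1})\quad (i\ge 1),\qquad x_0(t)\equiv 1 .$$ Let $\mathbf{X}^{(n)}(t)=(X^{(n)}_i(t))_{i\in\mathbb{Z}_+}$, where $X_i^{(n)}(t)$ is the proportion of the $n$ queues with length at least $i$ at time $t$. Suppose that (a) for each $n$, the random walkers are initialized to independent uniform random positions; (b) for each $n$, the initial queue-length vector $\mathbf{Q}^{(n)}(0)$ is deterministic; (c) $\lim_{n\to\infty}\|\mathbf{X}^{(n)}(0)-\mathbf{x}(0)\|_1=0$; (d) $\|\mathbf{x}(0)\|_1<+\infty$. Then for every finite $T>0$, $$\lim_{n\to\infty}\ \sup_{0\le t\le T}\|\mathbf{X}^{(n)}(t)-\mathbf{x}(t)\|_1=0\qquad\text{almost surely.}$$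
   Context: Model. Fix constants $0<\lambda<1$ and integers $d\ge 2$, $k\ge 3$. For each $n$ (in an infinite set of positive integers for which the graphs below are given) there are $n$ servers, identified with the vertices $[n]=\{1,\dots,n\}$ of a $k$-regular graph $G^{(n)}$; each server has its own queue. Jobs arrive according to a Poisson process of rate $\lambda n$. Service times are i.i.d. exponential with mean $1$; each server works whenever its queue is nonempty. $\mathbf{Q}^{(n)}(t)=(Q^{(n)}_1(t),\dots,Q^{(n)}_n(t))\in\mathbb{Z}_+^n$ is the vector of queue lengths at time $t$; $\mathbb{Z}_+=\{0,1,2,\dots\}$. NBRW-Po$d$ scheme. There are $d$ independent non-backtracking random walkers on $G^{(n)}$, independent of the arrivals and services. The state of a walker is a directed edge $(u,v)$ of $G^{(n)}$ (it is at $v$, having come from $u$); in one step it moves to $(v,w)$ with $w$ uniformly distributed over the $k-1$ neighbors of $v$ other than $u$. When a job arrives, it joins the shortest queue among the $d$ queues at the current positions of the walkers (ties broken arbitrarily, without knowledge of the future), and then each walker takes one step. "Independent uniform random positions" means that the $d$ initial directed edges are independent and uniform over all directed edges of $G^{(n)}$. Expander sequence. For a $k$-regular graph $G^{(n)}$ on $n$ vertices let $k=\mu_1\ge\mu_2\ge\dots\ge\mu_n$ be the eigenvalues of its adjacency matrix and $\mu^{(n)}=\max\{\mu_2,|\mu_n|\}$. The sequence is a $\theta$-expander sequence if $\limsup_{n\to\infty}\mu^{(n)}\le\theta$ where $\theta<k$ is a constant. (The constant $\theta$ is unrelated to the arrival parameter $\lambda$.) $\|\mathbf{x}\|_1=\sum_{i\ge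 0}|x_i|$. The systems for different $n$ are defined on one common probability space. *)

theory Defs
  imports "HOL-Probability.Probability" "Jordan_Normal_Form.Char_Poly"
begin

section \<open>Graphs\<close>

text \<open>A simple graph on the vertices \<open>{1..n}\<close> is a symmetric irreflexive relation \<open>G\<close>. The elements
  of \<open>G\<close> are then exactly the directed edges, and \<open>G `` {v}\<close> is the set of neighbors of \<open>v\<close>.\<close>

definition regular_graph :: "nat \<Rightarrow> nat \<Rightarrow> (nat \<times> nat) set \<Rightarrow> bool" where
  "regular_graph n k G \<longleftrightarrow>
     G \<subseteq> {1..n} \<times> {1..n} \<and> sym G \<and> irrefl G \<and> (\<forall>v\<in>{1..n}. card (G `` {v}) = k)"

definition is_cycle :: "(nat \<times> nat) set \<Rightarrow> nat list \<Rightarrow> bool" where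
  "is_cycle G vs \<longleftrightarrow> 3 \<le> length vs \<and> distinct vs \<and>
     (\<forall>i<length vs. (vs ! i, vs ! (Suc i mod length vs)) \<in> G)"

definition girth :: "(nat \<times> nat) set \<Rightarrow> enat" where
  "girth G = (INF vs\<in>Collect (is_cycle G). enat (length vs))"

text \<open>Matrix indices start at 0, vertices at 1.\<close>

definition adjacency_matrix :: "nat \<Rightarrow> (nat \<times> nat) set \<Rightarrow> real mat" where
  "adjacency_matrix n G = Matrix.mat n n (\<lambda>(i, j). if (Suc i, Suc j) \<in> G then 1 else 0)"

text \<open>The eigenvalues with multiplicity, in non-increasing order. An adjacency matrix is real
  symmetric, so the list has length \<open>n\<close>.\<close>

definition graph_spectrum :: "nat \<Rightarrow> (nat \<times> nat) set \<Rightarrow> real list" where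
  "graph_spectrum n G =
     rev (sorted_list_of_multiset (proots (char_poly (adjacency_matrix n G))))"

definition second_eigenvalue :: "nat \<Rightarrow> (nat \<times> nat) set \<Rightarrow> real" where
  "second_eigenvalue n G = max (graph_spectrum n G ! 1) \<bar>graph_spectrum n G ! (n - 1)\<bar>"

text \<open>The filter \<open>n \<rightarrow> \<infinity>\<close> along an infinite set \<open>N\<close> of indices.\<close>

definition along :: "nat set \<Rightarrow> nat filter" where
  "along N = inf sequentially (principal N)"

definition expander_sequence :: "nat set \<Rightarrow> nat \<Rightarrow> real \<Rightarrow> (nat \<Rightarrow> (nat \<times> nat) set) \<Rightarrow> bool" where
  "expander_sequence N k \<theta> G \<longleftrightarrow> \<theta> < real k \<and> (\<forall>n\<in>N. regular_graph n k (G n)) \<and>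
     Limsup (along N) (\<lambda>n. ereal (second_eigenvalue n (G n))) \<le> ereal \<theta>"


section \<open>Non-backtracking random walks\<close>

definition nb_step :: "(nat \<times> nat) set \<Rightarrow> nat \<times> nat \<Rightarrow> (nat \<times> nat) pmf" where
  "nb_step G e = map_pmf (Pair (snd e)) (pmf_of_set (G `` {snd e} - {fst e}))"

text \<open>The initial distribution on the directed edges is left open here.\<close>

definition (in prob_space) nbrw :: "(nat \<times> nat) set \<Rightarrow> (nat \<Rightarrow> 'a \<Rightarrow> nat \<times> nat) \<Rightarrow> bool" where
  "nbrw G W \<longleftrightarrow>
     (\<forall>j. random_variable (count_space UNIV) (W j)) \<and> (AE \<omega> in M. W 0 \<omega> \<in> G) \<and>
     (\<forall>j e. prob {\<omega>\<in>space M. \<forall>i\<le>Suc j. W i \<omega> = e i} =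
        prob {\<omega>\<in>space M. \<forall>i\<le>j. W i \<omega> = e i} * pmf (nb_step G (e j)) (e (Suc j)))"

definition (in prob_space) uniform_start ::
  "(nat \<times> nat) set \<Rightarrow> nat \<Rightarrow> (nat \<Rightarrow> nat \<Rightarrow> 'a \<Rightarrow> nat \<times> nat) \<Rightarrow> bool" where
  "uniform_start G d W \<longleftrightarrow>
     indep_vars (\<lambda>_. count_space UNIV) (\<lambda>l. W l 0) {..<d} \<and>
     (\<forall>l<d. distr M (count_space UNIV) (W l 0) = measure_pmf (pmf_of_set G))"


section \<open>The queueing system\<close>

text \<open>Arguments throughout: arrivals are counted from 0; \<open>E 0\<close> is the time of arrival 0 and \<open>E j\<close>, for
  \<open>j > 0\<close>, the time between arrivals \<open>j - 1\<close> and \<open>j\<close>, \<open>S v m\<close> is the duration of the \<open>m\<close>-th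
  service performed by server \<open>v\<close> (\<open>m\<close> from 0), \<open>W l j\<close> the directed edge
  of walker \<open>l\<close> seen by arrival \<open>j\<close>, \<open>U\<close> a \<open>\<sigma>\<close>-algebra of additional randomness available for breaking
  ties, \<open>c j\<close> the server joined by arrival \<open>j\<close>, and \<open>Q v t\<close> the length of queue \<open>v\<close> at
  time \<open>t\<close>.\<close>

definition arrival_time :: "(nat \<Rightarrow> 'a \<Rightarrow> real) \<Rightarrow> nat \<Rightarrow> 'a \<Rightarrow> real" where
  "arrival_time E j \<omega> = (\<Sum>i\<le>j. E i \<omega>)"

definition joined ::
  "(nat \<Rightarrow> 'a \<Rightarrow> real) \<Rightarrow> (nat \<Rightarrow> 'a \<Rightarrow> nat) \<Rightarrow> nat \<Rightarrow> real \<Rightarrow> 'a \<Rightarrow> nat" where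
  "joined E c v t \<omega> = card {j. arrival_time E j \<omega> \<le> t \<and> c j \<omega> = v}"

definition busy_time :: "(nat \<Rightarrow> real \<Rightarrow> 'a \<Rightarrow> nat) \<Rightarrow> nat \<Rightarrow> real \<Rightarrow> 'a \<Rightarrow> real" where
  "busy_time Q v t \<omega> = measure lborel {s\<in>{0..t}. 0 < Q v s \<omega>}"

definition departed ::
  "(nat \<Rightarrow> nat \<Rightarrow> 'a \<Rightarrow> real) \<Rightarrow> (nat \<Rightarrow> real \<Rightarrow> 'a \<Rightarrow> nat) \<Rightarrow> nat \<Rightarrow> real \<Rightarrow> 'a \<Rightarrow> nat" where
  "departed S Q v t \<omega> = card {m. (\<Sum>i\<le>m. S v i \<omega>) \<le> busy_time Q v t \<omega>}"

datatype source = Interarrival nat | Service nat nat | Walker nat | Tie_Breaking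

definition sources :: "nat \<Rightarrow> nat \<Rightarrow> source set" where
  "sources n d = {Interarrival j | j. True} \<union> {Service v m | v m. v \<in> {1..n}} \<union>
     {Walker l | l. l < d} \<union> {Tie_Breaking}"

text \<open>A walker contributes the \<open>\<sigma>\<close>-algebra generated by its whole trajectory.\<close>

definition source_algebra :: "'a measure \<Rightarrow> (nat \<Rightarrow> 'a \<Rightarrow> real) \<Rightarrow> (nat \<Rightarrow> nat \<Rightarrow> 'a \<Rightarrow> real) \<Rightarrow>
    (nat \<Rightarrow> nat \<Rightarrow> 'a \<Rightarrow> nat \<times> nat) \<Rightarrow> 'a measure \<Rightarrow> source \<Rightarrow> 'a measure" where
  "source_algebra M E S W U x = (case x of
     Interarrival j \<Rightarrow> vimage_algebra (space M) (E j) borel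
   | Service v m \<Rightarrow> vimage_algebra (space M) (S v m) borel
   | Walker l \<Rightarrow> vimage_algebra (space M) (\<lambda>\<omega> j. W l j \<omega>) (\<Pi>\<^sub>M j\<in>UNIV. count_space UNIV)
   | Tie_Breaking \<Rightarrow> U)"

text \<open>What is known when job \<open>j\<close> is routed: the additional randomness, the arrival times and walker
  states up to arrival \<open>j\<close>, and the queue lengths strictly before that arrival (hence nothing about
  the remaining service times beyond what these paths reveal).\<close>

definition history :: "'a measure \<Rightarrow> nat \<Rightarrow> nat \<Rightarrow> (nat \<Rightarrow> 'a \<Rightarrow> real) \<Rightarrow>
    (nat \<Rightarrow> nat \<Rightarrow> 'a \<Rightarrow> nat \<times> nat) \<Rightarrow> 'a measure \<Rightarrow> (nat \<Rightarrow> real \<Rightarrow> 'a \<Rightarrow> nat) \<Rightarrow> nat \<Rightarrow> 'a measure"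
  where
  "history M n d E W U Q j = sigma (space M)
     (sets U \<union>
      {E i -` B \<inter> space M | i B. i \<le> j \<and> B \<in> sets borel} \<union>
      {W l i -` {e} \<inter> space M | l i e. l < d \<and> i \<le> j} \<union>
      {{\<omega>\<in>space M. s < arrival_time E j \<omega> \<and> Q v s \<omega> = q} | v s q. v \<in> {1..n} \<and> 0 \<le> s})"

text \<open>The Poisson arrival process of rate \<open>lam * n\<close> is given by its i.i.d. exponential interarrival
  times. The initial queue lengths are not constrained here.\<close>

locale nbrw_pod_system = prob_space M for M :: "'a measure" +
  fixes lam :: real and d n :: nat and G :: "(nat \<times> nat) set"
    and E :: "nat \<Rightarrow> 'a \<Rightarrow> real"
    and S :: "nat \<Rightarrow> nat \<Rightarrow> 'a \<Rightarrow> real"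
    and W :: "nat \<Rightarrow> nat \<Rightarrow> 'a \<Rightarrow> nat \<times> nat"
    and U :: "'a measure"
    and c :: "nat \<Rightarrow> 'a \<Rightarrow> nat"
    and Q :: "nat \<Rightarrow> real \<Rightarrow> 'a \<Rightarrow> nat"
  assumes interarrival_distributed:
      "\<And>j. distributed M lborel (E j) (exponential_density (lam * real n))"
    and service_distributed:
      "\<And>v m. v \<in> {1..n} \<Longrightarrow> distributed M lborel (S v m) (exponential_density 1)"
    and walkers: "\<And>l. l < d \<Longrightarrow> nbrw G (W l)"
    and tie_breaking_subalgebra: "subalgebra M U"
    and independent_sources:
      "indep_sets (\<lambda>x. sets (source_algebra M E S W U x)) (sources n d)"
    and queue_measurable:
      "\<And>v t. v \<in> {1..n} \<Longrightarrow> 0 \<le> t \<Longrightarrow> random_variable (count_space UNIV) (Q v t)"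
    and choice_nonanticipating:
      "\<And>j. c j \<in> measurable (history M n d E W U Q j) (count_space UNIV)"
    and joins_shortest:
      "AE \<omega> in M. \<forall>j. (\<exists>l<d. c j \<omega> = snd (W l j \<omega>)) \<and>
         (\<forall>l<d. \<forall>\<^sub>F s in at_left (arrival_time E j \<omega>). Q (c j \<omega>) s \<omega> \<le> Q (snd (W l j \<omega>)) s \<omega>)"
    and queue_dynamics:
      "AE \<omega> in M. \<forall>t\<ge>0. \<forall>v\<in>{1..n}.
         Q v t \<omega> + departed S Q v t \<omega> = Q v 0 \<omega> + joined E c v t \<omega>"


section \<open>The limiting dynamical system\<close>

text \<open>The values are in \<open>ennreal\<close>, so that divergent sums and unbounded suprema are \<open>\<infinity>\<close>.\<close>

definition l1_norm :: "(nat \<Rightarrow> real) \<Rightarrow> ennreal" where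
  "l1_norm x = (\<Sum>i. ennreal \<bar>x i\<bar>)"

definition queue_proportion :: "nat \<Rightarrow> (nat \<Rightarrow> nat) \<Rightarrow> nat \<Rightarrow> real" where
  "queue_proportion n q i = real (card {v\<in>{1..n}. i \<le> q v}) / real n"

definition fluid_solution :: "real \<Rightarrow> nat \<Rightarrow> (real \<Rightarrow> nat \<Rightarrow> real) \<Rightarrow> bool" where
  "fluid_solution lam d x \<longleftrightarrow>
     (\<forall>t\<ge>0. \<forall>i. x t i \<in> {0..1}) \<and> (\<forall>t\<ge>0. x t 0 = 1) \<and>
     (\<forall>i\<ge>1. \<forall>t\<ge>0. ((\<lambda>s. x s i) has_real_derivative
        lam * (x t (i - 1) ^ d - x t i ^ d) - (x t i - x t (i + 1))) (at t within {0..}))"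

end

theory Submission
  imports Defs "HOL-Real_Asymp.Real_Asymp" "Jordan_Normal_Form.Schur_Decomposition"
begin

text \<open>
  Why the theorem holds. The time axis is cut into windows of length \<open>h = 1 / K\<close>. It suffices that, for each
  fixed \<open>K\<close>, in all large systems every window up to the horizon changes the proportion of queues of length at
  least \<open>i\<close>, for all \<open>i \<le> K\<close>, by \<open>h\<close> times the right-hand side of the differential equation, up to an error
  \<open>C * h\<^sup>2\<close> with \<open>C\<close> depending on \<open>d\<close> only. Such a recursion is the Euler scheme of the equation, and Gronwall's
  inequality with the weights \<open>2\<^sup>-\<^sup>i\<close> compares the two (\<open>wdev_step\<close>, \<open>coordinate_bound\<close>). The mass above level
  \<open>K\<close> needs its own estimate, because the limit is in the \<open>l\<^sub>1\<close> norm: it grows by at most the jobs that see only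
  queues of length at least \<open>K\<close>, and by Markov's inequality these are few (\<open>level_markov\<close>, \<open>tail_bound\<close>).

  Within one window the state at its start serves as a proxy for the state met by each job (\<open>window_level\<close>). Jobs
  that look at a server twice looked at, or at one that finishes a service in the window, spoil this; they are of
  order \<open>h\<^sup>2 * n\<close>. So four counts must concentrate: arrivals, jobs all of whose candidate queues have length at
  least \<open>i\<close>, repeated visits, and services that end in the window.

  The walkers enter through two properties of the graph. The spectral gap makes the non-backtracking walk forget
  its start after about \<open>(ln n)\<^sup>2\<close> steps, much less than the order \<open>n\<close> steps of a window (\<open>nb_op_mixing\<close>); hence
  the walkers, one after the other, hit a set of density \<open>a\<close> a proportion \<open>a\<close> of the time, which gives the power
  \<open>a ^ d\<close> (\<open>step_bad_prob\<close>, \<open>hits_telescope\<close>). Large girth forbids quick returns and makes returns before the mixing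
  time unlikely (\<open>no_quick_return\<close>, \<open>nb_op_pow_le\<close>); hence revisits are rare (\<open>rep_bad_prob\<close>).

  The probabilistic difficulty is that the walkers, the services and the dispatching decisions interact. Each count
  is treated by revealing the randomness in a suitable order: all sources but one walker, and that walker step by
  step (\<open>KW\<close>); or everything that does not depend on the current and later services of one server (\<open>KV\<close>), where
  memorylessness makes the residual service fresh (\<open>past_trace\<close>, \<open>cell_service\<close>). An exponential inequality for
  trials revealed one at a time (\<open>adaptive_chernoff\<close>) then bounds the failure probability of a window by a summable
  sequence (\<open>win_bad_rare\<close>, \<open>window_bound_summable\<close>), and the Borel-Cantelli lemma makes all windows good
  eventually (\<open>almost_all_windows\<close>).
\<close>

section \<open>A Chernoff bound for trials revealed one at a time\<close>

lemma exp_le_one_plus_sq: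
  fixes u :: real
  assumes "0 \<le> u" "u \<le> 1"
  shows "exp u \<le> 1 + u + u^2"
  using exp_bound[OF assms] by simp

lemma borel_measurable_of_bool_mem [measurable]:
  "A \<in> sets M ==> (\<lambda>\<omega>. of_bool (\<omega> \<in> A) :: real) \<in> borel_measurable M"
  using borel_measurable_indicator[of A M] unfolding indicator_def by simp

text \<open>Downward induction on the first trial \<open>q\<close>. The family \<open>K r\<close> holds the events decided before trial \<open>r\<close>; it need
  not be a \<open>\<sigma>\<close>-algebra, since splitting an event by the trials already seen uses only intersections and differences. The statement
  ranges over all \<open>F\<close>, so that it can be applied to the pieces into which \<open>A q\<close> and \<open>Z q\<close> cut an event.\<close>

lemma (in prob_space) adaptive_chernoff_from:
  fixes H :: "'a set" and A Z :: "nat => 'a set" and K :: "nat => 'a set set" and p u x :: real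
  assumes Kev: "\<And>r. r < m ==> K r \<subseteq> events"
    and Kint: "\<And>r F F'. r < m ==> F \<in> K r ==> F' \<in> K r ==> F \<inter> F' \<in> K r"
    and Kdiff: "\<And>r F F'. r < m ==> F \<in> K r ==> F' \<in> K r ==> F - F' \<in> K r"
    and A: "\<And>i r. i \<le> r ==> r < m ==> A i \<in> K r"
    and Z: "\<And>i r. i < r ==> r < m ==> Z i \<in> K r"
    and Zev: "\<And>r. r < m ==> Z r \<in> events"
    and cond: "\<And>r F. r < m ==> F \<in> K r ==> F \<subseteq> H \<inter> A r ==> prob (F \<inter> Z r) \<le> p * prob F"
    and p: "0 \<le> p" "p \<le> 2" and u: "0 \<le> u" "u \<le> 1"
  shows "q \<le> m ==> F \<in> events ==> (\<And>r. q \<le> r ==> r < m ==> F \<in> K r) ==> F \<subseteq> H ==>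
    prob (F \<inter> {\<omega>\<in>space M. x \<le> (\<Sum>r\<in>{q..<m}. of_bool (\<omega> \<in> A r) * (of_bool (\<omega> \<in> Z r) - p))})
      \<le> exp (2 * u^2 * real (m - q) - u * x) * prob F"
proof (induction q arbitrary: F x rule: inc_induct)
  case base
  show ?case
  proof (cases "x \<le> 0")
    case True
    then have "1 \<le> exp (- u * x)" using u by (simp add: mult_nonneg_nonpos)
    then have "1 * prob F \<le> exp (- u * x) * prob F" by (intro mult_right_mono) auto
    moreover have "prob (F \<inter> {\<omega> \<in> space M. x \<le> 0}) \<le> prob F"
      using base by (intro finite_measure_mono) auto
    ultimately show ?thesis using True by simp
  qed auto
next
  case (step q)
  define S where "S = (\<lambda>q \<omega>. \<Sum>r\<in>{q..<m}. of_bool (\<omega> \<in> A r) * (of_bool (\<omega> \<in> Z r) - p))"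
  define c where "c = exp (2 * u^2 * real (m - Suc q))"
  have Sq: "S q \<omega> = of_bool (\<omega> \<in> A q) * (of_bool (\<omega> \<in> Z q) - p) + S (Suc q) \<omega>" for \<omega>
    unfolding S_def using step.hyps by (simp add: sum.atLeast_Suc_lessThan del: sum_of_bool_mult_eq sum_mult_of_bool_eq)
  have FK: "F \<in> K r" if "q \<le> r" "r < m" for r using step.prems that by auto
  have qm: "q < m" using step.hyps by auto
  have AK: "A q \<in> K r" if "q \<le> r" "r < m" for r using A that by auto
  have Aev: "A q \<in> events" "Z q \<in> events" using AK[of q] Kev[OF qm] Zev[OF qm] qm by auto
  note Fev = step.prems(1)
  define F1 F2 F3 where "F1 = F - A q" and "F2 = F \<inter> A q \<inter> Z q" and "F3 = F \<inter> A q - Z q"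
  have ev: "F1 \<in> events" "F2 \<in> events" "F3 \<in> events" unfolding F1_def F2_def F3_def using Fev Aev by auto
  have K1: "F1 \<in> K r" "F2 \<in> K r" "F3 \<in> K r" if "Suc q \<le> r" "r < m" for r
    unfolding F1_def F2_def F3_def using that FK[of r] AK[of r] Z[of q r] Kint[of r] Kdiff[of r] by auto
  have sub: "F1 \<subseteq> H" "F2 \<subseteq> H" "F3 \<subseteq> H" using step.prems(3) unfolding F1_def F2_def F3_def by auto
  have IH: "prob (F' \<inter> {\<omega>\<in>space M. y \<le> S (Suc q) \<omega>}) \<le> c * exp (- u * y) * prob F'"
    if "F' \<in> {F1, F2, F3}" for F' y
  proof -
    have "prob (F' \<inter> {\<omega>\<in>space M. y \<le> S (Suc q) \<omega>}) \<le> exp (2 * u^2 * real (m - Suc q) - u * y) * prob F'"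
      unfolding S_def by (rule step.IH) (use that ev K1 sub in auto)
    then show ?thesis by (simp add: c_def mult_exp_exp)
  qed
  have eq: "F \<inter> {\<omega>\<in>space M. x \<le> S q \<omega>} =
     (F1 \<inter> {\<omega>\<in>space M. x \<le> S (Suc q) \<omega>}) \<union> (F2 \<inter> {\<omega>\<in>space M. x - (1 - p) \<le> S (Suc q) \<omega>})
     \<union> (F3 \<inter> {\<omega>\<in>space M. x + p \<le> S (Suc q) \<omega>})"
    by (auto simp: Sq F1_def F2_def F3_def)
  have Smeas: "{\<omega>\<in>space M. y \<le> S (Suc q) \<omega>} \<in> events" for y
  proof -
    have "A r \<in> events \<and> Z r \<in> events" if "r \<in> {Suc q..<m}" for r
      using that A[of r r] Kev[of r] Zev[of r] by auto
    then have "S (Suc q) \<in> borel_measurable M" unfolding S_def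
      by (intro borel_measurable_sum borel_measurable_times borel_measurable_diff borel_measurable_const
          borel_measurable_of_bool_mem) auto
    then show ?thesis by measurable
  qed
  have FA: "prob (F \<inter> A q) = prob F2 + prob F3"
    using finite_measure_Union[of F2 F3] ev unfolding F2_def F3_def
    by (metis Diff_disjoint Int_Diff Int_Diff_Un Int_commute inf.left_commute inf_bot_right)
  have FF: "prob F = prob F1 + prob (F \<inter> A q)"
  proof -
    have "F1 \<inter> (F \<inter> A q) = {}" "F1 \<union> (F \<inter> A q) = F" unfolding F1_def by auto
    then show ?thesis using finite_measure_Union[of F1 "F \<inter> A q"] ev(1) Fev Aev by auto
  qed
  have c2: "prob F2 \<le> p * prob (F \<inter> A q)"
    unfolding F2_def by (rule cond[OF qm]) (use FK[of q] AK[of q] Kint[of q] qm step.prems(3) in auto)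
  define w where "w = exp (- u * p) * (1 + p * (exp u - 1))"
  have e1: "exp u - 1 \<le> u + u^2" using exp_le_one_plus_sq[OF u] by simp
  have "w \<le> exp (- u * p) * exp (p * (exp u - 1))"
    unfolding w_def by (intro mult_left_mono) auto
  also have "... = exp (p * (exp u - 1) - u * p)" by (simp add: mult_exp_exp)
  also have "... \<le> exp (2 * u^2)"
  proof -
    have "p * (exp u - 1) \<le> p * (u + u^2)" using e1 p by (intro mult_left_mono)
    moreover have "p * u^2 \<le> 2 * u^2" using p by (intro mult_right_mono) auto
    ultimately show ?thesis by (simp add: algebra_simps)
  qed
  finally have w: "w \<le> exp (2 * u^2)" .
  have "exp (- u * p) * prob F3 + exp (u - u * p) * prob F2 =
        exp (- u * p) * (prob (F \<inter> A q) + (exp u - 1) * prob F2)"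
    by (simp add: FA algebra_simps exp_diff exp_minus divide_inverse)
  also have "... \<le> exp (- u * p) * (prob (F \<inter> A q) + (exp u - 1) * (p * prob (F \<inter> A q)))"
    using c2 u by (intro mult_left_mono add_left_mono) auto
  also have "... = w * prob (F \<inter> A q)" by (simp add: w_def algebra_simps)
  also have "... \<le> exp (2 * u^2) * prob (F \<inter> A q)" using w by (intro mult_right_mono) auto
  finally have m1: "exp (- u * p) * prob F3 + exp (u - u * p) * prob F2 \<le> exp (2 * u^2) * prob (F \<inter> A q)" .
  have m2: "prob F1 \<le> exp (2 * u^2) * prob F1"
    using mult_right_mono[of 1 "exp (2 * u^2)" "prob F1"] by simp
  have Un3: "prob (B1 \<union> B2 \<union> B3) \<le> prob B1 + prob B2 + prob B3"
    if "B1 \<in> events" "B2 \<in> events" "B3 \<in> events" for B1 B2 B3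
    using measure_Un_le[of "B1 \<union> B2" M B3] measure_Un_le[of B1 M B2] that by auto
  have "prob (F \<inter> {\<omega>\<in>space M. x \<le> S q \<omega>}) \<le> prob (F1 \<inter> {\<omega>\<in>space M. x \<le> S (Suc q) \<omega>})
     + prob (F2 \<inter> {\<omega>\<in>space M. x - (1 - p) \<le> S (Suc q) \<omega>}) + prob (F3 \<inter> {\<omega>\<in>space M. x + p \<le> S (Suc q) \<omega>})"
    unfolding eq by (intro Un3 sets.Int ev Smeas)
  also have "... \<le> c * exp (- u * x) * prob F1 + c * exp (- u * (x - (1 - p))) * prob F2 + c * exp (- u * (x + p)) * prob F3"
    by (intro add_mono IH) auto
  also have "... = c * exp (- u * x) * (prob F1 + (exp (- u * p) * prob F3 + exp (u - u * p) * prob F2))"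
  proof -
    have "exp (- u * (x - (1 - p))) = exp (- u * x) * exp (u - u * p)" "exp (- u * (x + p)) = exp (- u * x) * exp (- u * p)"
      unfolding mult_exp_exp by (simp_all add: algebra_simps)
    then show ?thesis by (simp only: algebra_simps)
  qed
  also have "... \<le> c * exp (- u * x) * (exp (2 * u^2) * prob F1 + exp (2 * u^2) * prob (F \<inter> A q))"
    using m1 m2 by (intro mult_left_mono add_mono) (auto simp: c_def)
  also have "... = c * exp (- u * x) * exp (2 * u^2) * prob F" by (simp add: FF algebra_simps)
  also have "c * exp (- u * x) * exp (2 * u^2) = exp (2 * u^2 * real (m - q) - u * x)"
  proof -
    have "real (m - q) = real (m - Suc q) + 1" using qm by simp
    then show ?thesis by (simp add: c_def mult_exp_exp algebra_simps)
  qed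
  finally show ?case unfolding S_def .
qed

text \<open>The optimal exponent is \<open>u = x / (4 * y)\<close>; the bound on \<open>x\<close> keeps it below \<open>1\<close>.\<close>

lemma (in prob_space) adaptive_chernoff:
  fixes H :: "'a set" and A Z :: "nat => 'a set" and K :: "nat => 'a set set" and p x :: real
  assumes "\<And>r. r < m ==> K r \<subseteq> events"
    and "\<And>r F F'. r < m ==> F \<in> K r ==> F' \<in> K r ==> F \<inter> F' \<in> K r"
    and "\<And>r F F'. r < m ==> F \<in> K r ==> F' \<in> K r ==> F - F' \<in> K r"
    and "\<And>i r. i \<le> r ==> r < m ==> A i \<in> K r"
    and "\<And>i r. i < r ==> r < m ==> Z i \<in> K r"
    and "\<And>r. r < m ==> Z r \<in> events"
    and "\<And>r F. r < m ==> F \<in> K r ==> F \<subseteq> H \<inter> A r ==> prob (F \<inter> Z r) \<le> p * prob F"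
    and "0 \<le> p" "p \<le> 2"
    and H: "H \<in> events" "\<And>r. r < m ==> H \<in> K r"
    and x: "0 \<le> x" "x \<le> 4 * y" "real m \<le> y" "0 < y"
  shows "prob (H \<inter> {\<omega>\<in>space M. x \<le> (\<Sum>r<m. of_bool (\<omega> \<in> A r) * (of_bool (\<omega> \<in> Z r) - p))})
      \<le> exp (- (x^2 / (8 * y))) * prob H"
proof -
  define u where "u = x / (4 * y)"
  have u: "0 \<le> u" "u \<le> 1" using x by (auto simp: u_def divide_simps)
  have "prob (H \<inter> {\<omega>\<in>space M. x \<le> (\<Sum>r\<in>{0..<m}. of_bool (\<omega> \<in> A r) * (of_bool (\<omega> \<in> Z r) - p))})
      \<le> exp (2 * u^2 * real (m - 0) - u * x) * prob H"
    by (rule adaptive_chernoff_from[of m K A Z H p u 0]) (use assms u in auto)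
  also have "exp (2 * u^2 * real (m - 0) - u * x) \<le> exp (- (x^2 / (8 * y)))"
  proof -
    have "2 * u^2 * real m \<le> 2 * u^2 * y" using x by (intro mult_left_mono) auto
    moreover have "2 * u^2 * y - u * x = - (x^2 / (8 * y))"
      using x by (simp add: u_def power2_eq_square field_simps)
    ultimately show ?thesis by simp
  qed
  finally show ?thesis by (simp add: atLeast0LessThan mult_right_mono)
qed

section \<open>Spectral gap\<close>

lemma trace_mult_commute:
  fixes A B :: "'a :: comm_semiring_0 mat"
  assumes "A \<in> carrier_mat n m" "B \<in> carrier_mat m n"
  shows "(\<Sum>i<n. (A * B) $$ (i, i)) = (\<Sum>j<m. (B * A) $$ (j, j))"
proof -
  have "(\<Sum>i<n. (A * B) $$ (i, i)) = (\<Sum>i<n. \<Sum>j<m. A $$ (i, j) * B $$ (j, i))"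
    using assms by (intro sum.cong) (auto simp: scalar_prod_def atLeast0LessThan)
  also have "... = (\<Sum>j<m. \<Sum>i<n. B $$ (j, i) * A $$ (i, j))"
    by (subst sum.swap) (simp add: mult.commute)
  also have "... = (\<Sum>j<m. (B * A) $$ (j, j))"
    using assms by (intro sum.cong) (auto simp: scalar_prod_def atLeast0LessThan)
  finally show ?thesis .
qed

lemma upper_triangular_pow_diag:
  fixes B :: "'a :: comm_semiring_1 mat"
  assumes B: "B \<in> carrier_mat n n" "upper_triangular B"
  shows "upper_triangular (B ^\<^sub>m m) \<and> (\<forall>i<n. (B ^\<^sub>m m) $$ (i, i) = (B $$ (i, i)) ^ m)"
proof (induction m)
  case 0
  then show ?case using B by auto
next
  case (Suc m)
  have car: "B ^\<^sub>m m \<in> carrier_mat n n" using B by simp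
  have ent: "(B ^\<^sub>m Suc m) $$ (i, l) = (\<Sum>j<n. (B ^\<^sub>m m) $$ (i, j) * B $$ (j, l))" if "i < n" "l < n" for i l
    using B car that by (auto simp: scalar_prod_def atLeast0LessThan)
  have z: "(B ^\<^sub>m m) $$ (i, j) * B $$ (j, l) = 0" if "i < n" "j < n" "l \<le> i" "\<not> (j = i \<and> l = i)" for i j l
  proof (cases "j < i")
    case True
    then show ?thesis using Suc.IH that car by (auto simp: upper_triangularD)
  next
    case False
    then have "l < j" using that by auto
    then show ?thesis using B that by (auto simp: upper_triangularD)
  qed
  have "(B ^\<^sub>m Suc m) $$ (i, l) = 0" if "i < n" "l < i" for i l
    unfolding ent[OF that(1) order.strict_trans[OF that(2,1)]] by (intro sum.neutral ballI z) (use that in auto)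
  moreover have "(B ^\<^sub>m Suc m) $$ (i, i) = (B $$ (i, i)) ^ Suc m" if "i < n" for i
  proof -
    have "(B ^\<^sub>m Suc m) $$ (i, i) = (\<Sum>j\<in>{i}. (B ^\<^sub>m m) $$ (i, j) * B $$ (j, i))"
      unfolding ent[OF that that] by (intro sum.mono_neutral_right) (use that z[of i _ i] in auto)
    then show ?thesis using Suc.IH that by (simp add: mult.commute)
  qed
  ultimately show ?case using B by (auto intro!: upper_triangularI)
qed

lemma trace_power_eq_sum_roots:
  fixes A :: "real mat"
  assumes A: "A \<in> carrier_mat n n" and es: "char_poly A = (\<Prod>e\<leftarrow>es. [:- e, 1:])"
  shows "(\<Sum>i<n. (A ^\<^sub>m m) $$ (i, i)) = (\<Sum>e\<leftarrow>es. e ^ m)"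
proof -
  obtain B P Q where "schur_decomposition A es = (B, P, Q)" by (cases "schur_decomposition A es")
  from schur_decomposition[OF A es this]
  have w: "similar_mat_wit A B P Q" and ut: "upper_triangular B" and diag: "diag_mat B = es" by auto
  note car = similar_mat_witD2[OF A w]
  have B: "B \<in> carrier_mat n n" and P: "P \<in> carrier_mat n n" and Q: "Q \<in> carrier_mat n n"
    and QP: "Q * P = 1\<^sub>m n" using car by auto
  have Bm: "B ^\<^sub>m m \<in> carrier_mat n n" using B by simp
  have "(\<Sum>i<n. (A ^\<^sub>m m) $$ (i, i)) = (\<Sum>i<n. (P * (B ^\<^sub>m m * Q)) $$ (i, i))"
    using similar_mat_wit_pow_id[OF w, of m] assoc_mult_mat[OF P Bm Q] by simp
  also have "... = (\<Sum>i<n. ((B ^\<^sub>m m * Q) * P) $$ (i, i))"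
    by (rule trace_mult_commute) (use P Q Bm in auto)
  also have "(B ^\<^sub>m m * Q) * P = B ^\<^sub>m m"
    using assoc_mult_mat[OF Bm Q P] QP right_mult_one_mat[OF Bm] by simp
  also have "(\<Sum>i<n. (B ^\<^sub>m m) $$ (i, i)) = (\<Sum>i<n. (B $$ (i, i)) ^ m)"
    using upper_triangular_pow_diag[OF B ut] by auto
  also have "... = (\<Sum>e\<leftarrow>es. e ^ m)"
    using B unfolding diag[symmetric] diag_mat_def
    by (simp add: sum_list_sum_nth atLeast0LessThan comp_def)
  finally show ?thesis .
qed

interpretation of_real_poly_hom: map_poly_inj_idom_hom of_real ..

text \<open>The characteristic polynomial splits over the complex numbers, and the roots are real because the quadratic form of an eigenvector is.\<close>

lemma symmetric_char_poly_splits: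
  fixes A :: "real mat"
  assumes A: "A \<in> carrier_mat n n" and sym: "\<And>i j. i < n ==> j < n ==> A $$ (i, j) = A $$ (j, i)"
  shows "\<exists>es. char_poly A = (\<Prod>e\<leftarrow>es. [:- e, 1:]) \<and> length es = n"
proof -
  define C where "C = map_mat complex_of_real A"
  have C: "C \<in> carrier_mat n n" using A by (simp add: C_def)
  obtain as where as: "char_poly C = (\<Prod>a\<leftarrow>as. [:- a, 1:])" "length as = n"
    using char_poly_factorized[OF C] by blast
  have real: "a \<in> \<real>" if "a \<in> set as" for a
  proof -
    have "poly (char_poly C) a = 0"
      unfolding as(1) poly_prod_list using that by (auto simp: prod_list_zero_iff)
    then obtain v where v: "eigenvector C v a"
      using eigenvalue_root_char_poly[OF C] unfolding eigenvalue_def by blast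
    then have vc: "v \<in> carrier_vec n" "v \<noteq> 0\<^sub>v n" and Cv: "C *\<^sub>v v = a \<cdot>\<^sub>v v"
      using C unfolding eigenvector_def by auto
    have row: "a * v $ i = (\<Sum>j<n. complex_of_real (A $$ (i, j)) * v $ j)" if "i < n" for i
    proof -
      have "a * v $ i = (C *\<^sub>v v) $ i" using Cv vc that by simp
      also have "... = (\<Sum>j<n. complex_of_real (A $$ (i, j)) * v $ j)"
        using A vc that by (auto simp: C_def scalar_prod_def atLeast0LessThan)
      finally show ?thesis .
    qed
    define R where "R = (\<Sum>i<n. (cmod (v $ i))^2)"
    define s where "s = (\<Sum>i<n. \<Sum>j<n. cnj (v $ i) * complex_of_real (A $$ (i, j)) * v $ j)"
    have "R \<noteq> 0"
    proof
      assume "R = 0"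
      then have "\<forall>i<n. v $ i = 0" unfolding R_def by (subst (asm) sum_nonneg_eq_0_iff) auto
      then have "v = 0\<^sub>v n" using vc by (intro eq_vecI) auto
      then show False using vc by simp
    qed
    have "cnj s = (\<Sum>i<n. \<Sum>j<n. cnj (v $ j) * complex_of_real (A $$ (i, j)) * v $ i)"
      by (simp add: s_def mult_ac)
    also have "... = s" unfolding s_def by (subst sum.swap) (auto intro!: sum.cong simp: sym)
    finally have cs: "cnj s = s" .
    have "s = (\<Sum>i<n. cnj (v $ i) * (a * v $ i))"
      unfolding s_def by (intro sum.cong) (auto simp: row sum_distrib_left mult_ac)
    also have "... = a * complex_of_real R"
      by (simp add: R_def sum_distrib_left mult_ac complex_norm_square[symmetric])
    finally have "cnj a * complex_of_real R = a * complex_of_real R" using cs by (metis complex_cnj_complex_of_real complex_cnj_mult)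
    then have "cnj a = a" using \<open>R \<noteq> 0\<close> by simp
    then show ?thesis by (simp add: Reals_cnj_iff)
  qed
  define es where "es = map Re as"
  have as_es: "as = map complex_of_real es"
    unfolding es_def using real by (auto simp: comp_def intro!: map_idI[symmetric])
  have "map_poly complex_of_real (char_poly A) = char_poly C"
    unfolding C_def by (rule of_real_hom.char_poly_hom[OF A, symmetric])
  also have "... = (\<Prod>e\<leftarrow>es. map_poly complex_of_real [:- e, 1:])"
    unfolding as(1) as_es by (simp add: comp_def)
  also have "... = map_poly complex_of_real (\<Prod>e\<leftarrow>es. [:- e, 1:])"
    by (induction es) (simp_all add: of_real_poly_hom.hom_mult del: mult_pCons_left)
  finally have "char_poly A = (\<Prod>e\<leftarrow>es. [:- e, 1:])"
    by (metis of_real_poly_hom.injectivity)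
  moreover have "length es = n" using as by (simp add: es_def)
  ultimately show ?thesis by blast
qed

lemma graph_spectrum_char_poly:
  assumes "regular_graph n k G"
  shows "char_poly (adjacency_matrix n G) = (\<Prod>e\<leftarrow>graph_spectrum n G. [:- e, 1:])"
    and "length (graph_spectrum n G) = n" and "sorted (rev (graph_spectrum n G))"
proof -
  let ?A = "adjacency_matrix n G"
  have symG: "sym G" using assms by (auto simp: regular_graph_def)
  have A: "?A \<in> carrier_mat n n" by (simp add: adjacency_matrix_def)
  have "?A $$ (i, j) = ?A $$ (j, i)" if "i < n" "j < n" for i j
    using that symG by (auto simp: adjacency_matrix_def dest: symD)
  from symmetric_char_poly_splits[OF A this]
  obtain es where es: "char_poly ?A = (\<Prod>e\<leftarrow>es. [:- e, 1:])" "length es = n" by blast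
  have "proots (char_poly ?A) = mset es"
    unfolding es(1)
  proof (induction es)
    case (Cons a es)
    have "(\<Prod>e\<leftarrow>es. [:- e, 1:]) \<noteq> 0" by (auto simp: prod_list_zero_iff)
    then have "proots ([:- a, 1:] * (\<Prod>e\<leftarrow>es. [:- e, 1:])) = {#a#} + mset es"
      by (subst proots_mult) (auto simp: Cons simp del: mult_pCons_left)
    then show ?case by (simp del: mult_pCons_left)
  qed simp
  then have eq: "mset (graph_spectrum n G) = mset es"
    by (simp add: graph_spectrum_def)
  then show "length (graph_spectrum n G) = n" using es(2) by (metis size_mset)
  show "char_poly ?A = (\<Prod>e\<leftarrow>graph_spectrum n G. [:- e, 1:])"
    unfolding es(1) using eq by (metis mset_map prod_mset_prod_list)
  show "sorted (rev (graph_spectrum n G))" by (simp add: graph_spectrum_def)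
qed

lemma pow_mat_add:
  fixes A :: "'a :: semiring_1 mat"
  assumes "A \<in> carrier_mat n n"
  shows "A ^\<^sub>m (l + m) = A ^\<^sub>m l * A ^\<^sub>m m"
proof (induction m)
  case (Suc m)
  have "A ^\<^sub>m l \<in> carrier_mat n n" "A ^\<^sub>m m \<in> carrier_mat n n" using assms by auto
  then show ?case using Suc assms by (simp add: assoc_mult_mat[of _ n n _ n _ n])
qed (use assms in \<open>simp add: right_mult_one_mat[of _ n n]\<close>)

lemma power_bound_imp_le:
  fixes q s c :: real
  assumes "\<And>m. q ^ m \<le> c * s ^ m" "0 \<le> s"
  shows "q \<le> s"
proof (rule ccontr)
  assume "\<not> q \<le> s"
  then have q: "0 < q" "s < q" using assms by auto
  then have "(\<lambda>m. c * (s / q) ^ m) \<longlonglongrightarrow> c * 0"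
    by (intro tendsto_mult tendsto_const LIMSEQ_realpow_zero) (use assms in auto)
  moreover have "1 \<le> c * (s / q) ^ m" for m
    using assms(1)[of m] q by (simp add: power_divide field_simps)
  ultimately have "1 \<le> c * 0" by (intro LIMSEQ_le_const[of _ _ 1]) auto
  then show False by simp
qed

text \<open>For \<open>w m = |A\<^sup>m f|\<^sup>2\<close>, Cauchy-Schwarz gives the convexity, and the first ratio \<open>w 1 / w 0\<close> bounds the growth
  from below. So a bound on the growth of the powers bounds the first step.\<close>

lemma log_convex_growth:
  fixes w :: "nat => real"
  assumes pos: "0 < w 0" "0 < w 1" and cvx: "\<And>m. (w (Suc m))^2 \<le> w m * w (Suc (Suc m))"
  shows "0 < w m \<and> w m * w 1 \<le> w (Suc m) * w 0"
proof (induction m)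
  case (Suc m)
  have a: "0 < w m * w 1" using Suc pos by simp
  then have p: "0 < w (Suc m)" using Suc pos by (meson less_le_trans zero_less_mult_pos2)
  have "w (Suc m) * w 1 * w m \<le> w (Suc m) * (w (Suc m) * w 0)"
    using Suc p by (simp add: mult_ac mult_left_mono)
  also have "... = (w (Suc m))^2 * w 0" by (simp add: power2_eq_square)
  also have "... \<le> (w m * w (Suc (Suc m))) * w 0" using cvx pos by (intro mult_right_mono) auto
  finally have "w m * (w (Suc m) * w 1) \<le> w m * (w (Suc (Suc m)) * w 0)" by (simp add: mult_ac)
  then show ?case using p Suc by simp
qed (use pos in auto)

lemma regular_graph_sum_eq:
  assumes "regular_graph n k G" "v \<in> {1..n}"
  shows "(\<Sum>w\<in>G `` {v}. f w) = (\<Sum>j<n. (if (v, Suc j) \<in> G then 1 else 0) * (f (Suc j) :: real))"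
proof -
  have eq: "G `` {v} = Suc ` {j. j < n \<and> (v, Suc j) \<in> G}"
  proof (rule equalityI; rule subsetI)
    fix w assume "w \<in> G `` {v}"
    then have "(v, w) \<in> G" "w \<in> {1..n}" using assms by (auto simp: regular_graph_def)
    then show "w \<in> Suc ` {j. j < n \<and> (v, Suc j) \<in> G}" by (intro image_eqI[of _ _ "w - 1"]) auto
  qed auto
  have "(\<Sum>w\<in>G `` {v}. f w) = (\<Sum>j | j < n \<and> (v, Suc j) \<in> G. f (Suc j))"
    unfolding eq by (subst sum.reindex) auto
  also have "... = (\<Sum>j<n. (if (v, Suc j) \<in> G then 1 else 0) * f (Suc j))"
    by (rule sum.mono_neutral_cong_left) auto
  finally show ?thesis .
qed

lemma spectrum_tail_power_sum:
  fixes xs :: "real list"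
  assumes "sorted (rev xs)" "length xs = n" "2 \<le> n" "x \<in> set xs"
    and "max (xs ! 1) \<bar>xs ! (n - 1)\<bar> < x"
  shows "(\<Sum>e\<leftarrow>xs. e ^ (2 * m)) \<le> x ^ (2 * m) + real n * (max (xs ! 1) \<bar>xs ! (n - 1)\<bar>) ^ (2 * m)"
proof -
  define \<mu> where "\<mu> = max (xs ! 1) \<bar>xs ! (n - 1)\<bar>"
  have mono: "xs ! j \<le> xs ! i" if "i \<le> j" "j < n" for i j
    using assms(1,2) that by (metis sorted_rev_iff_nth_mono)
  have le: "\<bar>xs ! i\<bar> \<le> \<mu>" if "1 \<le> i" "i < n" for i
    using mono[of 1 i, OF that] mono[of i "n - 1"] that unfolding \<mu>_def by linarith
  obtain i where i: "i < n" "xs ! i = x" using assms by (metis in_set_conv_nth)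
  have "i = 0" using le[of i] i assms(5) unfolding \<mu>_def[symmetric] by (cases i) auto
  have "(\<Sum>e\<leftarrow>xs. e ^ (2 * m)) = (\<Sum>i<n. (xs ! i) ^ (2 * m))"
    using assms(2) by (simp add: sum_list_sum_nth atLeast0LessThan)
  also have "... = x ^ (2 * m) + (\<Sum>i\<in>{1..<n}. (xs ! i) ^ (2 * m))"
    using i \<open>i = 0\<close> assms(3) by (simp add: atLeast0LessThan[symmetric] sum.atLeast_Suc_lessThan)
  also have "(\<Sum>i\<in>{1..<n}. (xs ! i) ^ (2 * m)) \<le> (\<Sum>i\<in>{1..<n}. \<mu> ^ (2 * m))"
  proof (rule sum_mono)
    fix i assume "i \<in> {1..<n}"
    then have "\<bar>xs ! i\<bar> ^ (2 * m) \<le> \<mu> ^ (2 * m)" using le by (intro power_mono) auto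
    then show "(xs ! i) ^ (2 * m) \<le> \<mu> ^ (2 * m)" by (simp add: power_even_abs)
  qed
  also have "... \<le> real n * \<mu> ^ (2 * m)" by (simp add: mult_right_mono)
  finally show ?thesis unfolding \<mu>_def by simp
qed

text \<open>No eigenvectors are used. The trace of \<open>A\<^sup>2\<^sup>m\<close> is the power sum of the spectrum; the constant vector accounts for
  \<open>k\<^sup>2\<^sup>m\<close> of it, so that by Bessel's inequality the powers of \<open>A\<close> on vectors orthogonal to the constants grow at
  most like \<open>n * \<mu>\<^sup>2\<^sup>m\<close>. By log-convexity this growth rate already bounds the first application of \<open>A\<close>.\<close>

lemma adjacency_contraction:
  fixes f :: "nat => real"
  assumes G: "regular_graph n k G" and n: "2 \<le> n"
    and mu: "second_eigenvalue n G < real k"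
    and f0: "(\<Sum>v\<in>{1..n}. f v) = 0"
  shows "(\<Sum>v\<in>{1..n}. (\<Sum>w\<in>G `` {v}. f w)^2) \<le> (second_eigenvalue n G)^2 * (\<Sum>v\<in>{1..n}. (f v)^2)"
proof -
  define A where "A = adjacency_matrix n G"
  define \<mu> where "\<mu> = second_eigenvalue n G"
  define p where "p = (\<lambda>m i j. (A ^\<^sub>m m) $$ (i, j))"
  define g where "g = (\<lambda>j. f (Suc j))"
  define u where "u = (\<lambda>m i. \<Sum>j<n. p m i j * g j)"
  define w where "w = (\<lambda>m. \<Sum>i<n. (u m i)^2)"
  note spec = graph_spectrum_char_poly[OF G]
  have A: "A \<in> carrier_mat n n" by (simp add: A_def adjacency_matrix_def)
  have Aij: "A $$ (i, j) = (if (Suc i, Suc j) \<in> G then 1 else 0)" if "i < n" "j < n" for i j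
    using that by (simp add: A_def adjacency_matrix_def)
  have symG: "sym G" using G by (auto simp: regular_graph_def)
  have Asym: "A $$ (i, j) = A $$ (j, i)" if "i < n" "j < n" for i j
    using that symG by (auto simp: Aij dest: symD)
  have Am: "A ^\<^sub>m m \<in> carrier_mat n n" for m using A by simp
  have pSuc: "p (Suc m) i l = (\<Sum>j<n. p m i j * A $$ (j, l))" if "i < n" "l < n" for m i l
    using that A Am[of m] by (auto simp: p_def scalar_prod_def atLeast0LessThan)
  have p0: "p 0 i l = (if i = l then 1 else 0)" if "i < n" "l < n" for i l
    using that A by (auto simp: p_def)
  have pSuc': "p (Suc m) i l = (\<Sum>j<n. A $$ (i, j) * p m j l)" if "i < n" "l < n" for m i l
    using that
  proof (induction m arbitrary: l)
    case 0
    have "(\<Sum>j<n. p 0 i j * A $$ (j, l)) = (\<Sum>j<n. if j = i then A $$ (j, l) else 0)"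
      using 0 by (intro sum.cong) (auto simp: p0)
    moreover have "(\<Sum>j<n. A $$ (i, j) * p 0 j l) = (\<Sum>j<n. if j = l then A $$ (i, j) else 0)"
      using 0 by (intro sum.cong) (auto simp: p0)
    ultimately show ?case using 0 by (simp add: pSuc)
  next
    case (Suc m)
    have "p (Suc (Suc m)) i l = (\<Sum>j<n. (\<Sum>h<n. A $$ (i, h) * p m h j) * A $$ (j, l))"
      unfolding pSuc[OF Suc.prems] using Suc by (intro sum.cong) auto
    also have "... = (\<Sum>h<n. A $$ (i, h) * (\<Sum>j<n. p m h j * A $$ (j, l)))"
      by (simp add: sum_distrib_left sum_distrib_right mult_ac) (subst sum.swap, simp)
    also have "... = (\<Sum>h<n. A $$ (i, h) * p (Suc m) h l)"
      using Suc.prems by (intro sum.cong) (auto simp: pSuc)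
    finally show ?case .
  qed
  have psym: "p m i j = p m j i" if "i < n" "j < n" for m i j
    using that
  proof (induction m arbitrary: i j)
    case (Suc m)
    have "p (Suc m) i j = (\<Sum>h<n. p m h i * A $$ (j, h))"
      unfolding pSuc[OF Suc.prems] using Suc by (intro sum.cong) (auto simp: Asym)
    also have "... = p (Suc m) j i" unfolding pSuc'[OF Suc.prems(2,1)] by (simp add: mult.commute)
    finally show ?case .
  qed (auto simp: p0)
  have deg: "(\<Sum>j<n. A $$ (i, j)) = real k" if "i < n" for i
  proof -
    have "(\<Sum>j<n. A $$ (i, j)) = (\<Sum>w\<in>G `` {Suc i}. 1)"
      unfolding regular_graph_sum_eq[OF G, of "Suc i" "\<lambda>_. 1"] using that
      by (subst regular_graph_sum_eq[OF G]) (auto simp: Aij)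
    also have "... = real k" using G that by (auto simp: regular_graph_def)
    finally show ?thesis .
  qed
  have prow: "(\<Sum>j<n. p m i j) = real k ^ m" if "i < n" for m i
    using that
  proof (induction m arbitrary: i)
    case 0
    then show ?case by (simp add: p0)
  next
    case (Suc m)
    have "(\<Sum>j<n. p (Suc m) i j) = (\<Sum>j<n. \<Sum>h<n. A $$ (i, h) * p m h j)"
      using Suc by (intro sum.cong) (auto simp: pSuc')
    also have "... = (\<Sum>h<n. A $$ (i, h) * (\<Sum>j<n. p m h j))"
      by (subst sum.swap) (simp add: sum_distrib_left)
    also have "... = (\<Sum>h<n. A $$ (i, h) * real k ^ m)" using Suc by simp
    also have "... = real k ^ Suc m" using deg[OF Suc.prems] by (simp add: sum_distrib_right[symmetric])
    finally show ?case .
  qed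
  have uSuc: "u (Suc m) i = (\<Sum>j<n. A $$ (i, j) * u m j)" if "i < n" for m i
    unfolding u_def using that
    by (simp add: pSuc' sum_distrib_left sum_distrib_right mult.assoc) (subst sum.swap, simp)
  have u0: "u 0 i = g i" if "i < n" for i
  proof -
    have "u 0 i = (\<Sum>j<n. if j = i then g j else 0)"
      unfolding u_def using that by (intro sum.cong) (auto simp: p0)
    then show ?thesis using that by simp
  qed
  have wN: "w 0 = (\<Sum>i<n. (g i)^2)" unfolding w_def using u0 by simp
  have g0: "(\<Sum>j<n. g j) = 0"
    using f0 unfolding g_def by (simp add: sum.atLeast1_atMost_eq)
  have cvx: "(w (Suc m))^2 \<le> w m * w (Suc (Suc m))" for m
  proof -
    have "w (Suc m) = (\<Sum>i<n. u (Suc m) i * (\<Sum>j<n. A $$ (i, j) * u m j))"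
      unfolding w_def by (intro sum.cong) (auto simp: uSuc power2_eq_square)
    also have "... = (\<Sum>j<n. u m j * (\<Sum>i<n. A $$ (i, j) * u (Suc m) i))"
      by (simp add: sum_distrib_left mult_ac) (subst sum.swap, simp)
    also have "... = (\<Sum>j<n. u m j * u (Suc (Suc m)) j)"
      by (intro sum.cong) (auto simp: uSuc[of _ "Suc m"] Asym)
    finally show ?thesis unfolding w_def by (simp add: Cauchy_Schwarz_ineq_sum)
  qed
  have tr: "(\<Sum>i<n. \<Sum>j<n. (p m i j)^2) = (\<Sum>e\<leftarrow>graph_spectrum n G. e ^ (2 * m))" for m
  proof -
    have "A ^\<^sub>m (m + m) = A ^\<^sub>m m * A ^\<^sub>m m" by (rule pow_mat_add[OF A])
    then have "(\<Sum>i<n. (A ^\<^sub>m (2 * m)) $$ (i, i)) = (\<Sum>i<n. \<Sum>j<n. p m i j * p m j i)"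
      using carrier_matD[OF Am[of m]] by (auto simp: mult_2 p_def scalar_prod_def atLeast0LessThan intro!: sum.cong)
    also have "... = (\<Sum>i<n. \<Sum>j<n. (p m i j)^2)"
      by (intro sum.cong) (auto simp: power2_eq_square psym)
    finally show ?thesis
      using trace_power_eq_sum_roots[OF A spec(1)[folded A_def], of "2 * m"] by simp
  qed
  have kin: "real k \<in> set (graph_spectrum n G)"
  proof -
    have "eigenvector A (vec n (\<lambda>_. 1)) (real k)"
      unfolding eigenvector_def using A deg n exI[of "\<lambda>i. i < n" 0]
      by (auto simp: scalar_prod_def atLeast0LessThan vec_eq_iff intro!: eq_vecI)
    then have "poly (char_poly A) (real k) = 0"
      using eigenvalue_root_char_poly[OF A] unfolding eigenvalue_def by blast
    then show ?thesis unfolding A_def spec(1) poly_prod_list by (auto simp: prod_list_zero_iff)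
  qed
  have tail: "(\<Sum>e\<leftarrow>graph_spectrum n G. e ^ (2 * m)) \<le> real k ^ (2 * m) + real n * \<mu> ^ (2 * m)" for m
    unfolding \<mu>_def second_eigenvalue_def
    by (rule spectrum_tail_power_sum[OF spec(3,2) n kin]) (use mu in \<open>simp add: second_eigenvalue_def\<close>)
  have bound: "w m \<le> w 0 * (real n * \<mu> ^ (2 * m))" if N: "0 < w 0" for m
  proof -
    have bessel: "(u m i)^2 / w 0 + (real k ^ m)^2 / real n \<le> (\<Sum>j<n. (p m i j)^2)" if "i < n" for i
    proof -
      define a b where "a = u m i / w 0" and "b = real k ^ m / real n"
      have "0 \<le> (\<Sum>j<n. (p m i j - a * g j - b)^2)" by (intro sum_nonneg) auto
      also have "... = (\<Sum>j<n. (p m i j)^2 + a^2 * (g j)^2 + b^2 - 2 * a * (p m i j * g j) - 2 * b * p m i j + 2 * a * b * g j)"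
        by (intro sum.cong) (auto simp: power2_eq_square algebra_simps)
      also have "... = (\<Sum>j<n. (p m i j)^2) + a^2 * w 0 + real n * b^2 - 2 * a * u m i - 2 * b * real k ^ m"
        unfolding sum.distrib sum_subtractf sum_distrib_left[symmetric] g0 wN[symmetric] prow[OF that]
        by (simp add: u_def)
      also have "... = (\<Sum>j<n. (p m i j)^2) - (u m i)^2 / w 0 - (real k ^ m)^2 / real n"
        using N n by (simp add: a_def b_def power2_eq_square)
      finally show ?thesis by simp
    qed
    have "w m / w 0 + (real k ^ m)^2 = (\<Sum>i<n. (u m i)^2 / w 0 + (real k ^ m)^2 / real n)"
      using n by (simp add: sum.distrib w_def sum_divide_distrib)
    also have "... \<le> (\<Sum>i<n. \<Sum>j<n. (p m i j)^2)" using bessel by (intro sum_mono) auto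
    also have "... \<le> real k ^ (2 * m) + real n * \<mu> ^ (2 * m)" unfolding tr by (rule tail)
    finally have "w m / w 0 \<le> real n * \<mu> ^ (2 * m)" by (simp add: power_mult[symmetric] mult.commute)
    then show ?thesis using N by (simp add: field_simps)
  qed
  have main: "w 1 \<le> \<mu>^2 * w 0"
  proof (cases "w 0 > 0 \<and> w 1 > 0")
    case True
    then have pos: "0 < w 0" "0 < w 1" by auto
    have grow: "w 0 * (w 1 / w 0) ^ m \<le> w m" for m
    proof (induction m)
      case (Suc m)
      have "w 0 * (w 1 / w 0) ^ Suc m = (w 0 * (w 1 / w 0) ^ m) * (w 1 / w 0)" by simp
      also have "... \<le> w m * (w 1 / w 0)" using Suc pos by (intro mult_right_mono) auto
      also have "... \<le> w (Suc m)" using log_convex_growth[OF pos cvx, of m] pos by (simp add: field_simps)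
      finally show ?case .
    qed simp
    have "(w 1 / w 0) ^ m \<le> real n * (\<mu>^2) ^ m" for m
    proof -
      have "w 0 * (w 1 / w 0) ^ m \<le> w 0 * (real n * \<mu> ^ (2 * m))"
        using grow[of m] bound[OF pos(1), of m] by simp
      then show ?thesis using pos by (simp add: power_mult)
    qed
    then have "w 1 / w 0 \<le> \<mu>^2" by (rule power_bound_imp_le) simp
    then show ?thesis using pos by (simp add: field_simps)
  next
    case False
    have nn: "0 \<le> w m" for m unfolding w_def by (intro sum_nonneg) auto
    show ?thesis
    proof (cases "w 1 = 0")
      case False
      with \<open>\<not> (w 0 > 0 \<and> w 1 > 0)\<close> nn[of 0] nn[of 1] have "w 0 = 0" by auto
      then have "w 1 = 0" using cvx[of 0] by simp
      then show ?thesis using False by simp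
    qed (use nn[of 0] in simp)
  qed
  have "w 1 = (\<Sum>v\<in>{1..n}. (\<Sum>w\<in>G `` {v}. f w)^2)"
  proof -
    have "(\<Sum>v\<in>{1..n}. (\<Sum>w\<in>G `` {v}. f w)^2) = (\<Sum>i<n. (\<Sum>w\<in>G `` {Suc i}. f w)^2)"
      by (simp add: sum.atLeast1_atMost_eq)
    also have "... = (\<Sum>i<n. (\<Sum>j<n. A $$ (i, j) * u 0 j)^2)"
    proof (intro sum.cong refl)
      fix i assume "i \<in> {..<n}"
      then have "(\<Sum>w\<in>G `` {Suc i}. f w) = (\<Sum>j<n. A $$ (i, j) * u 0 j)"
        by (subst regular_graph_sum_eq[OF G]) (auto simp: Aij u0 g_def intro!: sum.cong)
      then show "(\<Sum>w\<in>G `` {Suc i}. f w)^2 = (\<Sum>j<n. A $$ (i, j) * u 0 j)^2" by simp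
    qed
    also have "... = w 1" unfolding w_def by (intro sum.cong) (auto simp: uSuc)
    finally show ?thesis by simp
  qed
  moreover have "w 0 = (\<Sum>v\<in>{1..n}. (f v)^2)"
    unfolding wN g_def by (simp add: sum.atLeast1_atMost_eq)
  ultimately show ?thesis using main unfolding \<mu>_def by simp
qed

section \<open>Mixing of the non-backtracking walk\<close>

text \<open>The transition operator of the non-backtracking walk, acting on functions of directed edges.\<close>

definition nb_op :: "(nat \<times> nat) set => (nat \<times> nat => real) => nat \<times> nat => real" where
  "nb_op G g e = (\<Sum>w\<in>G `` {snd e} - {fst e}. g (snd e, w)) / real (card (G `` {snd e} - {fst e}))"

definition out_mean :: "(nat \<times> nat) set => nat => (nat \<times> nat => real) => nat => real" where
  "out_mean G k g v = (\<Sum>w\<in>G `` {v}. g (v, w)) / real k"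

context
  fixes n k :: nat and G :: "(nat \<times> nat) set"
  assumes G: "regular_graph n k G" and k: "3 \<le> k"
begin

lemma symG: "(u, v) \<in> G \<longleftrightarrow> (v, u) \<in> G"
  using G by (auto simp: regular_graph_def dest: symD)

lemma G_range: "(u, v) \<in> G ==> u \<in> {1..n} \<and> v \<in> {1..n}"
  using G by (auto simp: regular_graph_def)

lemma finG: "finite G"
  using G by (auto simp: regular_graph_def intro: finite_subset)

lemma fin_nbr [simp]: "finite (G `` {v})"
  using finG by (rule finite_Image)

lemma card_nbr: "v \<in> {1..n} ==> card (G `` {v}) = k"
  using G by (auto simp: regular_graph_def)

lemma card_next:
  assumes "(u, v) \<in> G" shows "card (G `` {v} - {u}) = k - 1"
  using assms G_range[OF assms] card_nbr[of v] symG by (subst card_Diff_singleton) auto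

lemma nb_op_edge:
  assumes "(u, v) \<in> G"
  shows "nb_op G g (u, v) = (\<Sum>w\<in>G `` {v} - {u}. g (v, w)) / real (k - 1)"
  using card_next[OF assms] by (simp add: nb_op_def)

lemma sum_edges: "(\<Sum>e\<in>G. g e) = (\<Sum>v\<in>{1..n}. \<Sum>w\<in>G `` {v}. (g (v, w) :: real))"
proof -
  have "G = Sigma {1..n} (\<lambda>v. G `` {v})" using G_range by auto
  then have "(\<Sum>e\<in>G. g e) = (\<Sum>e\<in>Sigma {1..n} (\<lambda>v. G `` {v}). g e)" by simp
  also have "... = (\<Sum>v\<in>{1..n}. \<Sum>w\<in>G `` {v}. g (v, w))"
    using sum.Sigma[of "{1..n}" "\<lambda>v. G `` {v}" "\<lambda>v w. g (v, w)"] by simp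
  finally show ?thesis .
qed

lemma sum_edges_rev: "(\<Sum>e\<in>G. g e) = (\<Sum>v\<in>{1..n}. \<Sum>w\<in>G `` {v}. (g (w, v) :: real))"
proof -
  have "(\<Sum>e\<in>G. g e) = (\<Sum>e\<in>G. g (prod.swap e))"
    by (rule sum.reindex_bij_witness[of _ prod.swap prod.swap]) (use symG in auto)
  then show ?thesis unfolding sum_edges by simp
qed

lemma card_edges: "real (card G) = real n * real k"
  using sum_edges[of "\<lambda>_. 1"] card_nbr by simp

lemma nb_op_mono:
  assumes "\<And>e. e \<in> G ==> g e \<le> c" "e \<in> G"
  shows "nb_op G g e \<le> c"
proof -
  obtain u v where e: "e = (u, v)" by (cases e)
  have "(\<Sum>w\<in>G `` {v} - {u}. g (v, w)) \<le> (\<Sum>w\<in>G `` {v} - {u}. c)"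
    using assms by (intro sum_mono) auto
  then show ?thesis
    using assms(2) k by (simp add: e nb_op_edge card_next divide_simps mult.commute)
qed

lemma nb_op_cong:
  assumes "\<And>e. e \<in> G ==> g e = h e" "e \<in> G"
  shows "nb_op G g e = nb_op G h e"
  unfolding nb_op_def using assms by (cases e) (auto intro!: sum.cong arg_cong2[where f="(/)"])

lemma nb_op_shift:
  assumes "e \<in> G" shows "nb_op G (\<lambda>e. g e - c) e = nb_op G g e - c"
proof -
  obtain u v where e: "e = (u, v)" by (cases e)
  show ?thesis using assms k
    by (simp add: e nb_op_edge sum_subtractf card_next diff_divide_distrib)
qed

text \<open>On the edges out of a vertex, the operator keeps the mean and multiplies the deviation from it by \<open>- 1 / (k - 1)\<close>, reversing the edge.
  This is the only place where the walk differs from a simple one.\<close>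

lemma nb_op_alt:
  assumes "(u, v) \<in> G"
  shows "nb_op G g (u, v) = out_mean G k g v - (g (v, u) - out_mean G k g v) / real (k - 1)"
proof -
  have "(\<Sum>w\<in>G `` {v} - {u}. g (v, w)) = real k * out_mean G k g v - g (v, u)"
    using assms symG k by (subst sum_diff1) (auto simp: out_mean_def)
  then show ?thesis unfolding nb_op_edge[OF assms] using k by (simp add: field_simps of_nat_diff)
qed

lemma out_mean_dev: "v \<in> {1..n} ==> (\<Sum>w\<in>G `` {v}. g (v, w) - out_mean G k g v) = 0"
  using card_nbr[of v] k by (simp add: sum_subtractf out_mean_def)

lemma sum_dev_sq:
  "(\<Sum>e\<in>G. (g e)^2) = real k * (\<Sum>v\<in>{1..n}. (out_mean G k g v)^2)
     + (\<Sum>v\<in>{1..n}. \<Sum>w\<in>G `` {v}. (g (v, w) - out_mean G k g v)^2)"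
proof -
  have "(\<Sum>w\<in>G `` {v}. (g (v, w))^2) = real k * (out_mean G k g v)^2 + (\<Sum>w\<in>G `` {v}. (g (v, w) - out_mean G k g v)^2)"
    if "v \<in> {1..n}" for v
  proof -
    let ?a = "out_mean G k g v"
    have "(\<Sum>w\<in>G `` {v}. (g (v, w))^2) = (\<Sum>w\<in>G `` {v}. ?a^2 + (g (v, w) - ?a)^2 + 2 * ?a * (g (v, w) - ?a))"
      by (intro sum.cong) (auto simp: power2_eq_square algebra_simps)
    also have "... = real k * ?a^2 + (\<Sum>w\<in>G `` {v}. (g (v, w) - ?a)^2)"
      unfolding sum.distrib sum_distrib_left[symmetric] out_mean_dev[OF that] using card_nbr[OF that] by simp
    finally show ?thesis .
  qed
  then show ?thesis unfolding sum_edges by (simp add: sum.distrib sum_distrib_left)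
qed

lemma nb_op_norm:
  "(\<Sum>e\<in>G. (nb_op G g e)^2) = real k * (\<Sum>v\<in>{1..n}. (out_mean G k g v)^2)
     + (\<Sum>v\<in>{1..n}. \<Sum>w\<in>G `` {v}. (g (v, w) - out_mean G k g v)^2) / (real (k - 1))^2"
proof -
  have "(\<Sum>w\<in>G `` {v}. (nb_op G g (w, v))^2) = real k * (out_mean G k g v)^2 +
      (\<Sum>w\<in>G `` {v}. (g (v, w) - out_mean G k g v)^2) / (real (k - 1))^2" if "v \<in> {1..n}" for v
  proof -
    let ?a = "out_mean G k g v" and ?c = "1 / real (k - 1)"
    have "(\<Sum>w\<in>G `` {v}. (nb_op G g (w, v))^2) =
       (\<Sum>w\<in>G `` {v}. ?a^2 + ?c^2 * (g (v, w) - ?a)^2 - 2 * ?a * ?c * (g (v, w) - ?a))"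
    proof (intro sum.cong refl)
      fix w assume "w \<in> G `` {v}"
      then have "(w, v) \<in> G" using symG by auto
      then have "nb_op G g (w, v) = ?a - ?c * (g (v, w) - ?a)" by (simp add: nb_op_alt)
      then show "(nb_op G g (w, v))^2 = ?a^2 + ?c^2 * (g (v, w) - ?a)^2 - 2 * ?a * ?c * (g (v, w) - ?a)"
        by (simp only: power2_diff power_mult_distrib) (simp only: mult_ac)
    qed
    also have "... = real k * ?a^2 + ?c^2 * (\<Sum>w\<in>G `` {v}. (g (v, w) - ?a)^2)"
      unfolding sum.distrib sum_subtractf[of "\<lambda>w. _ + _ w"] sum_distrib_left[symmetric] out_mean_dev[OF that]
      using card_nbr[OF that] by simp
    finally show ?thesis by (simp add: power_divide)
  qed
  then show ?thesis unfolding sum_edges_rev by (simp add: sum.distrib sum_distrib_left sum_divide_distrib)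
qed

lemma nb_op_sum: "(\<Sum>e\<in>G. nb_op G g e) = (\<Sum>e\<in>G. g e)"
proof -
  have "(\<Sum>w\<in>G `` {v}. nb_op G g (w, v)) = (\<Sum>w\<in>G `` {v}. g (v, w))" if "v \<in> {1..n}" for v
  proof -
    have "(\<Sum>w\<in>G `` {v}. nb_op G g (w, v)) =
       (\<Sum>w\<in>G `` {v}. out_mean G k g v - (g (v, w) - out_mean G k g v) / real (k - 1))"
      by (intro sum.cong refl nb_op_alt) (use symG in auto)
    also have "... = real k * out_mean G k g v"
      unfolding sum_subtractf[of "\<lambda>_. out_mean G k g v"] sum_divide_distrib[symmetric] out_mean_dev[OF that]
      using card_nbr[OF that] by simp
    finally show ?thesis using k by (simp add: out_mean_def)
  qed
  then show ?thesis by (subst sum_edges_rev, subst sum_edges) simp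
qed

lemma sum_sq_le_card: "(\<Sum>x\<in>A. f x)^2 \<le> real (card A) * (\<Sum>x\<in>A. (f x :: real)^2)"
  using Cauchy_Schwarz_ineq_sum[of "\<lambda>_. 1" f A] by simp

text \<open>One step need not contract: a function of the tail vertex keeps its norm. Write \<open>X\<close> for the part of the squared norm carried by the
  vertex means and \<open>Y\<close> for the deviations. A step shrinks \<open>Y\<close> at once and leaves \<open>X\<close>; but then the new means
  are, up to the deviations, the averages of the old means over neighbours, so the spectral gap shrinks \<open>X\<close> in the second step.\<close>

lemma nb_op_contraction:
  fixes r :: real
  assumes r: "0 \<le> r" "r < 1"
    and gap: "\<And>f. (\<Sum>v\<in>{1..n}. f v) = 0 ==>
      (\<Sum>v\<in>{1..n}. (\<Sum>w\<in>G `` {v}. f w)^2) \<le> (r * real k)^2 * (\<Sum>v\<in>{1..n}. (f v)^2)"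
    and g0: "(\<Sum>e\<in>G. g e) = 0"
  shows "(\<Sum>e\<in>G. (nb_op G (nb_op G g) e)^2) \<le> (1 - (1 - r^2)^2 / 32) * (\<Sum>e\<in>G. (g e)^2)"
proof -
  define a where "a = out_mean G k g"
  define g' where "g' = (\<lambda>e. g e - a (fst e))"
  define h where "h = nb_op G g"
  define b where "b = out_mean G k h"
  define X where "X = real k * (\<Sum>v\<in>{1..n}. (a v)^2)"
  define Y where "Y = (\<Sum>e\<in>G. (g' e)^2)"
  define y where "y = real k * (\<Sum>v\<in>{1..n}. (b v)^2)"
  define \<epsilon> where "\<epsilon> = 1 / real (k - 1)"
  define H where "H = (\<Sum>e\<in>G. (h e)^2)"
  have k1: "real (k - 1) \<ge> 2" using k by auto
  have eps: "0 \<le> \<epsilon>" "\<epsilon> \<le> 1 / 2" unfolding \<epsilon>_def using k1 by (auto simp: divide_simps)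
  have eps2: "\<epsilon>^2 \<le> 1 / 4" using power_mono[OF eps(2,1), of 2] by (simp add: power2_eq_square)
  have XY: "(\<Sum>e\<in>G. (g e)^2) = X + Y"
    unfolding X_def Y_def sum_dev_sq[of g] unfolding sum_edges[of "\<lambda>e. (g' e)^2"] unfolding g'_def a_def by simp
  have HX: "H = X + \<epsilon>^2 * Y"
    unfolding H_def X_def Y_def h_def nb_op_norm unfolding sum_edges[of "\<lambda>e. (g' e)^2"] unfolding g'_def a_def \<epsilon>_def
    by (simp add: power_divide)
  have XY0: "0 \<le> X" "0 \<le> Y" unfolding X_def Y_def by (auto intro!: sum_nonneg mult_nonneg_nonneg)
  have T2: "(\<Sum>e\<in>G. (nb_op G h e)^2) = y + \<epsilon>^2 * (H - y)"
    unfolding nb_op_norm H_def sum_dev_sq y_def b_def \<epsilon>_def by (simp add: power_divide)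
  have yH: "y \<le> H"
    unfolding H_def sum_dev_sq y_def b_def by (auto intro!: sum_nonneg)
  \<comment> \<open>\<open>t\<close> is the weight in Young's inequality that leaves room between \<open>(1 + t) * r^2\<close> and \<open>1 - t\<close>\<close>
  define t where "t = (1 - r^2) / 2"
  have r2: "r^2 < 1" "0 \<le> r^2" using r by (auto simp: power_less_one_iff abs_square_less_1)
  have t: "0 < t" "t \<le> 1 / 2" unfolding t_def using r2 by auto
  define p q where "p = (\<lambda>v. (\<Sum>w\<in>G `` {v}. a w) / real k)"
    and "q = (\<lambda>v. \<epsilon> * (\<Sum>w\<in>G `` {v}. g' (w, v)) / real k)"
  have bpq: "b v = p v - q v" if "v \<in> {1..n}" for v
  proof -
    have "(\<Sum>w\<in>G `` {v}. h (v, w)) = (\<Sum>w\<in>G `` {v}. a w - \<epsilon> * g' (w, v))"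
      by (intro sum.cong refl) (auto simp: h_def nb_op_alt a_def g'_def \<epsilon>_def)
    then show ?thesis unfolding b_def out_mean_def p_def q_def
      by (simp add: sum_subtractf sum_distrib_left diff_divide_distrib)
  qed
  have a0: "(\<Sum>v\<in>{1..n}. a v) = 0"
    using g0 k unfolding sum_edges a_def out_mean_def by (simp add: sum_divide_distrib[symmetric])
  have pX: "real k * (\<Sum>v\<in>{1..n}. (p v)^2) \<le> r^2 * X"
  proof -
    have "(\<Sum>v\<in>{1..n}. (p v)^2) = (\<Sum>v\<in>{1..n}. (\<Sum>w\<in>G `` {v}. a w)^2) / (real k)^2"
      unfolding p_def power_divide by (rule sum_divide_distrib[symmetric])
    also have "... \<le> ((r * real k)^2 * (\<Sum>v\<in>{1..n}. (a v)^2)) / (real k)^2"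
      by (intro divide_right_mono gap a0) auto
    also have "... = r^2 * (\<Sum>v\<in>{1..n}. (a v)^2)" using k by (simp add: power_mult_distrib)
    finally show ?thesis unfolding X_def by (simp add: mult_left_mono mult.left_commute)
  qed
  have qY: "real k * (\<Sum>v\<in>{1..n}. (q v)^2) \<le> \<epsilon>^2 * Y"
  proof -
    have "real k * (q v)^2 \<le> \<epsilon>^2 * (\<Sum>w\<in>G `` {v}. (g' (w, v))^2)" if "v \<in> {1..n}" for v
    proof -
      have "(\<Sum>w\<in>G `` {v}. g' (w, v))^2 \<le> real k * (\<Sum>w\<in>G `` {v}. (g' (w, v))^2)"
        using sum_sq_le_card[of "\<lambda>w. g' (w, v)" "G `` {v}"] card_nbr[OF that] by simp
      then have "\<epsilon>^2 * (\<Sum>w\<in>G `` {v}. g' (w, v))^2 \<le> \<epsilon>^2 * (real k * (\<Sum>w\<in>G `` {v}. (g' (w, v))^2))"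
        by (intro mult_left_mono) auto
      then show ?thesis unfolding q_def using k
        by (simp add: power_mult_distrib power_divide power2_eq_square[of "real k"] divide_simps mult_ac)
    qed
    then have "(\<Sum>v\<in>{1..n}. real k * (q v)^2) \<le> (\<Sum>v\<in>{1..n}. \<epsilon>^2 * (\<Sum>w\<in>G `` {v}. (g' (w, v))^2))"
      by (rule sum_mono)
    then show ?thesis unfolding Y_def sum_edges_rev by (simp add: sum_distrib_left)
  qed
  have young: "(p v - q v)^2 \<le> (1 + t) * (p v)^2 + (1 + 1 / t) * (q v)^2" for v
  proof -
    have "0 \<le> (t * p v + q v)^2 / t" using t by simp
    also have "... = t * (p v)^2 + 2 * p v * q v + (q v)^2 / t"
      using t by (simp add: power2_eq_square field_simps)
    finally show ?thesis by (simp add: power2_eq_square algebra_simps)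
  qed
  have y2: "y \<le> (1 + t) * (r^2 * X) + (1 + 1 / t) * (\<epsilon>^2 * Y)"
  proof -
    have "y = (\<Sum>v\<in>{1..n}. real k * (p v - q v)^2)" unfolding y_def by (simp add: bpq sum_distrib_left)
    also have "... \<le> (\<Sum>v\<in>{1..n}. real k * ((1 + t) * (p v)^2 + (1 + 1 / t) * (q v)^2))"
      by (intro sum_mono mult_left_mono young) auto
    also have "... = (1 + t) * (real k * (\<Sum>v\<in>{1..n}. (p v)^2)) + (1 + 1 / t) * (real k * (\<Sum>v\<in>{1..n}. (q v)^2))"
      by (simp add: sum.distrib sum_distrib_left algebra_simps)
    also have "... \<le> (1 + t) * (r^2 * X) + (1 + 1 / t) * (\<epsilon>^2 * Y)"
      using pX qY t by (intro add_mono mult_left_mono) auto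
    finally show ?thesis .
  qed
  \<comment> \<open>the mean part is bounded both trivially and through the gap; \<open>\<eta>\<close> mixes the two so that \<open>Y\<close> gets a factor at most \<open>1 / 2\<close>\<close>
  define \<eta> where "\<eta> = t / (4 * (1 + t))"
  have tt: "1 + 1 / t = (1 + t) / t" using t by (simp add: field_simps)
  have eta: "0 \<le> \<eta>" "\<eta> \<le> 1" unfolding \<eta>_def using t by (auto simp: field_simps)
  have eta3: "\<eta> * (1 + 1 / t) = 1 / 4" unfolding \<eta>_def tt using t by simp
  have "(1 + t) * r^2 \<le> 1 - t"
  proof -
    have "r^2 = 1 - 2 * t" unfolding t_def by (simp add: field_simps)
    moreover have "(1 + t) * (1 - 2 * t) = 1 - t - 2 * t^2" by (simp add: power2_eq_square algebra_simps)
    ultimately show ?thesis by simp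
  qed
  then have rX: "(1 + t) * (r^2 * X) \<le> (1 - t) * X" using XY0 by (simp add: mult_right_mono mult.assoc[symmetric])
  have "y = (1 - \<eta>) * y + \<eta> * y" by (simp add: algebra_simps)
  also have "... \<le> (1 - \<eta>) * (X + \<epsilon>^2 * Y) + \<eta> * ((1 - t) * X + (1 + 1 / t) * (\<epsilon>^2 * Y))"
    using eta yH HX y2 rX by (intro add_mono mult_left_mono) auto
  also have "... = (1 - \<eta> * t) * X + ((1 - \<eta>) * \<epsilon>^2 + (\<eta> * (1 + 1 / t)) * \<epsilon>^2) * Y"
    by (simp add: algebra_simps)
  also have "... \<le> (1 - \<eta> * t) * X + (1 / 2) * Y"
  proof -
    have "(1 - \<eta>) * \<epsilon>^2 \<le> 1 * \<epsilon>^2" using eta by (intro mult_right_mono) auto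
    then have "(1 - \<eta>) * \<epsilon>^2 + (\<eta> * (1 + 1 / t)) * \<epsilon>^2 \<le> 1 / 2" unfolding eta3 using eps2 by simp
    then show ?thesis using XY0 by (intro add_left_mono mult_right_mono) auto
  qed
  also have "... \<le> (1 - \<eta> * t) * X + (1 - \<eta> * t) * Y"
  proof -
    have "\<eta> * t \<le> 1 * (1 / 2)" using eta t by (intro mult_mono) auto
    then show ?thesis using XY0 by (intro add_left_mono mult_right_mono) auto
  qed
  finally have y1: "y \<le> (1 - \<eta> * t) * (X + Y)" by (simp add: algebra_simps)
  have "\<eta> * t \<ge> t^2 / 6"
    unfolding \<eta>_def using t by (simp add: power2_eq_square divide_simps)
  then have et: "\<eta> * t \<ge> (1 - r^2)^2 / 24" unfolding t_def by (simp add: power_divide)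
  have "y + \<epsilon>^2 * (H - y) \<le> y + 1 / 4 * (H - y)" using eps2 yH by (intro add_left_mono mult_right_mono) auto
  also have "... \<le> 3 / 4 * ((1 - \<eta> * t) * (X + Y)) + 1 / 4 * (X + Y)"
  proof -
    have "\<epsilon>^2 * Y \<le> 1 * Y" using XY0 eps2 by (intro mult_right_mono) auto
    then have "H \<le> X + Y" using HX by simp
    then show ?thesis using y1 by (simp add: field_simps)
  qed
  also have "... = (1 - 3 / 4 * (\<eta> * t)) * (X + Y)" by (simp add: field_simps)
  also have "... \<le> (1 - (1 - r^2)^2 / 32) * (X + Y)" using et XY0 by (intro mult_right_mono) auto
  finally show ?thesis using T2 XY unfolding h_def by simp
qed

lemma nb_op_pow_sum: "(\<Sum>e\<in>G. ((nb_op G ^^ m) g) e) = (\<Sum>e\<in>G. g e)"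
  by (induction m) (simp_all add: nb_op_sum)

lemma nb_op_pow_shift:
  assumes "e \<in> G" shows "(nb_op G ^^ m) (\<lambda>e. g e - c) e = (nb_op G ^^ m) g e - c"
  using assms
proof (induction m arbitrary: e)
  case (Suc m)
  have "(nb_op G ^^ Suc m) (\<lambda>e. g e - c) e = nb_op G (\<lambda>e. (nb_op G ^^ m) g e - c) e"
    using nb_op_cong[OF Suc.IH Suc.prems] by simp
  then show ?case using nb_op_shift[OF Suc.prems] by simp
qed simp

lemma nb_op_pow_bound:
  assumes "\<And>e. e \<in> G ==> (nb_op G ^^ m) g e \<le> c" "m \<le> m'" "e \<in> G"
  shows "(nb_op G ^^ m') g e \<le> c"
  using assms(2,3)
proof (induction m' arbitrary: e rule: dec_induct)
  case (step m')
  show ?case using nb_op_mono[of "(nb_op G ^^ m') g" c e] step by simp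
qed (use assms in auto)

text \<open>The contraction of the mean square gives uniform control at the price of the factor \<open>n * k\<close> (the number of edges), which the exponential
  decay beats once \<open>m\<close> exceeds a multiple of \<open>ln n\<close>.\<close>

lemma nb_op_mixing:
  fixes r :: real
  assumes r: "0 \<le> r" "r < 1" and n: "0 < n"
    and gap: "\<And>f. (\<Sum>v\<in>{1..n}. f v) = 0 ==>
      (\<Sum>v\<in>{1..n}. (\<Sum>w\<in>G `` {v}. f w)^2) \<le> (r * real k)^2 * (\<Sum>v\<in>{1..n}. (f v)^2)"
    and B: "B \<subseteq> {1..n}" and e: "e \<in> G"
  shows "\<bar>(nb_op G ^^ (2 * m)) (\<lambda>e. of_bool (snd e \<in> B)) e - real (card B) / real n\<bar>
     \<le> sqrt (real n * real k * (1 - (1 - r^2)^2 / 32) ^ m)"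
proof -
  define \<gamma> where "\<gamma> = 1 - (1 - r^2)^2 / 32"
  define c where "c = real (card B) / real n"
  define g :: "nat \<times> nat => real" where "g = (\<lambda>e. of_bool (snd e \<in> B) - c)"
  have cB: "card B \<le> n" using card_mono[OF _ B] by simp
  then have c: "0 \<le> c" "c \<le> 1" unfolding c_def using n by auto
  have "(1 - r^2)^2 \<le> 1^2" using r by (intro power_mono) (auto simp: power_le_one)
  then have gam: "0 \<le> \<gamma>" unfolding \<gamma>_def by simp
  have "(\<Sum>e\<in>G. g e) = (\<Sum>v\<in>{1..n}. \<Sum>w\<in>G `` {v}. (of_bool (v \<in> B) - c))"
    unfolding sum_edges_rev g_def by simp
  also have "... = (\<Sum>v\<in>{1..n}. real k * of_bool (v \<in> B) - real k * c)"
    by (intro sum.cong) (auto simp: card_nbr algebra_simps simp del: fin_nbr)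
  also have "... = real k * real (card B) - real n * real k * c"
    using B by (simp add: sum_subtractf sum_distrib_left[symmetric] Int_absorb1)
  also have "... = 0" unfolding c_def using n by simp
  finally have g0: "(\<Sum>e\<in>G. g e) = 0" .
  have norm: "(\<Sum>e\<in>G. ((nb_op G ^^ (2 * m)) g e)^2) \<le> \<gamma> ^ m * (\<Sum>e\<in>G. (g e)^2)" for m
  proof (induction m)
    case (Suc m)
    have "(\<Sum>e\<in>G. ((nb_op G ^^ (2 * Suc m)) g e)^2) \<le> \<gamma> * (\<Sum>e\<in>G. ((nb_op G ^^ (2 * m)) g e)^2)"
      using nb_op_contraction[OF r gap, of "(nb_op G ^^ (2 * m)) g"] nb_op_pow_sum[of "2 * m" g] g0
      unfolding \<gamma>_def by simp
    also have "... \<le> \<gamma> * (\<gamma> ^ m * (\<Sum>e\<in>G. (g e)^2))" using Suc gam by (intro mult_left_mono) auto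
    finally show ?case by simp
  qed simp
  have "((nb_op G ^^ (2 * m)) g e)^2 \<le> (\<Sum>e\<in>G. ((nb_op G ^^ (2 * m)) g e)^2)"
    using e finG by (intro member_le_sum) auto
  also have "... \<le> \<gamma> ^ m * (\<Sum>e\<in>G. (g e)^2)" by (rule norm)
  also have "... \<le> \<gamma> ^ m * (\<Sum>e\<in>G. 1)"
    using c gam by (intro mult_left_mono sum_mono) (auto simp: g_def abs_square_le_1)
  also have "... = real n * real k * \<gamma> ^ m" using card_edges by simp
  finally have "\<bar>(nb_op G ^^ (2 * m)) g e\<bar> \<le> sqrt (real n * real k * \<gamma> ^ m)"
    using real_le_rsqrt real_sqrt_le_mono by fastforce
  then show ?thesis unfolding g_def nb_op_pow_shift[OF e] c_def \<gamma>_def .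
qed

end

section \<open>Girth\<close>

definition nb_walk :: "(nat \<times> nat) set => (nat => nat) => nat => bool" where
  "nb_walk G z N \<longleftrightarrow> (\<forall>i<N. (z i, z (Suc i)) \<in> G) \<and> (\<forall>i. Suc (Suc i) \<le> N \<longrightarrow> z (Suc (Suc i)) \<noteq> z i)"

text \<open>Among the revisits of the walk take one in the shortest time: the vertices in between are distinct, and the walk does not backtrack, so they form a
  cycle.\<close>

lemma nb_walk_revisit_girth:
  assumes "irrefl G" "nb_walk G z N" "a < b" "b \<le> N" "z a = z b"
  shows "girth G \<le> enat (b - a)"
  using assms(3-5)
proof (induction "b - a" arbitrary: a b rule: less_induct)
  case less
  show ?case
  proof (cases "\<exists>a' b'. a \<le> a' \<and> a' < b' \<and> b' \<le> b \<and> z a' = z b' \<and> b' - a' < b - a")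
    case True
    then obtain a' b' where ab: "a \<le> a'" "a' < b'" "b' \<le> b" "z a' = z b'" "b' - a' < b - a" by blast
    have "girth G \<le> enat (b' - a')" using less.hyps[of b' a'] ab less.prems by auto
    also have "... \<le> enat (b - a)" using ab by simp
    finally show ?thesis .
  next
    case False
    define vs where "vs = map z [a..<b]"
    have len: "length vs = b - a" by (simp add: vs_def)
    have "inj_on z {a..<b}"
    proof (rule linorder_inj_onI')
      fix i j assume ij: "i \<in> {a..<b}" "j \<in> {a..<b}" "i < j"
      show "z i \<noteq> z j"
      proof
        assume "z i = z j"
        moreover have "j - i < b - a" using ij by auto
        ultimately show False using False ij by auto
      qed
    qed
    then have dist: "distinct vs" by (simp add: vs_def distinct_map)
    have edge: "(z i, z (Suc i)) \<in> G" if "i < b" for i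
      using assms(2) that less.prems by (auto simp: nb_walk_def)
    have "b - a \<noteq> 1"
    proof
      assume "b - a = 1"
      then have "b = Suc a" by simp
      then have "(z a, z a) \<in> G" using edge[of a] less.prems by simp
      then show False using assms(1) by (auto simp: irrefl_def)
    qed
    moreover have "b - a \<noteq> 2"
    proof
      assume "b - a = 2"
      then have "b = Suc (Suc a)" by simp
      then show False using assms(2) less.prems unfolding nb_walk_def by auto
    qed
    ultimately have "3 \<le> length vs" using less.prems len by linarith
    moreover have "(vs ! i, vs ! (Suc i mod length vs)) \<in> G" if "i < length vs" for i
    proof (cases "Suc i < length vs")
      case True
      then show ?thesis using edge[of "a + i"] by (simp add: vs_def)
    next
      case False
      then have "Suc i = length vs" using that by simp
      then have "Suc (a + i) = b" using len less.prems by simp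
      then show ?thesis using edge[of "a + i"] \<open>Suc i = length vs\<close> less.prems that by (auto simp: vs_def)
    qed
    ultimately have "is_cycle G vs" using dist by (simp add: is_cycle_def)
    then show ?thesis unfolding girth_def by (intro INF_lower2[of vs]) (auto simp: len)
  qed
qed

context
  fixes n k :: nat and G :: "(nat \<times> nat) set"
  assumes G: "regular_graph n k G" and k: "3 \<le> k"
begin

lemma nb_op_pow_path:
  assumes "e \<in> G" "(nb_op G ^^ r) (\<lambda>e. of_bool (snd e = v)) e \<noteq> 0"
  shows "\<exists>z. nb_walk G z (Suc r) \<and> z 0 = fst e \<and> z 1 = snd e \<and> z (Suc r) = v"
  using assms
proof (induction r arbitrary: e)
  case 0
  then show ?case
    by (intro exI[of _ "case_nat (fst e) (\<lambda>_. snd e)"]) (auto simp: nb_walk_def split: if_splits)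
next
  case (Suc r)
  obtain w where w: "w \<in> G `` {snd e} - {fst e}" "(nb_op G ^^ r) (\<lambda>e. of_bool (snd e = v)) (snd e, w) \<noteq> 0"
  proof -
    have "(\<Sum>w\<in>G `` {snd e} - {fst e}. (nb_op G ^^ r) (\<lambda>e. of_bool (snd e = v)) (snd e, w)) \<noteq> 0"
      using Suc.prems unfolding funpow.simps comp_def nb_op_def by auto
    then show ?thesis using that by (meson sum.neutral)
  qed
  from Suc.IH[OF _ w(2)] w(1) obtain z where z: "nb_walk G z (Suc r)" "z 0 = snd e" "z 1 = w" "z (Suc r) = v"
    by auto
  define z' where "z' = case_nat (fst e) z"
  have "nb_walk G z' (Suc (Suc r))"
    unfolding nb_walk_def
  proof (intro conjI allI impI)
    fix i assume "i < Suc (Suc r)"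
    then show "(z' i, z' (Suc i)) \<in> G" using z Suc.prems by (cases i) (auto simp: z'_def nb_walk_def)
  next
    fix i assume "Suc (Suc i) \<le> Suc (Suc r)"
    then show "z' (Suc (Suc i)) \<noteq> z' i" using z w by (cases i) (auto simp: z'_def nb_walk_def)
  qed
  then show ?case using z by (intro exI[of _ z']) (auto simp: z'_def)
qed

text \<open>Below half the girth, at most one first step leads to \<open>v\<close> in time: two different ones, joined at the start, would give a closed
  non-backtracking walk shorter than the girth. Each step therefore costs a factor \<open>k - 1\<close>.\<close>

lemma nb_op_pow_girth:
  assumes "e \<in> G" "enat (2 * r) < girth G"
  shows "(nb_op G ^^ r) (\<lambda>e. of_bool (snd e = v)) e \<le> 1 / real (k - 1) ^ r"
  using assms
proof (induction r arbitrary: e)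
  case (Suc r)
  define f where "f = (\<lambda>w. (nb_op G ^^ r) (\<lambda>e. of_bool (snd e = v)) (snd e, w))"
  obtain x y where e: "e = (x, y)" by (cases e)
  have IH: "f w \<le> 1 / real (k - 1) ^ r" if "w \<in> G `` {y} - {x}" for w
  proof -
    have "enat (2 * r) < girth G" using Suc.prems(2) by (rule order.strict_trans[rotated]) simp
    then show ?thesis unfolding f_def e using Suc.IH[of "(y, w)"] that by auto
  qed
  have uniq: "w1 = w2" if "w1 \<in> G `` {y} - {x}" "w2 \<in> G `` {y} - {x}" "f w1 \<noteq> 0" "f w2 \<noteq> 0" for w1 w2
  proof (rule ccontr)
    assume ne: "w1 \<noteq> w2"
    note w12 = that
    obtain z1 where z1: "nb_walk G z1 (Suc r)" "z1 0 = y" "z1 1 = w1" "z1 (Suc r) = v"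
      using nb_op_pow_path[of "(y, w1)" r v] w12(1) w12(3) by (fastforce simp: f_def e)
    obtain z2 where z2: "nb_walk G z2 (Suc r)" "z2 0 = y" "z2 1 = w2" "z2 (Suc r) = v"
      using nb_op_pow_path[of "(y, w2)" r v] w12(2) w12(4) by (fastforce simp: f_def e)
    \<comment> \<open>back from \<open>v\<close> along the second walk, then forth along the first\<close>
    define z where "z = (\<lambda>i. if i \<le> Suc r then z2 (Suc r - i) else z1 (i - Suc r))"
    have irr: "irrefl G" and sy: "sym G" using G by (auto simp: regular_graph_def)
    have "nb_walk G z (2 * Suc r)"
      unfolding nb_walk_def
    proof (intro conjI allI impI)
      fix i assume i: "i < 2 * Suc r"
      show "(z i, z (Suc i)) \<in> G"
      proof (cases "i < Suc r")
        case True
        then have "(z2 (r - i), z2 (Suc (r - i))) \<in> G" using z2(1) by (auto simp: nb_walk_def)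
        moreover have "Suc r - i = Suc (r - i)" using True by auto
        ultimately show ?thesis using True sy by (auto simp: z_def dest: symD)
      next
        case False
        then have "z i = z1 (i - Suc r)" using z1 z2 by (auto simp: z_def)
        moreover have "i - r = Suc (i - Suc r)" using False by arith
        then have "z (Suc i) = z1 (Suc (i - Suc r))" using False by (simp add: z_def)
        moreover have "i - Suc r < Suc r" using i by auto
        ultimately show ?thesis using z1(1) by (auto simp: nb_walk_def)
      qed
    next
      fix i assume i: "Suc (Suc i) \<le> 2 * Suc r"
      show "z (Suc (Suc i)) \<noteq> z i"
      proof (cases "Suc (Suc i) \<le> Suc r")
        case True
        then have "z2 (Suc (Suc (r - Suc i))) \<noteq> z2 (r - Suc i)" using z2(1) by (auto simp: nb_walk_def)
        moreover have "Suc r - i = Suc (Suc (r - Suc i))" "Suc r - Suc (Suc i) = r - Suc i" using True by auto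
        ultimately show ?thesis using True by (simp add: z_def)
      next
        case False
        show ?thesis
        proof (cases "i = r")
          case True
          then show ?thesis using z1 z2 ne by (simp add: z_def)
        next
          case False
          then have "Suc r \<le> i" using \<open>\<not> Suc (Suc i) \<le> Suc r\<close> by auto
          then have "Suc i - r = Suc (Suc (i - Suc r))" by arith
          then have "z i = z1 (i - Suc r)" "z (Suc (Suc i)) = z1 (Suc (Suc (i - Suc r)))"
            using z1 z2 \<open>Suc r \<le> i\<close> by (auto simp: z_def)
          moreover have "Suc (Suc (i - Suc r)) \<le> Suc r" using i \<open>Suc r \<le> i\<close> by auto
          ultimately show ?thesis using z1(1) by (auto simp: nb_walk_def)
        qed
      qed
    qed
    moreover have "z 0 = z (2 * Suc r)" using z1 z2 by (simp add: z_def)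
    ultimately have "girth G \<le> enat (2 * Suc r - 0)"
      by (intro nb_walk_revisit_girth[OF irr, of z "2 * Suc r" 0 "2 * Suc r"]) auto
    then show False using Suc.prems(2) by simp
  qed
  have fin: "finite (G `` {y} - {x})" using fin_nbr[OF G k] by simp
  have "(\<Sum>w\<in>G `` {y} - {x}. f w) \<le> 1 / real (k - 1) ^ r"
  proof (cases "\<exists>w\<in>G `` {y} - {x}. f w \<noteq> 0")
    case True
    then obtain w where w: "w \<in> G `` {y} - {x}" "f w \<noteq> 0" by blast
    have "f w' = 0" if "w' \<in> G `` {y} - {x} - {w}" for w' using uniq[of w' w] that w by blast
    then have "(\<Sum>w\<in>G `` {y} - {x}. f w) = f w" using sum.remove[OF fin w(1), of f] by simp
    then show ?thesis using IH[OF w(1)] by simp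
  qed simp
  then have "(\<Sum>w\<in>G `` {y} - {x}. f w) / real (k - 1) \<le> 1 / real (k - 1) ^ r / real (k - 1)"
    by (rule divide_right_mono) simp
  then show ?case
    using nb_op_edge[OF G k, of x y "(nb_op G ^^ r) (\<lambda>e. of_bool (snd e = v))"] Suc.prems(1)
    by (simp add: e f_def mult.commute)
qed simp

lemma nb_op_pow_le:
  assumes "e \<in> G" "enat (2 * rho) < girth G" "rho \<le> r"
  shows "(nb_op G ^^ r) (\<lambda>e. of_bool (snd e = v)) e \<le> 1 / real (k - 1) ^ rho"
  by (rule nb_op_pow_bound[OF G k _ assms(3,1)]) (rule nb_op_pow_girth[OF _ assms(2)])

end

section \<open>A single server\<close>

text \<open>Lindley's recursion: \<open>a\<close> lists the arrival times and \<open>sv\<close> the service times of the jobs at one first-come first-served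
  queue.\<close>

primrec svc_start :: "(nat => real) => (nat => real) => nat => real" where
  "svc_start a sv 0 = a 0"
| "svc_start a sv (Suc r) = max (a (Suc r)) (svc_start a sv r + sv r)"

definition svc_end :: "(nat => real) => (nat => real) => nat => real" where
  "svc_end a sv r = svc_start a sv r + sv r"

lemma svc_start_cong:
  "(\<And>i. i \<le> r ==> a i = a' i) ==> (\<And>i. i < r ==> sv i = sv' i) ==> svc_start a sv r = svc_start a' sv' r"
  by (induction r) auto

lemma svc_start_ge: "a r \<le> svc_start a sv r"
  by (cases r) auto

lemma svc_end_less_Suc: "0 < sv (Suc r) ==> svc_end a sv r < svc_end a sv (Suc r)"
  by (simp add: svc_end_def)

lemma svc_end_mono:
  assumes "\<And>i. 0 < sv i" "r \<le> r'" shows "svc_end a sv r \<le> svc_end a sv r'"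
  using assms(2)
proof (induction r' rule: dec_induct)
  case (step i)
  then show ?case using svc_end_less_Suc[of sv i a] assms(1) by (meson less_imp_le order.trans)
qed simp

lemma finite_downset_nat:
  fixes S :: "nat set"
  assumes "finite S" "\<And>i j. i \<in> S ==> j < i ==> j \<in> S"
  shows "S = {..<card S}"
proof (cases "S = {}")
  case False
  have "S = {..Max S}"
  proof (intro equalityI subsetI)
    fix i assume "i \<in> {..Max S}"
    then show "i \<in> S" using assms(2)[OF Max_in[OF assms(1) False], of i] Max_in[OF assms(1) False]
      by (cases "i = Max S") auto
  qed (use assms in auto)
  then have "card S = Suc (Max S)" by (metis card_atMost)
  then show ?thesis using \<open>S = {..Max S}\<close> by (simp add: lessThan_Suc_atMost)
qed simp

text \<open>The system specifies a queue implicitly, through its own busy time \<open>B\<close>: the number of departures is the number of services that fit into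
  \<open>B t\<close>. The aim is to solve this equation, showing that departures are the ends of service of Lindley's recursion. The horizon
  \<open>hz\<close> lets the arrivals after some job be ignored.\<close>

locale single_server =
  fixes Q :: "real => nat" and a sv :: "nat => real" and nj :: nat and hz :: real and B :: "real => real"
  assumes sv: "\<And>m. 0 < sv m" and div: "\<And>x. \<exists>m. x < (\<Sum>i\<le>m. sv i)"
    and a0: "\<And>r. r < nj ==> 0 \<le> a r" and amono: "\<And>r s. r \<le> s ==> s < nj ==> a r \<le> a s"
    and B: "\<And>t. B t = measure lborel {s\<in>{0..t}. 0 < Q s}"
    and dyn: "\<And>t. 0 \<le> t ==> t < hz ==>
      Q t + card {m. (\<Sum>i\<le>m. sv i) \<le> B t} = card {r. r < nj \<and> a r \<le> t}"
begin

definition "w m = (\<Sum>i<m. sv i)"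
definition "D t = card {m. (\<Sum>i\<le>m. sv i) \<le> B t}"
definition "A t = card {r. r < nj \<and> a r \<le> t}"

lemma w_Suc: "(\<Sum>i\<le>m. sv i) = w (Suc m)"
  by (simp add: w_def lessThan_Suc_atMost)

lemma w_Suc': "w (Suc m) = w m + sv m" by (simp add: w_def)

lemma w_strict: "strict_mono w"
  by (rule strict_mono_Suc_iff[THEN iffD2]) (simp add: w_Suc' sv)

lemma completed_set: "{m. w (Suc m) \<le> x} = {..<card {m. w (Suc m) \<le> x}}"
proof (rule finite_downset_nat)
  obtain m0 where "x < w (Suc m0)" using div[of x] by (auto simp: w_Suc)
  then have "{m. w (Suc m) \<le> x} \<subseteq> {..<m0}"
  proof (intro subsetI)
    fix m assume "m \<in> {m. w (Suc m) \<le> x}"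
    then have "w (Suc m) < w (Suc m0)" using \<open>x < w (Suc m0)\<close> by simp
    then show "m \<in> {..<m0}" using w_strict by (simp add: strict_mono_less)
  qed
  then show "finite {m. w (Suc m) \<le> x}" by (rule finite_subset) simp
  show "j \<in> {m. w (Suc m) \<le> x}" if "i \<in> {m. w (Suc m) \<le> x}" "j < i" for i j
    using that strict_monoD[OF w_strict, of "Suc j" "Suc i"] by auto
qed

lemma D_iff: "r < D t \<longleftrightarrow> w (Suc r) \<le> B t"
  using completed_set[of "B t"] unfolding D_def w_Suc by (metis lessThan_iff mem_Collect_eq)

lemma A_iff: "r < nj ==> r < A t \<longleftrightarrow> a r \<le> t"
proof -
  assume r: "r < nj"
  have "{r. r < nj \<and> a r \<le> t} = {..<A t}" unfolding A_def
    by (rule finite_downset_nat) (use amono in \<open>auto intro: order.trans less_imp_le\<close>)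
  then show ?thesis using r by auto
qed

lemma A_le: "A t \<le> nj"
  unfolding A_def using card_mono[of "{..<nj}" "{r. r < nj \<and> a r \<le> t}"] by auto

lemma dyn': "0 \<le> t ==> t < hz ==> Q t + D t = A t"
  using dyn by (simp add: D_def A_def)

text \<open>If the busy set failed to be measurable, its \<open>measure\<close> would be \<open>0\<close> by convention. From the first time \<open>t0\<close>
  where this happens no service would be completed, so the queue would equal the number of arrivals, and the busy set after \<open>t0\<close> would be
  explicit and hence measurable.\<close>

lemma busy_measurable:
  assumes "0 \<le> t" "t < hz" shows "{s\<in>{0..t}. 0 < Q s} \<in> sets lborel"
proof (rule ccontr)
  assume nm: "{s\<in>{0..t}. 0 < Q s} \<notin> sets lborel"
  define S where "S = (\<lambda>t. {s\<in>{0..t}. 0 < Q s})"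
  define I where "I = {t. 0 \<le> t \<and> t < hz \<and> S t \<notin> sets lborel}"
  have tI: "t \<in> I" using nm assms unfolding I_def S_def by blast
  have up: "u \<in> I" if "t' \<in> I" "t' \<le> u" "u < hz" for t' u
  proof -
    have "S t' = S u \<inter> {0..t'}" using that by (auto simp: S_def)
    then have "S u \<notin> sets lborel" using that by (auto simp: I_def)
    then show ?thesis using that by (auto simp: I_def)
  qed
  have QA: "Q u = A u" if "u \<in> I" for u
  proof -
    have "B u = 0" using that by (simp add: B I_def S_def measure_notin_sets)
    then have "\<not> 0 < D u" unfolding D_iff using sv[of 0] by (simp add: w_def)
    then show ?thesis using dyn'[of u] that by (simp add: I_def)
  qed
  define t0 where "t0 = Inf I"
  have bdd: "bdd_below I" by (rule bdd_belowI[of _ 0]) (auto simp: I_def)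
  have t0: "t0 \<le> t" unfolding t0_def using tI bdd by (rule cInf_lower)
  have t00: "0 \<le> t0" unfolding t0_def using tI by (intro cInf_greatest) (auto simp: I_def)
  have below: "S u \<in> sets lborel" if "u < t0" for u
  proof (cases "0 \<le> u")
    case True
    have "u \<notin> I" using that cInf_lower[OF _ bdd, of u] unfolding t0_def by auto
    then show ?thesis using True that t0 assms by (auto simp: I_def)
  next
    case False
    then have "S u = {}" by (auto simp: S_def)
    then show ?thesis by simp
  qed
  have above: "u \<in> I" if "t0 < u" "u \<le> t" for u
    using that tI assms up cInf_lessD[of I u] unfolding t0_def
    by (metis empty_iff less_imp_le order.strict_trans1)
  have eq: "S t = (\<Union>m. S (t0 - 1 / real (Suc m))) \<union> (S t \<inter> {t0}) \<union> (\<Union>r<nj. {t0<..t} \<inter> {a r..})"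
  proof (rule equalityI; rule subsetI)
    fix s assume s: "s \<in> S t"
    consider "s < t0" | "s = t0" | "t0 < s" by linarith
    then show "s \<in> (\<Union>m. S (t0 - 1 / real (Suc m))) \<union> (S t \<inter> {t0}) \<union> (\<Union>r<nj. {t0<..t} \<inter> {a r..})"
    proof cases
      case 1
      obtain m where "1 / real (Suc m) < t0 - s" using 1 nat_approx_posE[of "t0 - s"] by auto
      then have "s \<in> S (t0 - 1 / real (Suc m))" using s by (auto simp: S_def)
      then show ?thesis by blast
    next
      case 3
      then have "0 < A s" using QA[OF above[of s]] s by (auto simp: S_def)
      then have "\<exists>r<nj. a r \<le> s" unfolding A_def by (auto simp: card_gt_0_iff)
      then show ?thesis using 3 s by (auto simp: S_def)
    qed (use s in auto)
  next
    fix s assume s: "s \<in> (\<Union>m. S (t0 - 1 / real (Suc m))) \<union> (S t \<inter> {t0}) \<union> (\<Union>r<nj. {t0<..t} \<inter> {a r..})"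
    then consider m where "s \<in> S (t0 - 1 / real (Suc m))" | "s \<in> S t" | r where "r < nj" "t0 < s" "s \<le> t" "a r \<le> s" by auto
    then show "s \<in> S t"
    proof cases
      case 1
      have "0 \<le> 1 / real (Suc m)" by simp
      then have "t0 - 1 / real (Suc m) \<le> t" using t0 by linarith
      then show ?thesis using 1 by (auto simp: S_def)
    next
      case 3
      then have "0 < A s" using A_iff[of r s] by simp
      then show ?thesis using QA[OF above[of s]] 3 t00 by (auto simp: S_def)
    qed
  qed
  have "S t \<inter> {t0} \<in> sets lborel" by (cases "t0 \<in> S t") auto
  moreover have "(\<Union>m. S (t0 - 1 / real (Suc m))) \<in> sets lborel"
    by (intro sets.countable_UN'' below) auto
  moreover have "(\<Union>r<nj. {t0<..t} \<inter> {a r..}) \<in> sets lborel" by (intro sets.finite_UN) auto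
  ultimately have "S t \<in> sets lborel" by (subst eq) (intro sets.Un)
  then show False using tI by (simp add: I_def)
qed

lemma B_split:
  assumes "0 \<le> u" "u \<le> t" "t < hz"
  shows "{s\<in>{u<..t}. 0 < Q s} \<in> sets lborel" "B t = B u + measure lborel {s\<in>{u<..t}. 0 < Q s}"
proof -
  let ?S = "\<lambda>t. {s\<in>{0..t}. 0 < Q s}" and ?V = "{s\<in>{u<..t}. 0 < Q s}"
  have m: "?S t \<in> sets lborel" "?S u \<in> sets lborel" by (rule busy_measurable; use assms in linarith)+
  have V: "?V = ?S t - ?S u" using assms by auto
  show Vm: "?V \<in> sets lborel" unfolding V using m by (rule sets.Diff)
  have "emeasure lborel (?S u) \<le> emeasure lborel {0..u}" by (intro emeasure_mono) auto
  then have f1: "emeasure lborel (?S u) \<noteq> \<infinity>" using assms by (auto simp: top_unique)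
  have "emeasure lborel ?V \<le> emeasure lborel {u..t}" by (intro emeasure_mono) auto
  then have f2: "emeasure lborel ?V \<noteq> \<infinity>" using assms by (auto simp: top_unique)
  have "?S t = ?S u \<union> ?V" using assms by auto
  moreover have "?S u \<inter> ?V = {}" by auto
  ultimately show "B t = B u + measure lborel ?V"
    unfolding B using measure_Union[OF f1 f2 m(2) Vm] by simp
qed

lemma fmeasurable_Icc: "{u..t::real} \<in> fmeasurable lborel"
  by (auto simp: fmeasurable_def emeasure_lborel_Icc_eq)

lemma B_lip:
  assumes "0 \<le> u" "u \<le> t" "t < hz" shows "B u \<le> B t" "B t \<le> B u + (t - u)"
proof -
  note s = B_split[OF assms]
  show "B u \<le> B t" using s(2) by simp
  have "measure lborel {s\<in>{u<..t}. 0 < Q s} \<le> measure lborel {u..t}"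
    by (rule measure_mono_fmeasurable[OF _ s(1) fmeasurable_Icc]) auto
  then show "B t \<le> B u + (t - u)" using s(2) assms by simp
qed

lemma B_busy:
  assumes "0 \<le> u" "u \<le> t" "t < hz" "\<And>s. u < s ==> s < t ==> 0 < Q s"
  shows "B t = B u + (t - u)"
proof -
  note s = B_split[OF assms(1-3)]
  have fm: "{s\<in>{u<..t}. 0 < Q s} \<in> fmeasurable lborel"
    by (rule fmeasurableI2[OF fmeasurable_Icc[of u t] _ s(1)]) auto
  have "measure lborel {u<..<t} \<le> measure lborel {s\<in>{u<..t}. 0 < Q s}"
    by (rule measure_mono_fmeasurable) (use fm assms in auto)
  then show ?thesis using s(2) B_lip[OF assms(1-3)] assms by simp
qed

lemma B_idle:
  assumes "0 \<le> u" "u \<le> t" "t < hz" "\<And>s. u < s ==> s < t ==> Q s = 0"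
  shows "B t = B u"
proof -
  note s = B_split[OF assms(1-3)]
  have "measure lborel {s\<in>{u<..t}. 0 < Q s} \<le> measure lborel {t..t}"
  proof (rule measure_mono_fmeasurable[OF _ s(1) fmeasurable_Icc])
    show "{s \<in> {u<..t}. 0 < Q s} \<subseteq> {t..t}"
    proof
      fix s assume "s \<in> {s \<in> {u<..t}. 0 < Q s}"
      then show "s \<in> {t..t}" using assms(4)[of s] by (cases "s = t") auto
    qed
  qed
  then have "measure lborel {s\<in>{u<..t}. 0 < Q s} = 0"
    by (intro antisym measure_nonneg) simp
  then show ?thesis using s(2) by simp
qed

lemma start_nonneg: "r < nj ==> 0 \<le> svc_start a sv r"
  using svc_start_ge[of a r sv] a0[of r] by linarith

lemma server_step:
  assumes r: "r < nj"
    and before: "\<And>t. 0 \<le> t ==> t < hz ==> t < svc_start a sv r ==> B t < w (Suc r)"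
    and at: "svc_start a sv r < hz ==> B (svc_start a sv r) = w r"
  shows "0 \<le> t ==> t < hz ==> w (Suc r) \<le> B t \<longleftrightarrow> svc_end a sv r \<le> t"
    and "svc_end a sv r < hz ==> B (svc_end a sv r) = w (Suc r)"
proof -
  let ?m = "svc_start a sv r" and ?e = "svc_end a sv r"
  have me: "?m < ?e" using sv by (simp add: svc_end_def)
  have m0: "0 \<le> ?m" by (rule start_nonneg[OF r])
  have busy: "0 < Q s" if "?m < s" "s < ?e" "s < hz" for s
  proof -
    have "B s \<le> w r + (s - ?m)" using B_lip[of ?m s] at that m0 by auto
    also have "... < w (Suc r)" using that by (simp add: w_Suc' svc_end_def)
    finally have "\<not> r < D s" unfolding D_iff by simp
    moreover have "r < A s" using A_iff[OF r] svc_start_ge[of a r sv] that by auto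
    ultimately show ?thesis using dyn'[of s] that m0 by auto
  qed
  have val: "B t = w r + (t - ?m)" if "?m \<le> t" "t \<le> ?e" "t < hz" for t
    using B_busy[of ?m t] busy at that m0 by auto
  show Be: "B ?e = w (Suc r)" if "?e < hz" using val[of ?e] that me by (simp add: svc_end_def w_Suc')
  show "w (Suc r) \<le> B t \<longleftrightarrow> ?e \<le> t" if "0 \<le> t" "t < hz" for t
  proof (cases "t < ?m")
    case True
    then show ?thesis using before[OF that] me by auto
  next
    case False
    show ?thesis
    proof (cases "t < ?e")
      case True
      then show ?thesis using val[of t] False that by (simp add: svc_end_def w_Suc')
    next
      case F: False
      then show ?thesis using Be B_lip(1)[of ?e t] that m0 me by auto
    qed
  qed
qed

text \<open>The state when service \<open>r\<close> begins: the busy time is exactly the work of the earlier jobs. From then on the server is busy until the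
  service ends, and afterwards idle until the next arrival.\<close>

lemma server_inv:
  assumes "r < nj"
  shows "(\<forall>t. 0 \<le> t \<longrightarrow> t < hz \<longrightarrow> t < svc_start a sv r \<longrightarrow> B t < w (Suc r)) \<and>
     (svc_start a sv r < hz \<longrightarrow> B (svc_start a sv r) = w r)"
  using assms
proof (induction r)
  case 0
  have idle: "A t = 0" if "t < a 0" for t using A_iff[of 0 t] 0 that by auto
  have Q0: "Q t = 0" "D t = 0" if "0 \<le> t" "t < hz" "t < a 0" for t
    using dyn'[OF that(1,2)] idle[OF that(3)] by auto
  have "B t < w (Suc 0)" if "0 \<le> t" "t < hz" "t < a 0" for t
    using Q0(2)[OF that] D_iff[of 0 t] by auto
  moreover have "B (a 0) = w 0" if "a 0 < hz"
  proof -
    have "B (a 0) = B 0" using Q0 a0[OF 0] that by (intro B_idle) auto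
    also have "B 0 \<le> measure lborel {0..0::real}" unfolding B
      by (rule measure_mono_fmeasurable[OF _ busy_measurable fmeasurable_Icc]) (use a0[OF 0] that in auto)
    finally have "B (a 0) \<le> 0" by simp
    moreover have "0 \<le> B (a 0)" unfolding B by (rule measure_nonneg)
    ultimately show ?thesis by (simp add: w_def)
  qed
  ultimately show ?case by simp
next
  case (Suc r)
  let ?e = "svc_end a sv r"
  have r: "r < nj" using Suc by simp
  have "(\<forall>t. 0 \<le> t \<longrightarrow> t < hz \<longrightarrow> t < svc_start a sv r \<longrightarrow> B t < w (Suc r))"
    "(svc_start a sv r < hz \<longrightarrow> B (svc_start a sv r) = w r)" using Suc.IH[OF r] by auto
  then have iff: "\<And>t. 0 \<le> t ==> t < hz ==> w (Suc r) \<le> B t \<longleftrightarrow> ?e \<le> t"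
    and Be: "?e < hz ==> B ?e = w (Suc r)"
    using server_step[OF r] by blast+
  have e0: "0 \<le> ?e" using start_nonneg[OF r] sv[of r] by (simp add: svc_end_def)
  have start: "svc_start a sv (Suc r) = max (a (Suc r)) ?e" by (simp add: svc_end_def)
  have Ale: "A t \<le> Suc r" if "t < a (Suc r)" for t using A_iff[of "Suc r" t] Suc.prems that by auto
  have "B t < w (Suc (Suc r))" if t: "0 \<le> t" "t < hz" "t < max (a (Suc r)) ?e" for t
  proof (cases "t < ?e")
    case True
    then have "B t < w (Suc r)" using iff[OF t(1,2)] by auto
    then show ?thesis using sv[of "Suc r"] w_Suc'[of "Suc r"] by simp
  next
    case False
    then have "t < a (Suc r)" using t(3) by (auto simp: max_def split: if_splits)
    then have "D t \<le> Suc r" using Ale[of t] dyn'[OF t(1,2)] by linarith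
    then show ?thesis using D_iff[of "Suc r" t] by auto
  qed
  moreover have "B (max (a (Suc r)) ?e) = w (Suc r)" if h: "max (a (Suc r)) ?e < hz"
  proof (cases "a (Suc r) \<le> ?e")
    case True
    then show ?thesis using Be h by (simp add: max_absorb2)
  next
    case False
    have "Q s = 0" if "?e < s" "s < a (Suc r)" for s
    proof -
      have "r < D s" using iff[of s] D_iff[of r s] that h e0 by auto
      then show ?thesis using Ale[OF that(2)] dyn'[of s] that h e0 by auto
    qed
    then have "B (a (Suc r)) = B ?e" using False h e0 by (intro B_idle) auto
    then show ?thesis using False Be h by (simp add: max_absorb1)
  qed
  ultimately show ?case unfolding start by auto
qed

lemma departures:
  assumes "0 \<le> t" "t < hz"
  shows "card {m. (\<Sum>i\<le>m. sv i) \<le> B t} = card {r. r < nj \<and> svc_end a sv r \<le> t}"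
proof -
  have "D t \<le> nj" using dyn'[OF assms] A_le[of t] by linarith
  have "r < D t \<longleftrightarrow> r < nj \<and> svc_end a sv r \<le> t" for r
  proof (cases "r < nj")
    case True
    then show ?thesis
      using server_inv[OF True] server_step(1)[OF True _ _ assms] D_iff[of r t] by blast
  qed (use \<open>D t \<le> nj\<close> in auto)
  then have "{r. r < nj \<and> svc_end a sv r \<le> t} = {..<D t}" by auto
  then show ?thesis by (simp add: D_def)
qed

end

section \<open>Paths of the queueing system\<close>

definition visits :: "nat list => nat => nat list" where
  "visits ks v = filter (\<lambda>i. ks ! i = v) [0..<length ks]"

definition jobs :: "nat => nat list => nat => nat" where
  "jobs q ks v = q + length (visits ks v)"

text \<open>The jobs present at the start count as arriving at time \<open>0\<close>; the list \<open>ks\<close> records the servers joined by the first arrivals.\<close>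

definition job_arrival :: "(nat => real) => nat => nat list => nat => nat => real" where
  "job_arrival T q ks v r = (if r < q then 0 else T (visits ks v ! (r - q)))"

definition arrived :: "(nat => real) => nat list => nat => real => nat" where
  "arrived T ks v t = card {i. i < length ks \<and> ks ! i = v \<and> T i \<le> t}"

definition completed :: "(nat => real) => nat => nat list => nat => (nat => real) => real => nat" where
  "completed T q ks v sv t = card {r. r < jobs q ks v \<and> svc_end (job_arrival T q ks v) sv r \<le> t}"

text \<open>For a service that has not begun, the value is \<open>0\<close>, also if its job has not yet arrived. So the \<open>m\<close>th service always has a
  residual duration, whether or not the server is busy.\<close>

definition elapsed :: "(nat => real) => nat => nat list => nat => (nat => real) => nat => real => real" where
  "elapsed T q ks v sv m t =
     (if m < jobs q ks v then max 0 (t - svc_start (job_arrival T q ks v) sv m) else 0)"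

lemma set_visits: "set (visits ks v) = {i. i < length ks \<and> ks ! i = v}"
  by (auto simp: visits_def)

lemma sorted_visits: "sorted_wrt (<) (visits ks v)"
  unfolding visits_def by (rule sorted_wrt_filter) simp

lemma visits_take:
  assumes "j \<le> length ks"
  shows "\<exists>ys. visits ks v = visits (take j ks) v @ ys \<and> (\<forall>i\<in>set ys. j \<le> i)"
proof -
  have "[0..<length ks] = [0..<j] @ [j..<length ks]" using assms upt_add_eq_append[of 0 j "length ks - j"] by simp
  moreover have "filter (\<lambda>i. ks ! i = v) [0..<j] = visits (take j ks) v"
    unfolding visits_def using assms by (auto intro!: filter_cong)
  ultimately show ?thesis unfolding visits_def
    by (intro exI[of _ "filter (\<lambda>i. ks ! i = v) [j..<length ks]"]) auto
qed

lemma jobs_take: "j \<le> length ks ==> jobs q (take j ks) v \<le> jobs q ks v"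
  using visits_take[of j ks v] by (auto simp: jobs_def)

lemma job_arrival_take:
  assumes "j \<le> length ks" "r < jobs q (take j ks) v"
  shows "job_arrival T q ks v r = job_arrival T q (take j ks) v r"
proof -
  obtain ys where eq: "visits ks v = visits (take j ks) v @ ys" using visits_take[OF assms(1), of v] by blast
  have "visits ks v ! i = visits (take j ks) v ! i" if "i < length (visits (take j ks) v)" for i
    unfolding eq using that by (rule nth_append_left)
  then show ?thesis using assms(2) by (auto simp: job_arrival_def jobs_def)
qed

lemma visits_take_later:
  assumes "j \<le> length ks" "length (visits (take j ks) v) \<le> i" "i < length (visits ks v)"
  shows "j \<le> visits ks v ! i"
proof -
  obtain ys where eq: "visits ks v = visits (take j ks) v @ ys" "\<forall>i\<in>set ys. j \<le> i"
    using visits_take[OF assms(1), of v] by blast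
  have "visits ks v ! i = ys ! (i - length (visits (take j ks) v))"
    unfolding eq(1) using assms(2) by (rule nth_append_right)
  moreover have "length (visits ks v) = length (visits (take j ks) v) + length ys"
    unfolding eq(1) by (rule length_append)
  ultimately show ?thesis using eq(2) assms(2,3) by simp
qed

lemma svc_take:
  assumes "j \<le> length ks" "r < jobs q (take j ks) v"
  shows "svc_start (job_arrival T q ks v) sv r = svc_start (job_arrival T q (take j ks) v) sv r"
    and "svc_end (job_arrival T q ks v) sv r = svc_end (job_arrival T q (take j ks) v) sv r"
proof -
  show "svc_start (job_arrival T q ks v) sv r = svc_start (job_arrival T q (take j ks) v) sv r"
    by (rule svc_start_cong) (use job_arrival_take[OF assms(1)] assms(2) in auto)
  then show "svc_end (job_arrival T q ks v) sv r = svc_end (job_arrival T q (take j ks) v) sv r"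
    by (simp add: svc_end_def)
qed

lemma completed_take_le:
  assumes "j \<le> length ks" "t \<le> t'"
  shows "completed T q (take j ks) v sv t \<le> completed T q ks v sv t'"
  unfolding completed_def
proof (rule card_mono)
  show "{r. r < jobs q (take j ks) v \<and> svc_end (job_arrival T q (take j ks) v) sv r \<le> t}
    \<subseteq> {r. r < jobs q ks v \<and> svc_end (job_arrival T q ks v) sv r \<le> t'}"
    using svc_take(2)[OF assms(1), of _ q v T sv] jobs_take[OF assms(1), of q v] assms(2)
    by (auto intro: less_le_trans order.trans)
qed simp

lemma completed_set:
  assumes "\<And>i. 0 < sv i"
  shows "{r. r < jobs q ks v \<and> svc_end (job_arrival T q ks v) sv r \<le> t} = {..<completed T q ks v sv t}"
  unfolding completed_def
proof (rule finite_downset_nat)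
  fix i j assume "i \<in> {r. r < jobs q ks v \<and> svc_end (job_arrival T q ks v) sv r \<le> t}" "j < i"
  then show "j \<in> {r. r < jobs q ks v \<and> svc_end (job_arrival T q ks v) sv r \<le> t}"
    using svc_end_mono[of sv j i "job_arrival T q ks v"] assms by auto
qed simp

lemma less_completed_iff:
  assumes "\<And>i. 0 < sv i"
  shows "r < completed T q ks v sv t \<longleftrightarrow> r < jobs q ks v \<and> svc_end (job_arrival T q ks v) sv r \<le> t"
  using completed_set[where sv = sv and q = q and ks = ks and v = v and T = T and t = t, OF assms] by auto

text \<open>All that a bound on the number of completed services says about service \<open>m\<close> and later ones; the use of memorylessness rests on this.\<close>

lemma completed_le_iff:
  assumes "\<And>i. 0 < sv i"
  shows "completed T q ks v sv t \<le> m \<longleftrightarrow> elapsed T q ks v sv m t < sv m"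
  using less_completed_iff[where sv = sv and r = m and q = q and ks = ks and v = v and T = T and t = t, OF assms] assms[of m]
  by (auto simp: elapsed_def svc_end_def not_less[symmetric])

text \<open>A single realisation of the system: \<open>T\<close> the arrival times, \<open>c\<close> the servers joined, \<open>S\<close> the service times,
  \<open>Q\<close> the queue lengths and \<open>P l j\<close> the position of walker \<open>l\<close> at the arrival of job \<open>j\<close>. Ties are
  left to \<open>c\<close>.\<close>

locale queue_path =
  fixes n d :: nat and T :: "nat => real" and c :: "nat => nat" and q0 :: "nat => nat"
    and S :: "nat => nat => real" and Q :: "nat => real => nat" and P :: "nat => nat => nat"
  assumes T_pos: "\<And>j. 0 < T j" and T_mono: "strict_mono T" and T_unb: "\<And>x. \<exists>j. x < T j"
    and S_pos: "\<And>v m. v \<in> {1..n} ==> 0 < S v m"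
    and S_div: "\<And>v x. v \<in> {1..n} ==> \<exists>m. x < (\<Sum>i\<le>m. S v i)"
    and dyn: "\<And>v t. v \<in> {1..n} ==> 0 \<le> t ==>
      Q v t + card {m. (\<Sum>i\<le>m. S v i) \<le> measure lborel {s\<in>{0..t}. 0 < Q v s}} = q0 v + card {j. T j \<le> t \<and> c j = v}"
    and joins: "\<And>j. \<exists>l<d. c j = P l j"
    and shortest: "\<And>j l. l < d ==> \<forall>\<^sub>F s in at_left (T j). Q (c j) s \<le> Q (P l j) s"
    and P_range: "\<And>l j. l < d ==> P l j \<in> {1..n}"
begin

lemma T_less_iff: "T i < T j \<longleftrightarrow> i < j"
  using T_mono by (simp add: strict_mono_less)

lemma c_range: "c j \<in> {1..n}"
  using joins[of j] P_range by auto

abbreviation "hist j \<equiv> map c [0..<j]"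

lemma take_hist: "j \<le> j' ==> take j (hist j') = hist j"
  by (simp add: take_map)

lemma arrived_hist:
  assumes "t < T j" shows "card {i. T i \<le> t \<and> c i = v} = arrived T (hist j) v t"
proof -
  have "i < j" if "T i \<le> t" for i using that assms T_less_iff[of i j] by linarith
  then have "{i. T i \<le> t \<and> c i = v} = {i. i < length (hist j) \<and> hist j ! i = v \<and> T i \<le> t}" by auto
  then show ?thesis by (simp add: arrived_def)
qed

lemma arrivals_count:
  assumes "0 \<le> t"
  shows "card {r. r < jobs q ks v \<and> job_arrival T q ks v r \<le> t} = q + arrived T ks v t"
proof -
  let ?vs = "visits ks v"
  have 1: "{r. r < jobs q ks v \<and> job_arrival T q ks v r \<le> t} =
     {..<q} \<union> (\<lambda>i. q + i) ` {i. i < length ?vs \<and> T (?vs ! i) \<le> t}" (is "?L = ?R")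
  proof (rule equalityI; rule subsetI)
    fix r assume r: "r \<in> ?L"
    show "r \<in> ?R"
    proof (cases "r < q")
      case False
      then show ?thesis using r by (auto simp: jobs_def job_arrival_def intro!: image_eqI[of _ _ "r - q"])
    qed simp
  next
    fix r assume "r \<in> ?R" then show "r \<in> ?L" using assms by (auto simp: jobs_def job_arrival_def)
  qed
  have "card ?L = q + card {i. i < length ?vs \<and> T (?vs ! i) \<le> t}"
    unfolding 1 by (subst card_Un_disjoint) (auto simp: card_image)
  also have "card {i. i < length ?vs \<and> T (?vs ! i) \<le> t} = card ((!) ?vs ` {i. i < length ?vs \<and> T (?vs ! i) \<le> t})"
    by (rule card_image[symmetric]) (auto simp: inj_on_def nth_eq_iff_index_eq visits_def)
  also have "(!) ?vs ` {i. i < length ?vs \<and> T (?vs ! i) \<le> t} = {i\<in>set ?vs. T i \<le> t}"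
    by (auto simp: in_set_conv_nth)
  also have "card ... = arrived T ks v t" by (simp add: set_visits arrived_def conj_assoc)
  finally show ?thesis .
qed

lemma job_arrival_mono:
  assumes "r \<le> s" "s < jobs q ks v" shows "job_arrival T q ks v r \<le> job_arrival T q ks v s"
proof (cases "r < s \<and> q \<le> r")
  case True
  then have "visits ks v ! (r - q) < visits ks v ! (s - q)"
    using sorted_wrt_nth_less[OF sorted_visits, of "r - q" "s - q" ks v] assms by (auto simp: jobs_def)
  then show ?thesis using True T_less_iff by (auto simp: job_arrival_def intro: less_imp_le)
next
  case False
  then show ?thesis using assms(1) less_imp_le[OF T_pos] by (auto simp: job_arrival_def)
qed

text \<open>Before arrival \<open>j\<close>, a queue is an explicit function of the first \<open>j\<close> choices, the arrival times and the service times. This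
  makes the history available to the random choices measurable, one choice at a time.\<close>

lemma queue_explicit:
  assumes v: "v \<in> {1..n}" and t: "0 \<le> t" "t < T j"
  shows "Q v t + completed T (q0 v) (hist j) v (S v) t = q0 v + arrived T (hist j) v t"
proof -
  note dyn0 = dyn[OF v t(1)]
  interpret single_server "Q v" "job_arrival T (q0 v) (hist j) v" "S v" "jobs (q0 v) (hist j) v" "T j"
    "\<lambda>t. measure lborel {s\<in>{0..t}. 0 < Q v s}"
  proof
    show "0 \<le> job_arrival T (q0 v) (hist j) v r" for r
      using less_imp_le[OF T_pos] by (auto simp: job_arrival_def)
    show "Q v t + card {m. (\<Sum>i\<le>m. S v i) \<le> measure lborel {s \<in> {0..t}. 0 < Q v s}} =
       card {r. r < jobs (q0 v) (hist j) v \<and> job_arrival T (q0 v) (hist j) v r \<le> t}"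
      if "0 \<le> t" "t < T j" for t
      using dyn[OF v that(1)] arrived_hist[OF that(2), of v] arrivals_count[OF that(1), of "q0 v" "hist j" v] by simp
  qed (use v S_pos S_div job_arrival_mono in auto)
  show ?thesis
    using departures[OF t] dyn0 arrived_hist[OF t(2), of v] by (simp add: completed_def)
qed

end

section \<open>One window of a path\<close>

definition served :: "(nat => real) => (nat => nat) => nat list => (nat => nat => real) => nat => real => nat" where
  "served T q0 ks S v t = completed T (q0 v) ks v (S v) t"

text \<open>The residual service at time \<open>s\<close> is at most \<open>h\<close>. For an idle server this concerns the service of its next job; counting it
  too makes the event independent of the arrivals in the window.\<close>

definition fires :: "(nat => real) => (nat => nat) => nat list => (nat => nat => real) => real => real => nat => bool" where
  "fires T q0 ks S s h v \<longleftrightarrow> (let m = served T q0 ks S v s in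
     S v m \<le> elapsed T (q0 v) ks v (S v) m s + h)"

definition fires_twice :: "(nat => real) => (nat => nat) => nat list => (nat => nat => real) => real => real => nat => bool" where
  "fires_twice T q0 ks S s h v \<longleftrightarrow> fires T q0 ks S s h v \<and> S v (Suc (served T q0 ks S v s)) \<le> h"

text \<open>Only earlier jobs count: walkers at the same place for the same job do no harm.\<close>

definition repeats :: "(nat => nat => nat) => nat => nat => nat => nat set" where
  "repeats P d a b = {j\<in>{a..<b}. \<exists>l<d. \<exists>j'\<in>{a..<j}. \<exists>l'<d. P l' j' = P l j}"

definition visited :: "(nat => nat => nat) => nat => nat => nat => nat set" where
  "visited P d a b = {P l j | l j. l < d \<and> j \<in> {a..<b}}"

definition arrival_count :: "(nat => real) => real => nat" where
  "arrival_count T s = (LEAST j. s < T j)"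

lemma of_bool_change_le:
  fixes a :: real
  assumes "0 \<le> a"
  shows "\<bar>of_bool p1 - of_bool p2 - a * of_bool p3 + of_bool p4\<bar> \<le> a + 2"
  using assms by (cases p1; cases p2; cases p3; cases p4) auto

lemma level_arith:
  fixes E a b p q p' q' f g R F B :: real
  assumes "E = a - b - (p - q) + (f - g)" "\<bar>E\<bar> \<le> 4 * R + 3 * F + 3 * B"
    and "\<bar>p - p'\<bar> \<le> R + F" "\<bar>q - q'\<bar> \<le> R + F" "0 \<le> B" "0 \<le> F"
  shows "\<bar>a - b - (p' - q') + (f - g)\<bar> \<le> 6 * R + 6 * F + 6 * B"
  using assms by linarith

lemma tail_arith:
  fixes X A N E R F C B :: real
  assumes "X \<le> A + N + E" "E \<le> R" "\<bar>N - C\<bar> \<le> R + F" "0 \<le> B" "0 \<le> F"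
  shows "X \<le> A + C + 2 * R + 2 * F + 2 * B"
  using assms by linarith

context queue_path
begin

abbreviation "J \<equiv> arrival_count T"

lemma T_J: "s < T (J s)"
  unfolding arrival_count_def using T_unb[of s] by (rule LeastI_ex)

lemma less_J_iff: "i < J s \<longleftrightarrow> T i \<le> s"
proof
  assume "i < J s"
  then show "T i \<le> s" unfolding arrival_count_def using not_less_Least by fastforce
next
  assume "T i \<le> s"
  then have "T i < T (J s)" using T_J[of s] by linarith
  then show "i < J s" by (simp add: T_less_iff)
qed

lemma J_mono: "s \<le> t ==> J s \<le> J t"
  using less_J_iff[of "J t" s] T_J[of t] by (meson leI less_le_trans not_less_iff_gr_or_eq order.strict_trans2)

definition "arr v s t = card {j\<in>{J s..<J t}. c j = v}"
abbreviation "D v t \<equiv> served T q0 (hist (J t)) S v t"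

lemma arrived_eq: "t < T j ==> arrived T (hist j) v t = card {i\<in>{..<J t}. c i = v}"
  by (subst arrived_hist[symmetric]) (auto simp: less_J_iff intro!: arg_cong[where f=card])

lemma Q_D: "v \<in> {1..n} ==> 0 \<le> t ==> Q v t + D v t = q0 v + card {i\<in>{..<J t}. c i = v}"
  using queue_explicit[of v t "J t"] T_J[of t] arrived_eq[of t "J t" v] by (simp add: served_def)

lemma arr_split:
  assumes "s \<le> t" shows "card {i\<in>{..<J t}. c i = v} = card {i\<in>{..<J s}. c i = v} + arr v s t"
proof -
  have "{i\<in>{..<J t}. c i = v} = {i\<in>{..<J s}. c i = v} \<union> {j\<in>{J s..<J t}. c j = v}"
    using J_mono[OF assms] by auto
  then have "card {i\<in>{..<J t}. c i = v} = card ({i\<in>{..<J s}. c i = v} \<union> {j\<in>{J s..<J t}. c j = v})"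
    by (rule arg_cong)
  also have "... = card {i\<in>{..<J s}. c i = v} + card {j\<in>{J s..<J t}. c j = v}"
    by (rule card_Un_disjoint) auto
  finally show ?thesis unfolding arr_def .
qed

lemma Q_change:
  "v \<in> {1..n} ==> 0 \<le> s ==> s \<le> t ==> Q v t + D v t = Q v s + D v s + arr v s t"
  using Q_D[of v t] Q_D[of v s] arr_split[of s t v] by linarith

lemma D_mono: "s \<le> t ==> D v s \<le> D v t"
  unfolding served_def using completed_take_le[of "J s" "hist (J t)" s t T "q0 v" v "S v"] J_mono[of s t] take_hist[of "J s" "J t"]
  by simp

lemma jobs_hist: "jobs (q0 v) (hist (J s)) v = q0 v + card {i\<in>{..<J s}. c i = v}"
proof -
  have "length (visits (hist (J s)) v) = card (set (visits (hist (J s)) v))"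
    by (rule distinct_card[symmetric]) (simp add: visits_def)
  also have "set (visits (hist (J s)) v) = {i\<in>{..<J s}. c i = v}" by (auto simp: set_visits)
  finally show ?thesis by (simp add: jobs_def)
qed

lemma busy_iff: "v \<in> {1..n} ==> 0 \<le> s ==> 0 < Q v s \<longleftrightarrow> D v s < jobs (q0 v) (hist (J s)) v"
  using Q_D[of v s] jobs_hist[of v s] by linarith

context
  fixes v :: nat and s h :: real
  assumes v: "v \<in> {1..n}" and s: "0 \<le> s" and h: "0 \<le> h"
begin

abbreviation "f \<equiv> fires T q0 (hist (J s)) S s h v"

lemma S_pos': "\<And>i. 0 < S v i" using S_pos[OF v] .

text \<open>Later arrivals do not disturb the service that is current at time \<open>s\<close>; if its job is still to come, it ends even later than the residual
  time suggests.\<close>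

lemma later_end:
  assumes "s \<le> t" "D v s < jobs (q0 v) (hist (J t)) v"
  shows "svc_end (job_arrival T (q0 v) (hist (J t)) v) (S v) (D v s) > s
    \<and> svc_end (job_arrival T (q0 v) (hist (J t)) v) (S v) (D v s) \<ge> s + S v (D v s) - elapsed T (q0 v) (hist (J s)) v (S v) (D v s) s"
proof -
  let ?m = "D v s" and ?k = "hist (J s)" and ?k' = "hist (J t)"
  have le: "J s \<le> length ?k'" and tk: "take (J s) ?k' = ?k" using J_mono[OF assms(1)] take_hist by auto
  show ?thesis
  proof (cases "?m < jobs (q0 v) ?k v")
    case True
    then have e: "svc_end (job_arrival T (q0 v) ?k' v) (S v) ?m = svc_end (job_arrival T (q0 v) ?k v) (S v) ?m"
      using svc_take(2)[OF le, of ?m "q0 v" v T "S v"] tk by simp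
    have ns: "\<not> svc_end (job_arrival T (q0 v) ?k v) (S v) ?m \<le> s"
      using less_completed_iff[where sv = "S v" and r = ?m and q = "q0 v" and ks = ?k and v = v and T = T and t = s, OF S_pos'] True by (simp add: served_def)
    show ?thesis
    proof (cases "svc_start (job_arrival T (q0 v) ?k v) (S v) ?m \<le> s")
      case T1: True
      then show ?thesis using ns True T1 unfolding e by (simp add: elapsed_def svc_end_def)
    next
      case False
      then show ?thesis using ns True S_pos'[of ?m] unfolding e by (simp add: elapsed_def svc_end_def)
    qed
  next
    case False
    have m_ge: "q0 v \<le> ?m" using False by (simp add: jobs_def)
    have "J s \<le> visits ?k' v ! (?m - q0 v)"
      by (rule visits_take_later[OF le]) (use False assms(2) in \<open>auto simp: jobs_def tk\<close>)
    then have "T (visits ?k' v ! (?m - q0 v)) \<ge> T (J s)" using T_mono by (simp add: strict_mono_less_eq)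
    then have "s < job_arrival T (q0 v) ?k' v ?m" using T_J[of s] m_ge by (simp add: job_arrival_def)
    then have "s + S v ?m < svc_end (job_arrival T (q0 v) ?k' v) (S v) ?m"
      using svc_start_ge[of "job_arrival T (q0 v) ?k' v" ?m "S v"] by (simp add: svc_end_def)
    then show ?thesis using S_pos'[of ?m] False by (simp add: elapsed_def)
  qed
qed

lemma not_fires_idle:
  assumes "\<not> f" "s \<le> t" "t \<le> s + h" shows "D v t = D v s"
proof -
  have "\<not> D v s < D v t"
  proof
    assume lt: "D v s < D v t"
    then have "D v s < jobs (q0 v) (hist (J t)) v"
      and e: "svc_end (job_arrival T (q0 v) (hist (J t)) v) (S v) (D v s) \<le> t"
      using less_completed_iff[where sv = "S v" and r = "D v s" and q = "q0 v" and ks = "hist (J t)" and v = v and T = T and t = t, OF S_pos']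
      by (auto simp: served_def)
    then show False using later_end[OF assms(2)] assms by (auto simp: fires_def Let_def)
  qed
  then show ?thesis using D_mono[OF assms(2), of v] by linarith
qed

lemma fires_served:
  assumes "f" "0 < Q v s" shows "Suc (D v s) \<le> D v (s + h)"
proof -
  let ?m = "D v s" and ?k = "hist (J s)" and ?k' = "hist (J (s + h))"
  let ?a = "job_arrival T (q0 v) ?k v"
  have le: "J s \<le> length ?k'" and tk: "take (J s) ?k' = ?k" using J_mono[of s "s + h"] h take_hist by auto
  have m: "?m < jobs (q0 v) ?k v" using busy_iff[OF v s] assms by simp
  have m': "?m < jobs (q0 v) ?k' v" using jobs_take[OF le, of "q0 v" v] m tk by simp
  have am: "?a ?m \<le> s"
  proof (cases "?m < q0 v")
    case False
    then have "visits ?k v ! (?m - q0 v) \<in> set (visits ?k v)" using m by (intro nth_mem) (auto simp: jobs_def)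
    then show ?thesis using False by (auto simp: job_arrival_def set_visits less_J_iff)
  qed (use s in \<open>simp add: job_arrival_def\<close>)
  have start: "svc_start ?a (S v) ?m \<le> s"
  proof (cases ?m)
    case (Suc m1)
    then have "m1 < completed T (q0 v) ?k v (S v) s" by (simp add: served_def)
    then have "svc_end ?a (S v) m1 \<le> s"
      using less_completed_iff[where sv = "S v" and r = m1 and q = "q0 v" and ks = ?k and v = v and T = T and t = s, OF S_pos'] by simp
    then show ?thesis using am Suc by (simp add: svc_end_def)
  qed (use am in simp)
  have "svc_end ?a (S v) ?m \<le> s + h"
    using assms(1) start m by (simp add: fires_def Let_def elapsed_def svc_end_def)
  then have "svc_end (job_arrival T (q0 v) ?k' v) (S v) ?m \<le> s + h"
    using svc_take(2)[OF le, of ?m "q0 v" v T "S v"] m tk by simp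
  then have "?m < completed T (q0 v) ?k' v (S v) (s + h)"
    using less_completed_iff[where sv = "S v" and r = ?m and q = "q0 v" and ks = ?k' and v = v and T = T and t = "s + h", OF S_pos'] m' by simp
  then show ?thesis by (simp add: served_def)
qed

lemma served_twice:
  assumes "Suc (Suc (D v s)) \<le> D v (s + h)"
  shows "fires_twice T q0 (hist (J s)) S s h v"
proof -
  let ?m = "D v s" and ?k' = "hist (J (s + h))"
  have "f" using not_fires_idle[of "s + h"] assms h by fastforce
  have m': "Suc ?m < jobs (q0 v) ?k' v" "svc_end (job_arrival T (q0 v) ?k' v) (S v) (Suc ?m) \<le> s + h"
    using less_completed_iff[where sv = "S v" and r = "Suc ?m" and q = "q0 v" and ks = ?k' and v = v and T = T and t = "s + h", OF S_pos'] assms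
    by (auto simp: served_def)
  have "svc_end (job_arrival T (q0 v) ?k' v) (S v) ?m > s" using later_end[of "s + h"] m' h by simp
  moreover have "svc_end (job_arrival T (q0 v) ?k' v) (S v) ?m + S v (Suc ?m) \<le> svc_end (job_arrival T (q0 v) ?k' v) (S v) (Suc ?m)"
    by (simp add: svc_end_def)
  ultimately have "S v (Suc ?m) \<le> h" using m' by linarith
  then show ?thesis using \<open>f\<close> by (simp add: fires_twice_def)
qed

end

context
  fixes s h :: real
  assumes s: "0 \<le> s" and h: "0 \<le> h"
begin

abbreviation "fi v \<equiv> fires T q0 (hist (J s)) S s h v"
abbreviation "Jw \<equiv> {J s..<J (s + h)}"
abbreviation "Rp \<equiv> repeats P d (J s) (J (s + h))"
abbreviation "FV \<equiv> {v\<in>visited P d (J s) (J (s + h)). fi v}"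
abbreviation "DB \<equiv> {v\<in>{1..n}. fires_twice T q0 (hist (J s)) S s h v}"

definition "unclean = {j\<in>Jw. j \<in> Rp \<or> (\<exists>l<d. fi (P l j))}"

lemma finite_visited: "finite (visited P d a b)"
proof -
  have "visited P d a b \<subseteq> (\<lambda>(l, j). P l j) ` ({..<d} \<times> {a..<b})" by (auto simp: visited_def)
  then show ?thesis by (rule finite_subset) simp
qed

text \<open>An unclean job without repeat looks at a server that fires, and different such jobs look at different servers.\<close>

lemma card_unclean: "card unclean \<le> card Rp + card FV"
proof -
  \<comment> \<open>a firing server that job \<open>j\<close> looks at\<close>
  define pick where "pick = (\<lambda>j. P (SOME l. l < d \<and> fi (P l j)) j)"
  let ?N = "unclean - Rp"
  have pick: "\<exists>l<d. pick j = P l j \<and> fi (P l j)" if "j \<in> ?N" for j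
  proof -
    have "\<exists>l. l < d \<and> fi (P l j)" using that by (auto simp: unclean_def)
    from someI_ex[OF this] show ?thesis unfolding pick_def by blast
  qed
  have sep: "pick j' \<noteq> pick j" if jj: "j' \<in> ?N" "j \<in> ?N" "j' < j" for j' j
  proof
    assume eq: "pick j' = pick j"
    obtain l where l: "l < d" "pick j = P l j" using pick[OF jj(2)] by blast
    obtain l' where l': "l' < d" "pick j' = P l' j'" using pick[OF jj(1)] by blast
    have "j \<in> Rp" unfolding repeats_def using jj l l' eq
      by (intro CollectI conjI exI[of _ l] bexI[of _ j'] exI[of _ l']) (auto simp: unclean_def)
    then show False using jj by simp
  qed
  have "inj_on pick ?N" by (rule linorder_inj_onI') (use sep in auto)
  moreover have "pick ` ?N \<subseteq> FV"
  proof
    fix v assume "v \<in> pick ` ?N"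
    then obtain j where j: "j \<in> ?N" "v = pick j" by blast
    obtain l where "l < d" "pick j = P l j" "fi (P l j)" using pick[OF j(1)] by blast
    then show "v \<in> FV" using j by (auto simp: visited_def unclean_def)
  qed
  moreover have "finite FV" using finite_visited by simp
  ultimately have N: "card ?N \<le> card FV" by (rule card_inj_on_le)
  have "unclean \<subseteq> Rp \<union> ?N" by auto
  then have "card unclean \<le> card (Rp \<union> ?N)" by (intro card_mono) (auto simp: repeats_def unclean_def)
  also have "... \<le> card Rp + card ?N" by (rule card_Un_le)
  finally show ?thesis using N by simp
qed

text \<open>A clean job looks at servers that nobody visited before in the window and that do not complete a service, so the queues are as they were at its start.\<close>

lemma clean_frozen:
  assumes j: "j \<in> Jw" "j \<notin> unclean" and l: "l < d" and t: "s \<le> t" "t < T j"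
  shows "Q (P l j) t = Q (P l j) s"
proof -
  have "arr (P l j) s t = 0"
  proof -
    have "c j' \<noteq> P l j" if "j' \<in> {J s..<J t}" for j'
    proof
      assume eq: "c j' = P l j"
      have "T j' \<le> t" using that less_J_iff by auto
      then have "j' < j" using t T_less_iff[of j' j] by linarith
      then have j': "j' \<in> {J s..<j}" using that by auto
      obtain l' where "l' < d" "c j' = P l' j'" using joins by blast
      then have "l' < d" "P l' j' = P l j" using eq by auto
      then have "j \<in> Rp" using j' unfolding repeats_def using j l by blast
      then show False using j by (auto simp: unclean_def)
    qed
    then show ?thesis by (auto simp: arr_def)
  qed
  moreover have "D (P l j) t = D (P l j) s"
  proof (rule not_fires_idle[OF P_range[OF l] s h _ t(1)])
    show "\<not> fi (P l j)" using j l by (auto simp: unclean_def)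
    have "T j \<le> s + h" using j less_J_iff by auto
    then show "t \<le> s + h" using t by linarith
  qed
  ultimately show ?thesis using Q_change[OF P_range[OF l] s t(1), of j] by linarith
qed

lemma clean_join:
  assumes j: "j \<in> Jw" "j \<notin> unclean"
  shows "i \<le> Q (c j) s \<longleftrightarrow> (\<forall>l<d. i \<le> Q (P l j) s)"
proof -
  have sT: "s < T j" using j T_J[of s] T_mono by (meson atLeastLessThan_iff order.strict_trans2 strict_mono_less_eq)
  obtain l0 where l0: "l0 < d" "c j = P l0 j" using joins by blast
  have "Q (c j) s \<le> Q (P l j) s" if "l < d" for l
  proof -
    have "\<forall>\<^sub>F t in at_left (T j). Q (c j) t \<le> Q (P l j) t \<and> t \<in> {s<..<T j}"
      using shortest[OF that] eventually_at_left_real[OF sT] by (rule eventually_conj)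
    then obtain t where "Q (c j) t \<le> Q (P l j) t" "t \<in> {s<..<T j}"
      by (metis (mono_tags, lifting) eventually_happens trivial_limit_at_left_real)
    then show ?thesis using clean_frozen[OF j that, of t] clean_frozen[OF j l0(1), of t] l0 by auto
  qed
  then show ?thesis using l0 by (auto intro: order.trans)
qed

abbreviation "Cl i \<equiv> card {j\<in>Jw. \<forall>l<d. i \<le> Q (P l j) s}"
abbreviation "Nj i \<equiv> card {j\<in>Jw. i \<le> Q (c j) s}"
definition "err = card Rp + card FV + card DB"

lemma Nj_Cl: "Nj i \<le> Cl i + (card Rp + card FV)" "Cl i \<le> Nj i + (card Rp + card FV)"
proof -
  let ?A = "{j\<in>Jw. i \<le> Q (c j) s}" and ?B = "{j\<in>Jw. \<forall>l<d. i \<le> Q (P l j) s}"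
  have fin: "finite unclean" by (simp add: unclean_def)
  have "?A \<subseteq> ?B \<union> unclean" "?B \<subseteq> ?A \<union> unclean" using clean_join by blast+
  then have "card ?A \<le> card (?B \<union> unclean)" "card ?B \<le> card (?A \<union> unclean)"
    using fin by (auto intro!: card_mono)
  then show "Nj i \<le> Cl i + (card Rp + card FV)" "Cl i \<le> Nj i + (card Rp + card FV)"
    using card_Un_le[of ?B unclean] card_Un_le[of ?A unclean] card_unclean by linarith+
qed

lemma Nj_Cl_real: "\<bar>real (Nj i) - real (Cl i)\<bar> \<le> real (card Rp) + real (card FV)"
  using Nj_Cl[of i] by linarith

lemma sum_over_joined:
  fixes g :: "nat => real"
  assumes "finite R"
  shows "(\<Sum>v\<in>{1..n}. g v * real (card {j\<in>R. c j = v})) = (\<Sum>j\<in>R. g (c j))"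
proof -
  have "(\<Sum>v\<in>{1..n}. g v * real (card {j\<in>R. c j = v})) = (\<Sum>v\<in>{1..n}. \<Sum>j\<in>R. if c j = v then g v else 0)"
    using assms by (intro sum.cong refl) (simp add: sum.If_cases Int_def mult.commute)
  also have "... = (\<Sum>j\<in>R. \<Sum>v\<in>{1..n}. if c j = v then g v else 0)" by (rule sum.swap)
  also have "... = (\<Sum>j\<in>R. g (c j))" using c_range by (intro sum.cong refl) (simp add: sum.delta')
  finally show ?thesis .
qed

abbreviation "ar v \<equiv> arr v s (s + h)"

text \<open>Each arrival at a server after the first one in the window is a repeated visit.\<close>

lemma excess_le: "(\<Sum>v\<in>{1..n}. real (ar v - 1)) \<le> real (card Rp)"
proof -
  have "ar v - 1 \<le> card {j\<in>Rp. c j = v}" for v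
  proof (cases "{j\<in>Jw. c j = v} = {}")
    case False
    let ?A = "{j\<in>Jw. c j = v}"
    have "?A - {Min ?A} \<subseteq> {j\<in>Rp. c j = v}"
    proof
      fix j assume j: "j \<in> ?A - {Min ?A}"
      have M: "Min ?A \<in> ?A" by (rule Min_in[OF _ False]) simp
      moreover have "Min ?A \<le> j" using j by (intro Min_le) auto
      ultimately obtain j' where j': "j' < j" "c j' = c j" "j' \<in> Jw" using j
        by (metis (mono_tags, lifting) DiffE insertI1 mem_Collect_eq order.not_eq_order_implies_strict)
      obtain l where l: "l < d" "c j = P l j" using joins[of j] by blast
      obtain l' where l': "l' < d" "c j' = P l' j'" using joins[of j'] by blast
      have "j \<in> Rp" unfolding repeats_def using j j' l l'
        by (intro CollectI conjI exI[of _ l] bexI[of _ j'] exI[of _ l']) auto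
      then show "j \<in> {j\<in>Rp. c j = v}" using j by auto
    qed
    then have "card (?A - {Min ?A}) \<le> card {j\<in>Rp. c j = v}"
      by (intro card_mono) (auto simp: repeats_def)
    then show ?thesis using False Min_in[of ?A] by (simp add: card_Diff_singleton arr_def del: Min_in)
  next
    case True
    then have "ar v = 0" unfolding arr_def by (simp only: card.empty)
    then show ?thesis by simp
  qed
  then have "(\<Sum>v\<in>{1..n}. real (ar v - 1)) \<le> (\<Sum>v\<in>{1..n}. 1 * real (card {j\<in>Rp. c j = v}))"
    by (intro sum_mono) simp
  also have "... = (\<Sum>j\<in>Rp. 1)" by (rule sum_over_joined) (auto simp: repeats_def)
  also have "... = real (card Rp)" by simp
  finally show ?thesis .
qed

lemma joined_visited: "0 < ar v ==> v \<in> visited P d (J s) (J (s + h))"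
proof -
  assume "0 < ar v"
  then obtain j where "j \<in> Jw" "c j = v" by (auto simp: card_gt_0_iff arr_def)
  then show ?thesis using joins[of j] by (auto simp: visited_def)
qed

text \<open>A server with at most one arrival, and without both an arrival and a departure or two departures, moves by exactly the sum of its two indicators. All
  other servers are paid for by the three error terms.\<close>

lemma server_change:
  assumes v: "v \<in> {1..n}" and i: "1 \<le> i"
  shows "\<bar>(of_bool (i \<le> Q v (s + h)) - of_bool (i \<le> Q v s) - real (ar v) * of_bool (Q v s = i - 1)
     + of_bool (fi v \<and> Q v s = i) :: real)\<bar> \<le> 4 * real (ar v - 1) + 3 * of_bool (v \<in> FV) + 3 * of_bool (v \<in> DB)"
proof -
  have QD: "Q v (s + h) + D v (s + h) = Q v s + D v s + ar v" by (rule Q_change[OF v s]) (use h in simp)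
  have mono: "D v s \<le> D v (s + h)" using D_mono h by simp
  define fv db where "fv = (v \<in> FV)" and "db = (v \<in> DB)"
  have goal: "\<bar>(of_bool (i \<le> Q v (s + h)) - of_bool (i \<le> Q v s) - real (ar v) * of_bool (Q v s = i - 1)
     + of_bool (fi v \<and> Q v s = i) :: real)\<bar> \<le> 4 * real (ar v - 1) + 3 * of_bool fv + 3 * of_bool db"
  proof -
  consider "ar v = 0" "\<not> fi v" | "ar v = 0" "fi v" "Q v s = 0" | "ar v = 0" "fi v" "0 < Q v s"
    | "ar v = 1" "\<not> fi v" | "ar v = 1" "fi v" | "2 \<le> ar v" by linarith
  then show ?thesis
  proof cases
    case 1
    then have "Q v (s + h) = Q v s" using not_fires_idle[OF v s h, of "s + h"] h QD by simp
    then show ?thesis using 1 by simp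
  next
    case 2
    then have "Q v (s + h) = Q v s" using QD mono by simp
    then show ?thesis using 2 i by simp
  next
    case 3
    have D: "Suc (D v s) \<le> D v (s + h)" using fires_served[OF v s h] 3 by simp
    show ?thesis
    proof (cases "D v (s + h) = Suc (D v s)")
      case True
      then have "Q v s = Suc (Q v (s + h))" using QD 3 by simp
      then show ?thesis using 3 i by (auto simp: of_bool_def)
    next
      case False
      then have "fires_twice T q0 (hist (J s)) S s h v" using served_twice[OF v s h] D by simp
      then have db unfolding db_def using v by blast
      moreover have "Q v (s + h) \<le> Q v s" using QD mono 3 by simp
      ultimately show ?thesis using 3 by (auto simp: of_bool_def)
    qed
  next
    case 4
    then have "Q v (s + h) = Suc (Q v s)" using not_fires_idle[OF v s h, of "s + h"] h QD by simp
    then show ?thesis using 4 i by (auto simp: of_bool_def)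
  next
    case 5
    then have "0 < ar v" by simp
    then have fv unfolding fv_def using joined_visited 5(2) by blast
    then show ?thesis using 5 of_bool_change_le[of "real (ar v)" "i \<le> Q v (s + h)" "i \<le> Q v s" "Q v s = i - 1" "fi v \<and> Q v s = i"] by simp
  next
    case 6
    then have "real (ar v - 1) = real (ar v) - 1" "2 \<le> real (ar v)" by simp_all
    moreover have "0 \<le> (of_bool fv :: real)" "0 \<le> (of_bool db :: real)" by simp_all
    ultimately show ?thesis
      using of_bool_change_le[of "real (ar v)" "i \<le> Q v (s + h)" "i \<le> Q v s" "Q v s = i - 1" "fi v \<and> Q v s = i"] by linarith
  qed
  qed
  then show ?thesis unfolding fv_def db_def .
qed

abbreviation "N i t \<equiv> card {v\<in>{1..n}. i \<le> Q v t}"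
abbreviation "Fi i \<equiv> card {v\<in>{1..n}. i \<le> Q v s \<and> fi v}"

lemma card_eq_sum: "finite A ==> real (card {x\<in>A. p x}) = (\<Sum>x\<in>A. of_bool (p x))"
  by (simp add: Int_def of_bool_def sum.If_cases)

text \<open>Summed over the servers, the arrivals at level \<open>i - 1\<close> are a difference of counts of jobs that see only long queues. These use the state
  at time \<open>s\<close> alone, hence no longer the choices made in the window.\<close>

lemma window_level:
  assumes i: "1 \<le> i"
  shows "\<bar>real (N i (s + h)) - real (N i s) - (real (Cl (i - 1)) - real (Cl i)) + (real (Fi i) - real (Fi (Suc i)))\<bar>
    \<le> 6 * real err"
proof -
  let ?e = "\<lambda>v. of_bool (i \<le> Q v (s + h)) - of_bool (i \<le> Q v s) - real (ar v) * of_bool (Q v s = i - 1)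
     + of_bool (fi v \<and> Q v s = i) :: real"
  have fi: "(\<Sum>v\<in>{1..n}. of_bool (fi v \<and> Q v s = i)) = real (Fi i) - real (Fi (Suc i))"
  proof -
    have "(\<Sum>v\<in>{1..n}. of_bool (fi v \<and> Q v s = i)) = (\<Sum>v\<in>{1..n}. of_bool (i \<le> Q v s \<and> fi v) - of_bool (Suc i \<le> Q v s \<and> fi v) :: real)"
      by (intro sum.cong refl) (auto simp: of_bool_def)
    then show ?thesis by (simp only: card_eq_sum finite_atLeastAtMost sum_subtractf)
  qed
  have aj: "(\<Sum>v\<in>{1..n}. real (ar v) * of_bool (Q v s = i - 1)) = real (Nj (i - 1)) - real (Nj i)"
  proof -
    have "(\<Sum>v\<in>{1..n}. real (ar v) * of_bool (Q v s = i - 1)) = (\<Sum>j\<in>Jw. of_bool (Q (c j) s = i - 1))"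
      using sum_over_joined[of Jw "\<lambda>v. of_bool (Q v s = i - 1)"] unfolding arr_def by (simp only: mult.commute finite_atLeastLessThan)
    also have "... = (\<Sum>j\<in>Jw. of_bool (i - 1 \<le> Q (c j) s) - of_bool (i \<le> Q (c j) s))"
      using i by (intro sum.cong refl) (auto simp: of_bool_def)
    finally show ?thesis by (simp only: card_eq_sum finite_atLeastLessThan sum_subtractf)
  qed
  have "(\<Sum>v\<in>{1..n}. ?e v) = real (N i (s + h)) - real (N i s) - (real (Nj (i - 1)) - real (Nj i)) + (real (Fi i) - real (Fi (Suc i)))"
    unfolding sum.distrib sum_subtractf aj fi by (simp only: card_eq_sum finite_atLeastAtMost)
  moreover have "\<bar>\<Sum>v\<in>{1..n}. ?e v\<bar> \<le> 4 * real (card Rp) + 3 * real (card FV) + 3 * real (card DB)"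
  proof -
    have "\<bar>\<Sum>v\<in>{1..n}. ?e v\<bar> \<le> (\<Sum>v\<in>{1..n}. 4 * real (ar v - 1) + 3 * of_bool (v \<in> FV) + 3 * of_bool (v \<in> DB))"
      by (intro order.trans[OF sum_abs] sum_mono server_change i) auto
    also have "... = 4 * (\<Sum>v\<in>{1..n}. real (ar v - 1)) + 3 * (\<Sum>v\<in>{1..n}. of_bool (v \<in> FV)) + 3 * (\<Sum>v\<in>{1..n}. of_bool (v \<in> DB))"
      by (simp only: sum.distrib sum_distrib_left)
    also have "(\<Sum>v\<in>{1..n}. of_bool (v \<in> FV)) \<le> real (card FV)"
    proof -
      have "(\<Sum>v\<in>{1..n}. of_bool (v \<in> FV)) = real (card {v\<in>{1..n}. v \<in> FV})" by (simp only: card_eq_sum finite_atLeastAtMost)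
      also have "... \<le> real (card FV)" using finite_visited by (intro of_nat_mono card_mono) auto
      finally show ?thesis .
    qed
    also have "(\<Sum>v\<in>{1..n}. of_bool (v \<in> DB)) \<le> real (card DB)"
    proof -
      have "(\<Sum>v\<in>{1..n}. of_bool (v \<in> DB)) = real (card {v\<in>{1..n}. v \<in> DB})" by (simp only: card_eq_sum finite_atLeastAtMost)
      also have "... \<le> real (card DB)" by (intro of_nat_mono card_mono) auto
      finally show ?thesis .
    qed
    finally show ?thesis using excess_le by simp
  qed
  ultimately show ?thesis unfolding err_def of_nat_add distrib_left
    by (rule level_arith[OF _ _ Nj_Cl_real Nj_Cl_real of_nat_0_le_iff of_nat_0_le_iff])
qed

text \<open>Departures only help, so just the arrivals at queues of length at least \<open>K\<close> count.\<close>

lemma window_tail: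
  "(\<Sum>v\<in>{1..n}. real (Q v (s + h) - K)) \<le> (\<Sum>v\<in>{1..n}. real (Q v s - K)) + real (Cl K) + 2 * real err"
proof -
  have "real (Q v (s + h) - K) \<le> real (Q v s - K) + of_bool (K \<le> Q v s) * real (ar v) + real (ar v - 1)"
    if v: "v \<in> {1..n}" for v
  proof -
    have "Q v (s + h) + D v (s + h) = Q v s + D v s + ar v" by (rule Q_change[OF v s]) (use h in simp)
    moreover have "D v s \<le> D v (s + h)" using D_mono h by simp
    ultimately have "Q v (s + h) \<le> Q v s + ar v" by linarith
    then have "Q v (s + h) - K \<le> (Q v s - K) + (if K \<le> Q v s then ar v else 0) + (ar v - 1)" by auto
    then show ?thesis by (auto simp: of_bool_def split: if_splits)
  qed
  then have "(\<Sum>v\<in>{1..n}. real (Q v (s + h) - K)) \<le>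
    (\<Sum>v\<in>{1..n}. real (Q v s - K) + of_bool (K \<le> Q v s) * real (ar v) + real (ar v - 1))" by (rule sum_mono)
  also have "... = (\<Sum>v\<in>{1..n}. real (Q v s - K)) + real (Nj K) + (\<Sum>v\<in>{1..n}. real (ar v - 1))"
    unfolding sum.distrib using sum_over_joined[of Jw "\<lambda>v. of_bool (K \<le> Q v s)"] unfolding arr_def
    by (simp only: card_eq_sum finite_atLeastLessThan)
  finally show ?thesis unfolding err_def of_nat_add distrib_left add.assoc[symmetric]
    by (rule tail_arith[OF _ excess_le Nj_Cl_real of_nat_0_le_iff of_nat_0_le_iff])
qed

lemma within_window:
  assumes t: "s \<le> t" "t \<le> s + h"
  shows "\<bar>real (N i t) - real (N i s)\<bar> \<le> real (card Jw) + real (card {v\<in>{1..n}. fi v})"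
    and "(\<Sum>v\<in>{1..n}. real (Q v t - K)) \<le> (\<Sum>v\<in>{1..n}. real (Q v s - K)) + real (card Jw)"
proof -
  have QD: "Q v t + D v t = Q v s + D v s + arr v s t" and mono: "D v s \<le> D v t" if "v \<in> {1..n}" for v
    using Q_change[OF that s t(1)] D_mono[OF t(1)] by auto
  have sumarr: "(\<Sum>v\<in>{1..n}. real (arr v s t)) \<le> real (card Jw)"
  proof -
    have "(\<Sum>v\<in>{1..n}. 1 * real (arr v s t)) = real (card {J s..<J t})"
      unfolding arr_def by (subst sum_over_joined) auto
    also have "... \<le> real (card Jw)" using J_mono[OF t(2)] by (intro of_nat_mono card_mono) auto
    finally show ?thesis by simp
  qed
  have "\<bar>of_bool (i \<le> Q v t) - of_bool (i \<le> Q v s) :: real\<bar> \<le> real (arr v s t) + of_bool (fi v)" if v: "v \<in> {1..n}" for v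
  proof (cases "fi v \<or> 0 < arr v s t")
    case False
    then have "Q v t = Q v s" using not_fires_idle[OF v s h _ t] QD[OF v] by simp
    then show ?thesis by simp
  next
    case True
    then have "1 \<le> real (arr v s t) + of_bool (fi v)" by (auto simp: of_bool_def)
    then show ?thesis by (auto simp: of_bool_def)
  qed
  then have "\<bar>\<Sum>v\<in>{1..n}. of_bool (i \<le> Q v t) - of_bool (i \<le> Q v s) :: real\<bar> \<le> (\<Sum>v\<in>{1..n}. real (arr v s t) + of_bool (fi v))"
    by (intro order.trans[OF sum_abs] sum_mono)
  also have "... = (\<Sum>v\<in>{1..n}. real (arr v s t)) + real (card {v\<in>{1..n}. fi v})"
    by (simp only: sum.distrib card_eq_sum finite_atLeastAtMost)
  finally show "\<bar>real (N i t) - real (N i s)\<bar> \<le> real (card Jw) + real (card {v\<in>{1..n}. fi v})"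
    using sumarr by (simp only: card_eq_sum finite_atLeastAtMost sum_subtractf)
  have "real (Q v t - K) \<le> real (Q v s - K) + real (arr v s t)" if v: "v \<in> {1..n}" for v
    using QD[OF v] mono[OF v] by linarith
  then have "(\<Sum>v\<in>{1..n}. real (Q v t - K)) \<le> (\<Sum>v\<in>{1..n}. real (Q v s - K) + real (arr v s t))" by (rule sum_mono)
  then show "(\<Sum>v\<in>{1..n}. real (Q v t - K)) \<le> (\<Sum>v\<in>{1..n}. real (Q v s - K)) + real (card Jw)"
    using sumarr by (simp add: sum.distrib)
qed

end

lemma Q_0: "v \<in> {1..n} ==> Q v 0 = q0 v"
proof -
  assume v: "v \<in> {1..n}"
  have "J 0 = 0" using less_J_iff[of _ 0] T_pos by (metis gr0I not_less)
  moreover have "D v 0 = 0"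
  proof (rule ccontr)
    assume "D v 0 \<noteq> 0"
    then have "0 < completed T (q0 v) (hist (J 0)) v (S v) 0" by (simp add: served_def)
    then have "svc_end (job_arrival T (q0 v) (hist (J 0)) v) (S v) 0 \<le> 0"
      using less_completed_iff[where sv = "S v" and r = 0 and q = "q0 v" and ks = "hist (J 0)" and v = v and T = T and t = 0, OF S_pos[OF v]] by blast
    moreover have "0 \<le> job_arrival T (q0 v) (hist (J 0)) v 0"
      using less_imp_le[OF T_pos] by (simp add: job_arrival_def)
    ultimately show False using S_pos[OF v, of 0] by (simp add: svc_end_def)
  qed
  ultimately show ?thesis using Q_D[OF v, of 0] by simp
qed

end

section \<open>Sums of exponential variables\<close>

lemma (in prob_space) indep_sets_inj:
  assumes "indep_sets F I" "inj_on f I'" "f ` I' \<subseteq> I"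
  shows "indep_sets (\<lambda>i. F (f i)) I'"
proof (rule indep_setsI)
  show "F (f i) \<subseteq> events" if "i \<in> I'" for i using assms that by (auto simp: indep_sets_def)
next
  fix A J assume J: "J \<noteq> {}" "J \<subseteq> I'" "finite J" and A: "\<forall>j\<in>J. A j \<in> F (f j)"
  have inj: "inj_on f J" using assms(2) J by (auto intro: inj_on_subset)
  define B where "B = (\<lambda>k. A (the_inv_into J f k))"
  have B: "B (f j) = A j" if "j \<in> J" for j using that inj by (simp add: B_def the_inv_into_f_f)
  have "prob (\<Inter>k\<in>f ` J. B k) = (\<Prod>k\<in>f ` J. prob (B k))"
  proof (rule indep_setsD[OF assms(1)])
    show "f ` J \<subseteq> I" using J assms(3) by blast
    show "\<forall>k\<in>f ` J. B k \<in> F k" using A B by auto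
  qed (use J in auto)
  then show "prob (\<Inter>j\<in>J. A j) = (\<Prod>j\<in>J. prob (A j))"
    using B inj by (simp add: prod.reindex)
qed

lemma nn_integral_exponential_mgf:
  fixes l u :: real
  assumes "0 < l" "- l < u"
  shows "(\<integral>\<^sup>+x. ennreal (exponential_density l x) * ennreal (exp (- u * x)) \<partial>lborel) = ennreal (l / (l + u))"
proof -
  have lu: "0 < l + u" using assms by simp
  interpret D: prob_space "density lborel (exponential_density (l + u))"
    by (rule prob_space_exponential_density[OF lu])
  have "(\<integral>\<^sup>+x. ennreal (exponential_density (l + u) x) \<partial>lborel) = 1"
    using D.emeasure_space_1 by (simp add: emeasure_density)
  moreover have "ennreal (exponential_density l x) * ennreal (exp (- u * x)) =
      ennreal (l / (l + u)) * ennreal (exponential_density (l + u) x)" for x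
  proof -
    have "l / (l + u) * ((l + u) * y) = l * y" for y using lu by simp
    moreover have "exp (- x * l) * exp (- u * x) = exp (- x * (l + u))" by (simp add: mult_exp_exp algebra_simps)
    ultimately have "exponential_density l x * exp (- u * x) = l / (l + u) * exponential_density (l + u) x"
      by (simp add: exponential_density_def mult.assoc)
    then show ?thesis using lu assms
      by (simp add: ennreal_mult[symmetric] exponential_density_nonneg)
  qed
  ultimately show ?thesis
    by (simp add: nn_integral_cmult)
qed

text \<open>One statement for both tails, according to the sign of \<open>u\<close>.\<close>

lemma (in prob_space) exponential_sum_chernoff:
  fixes X :: "nat => 'a => real" and l u x :: real
  assumes l: "0 < l" "- l < u" and I: "finite I"
    and X: "\<And>i. i \<in> I ==> distributed M lborel (X i) (exponential_density l)"
    and ind: "indep_vars (\<lambda>_. borel) X I"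
  shows "prob {w\<in>space M. u * (\<Sum>i\<in>I. X i w) \<le> u * x} \<le> exp (u * x) * (l / (l + u)) ^ card I"
proof -
  have rv [measurable]: "i \<in> I ==> random_variable borel (X i)" for i
    using distributed_measurable[OF X[of i]] by simp
  define Y where "Y = (\<lambda>w. \<Prod>i\<in>I. ennreal (exp (- u * X i w)))"
  have Yexp: "Y w = ennreal (exp (- u * (\<Sum>i\<in>I. X i w)))" for w
    unfolding Y_def using I by (simp add: prod_ennreal exp_sum[symmetric] sum_distrib_left)
  have "(\<integral>\<^sup>+w. Y w \<partial>M) = (\<Prod>i\<in>I. \<integral>\<^sup>+w. ennreal (exp (- u * X i w)) \<partial>M)"
    unfolding Y_def by (rule indep_vars_nn_integral[OF I]) (auto intro!: indep_vars_compose2[OF ind])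
  also have "... = (\<Prod>i\<in>I. ennreal (l / (l + u)))"
  proof (intro prod.cong refl)
    fix i assume "i \<in> I"
    have "(\<integral>\<^sup>+w. ennreal (exp (- u * X i w)) \<partial>M) =
        (\<integral>\<^sup>+x. ennreal (exponential_density l x) * ennreal (exp (- u * x)) \<partial>lborel)"
      by (rule distributed_nn_integral[OF X[OF \<open>i \<in> I\<close>], symmetric]) measurable
    then show "(\<integral>\<^sup>+w. ennreal (exp (- u * X i w)) \<partial>M) = ennreal (l / (l + u))"
      using nn_integral_exponential_mgf[OF l] by simp
  qed
  also have "... = ennreal ((l / (l + u)) ^ card I)" using l by (simp add: ennreal_power)
  finally have EY: "(\<integral>\<^sup>+w. Y w \<partial>M) = ennreal ((l / (l + u)) ^ card I)" .
  have "emeasure M {w\<in>space M. u * (\<Sum>i\<in>I. X i w) \<le> u * x}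
      \<le> emeasure M ({w\<in>space M. 1 \<le> ennreal (exp (u * x)) * Y w})"
  proof (intro emeasure_mono)
    show "{w\<in>space M. u * (\<Sum>i\<in>I. X i w) \<le> u * x} \<subseteq> {w\<in>space M. 1 \<le> ennreal (exp (u * x)) * Y w}"
      by (auto simp: Yexp ennreal_mult[symmetric] mult_exp_exp)
  qed (unfold Yexp, measurable)
  also have "... \<le> ennreal (exp (u * x)) * (\<integral>\<^sup>+w. Y w * indicator (space M) w \<partial>M)"
    by (rule nn_integral_Markov_inequality) (unfold Yexp, measurable)
  also have "(\<integral>\<^sup>+w. Y w * indicator (space M) w \<partial>M) = (\<integral>\<^sup>+w. Y w \<partial>M)"
    by (intro nn_integral_cong) auto
  finally show ?thesis unfolding EY emeasure_eq_measure using l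
    by (simp add: ennreal_mult[symmetric])
qed

section \<open>Traces of \<sigma>-algebras\<close>

text \<open>On the event \<open>C\<close>, the event \<open>F\<close> is determined by the information in \<open>D\<close>. Unlike conditional probability this
  makes sense on null events as well, and \<open>D\<close> may vary with \<open>C\<close>.\<close>

definition trace_in :: "'a measure => 'a set => 'a set => bool" where
  "trace_in D C F \<longleftrightarrow> (\<exists>X\<in>sets D. F \<inter> C = X \<inter> C)"

lemma trace_in_sets: "F \<in> sets D ==> trace_in D C F"
  by (auto simp: trace_in_def)

lemma trace_in_compl:
  assumes "trace_in D C F" "C \<subseteq> space D" shows "trace_in D C (space D - F)"
proof -
  obtain X where "X \<in> sets D" "F \<inter> C = X \<inter> C" using assms by (auto simp: trace_in_def)
  then show ?thesis unfolding trace_in_def using assms(2) by (intro bexI[of _ "space D - X"]) auto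
qed

lemma trace_in_UN:
  assumes "countable I" "\<And>i. i \<in> I ==> trace_in D C (F i)" shows "trace_in D C (\<Union>i\<in>I. F i)"
proof -
  have "\<forall>i\<in>I. \<exists>X. X \<in> sets D \<and> F i \<inter> C = X \<inter> C" using assms by (auto simp: trace_in_def)
  then obtain X where "\<forall>i\<in>I. X i \<in> sets D \<and> F i \<inter> C = X i \<inter> C" by metis
  then show ?thesis unfolding trace_in_def using assms(1)
    by (intro bexI[of _ "\<Union>i\<in>I. X i"] sets.countable_UN'') auto
qed

lemma trace_in_Int:
  assumes "trace_in D C F" "trace_in D C F'" shows "trace_in D C (F \<inter> F')"
proof -
  obtain X X' where "X \<in> sets D" "F \<inter> C = X \<inter> C" "X' \<in> sets D" "F' \<inter> C = X' \<inter> C"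
    using assms by (auto simp: trace_in_def)
  then show ?thesis unfolding trace_in_def by (intro bexI[of _ "X \<inter> X'"]) auto
qed

lemma trace_in_cong: "F \<inter> C = F' \<inter> C ==> trace_in D C F \<longleftrightarrow> trace_in D C F'"
  by (simp add: trace_in_def)

lemma trace_in_mono: "trace_in D C F ==> C' \<subseteq> C ==> sets D \<subseteq> sets D' ==> trace_in D' C' F"
  unfolding trace_in_def by blast

lemma trace_in_sigma_sets:
  assumes "A \<in> sigma_sets (space D) Gen" "\<And>F. F \<in> Gen ==> trace_in D C F" "C \<subseteq> space D"
  shows "trace_in D C A"
  using assms(1)
proof induction
  case Empty
  then show ?case by (intro trace_in_sets) auto
next
  case (Compl a)
  then show ?case by (intro trace_in_compl assms(3))
next
  case (Union a)
  then show ?case using trace_in_UN[of UNIV D C a] by auto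
qed (rule assms(2))

section \<open>Memorylessness\<close>

text \<open>The elapsed time \<open>Y\<close> may be random as long as it is independent of \<open>X\<close>. Points with negative \<open>Y\<close> are left out,
  which allows the identity to be restricted to an event.\<close>

lemma (in prob_space) memoryless_indep:
  fixes Y X :: "'a => real" and h :: real
  assumes X: "distributed M lborel X (exponential_density 1)"
    and ind: "indep_var borel Y borel X" and h: "0 \<le> h"
  shows "prob {w\<in>space M. 0 \<le> Y w \<and> Y w < X w \<and> X w \<le> Y w + h}
    = (1 - exp (- h)) * prob {w\<in>space M. 0 \<le> Y w \<and> Y w < X w}"
proof -
  have Ym [measurable]: "Y \<in> borel_measurable M" and Xm [measurable]: "X \<in> borel_measurable M"
    using ind by (auto simp: indep_var_distribution_eq)
  let ?\<mu> = "distr M borel Y" and ?\<nu> = "distr M borel X"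
  interpret N: prob_space ?\<nu> by (rule prob_space_distr) simp
  have pair: "distr M (borel \<Otimes>\<^sub>M borel) (\<lambda>w. (Y w, X w)) = ?\<mu> \<Otimes>\<^sub>M ?\<nu>"
    using ind by (simp add: indep_var_distribution_eq)
  have gt: "emeasure ?\<nu> {y<..} = ennreal (exp (- y))" if "0 \<le> y" for y
    using exponential_distributedD_gt[OF X that] by (simp add: emeasure_distr emeasure_eq_measure vimage_def Int_def conj_commute)
  have shift: "emeasure M {w\<in>space M. 0 \<le> Y w \<and> Y w + a < X w}
      = (\<integral>\<^sup>+y. indicator {0..} y * ennreal (exp (- y)) \<partial>?\<mu>) * ennreal (exp (- a))" if a: "0 \<le> a" for a
  proof -
    let ?S = "{(y, x). 0 \<le> y \<and> y + a < x} :: (real \<times> real) set"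
    have "?S = {p\<in>space (borel \<Otimes>\<^sub>M borel). 0 \<le> fst p \<and> fst p + a < snd p}" by (auto simp: space_pair_measure)
    also have "... \<in> sets (borel \<Otimes>\<^sub>M borel)" by measurable
    finally have S [measurable]: "?S \<in> sets (borel \<Otimes>\<^sub>M borel)" .
    have "emeasure M {w\<in>space M. 0 \<le> Y w \<and> Y w + a < X w} = emeasure (?\<mu> \<Otimes>\<^sub>M ?\<nu>) ?S"
      unfolding pair[symmetric] by (subst emeasure_distr) (auto intro!: arg_cong2[where f=emeasure])
    also have "... = (\<integral>\<^sup>+y. emeasure ?\<nu> (Pair y -` ?S) \<partial>?\<mu>)"
      by (rule N.emeasure_pair_measure_alt) simp
    also have "... = (\<integral>\<^sup>+y. indicator {0..} y * ennreal (exp (- y)) * ennreal (exp (- a)) \<partial>?\<mu>)"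
    proof (intro nn_integral_cong)
      fix y :: real
      show "emeasure ?\<nu> (Pair y -` ?S) = indicator {0..} y * ennreal (exp (- y)) * ennreal (exp (- a))"
      proof (cases "0 \<le> y")
        case True
        then have "Pair y -` ?S = {y + a<..}" by auto
        then show ?thesis using gt[of "y + a"] True a by (simp add: ennreal_mult[symmetric] mult_exp_exp)
      qed auto
    qed
    finally show ?thesis by (simp add: nn_integral_multc)
  qed
  define I where "I = prob {w\<in>space M. 0 \<le> Y w \<and> Y w < X w}"
  have p: "prob {w\<in>space M. 0 \<le> Y w \<and> Y w + h < X w} = I * exp (- h)"
  proof -
    have "ennreal (prob {w\<in>space M. 0 \<le> Y w \<and> Y w + h < X w}) = ennreal I * ennreal (exp (- h))"
      using shift[of h] shift[of 0] h by (simp add: emeasure_eq_measure I_def)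
    then show ?thesis by (simp add: ennreal_mult[symmetric] I_def)
  qed
  have "{w\<in>space M. 0 \<le> Y w \<and> Y w < X w \<and> X w \<le> Y w + h} =
     {w\<in>space M. 0 \<le> Y w \<and> Y w < X w} - {w\<in>space M. 0 \<le> Y w \<and> Y w + h < X w}" by auto
  also have "prob ... = prob {w\<in>space M. 0 \<le> Y w \<and> Y w < X w} - prob {w\<in>space M. 0 \<le> Y w \<and> Y w + h < X w}"
  proof (rule finite_measure_Diff)
    show "{w\<in>space M. 0 \<le> Y w \<and> Y w + h < X w} \<subseteq> {w\<in>space M. 0 \<le> Y w \<and> Y w < X w}" using h by auto
  qed measurable
  also have "... = I - I * exp (- h)" unfolding p I_def ..
  finally show ?thesis by (simp add: I_def algebra_simps)
qed

section \<open>Sources of randomness\<close>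

context nbrw_pod_system
begin

abbreviation "\<S> \<equiv> sources n d"

definition src :: "source set => 'a measure" where
  "src X = sigma (space M) (\<Union>x\<in>X. sets (source_algebra M E S W U x))"

lemma space_source: "space (source_algebra M E S W U x) = space M"
  using tie_breaking_subalgebra
  by (cases x) (auto simp: source_algebra_def subalgebra_def)

lemma sources_Pow: "(\<Union>x\<in>X. sets (source_algebra M E S W U x)) \<subseteq> Pow (space M)"
  using sets.space_closed[of "source_algebra M E S W U x" for x] unfolding space_source by blast

lemma space_src [simp]: "space (src X) = space M"
  unfolding src_def by (rule space_measure_of[OF sources_Pow])

lemma sets_src: "sets (src X) = sigma_sets (space M) (\<Union>x\<in>X. sets (source_algebra M E S W U x))"
  unfolding src_def by (rule sets_measure_of[OF sources_Pow])

lemma source_events: "x \<in> \<S> ==> sets (source_algebra M E S W U x) \<subseteq> events"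
  using independent_sources by (auto simp: indep_sets_def)

lemma src_events: "X \<subseteq> \<S> ==> sets (src X) \<subseteq> events"
  unfolding sets_src using source_events by (intro sets.sigma_sets_subset) auto

lemma src_mono: "X \<subseteq> Y ==> sets (src X) \<subseteq> sets (src Y)"
  unfolding sets_src by (intro sigma_sets_mono') auto

lemma source_src: "x \<in> X ==> A \<in> sets (source_algebra M E S W U x) ==> A \<in> sets (src X)"
  unfolding sets_src by auto

lemma src_indep:
  assumes "X \<subseteq> \<S>" "Y \<subseteq> \<S>" "X \<inter> Y = {}" "A \<in> sets (src X)" "B \<in> sets (src Y)"
  shows "prob (A \<inter> B) = prob A * prob B"
proof -
  have "indep_sets (\<lambda>b. sigma_sets (space M) (\<Union>x\<in>case_bool X Y b. sets (source_algebra M E S W U x))) UNIV"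
  proof (rule indep_sets_collect_sigma)
    show "indep_sets (\<lambda>x. sets (source_algebra M E S W U x)) (\<Union>b\<in>UNIV. case_bool X Y b)"
      by (rule indep_sets_mono_index[OF _ independent_sources]) (use assms in \<open>auto simp: UNIV_bool\<close>)
    show "disjoint_family_on (case_bool X Y) UNIV"
      using assms(3) by (auto simp: disjoint_family_on_def split: bool.split)
  qed (rule sets.Int_stable)
  then have "prob (\<Inter>b\<in>UNIV. case_bool A B b) = (\<Prod>b\<in>UNIV. prob (case_bool A B b))"
    by (rule indep_setsD) (use assms(4,5) in \<open>auto simp: sets_src split: bool.split\<close>)
  then show ?thesis by (simp add: UNIV_bool Int_commute mult.commute)
qed

lemma measurable_src_real:
  assumes "x \<in> X" "source_algebra M E S W U x = vimage_algebra (space M) f borel"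
  shows "(f :: 'a => real) \<in> borel_measurable (src X)"
proof (rule measurableI)
  fix A :: "real set" assume "A \<in> sets borel"
  then show "f -` A \<inter> space (src X) \<in> sets (src X)"
    using source_src[OF assms(1)] assms(2) by (simp add: in_vimage_algebra)
qed simp

lemma E_measurable_src: "Interarrival j \<in> X ==> E j \<in> borel_measurable (src X)"
  by (rule measurable_src_real) (auto simp: source_algebra_def)

lemma S_measurable_src: "Service v m \<in> X ==> S v m \<in> borel_measurable (src X)"
  by (rule measurable_src_real) (auto simp: source_algebra_def)

lemma W_measurable_src:
  assumes "Walker l \<in> X" shows "W l j \<in> measurable (src X) (count_space UNIV)"
proof -
  have 1: "(\<lambda>w j. W l j w) \<in> measurable (src X) (\<Pi>\<^sub>M j\<in>UNIV. count_space UNIV)"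
  proof (rule measurableI)
    fix A assume "A \<in> sets (\<Pi>\<^sub>M j\<in>(UNIV :: nat set). count_space (UNIV :: (nat \<times> nat) set))"
    then show "(\<lambda>w j. W l j w) -` A \<inter> space (src X) \<in> sets (src X)"
      using source_src[OF assms] by (simp add: in_vimage_algebra source_algebra_def)
  qed (auto simp: space_PiM)
  have "(\<lambda>w. w j) \<in> measurable (\<Pi>\<^sub>M j\<in>(UNIV :: nat set). count_space (UNIV :: (nat \<times> nat) set)) (count_space UNIV)"
    by (rule measurable_component_singleton) simp
  from measurable_compose[OF 1 this] show ?thesis by simp
qed

lemma U_src: "Tie_Breaking \<in> X ==> A \<in> sets U ==> A \<in> sets (src X)"
  by (rule source_src[of Tie_Breaking]) (auto simp: source_algebra_def)

lemma in_sources [simp]: "Interarrival j \<in> \<S>" "Service v m \<in> \<S> \<longleftrightarrow> v \<in> {1..n}" "Walker l \<in> \<S> \<longleftrightarrow> l < d"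
  "Tie_Breaking \<in> \<S>"
  by (auto simp: sources_def)

lemma borel_src_imp: "f \<in> measurable (src X) N ==> X \<subseteq> \<S> ==> f \<in> measurable M N"
  using src_events[of X] by (auto simp: measurable_def)

lemma E_measurable [measurable]: "E j \<in> borel_measurable M"
  by (rule borel_src_imp[OF E_measurable_src[of j "{Interarrival j}"]]) auto

lemma S_measurable: "v \<in> {1..n} ==> S v m \<in> borel_measurable M"
  by (rule borel_src_imp[OF S_measurable_src[of v m "{Service v m}"]]) auto

lemma W_measurable: "l < d ==> W l j \<in> measurable M (count_space UNIV)"
  by (rule borel_src_imp[OF W_measurable_src[of l "{Walker l}"]]) auto

abbreviation "T j \<equiv> arrival_time E j"

lemma T_measurable_src: "range Interarrival \<subseteq> X ==> T j \<in> borel_measurable (src X)"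
  unfolding arrival_time_def[abs_def] by (intro borel_measurable_sum E_measurable_src) auto

lemma T_measurable [measurable]: "T j \<in> borel_measurable M"
  unfolding arrival_time_def[abs_def] by (intro borel_measurable_sum E_measurable)

lemma history_events:
  assumes "F \<in> sets (history M n d E W U Q j)" shows "F \<in> events"
proof -
  let ?Gen = "sets U \<union> {E i -` B \<inter> space M | i B. i \<le> j \<and> B \<in> sets borel} \<union>
      {W l i -` {e} \<inter> space M | l i e. l < d \<and> i \<le> j} \<union>
      {{w\<in>space M. s < T j w \<and> Q v s w = q} | v s q. v \<in> {1..n} \<and> 0 \<le> s}"
  have ev: "?Gen \<subseteq> events"
  proof -
    have 1: "sets U \<subseteq> events" using tie_breaking_subalgebra by (simp add: subalgebra_def)
    have "E i -` B \<inter> space M \<in> events" if "B \<in> sets borel" for i B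
      by (rule measurable_sets[OF E_measurable that])
    then have 2: "{E i -` B \<inter> space M | i B. i \<le> j \<and> B \<in> sets borel} \<subseteq> events" by blast
    have "W l i -` {e} \<inter> space M \<in> events" if "l < d" for l i e
      using measurable_sets[OF W_measurable[OF that, of i], of "{e}"] by simp
    then have 3: "{W l i -` {e} \<inter> space M | l i e. l < d \<and> i \<le> j} \<subseteq> events" by blast
    have "{w\<in>space M. s < T j w \<and> Q v s w = q} \<in> events" if "v \<in> {1..n}" "0 \<le> s" for v s q
    proof -
      have [measurable]: "Q v s \<in> measurable M (count_space UNIV)" using queue_measurable[OF that] .
      show ?thesis by measurable
    qed
    then have 4: "{{w\<in>space M. s < T j w \<and> Q v s w = q} | v s q. v \<in> {1..n} \<and> 0 \<le> s} \<subseteq> events" by blast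
    show ?thesis by (intro Un_least 1 2 3 4)
  qed
  then have "?Gen \<subseteq> Pow (space M)" using sets.space_closed by blast
  then have "sets (history M n d E W U Q j) = sigma_sets (space M) ?Gen"
    unfolding history_def by (rule sets_measure_of)
  then show ?thesis using assms sets.sigma_sets_subset[OF ev] by auto
qed

lemma history_sets: "sets (history M n d E W U Q j) = sigma_sets (space M) (sets U \<union>
      {E i -` B \<inter> space M | i B. i \<le> j \<and> B \<in> sets borel} \<union>
      {W l i -` {e} \<inter> space M | l i e. l < d \<and> i \<le> j} \<union>
      {{w\<in>space M. s < T j w \<and> Q v s w = q} | v s q. v \<in> {1..n} \<and> 0 \<le> s})"
  unfolding history_def
proof (rule sets_measure_of)
  have "sets U \<subseteq> Pow (space M)"
    using tie_breaking_subalgebra sets.space_closed[of U] by (simp add: subalgebra_def)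
  then show "sets U \<union>
      {E i -` B \<inter> space M | i B. i \<le> j \<and> B \<in> sets borel} \<union>
      {W l i -` {e} \<inter> space M | l i e. l < d \<and> i \<le> j} \<union>
      {{w\<in>space M. s < T j w \<and> Q v s w = q} | v s q. v \<in> {1..n} \<and> 0 \<le> s} \<subseteq> Pow (space M)" by blast
qed

lemma space_history: "space (history M n d E W U Q j) = space M"
  unfolding history_def by (rule space_measure_of_conv)

lemma c_measurable [measurable]: "c j \<in> measurable M (count_space UNIV)"
proof (rule measurableI)
  fix A assume "A \<in> sets (count_space (UNIV :: nat set))"
  then have "c j -` A \<inter> space M \<in> sets (history M n d E W U Q j)"
    using measurable_sets[OF choice_nonanticipating[of j], of A] by (simp add: space_history)
  then show "c j -` A \<inter> space M \<in> events" by (rule history_events)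
qed simp

end

section \<open>Conditioning on cells\<close>

context prob_space
begin

lemma prob_cells_le:
  assumes I: "countable I" "disjoint_family_on C I" "\<And>i. i \<in> I ==> C i \<in> events"
    and A: "A \<in> events" "A \<subseteq> (\<Union>i\<in>I. C i)" and B: "B \<in> events" and q: "0 \<le> q"
    and le: "\<And>i. i \<in> I ==> prob (A \<inter> C i) \<le> q * prob (B \<inter> C i)"
  shows "prob A \<le> q * prob B"
proof -
  have split: "emeasure M (\<Union>i\<in>I. X \<inter> C i) = (\<integral>\<^sup>+i. emeasure M (X \<inter> C i) \<partial>count_space I)" if "X \<in> events" for X
    by (rule emeasure_UN_countable) (use I that in \<open>auto simp: disjoint_family_on_def\<close>)
  have "A = (\<Union>i\<in>I. A \<inter> C i)" using A(2) by auto
  then have "emeasure M A = (\<integral>\<^sup>+i. emeasure M (A \<inter> C i) \<partial>count_space I)" using split[OF A(1)] by simp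
  also have "... \<le> (\<integral>\<^sup>+i. ennreal q * emeasure M (B \<inter> C i) \<partial>count_space I)"
    using le q by (intro nn_integral_mono) (simp add: emeasure_eq_measure ennreal_mult[symmetric])
  also have "... = ennreal q * emeasure M (\<Union>i\<in>I. B \<inter> C i)" by (simp only: split[OF B]) (simp add: nn_integral_cmult)
  also have "... \<le> ennreal q * emeasure M B" using B by (intro mult_left_mono emeasure_mono) auto
  finally show ?thesis using q by (simp add: emeasure_eq_measure ennreal_mult[symmetric])
qed

text \<open>Outer probability: the bad events involve path properties of queues on a set of full measure only, and an enclosing event is all that the
  Borel-Cantelli lemma needs.\<close>

definition rare :: "real => 'a set => bool" where
  "rare p A \<longleftrightarrow> (\<exists>B\<in>events. A \<subseteq> B \<and> prob B \<le> p)"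

lemma rare_event: "B \<in> events ==> prob B \<le> p ==> A \<subseteq> B ==> rare p A"
  by (auto simp: rare_def)

lemma rare_mono: "rare p B ==> A \<subseteq> B ==> p \<le> q ==> rare q A"
  unfolding rare_def by (meson order.trans)

lemma rare_Un:
  assumes "rare p A" "rare q B" shows "rare (p + q) (A \<union> B)"
proof -
  obtain A' B' where AB: "A' \<in> events" "A \<subseteq> A'" "prob A' \<le> p" "B' \<in> events" "B \<subseteq> B'" "prob B' \<le> q"
    using assms by (auto simp: rare_def)
  show ?thesis by (rule rare_event[of "A' \<union> B'"]) (use AB measure_Un_le[of A' M B'] in auto)
qed

lemma rare_UN:
  assumes "finite I" "\<And>i. i \<in> I ==> rare p (A i)" shows "rare (real (card I) * p) (\<Union>i\<in>I. A i)"
  using assms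
proof (induction I rule: finite_induct)
  case (insert i I)
  then have "rare (p + real (card I) * p) (A i \<union> (\<Union>i\<in>I. A i))" by (intro rare_Un) auto
  then show ?case using insert.hyps by (simp add: algebra_simps)
qed (auto intro: rare_event[of "{}"])

lemma rare_cells:
  assumes I: "countable I" "disjoint_family_on C I" "\<And>i. i \<in> I ==> C i \<in> events"
    and A: "A \<subseteq> (\<Union>i\<in>I. C i)" and q: "0 \<le> q"
    and le: "\<And>i. i \<in> I ==> \<exists>B\<in>events. A \<inter> C i \<subseteq> B \<and> prob (B \<inter> C i) \<le> q * prob (C i)"
  shows "rare q A"
proof -
  obtain B where B: "\<And>i. i \<in> I ==> B i \<in> events \<and> A \<inter> C i \<subseteq> B i \<and> prob (B i \<inter> C i) \<le> q * prob (C i)" using le by metis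
  let ?B = "\<Union>i\<in>I. B i \<inter> C i"
  have ev: "?B \<in> events" using B I by (intro sets.countable_UN'') auto
  have "prob ?B \<le> q * prob (space M)"
  proof (rule prob_cells_le[OF I ev _ _ q])
    fix i assume i: "i \<in> I"
    have "?B \<inter> C i = B i \<inter> C i" using I(2) i by (fastforce simp: disjoint_family_on_def)
    moreover have "space M \<inter> C i = C i" using I(3)[OF i] sets.sets_into_space by blast
    ultimately show "prob (?B \<inter> C i) \<le> q * prob (space M \<inter> C i)" using B[OF i] by simp
  qed auto
  moreover have "A \<subseteq> ?B"
  proof
    fix y assume "y \<in> A"
    then obtain i where "i \<in> I" "y \<in> A \<inter> C i" using A by blast
    then show "y \<in> ?B" using B[of i] by blast
  qed
  ultimately show ?thesis by (intro rare_event[OF ev]) (auto simp: prob_space)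
qed

text \<open>Events determined by \<open>D i\<close> on every cell \<open>C i\<close>. This family is closed under intersections and differences, which is all that
  \<open>adaptive_chernoff\<close> asks for.\<close>

definition known :: "('i => 'a measure) => ('i => 'a set) => 'a set set" where
  "known D C = {F\<in>events. \<forall>i. trace_in (D i) (C i) F}"

lemma known_events: "known D C \<subseteq> events" by (auto simp: known_def)

lemma known_sets:
  assumes "\<And>i. F \<in> sets (D i)" "F \<in> events" shows "F \<in> known D C"
  using assms by (auto simp: known_def intro: trace_in_sets)

lemma known_Int: "F \<in> known D C ==> F' \<in> known D C ==> F \<inter> F' \<in> known D C"
  by (auto simp: known_def intro: trace_in_Int)

lemma known_Diff:
  assumes F: "F \<in> known D C" "F' \<in> known D C" and D: "\<And>i. space (D i) = space M" "\<And>i. C i \<subseteq> space M"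
  shows "F - F' \<in> known D C"
proof -
  have "F \<subseteq> space M" using F(1) sets.sets_into_space by (auto simp: known_def)
  then have "F - F' = F \<inter> (space M - F')" by auto
  moreover have "space M - F' \<in> known D C"
    using F(2) trace_in_compl[of "D i" "C i" F' for i] D by (auto simp: known_def)
  ultimately show ?thesis using known_Int[OF F(1)] by simp
qed

lemma known_UN: "countable I ==> (\<And>i. i \<in> I ==> F i \<in> known D C) ==> (\<Union>i\<in>I. F i) \<in> known D C"
  by (auto simp: known_def intro!: trace_in_UN sets.countable_UN'')

end

section \<open>Good paths\<close>

lemma (in prob_space) AE_exponential_pos:
  assumes X: "distributed M lborel X (exponential_density l)" and l: "0 < l"
  shows "AE w in M. 0 < X w"
proof (rule AE_I)
  have [measurable]: "X \<in> borel_measurable M" using distributed_measurable[OF X] by simp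
  show "{w\<in>space M. \<not> 0 < X w} \<subseteq> {w\<in>space M. X w \<le> 0}" by auto
  show "emeasure M {w\<in>space M. X w \<le> 0} = 0"
    using exponential_distributedD_le[OF X order.refl l] by (simp add: emeasure_eq_measure)
  show "{w\<in>space M. X w \<le> 0} \<in> events" by measurable
qed

lemma (in prob_space) AE_exponential_sum_unbounded:
  fixes X :: "nat => 'a => real"
  assumes X: "\<And>i. distributed M lborel (X i) (exponential_density l)" and l: "0 < l"
    and ind: "indep_vars (\<lambda>_. borel) X UNIV"
  shows "AE w in M. \<forall>x. \<exists>m. x < (\<Sum>i\<le>m. X i w)"
proof -
  have [measurable]: "X i \<in> borel_measurable M" for i using distributed_measurable[OF X] by simp
  have bnd: "prob {w\<in>space M. (\<Sum>i\<le>m. X i w) \<le> x} \<le> exp (l * x) * (1 / 2) ^ Suc m" for m x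
  proof -
    have "prob {w\<in>space M. l * (\<Sum>i\<in>{..m}. X i w) \<le> l * x} \<le> exp (l * x) * (l / (l + l)) ^ card {..m}"
      by (rule exponential_sum_chernoff[OF l _ _ X indep_vars_subset[OF ind]]) (use l in auto)
    then show ?thesis using l by simp
  qed
  have "AE w in M. \<exists>m. real x < (\<Sum>i\<le>m. X i w)" for x :: nat
  proof (rule AE_I)
    let ?B = "{w\<in>space M. \<forall>m. (\<Sum>i\<le>m. X i w) \<le> real x}"
    show "{w\<in>space M. \<not> (\<exists>m. real x < (\<Sum>i\<le>m. X i w))} \<subseteq> ?B" by (auto simp: not_less)
    show B: "?B \<in> events" by measurable
    have le: "prob ?B \<le> exp (l * real x) * (1 / 2) ^ Suc m" for m
    proof -
      have "prob ?B \<le> prob {w\<in>space M. (\<Sum>i\<le>m. X i w) \<le> real x}"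
        by (intro finite_measure_mono) auto
      then show ?thesis using bnd[of m "real x"] by linarith
    qed
    have lim: "(\<lambda>m. exp (l * real x) * (1 / 2) ^ Suc m) \<longlonglongrightarrow> exp (l * real x) * 0"
      by (intro tendsto_mult tendsto_const LIMSEQ_Suc LIMSEQ_realpow_zero) auto
    have "prob ?B \<le> exp (l * real x) * 0" by (rule LIMSEQ_le_const[OF lim]) (use le in blast)
    then show "emeasure M ?B = 0" by (simp add: emeasure_eq_measure measure_le_0_iff)
  qed
  then have "AE w in M. \<forall>x::nat. \<exists>m. real x < (\<Sum>i\<le>m. X i w)" by (simp add: AE_all_countable)
  then show ?thesis
  proof eventually_elim
    case (elim w)
    show ?case
    proof
      fix x
      obtain N where "x \<le> real N" using real_arch_simple by blast
      then show "\<exists>m. x < (\<Sum>i\<le>m. X i w)" using elim by (meson order.strict_trans1)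
    qed
  qed
qed

context nbrw_pod_system
begin

lemma sources_indep_vars:
  assumes "inj_on f I" "f ` I \<subseteq> \<S>"
    and "\<And>i. i \<in> I ==> source_algebra M E S W U (f i) = vimage_algebra (space M) (X i) borel"
    and "\<And>i. i \<in> I ==> X i \<in> borel_measurable M"
  shows "indep_vars (\<lambda>_. borel :: real measure) X I"
  unfolding indep_vars_def2
proof (intro conjI ballI)
  have "indep_sets (\<lambda>i. sets (source_algebra M E S W U (f i))) I"
    by (rule indep_sets_inj[OF independent_sources assms(1,2)])
  then show "indep_sets (\<lambda>i. {X i -` A \<inter> space M | A. A \<in> sets borel}) I"
  proof (rule indep_sets_mono_sets)
    fix i assume "i \<in> I"
    then show "{X i -` A \<inter> space M | A. A \<in> sets borel} \<subseteq> sets (source_algebra M E S W U (f i))"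
      using in_vimage_algebra[of _ borel "X i" "space M"] assms(3)[of i] by auto
  qed
qed (use assms in auto)

lemma indep_E: "indep_vars (\<lambda>_. borel) E UNIV"
  by (rule sources_indep_vars[of Interarrival]) (auto simp: source_algebra_def inj_on_def)

lemma indep_S: "v \<in> {1..n} ==> indep_vars (\<lambda>_. borel) (S v) UNIV"
  by (rule sources_indep_vars[of "Service v"]) (auto simp: source_algebra_def inj_on_def S_measurable)

text \<open>The Markov property of one walker, given everything that the other sources produce.\<close>

definition "wpath l j w = map (\<lambda>i. W l i w) [0..<Suc j]"

lemma wpath_eq: "length xs = Suc j ==> wpath l j w = xs \<longleftrightarrow> (\<forall>i\<le>j. W l i w = xs ! i)"
  unfolding wpath_def by (auto simp: list_eq_iff_nth_eq less_Suc_eq_le simp del: upt_Suc)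

lemma wpath_src: "Walker l \<in> X ==> {w\<in>space M. \<forall>i\<le>j. W l i w = e i} \<in> sets (src X)"
proof -
  assume X: "Walker l \<in> X"
  have [measurable]: "W l i \<in> measurable (src X) (count_space UNIV)" for i by (rule W_measurable_src[OF X])
  have "{w\<in>space (src X). \<forall>i\<le>j. W l i w = e i} \<in> sets (src X)" by measurable
  then show ?thesis unfolding space_src .
qed

lemma wpath_events:
  assumes "l < d" shows "{w\<in>space M. wpath l j w = xs} \<in> events"
proof (cases "length xs = Suc j")
  case True
  have [measurable]: "W l i \<in> measurable M (count_space UNIV)" for i by (rule W_measurable[OF assms])
  show ?thesis unfolding wpath_eq[OF True] by measurable
next
  case False
  then have e: "{w\<in>space M. wpath l j w = xs} = {}" by (auto simp: wpath_def simp del: upt_Suc)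
  show ?thesis unfolding e by simp
qed

lemma wpath_cells:
  assumes l: "l < d" and A: "A \<in> events" and B: "B \<in> events" and q: "0 \<le> q"
    and le: "\<And>xs. length xs = Suc j ==> prob (A \<inter> {w\<in>space M. wpath l j w = xs}) \<le> q * prob (B \<inter> {w\<in>space M. wpath l j w = xs})"
  shows "prob A \<le> q * prob B"
proof (rule prob_cells_le[where I = "{xs. length xs = Suc j}" and C = "\<lambda>xs. {w\<in>space M. wpath l j w = xs}", OF _ _ wpath_events[OF l] A _ B q le])
  show "A \<subseteq> (\<Union>xs\<in>{xs. length xs = Suc j}. {w\<in>space M. wpath l j w = xs})"
    using sets.sets_into_space[OF A] by (auto simp: wpath_def)
qed (auto simp: disjoint_family_on_def)

text \<open>Independence of the walker from the other sources turns its Markov property into one that holds jointly with them.\<close>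

lemma walker_step_path:
  assumes l: "l < d" and X: "X \<in> sets (src (\<S> - {Walker l}))" and xs: "length xs = Suc j"
  shows "prob (X \<inter> {w\<in>space M. wpath l j w = xs \<and> W l (Suc j) w = e'})
     = pmf (nb_step G (xs ! j)) e' * prob (X \<inter> {w\<in>space M. wpath l j w = xs})"
proof -
  define e where "e = (\<lambda>i. (xs @ [e']) ! i)"
  have e: "e i = xs ! i" if "i \<le> j" for i using that xs by (simp add: e_def nth_append)
  have e': "e (Suc j) = e'" using xs by (simp add: e_def nth_append)
  have eq1: "{w\<in>space M. wpath l j w = xs \<and> W l (Suc j) w = e'} = {w\<in>space M. \<forall>i\<le>Suc j. W l i w = e i}"
    unfolding wpath_eq[OF xs] using e e' by (auto simp: le_Suc_eq)
  have eq2: "{w\<in>space M. wpath l j w = xs} = {w\<in>space M. \<forall>i\<le>j. W l i w = e i}"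
    unfolding wpath_eq[OF xs] using e by auto
  have ind: "prob (X \<inter> {w\<in>space M. \<forall>i\<le>m. W l i w = e i}) = prob X * prob {w\<in>space M. \<forall>i\<le>m. W l i w = e i}" for m
    by (rule src_indep[OF _ _ _ X wpath_src[of l "{Walker l}"]]) (use l in auto)
  have "prob {w\<in>space M. \<forall>i\<le>Suc j. W l i w = e i} =
        prob {w\<in>space M. \<forall>i\<le>j. W l i w = e i} * pmf (nb_step G (e j)) (e (Suc j))"
    using walkers[OF l] unfolding nbrw_def by blast
  then show ?thesis unfolding eq1 eq2 ind using e[of j] e' by simp
qed

end

locale pod_setup = nbrw_pod_system M lam d n G E S W U c Q
  for M :: "'a measure" and lam :: real and d n :: nat and G :: "(nat \<times> nat) set"
    and E :: "nat => 'a => real" and S :: "nat => nat => 'a => real"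
    and W :: "nat => nat => 'a => nat \<times> nat" and U :: "'a measure"
    and c :: "nat => 'a => nat" and Q :: "nat => real => 'a => nat" +
  fixes k :: nat and q0 :: "nat => nat"
  assumes lam_pos: "0 < lam" and d_pos: "0 < d" and n_pos: "0 < n" and graph: "regular_graph n k G" and k3: "3 \<le> k"
    and initial: "\<And>v. v \<in> {1..n} ==> AE w in M. Q v 0 w = q0 v"
begin

lemma AE_W_step:
  assumes l: "l < d"
  shows "AE w in M. W l j w \<in> G \<longrightarrow> W l (Suc j) w \<in> G \<and> fst (W l (Suc j) w) = snd (W l j w) \<and> snd (W l (Suc j) w) \<noteq> fst (W l j w)"
proof -
  have [measurable]: "W l i \<in> measurable M (count_space UNIV)" for i by (rule W_measurable[OF l])
  have step: "prob {w\<in>space M. W l j w = e \<and> W l (Suc j) w = e'} \<le> pmf (nb_step G e) e' * prob {w\<in>space M. W l j w = e}" for e e'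
  proof (rule wpath_cells[OF l, of _ _ _ j])
    fix xs :: "(nat \<times> nat) list" assume xs: "length xs = Suc j"
    let ?A = "{w\<in>space M. W l j w = e \<and> W l (Suc j) w = e'}" and ?B = "{w\<in>space M. W l j w = e}"
    let ?C = "{w\<in>space M. wpath l j w = xs}"
    show "prob (?A \<inter> ?C) \<le> pmf (nb_step G e) e' * prob (?B \<inter> ?C)"
    proof (cases "xs ! j = e")
      case True
      have "?A \<inter> ?C = space M \<inter> {w\<in>space M. wpath l j w = xs \<and> W l (Suc j) w = e'}" "?B \<inter> ?C = space M \<inter> ?C"
        using wpath_eq[OF xs] True by auto
      then show ?thesis using walker_step_path[OF l _ xs, of "space M" e'] True sets.top[of "src (\<S> - {Walker l})"] by simp
    next
      case False
      then have "?A \<inter> ?C = {}" using wpath_eq[OF xs] by auto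
      then show ?thesis by simp
    qed
  qed auto
  have "AE w in M. \<not> (W l j w = e \<and> W l (Suc j) w = e')" if "pmf (nb_step G e) e' = 0" for e e'
  proof (rule AE_I[of _ _ "{w\<in>space M. W l j w = e \<and> W l (Suc j) w = e'}"])
    show "emeasure M {w\<in>space M. W l j w = e \<and> W l (Suc j) w = e'} = 0"
      using step[of e e'] that by (simp add: emeasure_eq_measure measure_le_0_iff)
  qed auto
  then have "AE w in M. \<forall>p\<in>{p. pmf (nb_step G (fst p)) (snd p) = 0}. \<not> (W l j w = fst p \<and> W l (Suc j) w = snd p)"
    by (subst AE_ball_countable) auto
  then show ?thesis
  proof eventually_elim
    case (elim w)
    show ?case
    proof
      obtain u v where e: "W l j w = (u, v)" by (cases "W l j w")
      assume "W l j w \<in> G"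
      then have uv: "(u, v) \<in> G" using e by simp
      have "card (G `` {v} - {u}) = k - 1" by (rule card_next[OF graph k3 uv])
      then have "0 < card (G `` {v} - {u})" using k3 by simp
      then have ne: "G `` {v} - {u} \<noteq> {}" "finite (G `` {v} - {u})" unfolding card_gt_0_iff by blast+
      have "pmf (nb_step G (u, v)) (W l (Suc j) w) \<noteq> 0"
        using elim[THEN bspec, of "((u, v), W l (Suc j) w)"] e by auto
      then have "W l (Suc j) w \<in> set_pmf (nb_step G (u, v))" by (simp add: set_pmf_iff)
      then show "W l (Suc j) w \<in> G \<and> fst (W l (Suc j) w) = snd (W l j w) \<and> snd (W l (Suc j) w) \<noteq> fst (W l j w)"
        using ne e by (auto simp: nb_step_def set_pmf_of_set)
    qed
  qed
qed

text \<open>The properties that hold along almost every realisation. The rest of the argument on one path is deterministic.\<close>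

definition "good w \<longleftrightarrow> queue_path n d (\<lambda>j. T j w) (\<lambda>j. c j w) q0 (\<lambda>v m. S v m w) (\<lambda>v t. Q v t w) (\<lambda>l j. snd (W l j w))
  \<and> (\<forall>l<d. \<forall>j. W l j w \<in> G \<and> fst (W l (Suc j) w) = snd (W l j w) \<and> snd (W l (Suc j) w) \<noteq> fst (W l j w))"

lemma AE_good: "AE w in M. good w"
proof -
  have ln: "0 < lam * real n" using lam_pos n_pos by simp
  have a1: "AE w in M. \<forall>j. 0 < E j w"
    using AE_exponential_pos[OF interarrival_distributed ln] by (simp add: AE_all_countable)
  have a2: "AE w in M. \<forall>x. \<exists>m. x < T m w"
    unfolding arrival_time_def by (rule AE_exponential_sum_unbounded[OF interarrival_distributed ln indep_E])
  have a3: "AE w in M. \<forall>v\<in>{1..n}. \<forall>m. 0 < S v m w"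
  proof -
    have "AE w in M. 0 < S v m w" if "v \<in> {1..n}" for v m
      by (rule AE_exponential_pos[OF service_distributed[OF that]]) simp
    then show ?thesis by (simp add: AE_ball_countable AE_all_countable del: atLeastAtMost_iff)
  qed
  have a4: "AE w in M. \<forall>v\<in>{1..n}. \<forall>x. \<exists>m. x < (\<Sum>i\<le>m. S v i w)"
  proof -
    have "AE w in M. \<forall>x. \<exists>m. x < (\<Sum>i\<le>m. S v i w)" if "v \<in> {1..n}" for v
      by (rule AE_exponential_sum_unbounded[OF service_distributed[OF that] _ indep_S[OF that]]) simp
    then show ?thesis by (simp add: AE_ball_countable del: atLeastAtMost_iff)
  qed
  have a5: "AE w in M. \<forall>l\<in>{..<d}. W l 0 w \<in> G"
    using walkers by (auto simp: AE_ball_countable nbrw_def)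
  have a6: "AE w in M. \<forall>l\<in>{..<d}. \<forall>j. W l j w \<in> G \<longrightarrow> W l (Suc j) w \<in> G \<and> fst (W l (Suc j) w) = snd (W l j w) \<and> snd (W l (Suc j) w) \<noteq> fst (W l j w)"
    using AE_W_step by (simp add: AE_ball_countable AE_all_countable del: lessThan_iff) (simp)
  have a7: "AE w in M. \<forall>v\<in>{1..n}. Q v 0 w = q0 v"
    using initial by (simp add: AE_ball_countable del: atLeastAtMost_iff)
  show ?thesis using a1 a2 a3 a4 a5 a6 a7 joins_shortest queue_dynamics
  proof eventually_elim
    case (elim w)
    have WG: "W l j w \<in> G" if "l < d" for l j
      using that elim(5,6) by (induction j) auto
    have "queue_path n d (\<lambda>j. T j w) (\<lambda>j. c j w) q0 (\<lambda>v m. S v m w) (\<lambda>v t. Q v t w) (\<lambda>l j. snd (W l j w))"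
    proof
      show "0 < T j w" for j unfolding arrival_time_def using elim(1) by (intro sum_pos) auto
      show "strict_mono (\<lambda>j. T j w)"
        using elim(1) by (simp add: strict_mono_Suc_iff arrival_time_def)
      show "\<exists>j. x < T j w" for x using elim(2) by blast
      show "snd (W l j w) \<in> {1..n}" if "l < d" for l j
        using WG[OF that, of j] graph by (cases "W l j w") (auto simp: regular_graph_def)
      show "Q v t w + card {m. (\<Sum>i\<le>m. S v i w) \<le> measure lborel {s \<in> {0..t}. 0 < Q v s w}} =
          q0 v + card {j. T j w \<le> t \<and> c j w = v}" if "v \<in> {1..n}" "0 \<le> t" for v t
        using elim(9) elim(7) that by (auto simp: departed_def busy_time_def joined_def)
    qed (use elim in auto)
    then show ?case using WG elim(6) by (auto simp: good_def)
  qed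
qed

text \<open>A measurable set of full measure with good paths only. Working inside it frees every later statement from null sets.\<close>

definition "Om = (SOME X. X \<in> events \<and> prob X = 1 \<and> (\<forall>w\<in>X. good w))"

lemma Om: "Om \<in> events" "prob Om = 1" "w \<in> Om ==> good w"
proof -
  obtain N where N: "{w\<in>space M. \<not> good w} \<subseteq> N" "emeasure M N = 0" "N \<in> events"
    using AE_E[OF AE_good] by blast
  have "space M - N \<in> events \<and> prob (space M - N) = 1 \<and> (\<forall>w\<in>space M - N. good w)"
    using N by (auto simp: prob_compl emeasure_eq_measure)
  then have "Om \<in> events \<and> prob Om = 1 \<and> (\<forall>w\<in>Om. good w)" unfolding Om_def by (rule someI)
  then show "Om \<in> events" "prob Om = 1" "w \<in> Om ==> good w" by auto
qed

lemma Om_space: "w \<in> Om ==> w \<in> space M"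
  using sets.sets_into_space[OF Om(1)] by auto

lemma prob_Om: assumes "F \<in> events" shows "prob (F \<inter> Om) = prob F"
proof -
  have "prob (F - Om) \<le> prob (space M - Om)" using sets.sets_into_space[OF assms] Om(1) by (intro finite_measure_mono) auto
  also have "... = 0" using Om by (simp add: prob_compl)
  finally have z: "prob (F - Om) = 0" by (simp add: measure_le_0_iff)
  have "prob F = prob (F \<inter> Om) + prob (F - Om)"
    using finite_measure_Union[of "F \<inter> Om" "F - Om"] assms Om(1) by (simp add: Int_Diff_Un Int_Diff Diff_Int_distrib)
  then show ?thesis using z by simp
qed

end

context pod_setup
begin

section \<open>What the history reveals\<close>

lemma svc_start_measurable:
  assumes "\<And>j. T j \<in> borel_measurable D" "\<And>i. i < r ==> S v i \<in> borel_measurable D"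
  shows "(\<lambda>w. svc_start (job_arrival (\<lambda>j. T j w) q ks v) (\<lambda>i. S v i w) r) \<in> borel_measurable D"
  using assms(2)
proof (induction r)
  case 0
  have [measurable]: "T j \<in> borel_measurable D" for j by (rule assms(1))
  show ?case by (cases "0 < q") (simp_all add: job_arrival_def)
next
  case (Suc r)
  have [measurable]: "T j \<in> borel_measurable D" for j by (rule assms(1))
  have [measurable]: "S v r \<in> borel_measurable D" using Suc.prems by simp
  have [measurable]: "(\<lambda>w. svc_start (job_arrival (\<lambda>j. T j w) q ks v) (\<lambda>i. S v i w) r) \<in> borel_measurable D"
    using Suc by simp
  have [measurable]: "(\<lambda>w. job_arrival (\<lambda>j. T j w) q ks v (Suc r)) \<in> borel_measurable D"
    by (cases "Suc r < q") (simp_all add: job_arrival_def)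
  show ?case by simp
qed

lemma svc_end_measurable:
  assumes "\<And>j. T j \<in> borel_measurable D" "\<And>i. i \<le> r ==> S v i \<in> borel_measurable D"
  shows "(\<lambda>w. svc_end (job_arrival (\<lambda>j. T j w) q ks v) (\<lambda>i. S v i w) r) \<in> borel_measurable D"
  unfolding svc_end_def using assms by (intro borel_measurable_add svc_start_measurable) auto

lemma arrived_measurable:
  assumes "\<And>j. T j \<in> borel_measurable D"
  shows "(\<lambda>w. arrived (\<lambda>j. T j w) ks v t) \<in> measurable D (count_space UNIV)"
proof -
  have [measurable]: "T j \<in> borel_measurable D" for j by (rule assms)
  show ?thesis unfolding arrived_def by (rule measurable_card) measurable
qed

lemma completed_measurable:
  assumes "\<And>j. T j \<in> borel_measurable D" "\<And>i. S v i \<in> borel_measurable D"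
  shows "(\<lambda>w. completed (\<lambda>j. T j w) q ks v (\<lambda>i. S v i w) t) \<in> measurable D (count_space UNIV)"
proof -
  have [measurable]: "(\<lambda>w. svc_end (job_arrival (\<lambda>j. T j w) q ks v) (\<lambda>i. S v i w) r) \<in> borel_measurable D" for r
    by (rule svc_end_measurable) (use assms in auto)
  show ?thesis unfolding completed_def by (rule measurable_card) measurable
qed

abbreviation "finished v ks t w \<equiv> completed (\<lambda>j. T j w) (q0 v) ks v (\<lambda>i. S v i w) t"
abbreviation "fire ks s h v w \<equiv> fires (\<lambda>j. T j w) q0 ks (\<lambda>v m. S v m w) s h v"
abbreviation "fire2 ks s h v w \<equiv> fires_twice (\<lambda>j. T j w) q0 ks (\<lambda>v m. S v m w) s h v"
abbreviation "expl ks v t x w \<equiv> q0 v + arrived (\<lambda>j. T j w) ks v t = x + finished v ks t w"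

lemma Om_path: "w \<in> Om ==> queue_path n d (\<lambda>j. T j w) (\<lambda>j. c j w) q0 (\<lambda>v m. S v m w) (\<lambda>v t. Q v t w) (\<lambda>l j. snd (W l j w))"
  using Om(3) by (simp add: good_def)

lemma Q_expl:
  assumes "w \<in> Om" "v \<in> {1..n}" "0 \<le> t" "t < T j w"
  shows "Q v t w = x \<longleftrightarrow> expl (map (\<lambda>i. c i w) [0..<j]) v t x w"
  using queue_path.queue_explicit[OF Om_path[OF assms(1)] assms(2-4)] by linarith

text \<open>A choice is measurable with respect to the history, which mentions queue lengths. On a cell where the earlier choices are known these are explicit
  functions of the sources, so the choice is determined by the sources as well.\<close>

lemma choice_trace:
  assumes H: "H \<subseteq> Om" "\<And>w. w \<in> H ==> map (\<lambda>i. c i w) [0..<j] = ks"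
    and D: "space D = space M" "sets U \<subseteq> sets D" "\<And>i. E i \<in> borel_measurable D"
    and Wt: "\<And>l i e. l < d ==> i \<le> j ==> trace_in D H {w\<in>space M. W l i w = e}"
    and Qt: "\<And>v t x. v \<in> {1..n} ==> 0 \<le> t ==> trace_in D H {w\<in>space M. t < T j w \<and> expl ks v t x w}"
  shows "trace_in D H {w\<in>space M. c j w = y}"
proof (rule trace_in_sigma_sets)
  show "{w\<in>space M. c j w = y} \<in> sigma_sets (space D) (sets U \<union>
      {E i -` B \<inter> space M | i B. i \<le> j \<and> B \<in> sets borel} \<union>
      {W l i -` {e} \<inter> space M | l i e. l < d \<and> i \<le> j} \<union>
      {{w\<in>space M. s < T j w \<and> Q v s w = q} | v s q. v \<in> {1..n} \<and> 0 \<le> s})"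
  proof -
    have "c j -` {y} \<inter> space M \<in> sets (history M n d E W U Q j)"
      using measurable_sets[OF choice_nonanticipating[of j], of "{y}"] by (simp add: space_history)
    moreover have "c j -` {y} \<inter> space M = {w\<in>space M. c j w = y}" by auto
    ultimately show ?thesis unfolding history_sets D(1) by simp
  qed
  show "H \<subseteq> space D" using H(1) Om_space D(1) by auto
  fix F assume "F \<in> sets U \<union>
      {E i -` B \<inter> space M | i B. i \<le> j \<and> B \<in> sets borel} \<union>
      {W l i -` {e} \<inter> space M | l i e. l < d \<and> i \<le> j} \<union>
      {{w\<in>space M. s < T j w \<and> Q v s w = q} | v s q. v \<in> {1..n} \<and> 0 \<le> s}"
  then consider "F \<in> sets U" | i B where "F = E i -` B \<inter> space M" "i \<le> j" "B \<in> sets borel"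
    | l i e where "F = W l i -` {e} \<inter> space M" "l < d" "i \<le> j"
    | v s q where "F = {w\<in>space M. s < T j w \<and> Q v s w = q}" "v \<in> {1..n}" "0 \<le> s" by blast
  then show "trace_in D H F"
  proof cases
    case 1
    then show ?thesis using D(2) by (intro trace_in_sets) blast
  next
    case 2
    then show ?thesis using measurable_sets[OF D(3)[of i], of B] unfolding D(1) by (intro trace_in_sets) (simp only:)
  next
    case 3
    have "F = {w\<in>space M. W l i w = e}" using 3 by auto
    then show ?thesis using Wt[OF 3(2,3), of e] by (simp only:)
  next
    case 4
    have eq: "F \<inter> H = {w\<in>space M. s < T j w \<and> expl ks v s q w} \<inter> H"
    proof -
      have "(s < T j w \<and> Q v s w = q) = (s < T j w \<and> expl ks v s q w)" if "w \<in> H" for w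
        using Q_expl[of w v s j q] H that 4 by auto
      then show ?thesis unfolding 4(1) by blast
    qed
    show ?thesis unfolding trace_in_cong[OF eq] by (rule Qt[OF 4(2,3)])
  qed
qed

section \<open>Conditioning on the past of one walker\<close>

definition "others l = \<S> - {Walker l}"
definition "cellW l j xs = Om \<inter> {w. wpath l j w = xs}"

text \<open>Given the path of walker \<open>l\<close> up to step \<open>j\<close>, these events depend on the other sources only, whose future is included. So the
  next step of the walker is still free.\<close>

definition "KW l j = known (\<lambda>_. src (others l)) (cellW l j)"

lemma others_sub: "others l \<subseteq> \<S>" by (auto simp: others_def)

lemma cellW_space: "cellW l j xs \<subseteq> space M"
  using Om_space by (auto simp: cellW_def)

lemma cellW_empty: "length xs \<noteq> Suc j ==> cellW l j xs = {}"
  by (auto simp: cellW_def wpath_def simp del: upt_Suc)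

lemma trace_in_empty: "trace_in D {} F"
  unfolding trace_in_def by blast

lemma KW_I:
  assumes "F \<in> events" "\<And>xs. length xs = Suc j ==> trace_in (src (others l)) (cellW l j xs) F" shows "F \<in> KW l j"
proof -
  have "trace_in (src (others l)) (cellW l j xs) F" for xs
    by (cases "length xs = Suc j") (simp_all add: assms(2) cellW_empty trace_in_empty)
  then show ?thesis using assms(1) by (simp add: KW_def known_def)
qed

lemma KW_D: "F \<in> KW l j ==> trace_in (src (others l)) (cellW l j xs) F"
  by (auto simp: KW_def known_def)

lemma KW_events: "KW l j \<subseteq> events"
  unfolding KW_def by (rule known_events)

lemma src_KW: "F \<in> sets (src (others l)) ==> F \<in> KW l j"
  unfolding KW_def using src_events[OF others_sub[of l]] by (intro known_sets) auto

lemma KW_Int: "F \<in> KW l j ==> F' \<in> KW l j ==> F \<inter> F' \<in> KW l j"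
  unfolding KW_def by (rule known_Int)

lemma KW_Diff: "F \<in> KW l j ==> F' \<in> KW l j ==> F - F' \<in> KW l j"
  unfolding KW_def by (erule known_Diff) (simp_all only: space_src cellW_space)

lemma KW_UN: "countable I ==> (\<And>i. i \<in> I ==> F i \<in> KW l j) ==> (\<Union>i\<in>I. F i) \<in> KW l j"
  unfolding KW_def by (rule known_UN)

lemma Om_KW: "Om \<in> KW l j"
proof (rule KW_I[OF Om(1)])
  fix xs
  have "space M \<in> sets (src (others l))" using sets.top[of "src (others l)"] unfolding space_src .
  moreover have "Om \<inter> cellW l j xs = space M \<inter> cellW l j xs" using Om_space by (auto simp: cellW_def)
  ultimately show "trace_in (src (others l)) (cellW l j xs) Om" unfolding trace_in_def by blast
qed

text \<open>A random set of vertices is decided once the membership of every vertex is.\<close>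

lemma KW_set_value:
  assumes B: "B \<in> KW l j" and X: "\<And>v. v \<in> {1..n} ==> {w\<in>B. v \<in> X w} \<in> KW l j"
  shows "{w\<in>B. X w \<inter> {1..n} = b} \<in> KW l j"
proof (cases "b \<subseteq> {1..n}")
  case True
  define D where "D = (\<lambda>v. if v \<in> b then {w\<in>B. v \<in> X w} else B - {w\<in>B. v \<in> X w})"
  have DK: "D v \<in> KW l j" if "v \<in> {1..n}" for v
    unfolding D_def using X[OF that] KW_Diff[OF B X[OF that]] by simp
  have "I \<subseteq> {1..n} ==> B \<inter> (\<Inter>v\<in>I. D v) \<in> KW l j" if "finite I" for I
    using that
  proof (induction I rule: finite_induct)
    case (insert v I)
    have "D v \<inter> (B \<inter> (\<Inter>v\<in>I. D v)) \<in> KW l j"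
      by (rule KW_Int[OF DK]) (use insert in auto)
    moreover have "D v \<inter> (B \<inter> (\<Inter>v\<in>I. D v)) = B \<inter> (\<Inter>v\<in>insert v I. D v)" by blast
    ultimately show ?case by (simp only:)
  qed (simp add: B)
  then have "B \<inter> (\<Inter>v\<in>{1..n}. D v) \<in> KW l j" by simp
  moreover have "w \<in> B \<inter> (\<Inter>v\<in>{1..n}. D v) \<longleftrightarrow> w \<in> {w\<in>B. X w \<inter> {1..n} = b}" for w
  proof -
    have "w \<in> B ==> w \<in> D v \<longleftrightarrow> (v \<in> X w \<longleftrightarrow> v \<in> b)" for v by (simp add: D_def)
    then show ?thesis using True by blast
  qed
  ultimately show ?thesis by (metis (no_types, lifting) subset_antisym subsetI)
next
  case False
  then have "{w\<in>B. X w \<inter> {1..n} = b} = {}" by blast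
  then show ?thesis using src_KW[OF sets.empty_sets] by (metis (no_types))
qed

lemma KW_W:
  assumes "i \<le> j" "l < d" shows "{w\<in>space M. W l i w \<in> A} \<in> KW l j"
proof -
  have tr: "trace_in (src (others l)) (cellW l j xs) {w\<in>space M. W l i w \<in> A}" if "length xs = Suc j" for xs
  proof -
    have "W l i w = xs ! i" if "w \<in> cellW l j xs" for w
      using wpath_eq[OF \<open>length xs = Suc j\<close>, of l w] that assms by (auto simp: cellW_def)
    then have "{w\<in>space M. W l i w \<in> A} \<inter> cellW l j xs = (if xs ! i \<in> A then space M else {}) \<inter> cellW l j xs"
      using cellW_space by auto
    moreover have "(if xs ! i \<in> A then space M else {}) \<in> sets (src (others l))"
      using sets.top[of "src (others l)"] by (metis sets.empty_sets space_src)
    ultimately show ?thesis unfolding trace_in_def by blast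
  qed
  have ev: "{w\<in>space M. W l i w \<in> A} \<in> events"
    using measurable_sets[OF W_measurable[OF assms(2)], of A i] by (simp add: vimage_def Int_def conj_commute)
  show ?thesis by (rule KW_I[OF ev tr])
qed

lemma KW_mono: assumes "j \<le> j'" shows "KW l j \<subseteq> KW l j'"
proof
  fix F assume F: "F \<in> KW l j"
  show "F \<in> KW l j'"
  proof (rule KW_I)
    show "F \<in> events" using F KW_events by blast
    show "trace_in (src (others l)) (cellW l j' xs) F" for xs
      by (rule trace_in_mono[OF KW_D[OF F, of "take (Suc j) xs"]])
        (use assms in \<open>auto simp: cellW_def wpath_def take_map simp del: upt_Suc\<close>)
  qed
qed

text \<open>Sum \<open>walker_step_path\<close> over the possible pasts of the walker.\<close>

lemma KW_step:
  assumes l: "l < d" and F: "F \<in> KW l j"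
  shows "prob (F \<inter> {w\<in>space M. W l j w = e \<and> W l (Suc j) w = e'}) \<le> pmf (nb_step G e) e' * prob (F \<inter> {w\<in>space M. W l j w = e})"
proof (rule wpath_cells[OF l, of _ _ _ j])
  have [measurable]: "W l i \<in> measurable M (count_space UNIV)" for i by (rule W_measurable[OF l])
  have Fev: "F \<in> events" using F KW_events by auto
  let ?A = "{w\<in>space M. W l j w = e \<and> W l (Suc j) w = e'}" and ?B = "{w\<in>space M. W l j w = e}"
  have A: "?A \<in> events" "?B \<in> events" by measurable
  show "F \<inter> ?A \<in> events" "F \<inter> ?B \<in> events" using Fev A by auto
  fix xs :: "(nat \<times> nat) list" assume xs: "length xs = Suc j"
  let ?C = "{w\<in>space M. wpath l j w = xs}"
  let ?A' = "{w\<in>space M. wpath l j w = xs \<and> W l (Suc j) w = e'}"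
  have C: "?C \<in> events" by (rule wpath_events[OF l])
  show "prob (F \<inter> ?A \<inter> ?C) \<le> pmf (nb_step G e) e' * prob (F \<inter> ?B \<inter> ?C)"
  proof (cases "xs ! j = e")
    case True
    obtain X where X: "X \<in> sets (src (others l))" "F \<inter> cellW l j xs = X \<inter> cellW l j xs"
      using KW_D[OF F, of xs] by (auto simp: trace_in_def)
    have Xev: "X \<in> events" using X(1) src_events[OF others_sub[of l]] by auto
    have A': "?A' \<in> events" using C wpath_eq[OF xs, of l] by measurable
    have "prob (F \<inter> ?A \<inter> ?C) = prob (F \<inter> ?A \<inter> ?C \<inter> Om)" using Fev A C by (intro prob_Om[symmetric]) auto
    also have "F \<inter> ?A \<inter> ?C \<inter> Om = X \<inter> ?A' \<inter> Om"
      using X(2) wpath_eq[OF xs] True by (auto simp: cellW_def)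
    also have "prob ... = prob (X \<inter> ?A')" using Xev A' by (intro prob_Om) auto
    also have "... = pmf (nb_step G e) e' * prob (X \<inter> ?C)"
      using walker_step_path[OF l X(1)[unfolded others_def] xs] True by simp
    also have "prob (X \<inter> ?C) = prob (X \<inter> ?C \<inter> Om)" using Xev C by (intro prob_Om[symmetric]) auto
    also have "X \<inter> ?C \<inter> Om = F \<inter> ?B \<inter> ?C \<inter> Om"
      using X(2) wpath_eq[OF xs] True by (auto simp: cellW_def)
    also have "prob ... = prob (F \<inter> ?B \<inter> ?C)" using Fev A C by (intro prob_Om) auto
    finally show ?thesis by simp
  next
    case False
    then have "F \<inter> ?A \<inter> ?C = {}" using wpath_eq[OF xs] by auto
    then show ?thesis by simp
  qed
qed simp

lemma prob_split_edges:
  assumes l: "l < d" and F: "F \<in> events"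
  shows "prob F = (\<Sum>e\<in>G. prob (F \<inter> {w\<in>space M. W l j w = e}))"
proof -
  have [measurable]: "W l i \<in> measurable M (count_space UNIV)" for i by (rule W_measurable[OF l])
  have ev: "F \<inter> {w\<in>space M. W l j w = e} \<in> events" for e using F by measurable
  have "prob F = prob (F \<inter> Om)" using prob_Om[OF F] by simp
  also have "... \<le> prob (\<Union>e\<in>G. F \<inter> {w\<in>space M. W l j w = e})"
  proof (rule finite_measure_mono)
    show "F \<inter> Om \<subseteq> (\<Union>e\<in>G. F \<inter> {w\<in>space M. W l j w = e})"
      using Om(3) Om_space l by (auto simp: good_def)
  qed (intro sets.finite_UN finG[OF graph k3] ev)
  finally have le: "prob F \<le> prob (\<Union>e\<in>G. F \<inter> {w\<in>space M. W l j w = e})" .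
  have "prob (\<Union>e\<in>G. F \<inter> {w\<in>space M. W l j w = e}) \<le> prob F"
    by (rule finite_measure_mono[OF _ F]) blast
  with le have "prob F = prob (\<Union>e\<in>G. F \<inter> {w\<in>space M. W l j w = e})" by simp
  also have "... = (\<Sum>e\<in>G. prob (F \<inter> {w\<in>space M. W l j w = e}))"
    using ev finG[OF graph k3] by (intro finite_measure_finite_Union) (auto simp: disjoint_family_on_def)
  finally show ?thesis .
qed

lemma nb_op_pmf:
  assumes "e \<in> G" shows "nb_op G g e = (\<Sum>e'\<in>G. pmf (nb_step G e) e' * g e')"
proof -
  obtain u v where e: "e = (u, v)" by (cases e)
  have uv: "(u, v) \<in> G" using assms e by simp
  let ?A = "G `` {v} - {u}"
  have "0 < card ?A" using card_next[OF graph k3 uv] k3 by simp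
  then have A: "?A \<noteq> {}" "finite ?A" unfolding card_gt_0_iff by blast+
  have pm: "pmf (nb_step G (u, v)) e' = of_bool (fst e' = v \<and> snd e' \<in> ?A) / real (card ?A)" for e'
  proof (cases "fst e' = v")
    case True
    then have "e' = (v, snd e')" by (cases e') auto
    then have "pmf (nb_step G (u, v)) e' = pmf (pmf_of_set ?A) (snd e')"
      unfolding nb_step_def by (metis fst_conv inj_on_def pmf_map_inj' prod.inject snd_conv)
    then show ?thesis using True A by (simp add: indicator_def)
  next
    case False
    then have "e' \<notin> set_pmf (nb_step G (u, v))" by (auto simp: nb_step_def)
    then show ?thesis using False by (simp add: set_pmf_iff)
  qed
  have "(\<Sum>e'\<in>G. pmf (nb_step G e) e' * g e') = (\<Sum>e'\<in>Pair v ` ?A. g e' / real (card ?A))"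
    unfolding e pm
    by (rule sum.mono_neutral_cong_right) (use finG[OF graph k3] in \<open>auto simp: image_iff\<close>)
  also have "... = (\<Sum>w\<in>?A. g (v, w) / real (card ?A))" by (subst sum.reindex) (auto simp: inj_on_def)
  finally show ?thesis by (simp add: nb_op_def e sum_divide_distrib)
qed

lemma KW_expect:
  assumes l: "l < d" and F: "F \<in> KW l j" and g: "\<And>e. 0 \<le> g e"
  shows "(\<Sum>e\<in>G. prob (F \<inter> {w\<in>space M. W l (j + r) w = e}) * g e)
    \<le> (\<Sum>e\<in>G. prob (F \<inter> {w\<in>space M. W l j w = e}) * (nb_op G ^^ r) g e)"
  using g
proof (induction r arbitrary: g)
  case (Suc r)
  have [measurable]: "W l i \<in> measurable M (count_space UNIV)" for i by (rule W_measurable[OF l])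
  have Fr: "F \<in> KW l (j + r)" using F KW_mono[of j "j + r"] by auto
  have Fev: "F \<in> events" using F KW_events by auto
  have "prob (F \<inter> {w\<in>space M. W l (Suc (j + r)) w = e'}) \<le>
      (\<Sum>e\<in>G. pmf (nb_step G e) e' * prob (F \<inter> {w\<in>space M. W l (j + r) w = e}))" for e'
  proof -
    have ev: "F \<inter> {w\<in>space M. W l (Suc (j + r)) w = e'} \<in> events" using Fev by measurable
    have e: "F \<inter> {w\<in>space M. W l (Suc (j + r)) w = e'} \<inter> {w\<in>space M. W l (j + r) w = e}
      = F \<inter> {w\<in>space M. W l (j + r) w = e \<and> W l (Suc (j + r)) w = e'}" for e by auto
    show ?thesis unfolding prob_split_edges[OF l ev, of "j + r"] e by (intro sum_mono KW_step[OF l Fr])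
  qed
  then have "(\<Sum>e'\<in>G. prob (F \<inter> {w\<in>space M. W l (j + Suc r) w = e'}) * g e') \<le>
    (\<Sum>e'\<in>G. (\<Sum>e\<in>G. pmf (nb_step G e) e' * prob (F \<inter> {w\<in>space M. W l (j + r) w = e})) * g e')"
    using Suc.prems by (intro sum_mono mult_right_mono) auto
  also have "... = (\<Sum>e'\<in>G. \<Sum>e\<in>G. prob (F \<inter> {w\<in>space M. W l (j + r) w = e}) * (pmf (nb_step G e) e' * g e'))"
    by (simp add: sum_distrib_right sum_distrib_left mult_ac)
  also have "... = (\<Sum>e\<in>G. prob (F \<inter> {w\<in>space M. W l (j + r) w = e}) * nb_op G g e)"
    by (subst sum.swap) (simp add: sum_distrib_left nb_op_pmf)
  also have "... \<le> (\<Sum>e\<in>G. prob (F \<inter> {w\<in>space M. W l j w = e}) * (nb_op G ^^ r) (nb_op G g) e)"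
    by (rule Suc.IH) (use Suc.prems in \<open>auto simp: nb_op_def intro!: divide_nonneg_nonneg sum_nonneg split: prod.split\<close>)
  finally show ?case by (simp add: funpow_swap1)
qed simp

lemma KW_hit_le:
  assumes l: "l < d" and F: "F \<in> KW l j"
    and p: "\<And>e. e \<in> G ==> (nb_op G ^^ r) (\<lambda>e. of_bool (snd e \<in> B)) e \<le> p"
  shows "prob (F \<inter> {w\<in>space M. snd (W l (j + r) w) \<in> B}) \<le> p * prob F"
proof -
  have [measurable]: "W l i \<in> measurable M (count_space UNIV)" for i by (rule W_measurable[OF l])
  have Fev: "F \<in> events" using F KW_events by auto
  have "F \<inter> {w\<in>space M. snd (W l (j + r) w) \<in> B} \<in> events" using Fev by measurable
  from prob_split_edges[OF l this, of "j + r"]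
  have "prob (F \<inter> {w\<in>space M. snd (W l (j + r) w) \<in> B}) =
    (\<Sum>e\<in>G. prob (F \<inter> {w\<in>space M. snd (W l (j + r) w) \<in> B} \<inter> {w\<in>space M. W l (j + r) w = e}))" .
  also have "... = (\<Sum>e\<in>G. prob (F \<inter> {w\<in>space M. W l (j + r) w = e}) * of_bool (snd e \<in> B))"
  proof (intro sum.cong refl)
    fix e
    have "F \<inter> {w\<in>space M. snd (W l (j + r) w) \<in> B} \<inter> {w\<in>space M. W l (j + r) w = e}
      = (if snd e \<in> B then F \<inter> {w\<in>space M. W l (j + r) w = e} else {})" by auto
    then show "prob (F \<inter> {w\<in>space M. snd (W l (j + r) w) \<in> B} \<inter> {w\<in>space M. W l (j + r) w = e})
      = prob (F \<inter> {w\<in>space M. W l (j + r) w = e}) * of_bool (snd e \<in> B)" by simp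
  qed
  also have "... \<le> (\<Sum>e\<in>G. prob (F \<inter> {w\<in>space M. W l j w = e}) * (nb_op G ^^ r) (\<lambda>e. of_bool (snd e \<in> B)) e)"
    by (rule KW_expect[OF l F]) simp
  also have "... \<le> (\<Sum>e\<in>G. prob (F \<inter> {w\<in>space M. W l j w = e}) * p)"
    by (intro sum_mono mult_left_mono p) auto
  also have "... = p * prob F"
    unfolding prob_split_edges[OF l Fev, of j] by (simp add: sum_distrib_left mult.commute)
  finally show ?thesis .
qed

abbreviation "hlist j w \<equiv> map (\<lambda>i. c i w) [0..<j]"

lemma hlist_events: "{w\<in>space M. hlist j w = ks} \<in> events"
proof (cases "length ks = j")
  case True
  then have "{w\<in>space M. hlist j w = ks} = {w\<in>space M. \<forall>i<j. c i w = ks ! i}"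
    by (auto simp: list_eq_iff_nth_eq)
  also have "... \<in> events" by measurable
  finally show ?thesis .
next
  case False
  then have "{w\<in>space M. hlist j w = ks} = {}" by auto
  then show ?thesis by (simp only: sets.empty_sets)
qed

lemma inter_range: "range Interarrival \<subseteq> others l"
  by (auto simp: others_def)

lemma T_others: "T j \<in> borel_measurable (src (others l))"
  by (rule T_measurable_src[OF inter_range])

lemma expl_sets:
  fixes a b :: "'a => nat"
  assumes "a \<in> measurable D (count_space UNIV)" "b \<in> measurable D (count_space UNIV)"
  shows "{w\<in>space D. q + a w = x + b w} \<in> sets D"
proof -
  have "{w\<in>space D. q + a w = x + b w} = (\<Union>m. (a -` {m} \<inter> space D) \<inter> (b -` {y. q + m = x + y} \<inter> space D))" by auto
  also have "... \<in> sets D"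
    by (intro sets.countable_UN'' sets.Int measurable_sets[OF assms(1)] measurable_sets[OF assms(2)]) auto
  finally show ?thesis .
qed

lemma expl_others:
  assumes "v \<in> {1..n}" shows "{w\<in>space M. expl ks v t x w} \<in> sets (src (others l))"
proof -
  have Sv: "S v i \<in> borel_measurable (src (others l))" for i
    using assms by (intro S_measurable_src) (auto simp: others_def)
  show ?thesis
    using expl_sets[OF arrived_measurable[OF T_others] completed_measurable[OF T_others Sv]] unfolding space_src .
qed

text \<open>The choices of the servers enter one after the other, each determined by what precedes it.\<close>

lemma hlist_trace:
  fixes ks :: "nat list"
  assumes B: "\<And>i. B i \<subseteq> Om" "\<And>i. Suc i \<le> length ks ==> B (Suc i) \<subseteq> B i"
    and D: "space D = space M" "sets U \<subseteq> sets D" "\<And>i. E i \<in> borel_measurable D"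
    and Wt: "\<And>i l i' e. i < length ks ==> l < d ==> i' \<le> i ==> trace_in D (B i) {w\<in>space M. W l i' w = e}"
    and Qt: "\<And>i v t x. i < length ks ==> v \<in> {1..n} ==> 0 \<le> t ==> trace_in D (B i) {w\<in>space M. t < T i w \<and> expl (take i ks) v t x w}"
  shows "j \<le> length ks ==> trace_in D (B j) {w\<in>space M. hlist j w = take j ks}"
proof (induction j)
  case 0
  have "{w\<in>space M. hlist 0 w = take 0 ks} = space D" unfolding D(1) by auto
  then show ?case by (intro trace_in_sets) (simp only: sets.top)
next
  case (Suc j)
  then have j: "j < length ks" by simp
  define H where "H = B j \<inter> {w\<in>space M. hlist j w = take j ks}"
  have HB: "trace_in D H F" if "trace_in D (B j) F" for F
    using that by (rule trace_in_mono) (auto simp: H_def)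
  have "trace_in D H {w\<in>space M. c j w = ks ! j}"
    by (rule choice_trace[where ks = "take j ks" and j = j, OF _ _ D HB[OF Wt[OF j]] HB[OF Qt[OF j]]])
      (use B(1)[of j] in \<open>auto simp: H_def\<close>)
  then obtain X where X: "X \<in> sets D" "{w\<in>space M. c j w = ks ! j} \<inter> H = X \<inter> H"
    by (auto simp: trace_in_def)
  obtain Y where Y: "Y \<in> sets D" "{w\<in>space M. hlist j w = take j ks} \<inter> B j = Y \<inter> B j"
    using Suc by (auto simp: trace_in_def)
  have "{w\<in>space M. hlist (Suc j) w = take (Suc j) ks} = {w\<in>space M. hlist j w = take j ks} \<inter> {w\<in>space M. c j w = ks ! j}"
    using j by (auto simp: take_Suc_conv_app_nth)
  moreover have "B (Suc j) \<subseteq> B j" by (rule B(2)) (use j in simp)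
  ultimately have "{w\<in>space M. hlist (Suc j) w = take (Suc j) ks} \<inter> B (Suc j) = (X \<inter> Y) \<inter> B (Suc j)"
    using X(2) Y(2) unfolding H_def by blast
  then show ?case unfolding trace_in_def using sets.Int[OF X(1) Y(1)] by blast
qed

lemma hlist_cellW:
  assumes l: "l < d" and j: "j \<le> Suc j0"
  shows "trace_in (src (others l)) (cellW l j0 xs) {w\<in>space M. hlist j w = ks}"
proof (cases "length ks = j")
  case True
  have "trace_in (src (others l)) (cellW l j0 xs) {w\<in>space M. hlist j w = take j ks}"
  proof (rule hlist_trace[where B = "\<lambda>_. cellW l j0 xs"])
    show "sets U \<subseteq> sets (src (others l))" using U_src[of "others l"] by (auto simp: others_def)
    show "E i \<in> borel_measurable (src (others l))" for i by (rule E_measurable_src) (auto simp: others_def)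
    fix i assume i: "i < length ks"
    show "trace_in (src (others l)) (cellW l j0 xs) {w\<in>space M. W l' i' w = e}" if l': "l' < d" and i': "i' \<le> i" for l' i' e
    proof (cases "l' = l")
      case True
      have "{w\<in>space M. W l i' w \<in> {e}} \<in> KW l j0" using i i' \<open>length ks = j\<close> j l by (intro KW_W) auto
      from KW_D[OF this, of xs] show ?thesis using True by simp
    next
      case False
      have [measurable]: "W l' i' \<in> measurable (src (others l)) (count_space UNIV)"
        using False l' by (intro W_measurable_src) (auto simp: others_def)
      have "{w\<in>space (src (others l)). W l' i' w = e} \<in> sets (src (others l))" by measurable
      then show ?thesis unfolding space_src by (rule trace_in_sets)
    qed
    fix v x and t :: real assume v: "v \<in> {1..n}"
    have [measurable]: "T i \<in> borel_measurable (src (others l))" by (rule T_others)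
    have "{w\<in>space (src (others l)). t < T i w} \<in> sets (src (others l))" by measurable
    then have "{w\<in>space M. t < T i w} \<inter> {w\<in>space M. expl (take i ks) v t x w} \<in> sets (src (others l))"
      unfolding space_src using expl_others[OF v] by (rule sets.Int)
    moreover have "{w\<in>space M. t < T i w} \<inter> {w\<in>space M. expl (take i ks) v t x w} = {w\<in>space M. t < T i w \<and> expl (take i ks) v t x w}" by auto
    ultimately show "trace_in (src (others l)) (cellW l j0 xs) {w\<in>space M. t < T i w \<and> expl (take i ks) v t x w}"
      by (intro trace_in_sets) (simp only:)
  qed (use True in \<open>auto simp: cellW_def\<close>)
  then show ?thesis using True by simp
next
  case False
  then have "{w\<in>space M. hlist j w = ks} = {}" by auto
  then show ?thesis using trace_in_sets[OF sets.empty_sets] by metis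
qed

lemma hlist_KW:
  assumes "l < d" "j \<le> Suc j0" shows "{w\<in>space M. hlist j w = ks} \<in> KW l j0"
  by (rule KW_I[OF hlist_events hlist_cellW[OF assms]])

definition "J s w = arrival_count (\<lambda>j. T j w) s"

lemma less_J: "w \<in> Om ==> i < J s w \<longleftrightarrow> T i w \<le> s"
  unfolding J_def by (rule queue_path.less_J_iff[OF Om_path])

lemma J_eq: "w \<in> Om ==> J s w = j \<longleftrightarrow> (\<forall>i<j. T i w \<le> s) \<and> s < T j w"
  using less_J[of w _ s] by (metis linorder_neqE_nat not_less not_less_iff_gr_or_eq)

text \<open>Events that depend on the state at time \<open>s\<close>. Fixing the number \<open>j0\<close> of arrivals and the list of their choices reduces them
  to events about the sources.\<close>

lemma state_KW:
  assumes l: "l < d"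
    and p: "\<And>ks. length ks = j0 ==> {w\<in>space M. p ks w} \<in> KW l j0"
  shows "{w\<in>Om. J s w = j0 \<and> p (hlist (J s w) w) w} \<in> KW l j0"
proof -
  have [measurable]: "T j \<in> borel_measurable (src (others l))" for j by (rule T_others)
  have "{w\<in>space (src (others l)). (\<forall>i<j0. T i w \<le> s) \<and> s < T j0 w} \<in> sets (src (others l))" by measurable
  then have J: "{w\<in>space M. (\<forall>i<j0. T i w \<le> s) \<and> s < T j0 w} \<in> KW l j0" unfolding space_src by (rule src_KW)
  let ?F = "\<lambda>ks. Om \<inter> {w\<in>space M. (\<forall>i<j0. T i w \<le> s) \<and> s < T j0 w} \<inter> {w\<in>space M. hlist j0 w = ks} \<inter> {w\<in>space M. p ks w}"
  have "{w\<in>Om. J s w = j0 \<and> p (hlist (J s w) w) w} = {w\<in>Om. J s w = j0 \<and> p (hlist j0 w) w}"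
    by (rule Collect_cong) metis
  also have "... = {w\<in>Om. ((\<forall>i<j0. T i w \<le> s) \<and> s < T j0 w) \<and> p (hlist j0 w) w}"
    using J_eq[of _ s j0] by blast
  also have "... = (\<Union>ks\<in>{ks. length ks = j0}. ?F ks)" using Om_space by auto
  finally have "{w\<in>Om. J s w = j0 \<and> p (hlist (J s w) w) w} = (\<Union>ks\<in>{ks. length ks = j0}. ?F ks)" .
  moreover have "(\<Union>ks\<in>{ks. length ks = j0}. ?F ks) \<in> KW l j0"
    by (intro KW_UN KW_Int Om_KW J hlist_KW[OF l] p) auto
  ultimately show ?thesis by simp
qed

lemma Q_at:
  assumes "w \<in> Om" "v \<in> {1..n}" "0 \<le> s"
  shows "Q v s w = x \<longleftrightarrow> expl (hlist (J s w) w) v s x w"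
  using Q_expl[OF assms, of "J s w"] J_eq[OF assms(1), of s "J s w"] by blast

definition "lev i s w = {v\<in>{1..n}. i \<le> Q v s w}"

lemma lev_expl:
  assumes "w \<in> Om" "0 \<le> s"
  shows "lev i s w = {v\<in>{1..n}. \<not> (\<exists>x<i. expl (hlist (J s w) w) v s x w)}"
proof -
  have "i \<le> Q v s w \<longleftrightarrow> \<not> (\<exists>x<i. expl (hlist (J s w) w) v s x w)" if "v \<in> {1..n}" for v
    using Q_at[OF assms(1) that assms(2)] by (metis not_le)
  then show ?thesis unfolding lev_def by blast
qed

lemma lev_KW:
  assumes l: "l < d" and s: "0 \<le> s"
  shows "{w\<in>Om. J s w = j0 \<and> lev i s w = A} \<in> KW l j0"
proof -
  define B where "B = {w\<in>Om. J s w = j0}"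
  have "space M \<in> KW l j0" using sets.top[of "src (others l)"] unfolding space_src by (rule src_KW)
  then have BK: "B \<in> KW l j0" using state_KW[OF l, of j0 "\<lambda>_ _. True" s] by (simp add: B_def)
  have "{w\<in>B. v \<in> lev i s w} \<in> KW l j0" if v: "v \<in> {1..n}" for v
  proof -
    have "{w\<in>Om. J s w = j0 \<and> (\<exists>x<i. expl (hlist (J s w) w) v s x w)} \<in> KW l j0"
    proof (rule state_KW[OF l])
      fix ks :: "nat list"
      have "(\<Union>x\<in>{..<i}. {w\<in>space M. expl ks v s x w}) \<in> sets (src (others l))"
        by (intro sets.finite_UN expl_others v) auto
      moreover have "{w\<in>space M. \<exists>x<i. expl ks v s x w} = (\<Union>x\<in>{..<i}. {w\<in>space M. expl ks v s x w})" by auto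
      ultimately show "{w\<in>space M. \<exists>x<i. expl ks v s x w} \<in> KW l j0" by (intro src_KW) (simp only:)
    qed
    moreover have "{w\<in>B. v \<in> lev i s w} = B - {w\<in>Om. J s w = j0 \<and> (\<exists>x<i. expl (hlist (J s w) w) v s x w)}"
      using lev_expl[OF _ s, of _ i] v by (auto simp: B_def)
    ultimately show ?thesis using KW_Diff[OF BK] by (simp only:)
  qed
  from KW_set_value[OF BK this, of A] have "{w\<in>B. lev i s w \<inter> {1..n} = A} \<in> KW l j0" .
  moreover have "lev i s w \<inter> {1..n} = lev i s w" for w by (auto simp: lev_def)
  ultimately show ?thesis by (simp add: B_def)
qed

end

context pod_setup
begin

section \<open>Occupation counts of the walkers\<close>

text \<open>Consecutive positions of the walker are dependent, but positions \<open>tau\<close> steps apart are nearly independent. So the steps are split into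
  \<open>tau\<close> residue classes, on each of which the trials are conditioned on the walk \<open>tau\<close> steps earlier. The first
  \<open>tau\<close> steps have no such past; they are the term \<open>real tau\<close>.\<close>

lemma walker_chernoff:
  fixes p eps :: real
  assumes l: "l < d" and H: "H \<in> KW l j0"
    and A: "\<And>j. j < L ==> A j \<in> KW l j0" and Z: "\<And>j. j < L ==> Z j \<in> KW l (j0 + j)"
    and p: "0 \<le> p" "p \<le> 2" and tau: "0 < tau" "tau \<le> L" and eps: "0 \<le> eps" "eps \<le> 1"
    and cond: "\<And>j F. tau \<le> j ==> j < L ==> F \<in> KW l (j0 + j - tau) ==> F \<subseteq> H \<inter> A j ==> prob (F \<inter> Z j) \<le> p * prob F"
  shows "\<exists>B\<in>events. H \<inter> {w. eps * real L + real tau < (\<Sum>j<L. of_bool (w \<in> A j) * (of_bool (w \<in> Z j) - p))} \<subseteq> B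
    \<and> prob B \<le> real tau * exp (- (eps^2 * real L / (8 * real tau))) * prob H"
proof -
  define Y where "Y = (\<lambda>w j. of_bool (w \<in> A j) * (of_bool (w \<in> Z j) - p))"
  define x where "x = eps * real L / real tau"
  define m where "m = (\<lambda>rho. (L - 1 - rho) div tau)"
  \<comment> \<open>the \<open>r\<close>th trial of class \<open>rho\<close>; \<open>Suc\<close> skips the first \<open>tau\<close> steps\<close>
  define ix where "ix = (\<lambda>rho r. rho + tau * Suc r)"
  define B where "B = (\<lambda>rho. H \<inter> {w\<in>space M. x \<le> (\<Sum>r<m rho. Y w (ix rho r))})"
  have Hev: "H \<in> events" using H KW_events by auto
  have mL: "r < m rho \<longleftrightarrow> ix rho r < L" if "rho < tau" for rho r
  proof -
    have "r < m rho \<longleftrightarrow> Suc r * tau \<le> L - 1 - rho"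
      unfolding m_def Suc_le_eq[symmetric] by (rule less_eq_div_iff_mult_less_eq[OF tau(1)])
    also have "... \<longleftrightarrow> ix rho r < L" unfolding ix_def using that tau by (auto simp: mult.commute)
    finally show ?thesis .
  qed
  have AZev: "A j \<in> events" "Z j \<in> events" if "j < L" for j using A[OF that] Z[OF that] KW_events by blast+
  have Ym: "(\<lambda>w. Y w j) \<in> borel_measurable M" if "j < L" for j
    unfolding Y_def using AZev[OF that] by (intro borel_measurable_times borel_measurable_diff borel_measurable_of_bool_mem borel_measurable_const)
  have Bev: "B rho \<in> events" if "rho < tau" for rho
  proof -
    have [measurable]: "(\<lambda>w. \<Sum>r<m rho. Y w (ix rho r)) \<in> borel_measurable M"
      using mL[OF that] by (intro borel_measurable_sum Ym) auto
    have "{w\<in>space M. x \<le> (\<Sum>r<m rho. Y w (ix rho r))} \<in> events" by measurable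
    then show ?thesis unfolding B_def using Hev by (rule sets.Int[rotated])
  qed
  have Bprob: "prob (B rho) \<le> exp (- (eps^2 * real L / (8 * real tau))) * prob H" if "rho < tau" for rho
  proof -
    have "prob (H \<inter> {w\<in>space M. x \<le> (\<Sum>r<m rho. of_bool (w \<in> A (ix rho r)) * (of_bool (w \<in> Z (ix rho r)) - p))})
        \<le> exp (- (x^2 / (8 * (real L / real tau)))) * prob H"
    proof (rule adaptive_chernoff[where K = "\<lambda>r. KW l (j0 + rho + tau * r)"])
      fix r assume r: "r < m rho"
      have K0: "KW l j0 \<subseteq> KW l (j0 + rho + tau * r)" by (rule KW_mono) simp
      show "KW l (j0 + rho + tau * r) \<subseteq> events" by (rule KW_events)
      show "A (ix rho i) \<in> KW l (j0 + rho + tau * r)" if "i \<le> r" for i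
      proof -
        have "i < m rho" using that r by simp
        then show ?thesis using A[of "ix rho i"] mL[OF \<open>rho < tau\<close>] K0 by blast
      qed
      show "Z (ix rho i) \<in> KW l (j0 + rho + tau * r)" if "i < r" for i
      proof -
        have "i < m rho" using that r by simp
        moreover have "j0 + ix rho i \<le> j0 + rho + tau * r"
          unfolding ix_def using that by (metis add.assoc add_le_mono le_refl Suc_le_eq mult_le_mono2)
        ultimately show ?thesis using Z[of "ix rho i"] mL[OF \<open>rho < tau\<close>] KW_mono[of "j0 + ix rho i" "j0 + rho + tau * r" l] by blast
      qed
      show "Z (ix rho r) \<in> events" using AZev(2) r mL[OF \<open>rho < tau\<close>] by blast
      show "H \<in> KW l (j0 + rho + tau * r)" using H K0 by blast
      show "prob (F \<inter> Z (ix rho r)) \<le> p * prob F" if "F \<in> KW l (j0 + rho + tau * r)" "F \<subseteq> H \<inter> A (ix rho r)" for F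
      proof (rule cond)
        show "tau \<le> ix rho r" by (simp add: ix_def)
        show "ix rho r < L" using r mL[OF \<open>rho < tau\<close>] by blast
        have "j0 + ix rho r - tau = j0 + rho + tau * r" by (simp add: ix_def)
        then show "F \<in> KW l (j0 + ix rho r - tau)" using that(1) by simp
      qed (rule that(2))
    next
      have "real (m rho) * real tau \<le> real (L - 1 - rho)"
        unfolding m_def of_nat_mult[symmetric] of_nat_le_iff by (rule div_times_less_eq_dividend)
      then have "real (m rho) \<le> real (L - 1 - rho) / real tau" using tau by (simp add: pos_le_divide_eq)
      also have "... \<le> real L / real tau" by (intro divide_right_mono) auto
      finally show "real (m rho) \<le> real L / real tau" .
      show "0 < real L / real tau" using tau by simp
      have "eps * (real L / real tau) \<le> 4 * (real L / real tau)" using eps by (intro mult_right_mono) auto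
      then show "x \<le> 4 * (real L / real tau)" by (simp add: x_def)
      show "0 \<le> x" using eps by (simp add: x_def)
    qed (use p Hev KW_Int KW_Diff in auto)
    also have "x^2 / (8 * (real L / real tau)) = eps^2 * real L / (8 * real tau)"
      using tau by (simp add: x_def power2_eq_square field_simps)
    finally show ?thesis by (simp add: B_def Y_def)
  qed
  have split: "(\<Sum>j\<in>{tau..<L}. Y w j) = (\<Sum>rho<tau. \<Sum>r<m rho. Y w (ix rho r))" for w
  proof -
    have "(\<Sum>j\<in>{tau..<L}. Y w j) = (\<Sum>(rho, r)\<in>Sigma {..<tau} (\<lambda>rho. {..<m rho}). Y w (ix rho r))"
    proof (rule sum.reindex_bij_witness[where j = "\<lambda>j. (j mod tau, j div tau - 1)" and i = "\<lambda>(rho, r). ix rho r"])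
      fix j assume j: "j \<in> {tau..<L}"
      have "1 \<le> j div tau" using j tau by (simp add: Suc_le_eq div_greater_zero_iff)
      then have "Suc (j div tau - 1) = j div tau" by simp
      then have e: "ix (j mod tau) (j div tau - 1) = j" unfolding ix_def by (simp only: mod_mult_div_eq)
      then show "(case (j mod tau, j div tau - 1) of (rho, r) => ix rho r) = j" by simp
      show "(j mod tau, j div tau - 1) \<in> (SIGMA rho:{..<tau}. {..<m rho})"
        using e j tau mL[of "j mod tau" "j div tau - 1"] by simp
      show "(case (j mod tau, j div tau - 1) of (rho, r) => Y w (ix rho r)) = Y w j" using e by simp
    next
      fix b assume b: "b \<in> (SIGMA rho:{..<tau}. {..<m rho})"
      have "ix rho r mod tau = rho" "ix rho r div tau = Suc r" if "rho < tau" for rho r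
        unfolding ix_def using that by (simp_all del: mult_Suc_right)
      then show "((case b of (rho, r) => ix rho r) mod tau, (case b of (rho, r) => ix rho r) div tau - 1) = b"
        using b by auto
      show "(case b of (rho, r) => ix rho r) \<in> {tau..<L}" using b mL by (auto simp: ix_def)
    qed
    then show ?thesis by (simp add: sum.Sigma)
  qed
  have sub: "H \<inter> {w. eps * real L + real tau < (\<Sum>j<L. Y w j)} \<subseteq> (\<Union>rho\<in>{..<tau}. B rho)"
  proof
    fix w assume w: "w \<in> H \<inter> {w. eps * real L + real tau < (\<Sum>j<L. Y w j)}"
    show "w \<in> (\<Union>rho\<in>{..<tau}. B rho)"
    proof (rule ccontr)
      assume "w \<notin> (\<Union>rho\<in>{..<tau}. B rho)"
      then have "\<not> x \<le> (\<Sum>r<m rho. Y w (ix rho r))" if "rho < tau" for rho using w that sets.sets_into_space[OF Hev] by (auto simp: B_def)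
      then have "(\<Sum>rho<tau. \<Sum>r<m rho. Y w (ix rho r)) \<le> (\<Sum>rho<tau. x)" by (intro sum_mono less_imp_le) (auto simp: not_le)
      also have "... = eps * real L" using tau by (simp add: x_def)
      finally have late: "(\<Sum>j\<in>{tau..<L}. Y w j) \<le> eps * real L" unfolding split .
      have "(\<Sum>j<tau. Y w j) \<le> (\<Sum>j<tau. 1)" unfolding Y_def using p by (intro sum_mono) (auto simp: of_bool_def)
      then have "(\<Sum>j<tau. Y w j) \<le> real tau" by simp
      moreover have "(\<Sum>j<L. Y w j) = (\<Sum>j<tau. Y w j) + (\<Sum>j\<in>{tau..<L}. Y w j)"
        unfolding atLeast0LessThan[symmetric] using tau by (simp add: sum.atLeastLessThan_concat)
      ultimately show False using late w by simp
    qed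
  qed
  have "prob (\<Union>rho\<in>{..<tau}. B rho) \<le> (\<Sum>rho\<in>{..<tau}. prob (B rho))"
    by (rule finite_measure_subadditive_finite) (use Bev in auto)
  also have "... \<le> (\<Sum>rho\<in>{..<tau}. exp (- (eps^2 * real L / (8 * real tau))) * prob H)"
    using Bprob by (intro sum_mono) auto
  finally show ?thesis using sub Bev unfolding Y_def by (intro bexI[of _ "\<Union>rho\<in>{..<tau}. B rho"] conjI) (auto simp: mult.assoc)
qed

lemma card_eq_sum: "finite A ==> real (card {x\<in>A. p x}) = (\<Sum>x\<in>A. of_bool (p x))"
  by (simp add: Int_def of_bool_def sum.If_cases)

text \<open>The target may be random, provided that it is decided at time \<open>j\<close>: condition on its value.\<close>

lemma KW_random_hit:
  assumes l: "l < d" and F: "F \<in> KW l j"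
    and X: "\<And>v. v \<in> {1..n} ==> {w\<in>space M. v \<in> X w} \<in> KW l j"
    and m: "\<And>w. w \<in> Om ==> card (X w \<inter> {1..n}) \<le> m"
    and p: "\<And>B e. B \<subseteq> {1..n} ==> card B \<le> m ==> e \<in> G ==> (nb_op G ^^ r) (\<lambda>e. of_bool (snd e \<in> B)) e \<le> p"
    and p0: "0 \<le> p"
  shows "prob (F \<inter> {w\<in>Om. snd (W l (j + r) w) \<in> X w}) \<le> p * prob F"
proof -
  have [measurable]: "W l i \<in> measurable M (count_space UNIV)" for i by (rule W_measurable[OF l])
  have Fev: "F \<in> events" using F KW_events by auto
  define C where "C = (\<lambda>b. {w\<in>Om. X w \<inter> {1..n} = b})"
  let ?F = "\<lambda>b. F \<inter> C b"
  have Ck: "C b \<in> KW l j" for b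
    unfolding C_def
  proof (rule KW_set_value[OF Om_KW])
    fix v assume v: "v \<in> {1..n}"
    have "{w\<in>Om. v \<in> X w} = Om \<inter> {w\<in>space M. v \<in> X w}" using Om_space by auto
    then show "{w\<in>Om. v \<in> X w} \<in> KW l j" using KW_Int[OF Om_KW X[OF v]] by (simp only:)
  qed
  have FK: "?F b \<in> KW l j" if "b \<in> Pow {1..n}" for b by (rule KW_Int[OF F Ck])
  have Fbev: "?F b \<in> events" if "b \<in> Pow {1..n}" for b using FK[OF that] KW_events by blast
  let ?P = "Pow {1..n}"
  have finP: "finite ?P" by simp
  have hit: "prob (?F b \<inter> {w\<in>space M. snd (W l (j + r) w) \<in> b}) \<le> p * prob (?F b)" if "b \<in> ?P" for b
  proof (cases "card b \<le> m")
    case True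
    show ?thesis by (rule KW_hit_le[OF l FK[OF that]]) (use p[of b] True that in auto)
  next
    case False
    have e: "C b = {}" unfolding C_def using m False that by blast
    show ?thesis unfolding e by simp
  qed
  have rng: "snd (W l i w) \<in> {1..n}" if "w \<in> Om" for i w
    using queue_path.P_range[OF Om_path[OF that] l] .
  let ?A = "\<Union>b\<in>?P. ?F b \<inter> {w\<in>space M. snd (W l (j + r) w) \<in> b}"
  have Aev: "?A \<in> events"
  proof (intro sets.finite_UN finP sets.Int[OF Fbev])
    show "{w\<in>space M. snd (W l (j + r) w) \<in> b} \<in> events" for b by measurable
  qed
  have "F \<inter> {w\<in>Om. snd (W l (j + r) w) \<in> X w} \<subseteq> ?A"
  proof
    fix w assume w: "w \<in> F \<inter> {w\<in>Om. snd (W l (j + r) w) \<in> X w}"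
    then have "w \<in> C (X w \<inter> {1..n})" unfolding C_def by blast
    then show "w \<in> ?A"
      using w rng[of w "j + r"] Om_space by (intro UN_I[of "X w \<inter> {1..n}"]) auto
  qed
  then have "prob (F \<inter> {w\<in>Om. snd (W l (j + r) w) \<in> X w}) \<le> prob ?A" by (rule finite_measure_mono[OF _ Aev])
  also have "... \<le> p * prob F"
  proof (rule prob_cells_le[where I = ?P and C = ?F])
    fix b assume b: "b \<in> ?P"
    have "?A \<inter> ?F b = ?F b \<inter> {w\<in>space M. snd (W l (j + r) w) \<in> b}" using b unfolding C_def by blast
    moreover have "F \<inter> ?F b = ?F b" by auto
    ultimately show "prob (?A \<inter> ?F b) \<le> p * prob (F \<inter> ?F b)" using hit[OF b] by simp
  qed (use Aev Fbev Fev p0 in \<open>auto simp: disjoint_family_on_def C_def intro: countable_finite\<close>)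
  finally show ?thesis .
qed

definition "cell s i j0 A = {w\<in>Om. J s w = j0 \<and> lev i s w = A}"

lemma partition_state:
  assumes s: "0 \<le> s" and B: "Bad \<subseteq> Om" and q: "0 \<le> q"
    and le: "\<And>j0 A. A \<subseteq> {1..n} ==> \<exists>B\<in>events. Bad \<inter> cell s i j0 A \<subseteq> B \<and> prob B \<le> q * prob (cell s i j0 A)"
  shows "rare q Bad"
proof (rule rare_cells[where I = "UNIV \<times> Pow {1..n}" and C = "\<lambda>a. cell s i (fst a) (snd a)"])
  show "countable ((UNIV :: nat set) \<times> Pow {1..n})" by (intro countable_SIGMA) (auto intro: countable_finite)
  have cev: "cell s i j0 A \<in> events" for j0 A
    using lev_KW[OF d_pos s] KW_events unfolding cell_def by blast
  show "cell s i (fst a) (snd a) \<in> events" for a by (rule cev)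
  show "Bad \<subseteq> (\<Union>a\<in>UNIV \<times> Pow {1..n}. cell s i (fst a) (snd a))"
    using B by (auto simp: cell_def lev_def)
  fix a assume "a \<in> (UNIV :: nat set) \<times> Pow {1..n}"
  then obtain B where B: "B \<in> events" "Bad \<inter> cell s i (fst a) (snd a) \<subseteq> B" "prob B \<le> q * prob (cell s i (fst a) (snd a))"
    using le[of "snd a" "fst a"] by auto
  have "prob (B \<inter> cell s i (fst a) (snd a)) \<le> prob B" using B(1) by (intro finite_measure_mono) auto
  then show "\<exists>B\<in>events. Bad \<inter> cell s i (fst a) (snd a) \<subseteq> B \<and> prob (B \<inter> cell s i (fst a) (snd a)) \<le> q * prob (cell s i (fst a) (snd a))"
    using B by (intro bexI[of _ B]) auto
qed (use q in \<open>auto simp: disjoint_family_on_def cell_def\<close>)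

definition "tail_bd eps tau L = exp (- (eps^2 * real L / (8 * real tau)))"
definition "slack eps eps1 tau L = (eps + eps1) * real L + real tau"
definition "pos l j w = snd (W l j w)"
definition "hits s l m w A = {j\<in>{..<m}. \<forall>l'<l. pos l' (J s w + j) w \<in> A}"

text \<open>Walker \<open>l\<close> hits the level set too often or too rarely among the jobs for which all earlier walkers are in it.\<close>

definition "step_bad s eps eps1 tau L l i = {w\<in>Om. slack eps eps1 tau L < \<bar>real (card (hits s (Suc l) L w (lev i s w)))
    - real (card (hits s l L w (lev i s w))) * (real (card (lev i s w)) / real n)\<bar>}"
definition "rep_set s L l w = {j\<in>{..<L}. \<exists>j'<j. \<exists>l'<d. pos l' (J s w + j') w = pos l (J s w + j) w}"

text \<open>The chance of a repeat at a given job. A position is compared with at most \<open>d * L\<close> others that are fixed \<open>tau\<close> steps before,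
  to which mixing applies, and with the last \<open>tau\<close> positions of the same walker, to which the girth applies.\<close>

definition "rep_p eps1 tau rho L = (real (d * L) / real n + eps1) + real tau * (1 / real (k - 1) ^ rho)"
definition "rep_bad s eps eps1 tau rho L l = {w\<in>Om. eps * real L + real tau < real (card (rep_set s L l w)) - rep_p eps1 tau rho L * real L}"

lemma pos_others: "l' < d ==> l' \<noteq> l ==> {w\<in>space M. pos l' j w \<in> A} \<in> sets (src (others l))"
proof -
  assume l: "l' < d" "l' \<noteq> l"
  have [measurable]: "W l' j \<in> measurable (src (others l)) (count_space UNIV)"
    using l by (intro W_measurable_src) (auto simp: others_def)
  have "{w\<in>space (src (others l)). snd (W l' j w) \<in> A} \<in> sets (src (others l))" by measurable
  then show ?thesis unfolding space_src pos_def .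
qed

lemma pos_KW: "l < d ==> i \<le> j ==> {w\<in>space M. pos l i w \<in> A} \<in> KW l j"
  using KW_W[of i j l "{e. snd e \<in> A}"] by (simp add: pos_def)

lemma pos_KW': "l < d ==> l' < d ==> l' \<noteq> l \<or> i \<le> j ==> {w\<in>space M. pos l' i w \<in> A} \<in> KW l j"
  using pos_KW[of l i j A] src_KW[OF pos_others[of l' l i A], of j] by (cases "l' = l") auto

lemma pos_range: "w \<in> Om ==> l < d ==> pos l j w \<in> {1..n}"
  using queue_path.P_range[OF Om_path] by (simp add: pos_def)

lemma pair_KW:
  assumes "l < d" "l1 < d" "l2 < d" "l1 \<noteq> l \<or> i1 \<le> j" "l2 \<noteq> l \<or> i2 \<le> j"
  shows "{w\<in>space M. pos l1 i1 w = pos l2 i2 w} \<in> KW l j"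
proof -
  have "{w\<in>space M. pos l1 i1 w = pos l2 i2 w} = (\<Union>v. {w\<in>space M. pos l1 i1 w \<in> {v}} \<inter> {w\<in>space M. pos l2 i2 w \<in> {v}})"
    by auto
  also have "... \<in> KW l j" using assms by (intro KW_UN KW_Int pos_KW') auto
  finally show ?thesis .
qed

lemma KW_ex:
  assumes "finite I" "\<And>x. x \<in> I ==> {w\<in>space M. q x w} \<in> KW l j"
  shows "{w\<in>space M. \<exists>x\<in>I. q x w} \<in> KW l j"
proof -
  have "{w\<in>space M. \<exists>x\<in>I. q x w} = (\<Union>x\<in>I. {w\<in>space M. q x w})" by auto
  also have "... \<in> KW l j" using assms by (intro KW_UN) (auto intro: countable_finite)
  finally show ?thesis .
qed

context
  fixes s eps eps1 :: real and tau rho L :: nat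
  assumes s: "0 \<le> s" and tau: "0 < tau" "tau \<le> L" and eps: "0 \<le> eps" "eps \<le> 1" and eps1: "0 \<le> eps1" "eps1 \<le> 1"
    and mix: "\<And>B e. B \<subseteq> {1..n} ==> e \<in> G ==>
      \<bar>(nb_op G ^^ tau) (\<lambda>e. of_bool (snd e \<in> B)) e - real (card B) / real n\<bar> \<le> eps1"
    and girth: "enat (2 * rho) < girth G"
begin

lemma cell_KW: "l < d ==> cell s i j0 A \<in> KW l j0"
  unfolding cell_def by (rule lev_KW[OF _ s])

text \<open>Both directions are upper bounds: that walker \<open>l\<close> hits the set rarely means that it hits the complement often.\<close>

lemma step_bad_prob:
  assumes l: "l < d"
  shows "rare (2 * real tau * tail_bd eps tau L) (step_bad s eps eps1 tau L l i)"
proof (rule partition_state[OF s])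
  show "step_bad s eps eps1 tau L l i \<subseteq> Om" by (auto simp: step_bad_def)
  show "0 \<le> 2 * real tau * tail_bd eps tau L" by (simp add: tail_bd_def)
  fix j0 A assume A: "A \<subseteq> {1..n}"
  define a where "a = real (card A) / real n"
  have cA: "card A \<le> n" using card_mono[OF _ A] by simp
  have a: "0 \<le> a" "a \<le> 1" unfolding a_def using cA n_pos by auto
  define AA where "AA = (\<lambda>j. space M \<inter> (\<Inter>l'\<in>{..<l}. {w\<in>space M. pos l' (j0 + j) w \<in> A}))"
  have AA_iff: "w \<in> AA j \<longleftrightarrow> (\<forall>l'<l. pos l' (j0 + j) w \<in> A)" if "w \<in> Om" for w j
    using Om_space[OF that] by (auto simp: AA_def)
  have AA_src: "AA j \<in> sets (src (others l))" for j
  proof (cases "l = 0")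
    case True
    then have "AA j = space (src (others l))" by (simp add: AA_def)
    then show ?thesis by (simp only: sets.top)
  next
    case False
    have "(\<Inter>l'\<in>{..<l}. {w\<in>space M. pos l' (j0 + j) w \<in> A}) \<in> sets (src (others l))"
      using False l by (intro sets.finite_INT pos_others) auto
    moreover have "space M \<in> sets (src (others l))" using sets.top[of "src (others l)"] unfolding space_src .
    ultimately show ?thesis unfolding AA_def by (intro sets.Int)
  qed
  define Z where "Z = (\<lambda>j. {w\<in>space M. pos l (j0 + j) w \<in> A})"
  define Z' where "Z' = (\<lambda>j. {w\<in>space M. pos l (j0 + j) w \<in> {1..n} - A})"
  let ?H = "cell s i j0 A"
  let ?E = "\<lambda>Z p. ?H \<inter> {w. eps * real L + real tau < (\<Sum>j<L. of_bool (w \<in> AA j) * (of_bool (w \<in> Z j) - p))}"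
  have Hm: "?H \<in> KW l j0" by (rule cell_KW[OF l])
  have ZK: "Z j \<in> KW l (j0 + j)" "Z' j \<in> KW l (j0 + j)" for j unfolding Z_def Z'_def by (rule pos_KW[OF l order.refl])+
  have P1: "\<exists>B\<in>events. ?E Z (a + eps1) \<subseteq> B \<and> prob B \<le> real tau * tail_bd eps tau L * prob ?H" unfolding tail_bd_def
  proof (rule walker_chernoff[OF l Hm src_KW[OF AA_src] ZK(1) _ _ tau eps])
    show "0 \<le> a + eps1" "a + eps1 \<le> 2" using a eps1 by auto
    fix j F assume j: "tau \<le> j" "j < L" and F: "F \<in> KW l (j0 + j - tau)"
    have "prob (F \<inter> {w\<in>space M. snd (W l (j0 + j - tau + tau) w) \<in> A}) \<le> (a + eps1) * prob F"
      by (rule KW_hit_le[OF l F]) (use mix[OF A] in \<open>force simp: a_def abs_le_iff\<close>)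
    then show "prob (F \<inter> Z j) \<le> (a + eps1) * prob F" using j by (simp add: Z_def pos_def)
  qed
  have P2: "\<exists>B\<in>events. ?E Z' (1 - a + eps1) \<subseteq> B \<and> prob B \<le> real tau * tail_bd eps tau L * prob ?H" unfolding tail_bd_def
  proof (rule walker_chernoff[OF l Hm src_KW[OF AA_src] ZK(2) _ _ tau eps])
    show "0 \<le> 1 - a + eps1" "1 - a + eps1 \<le> 2" using a eps1 by auto
    fix j F assume j: "tau \<le> j" "j < L" and F: "F \<in> KW l (j0 + j - tau)"
    have sub: "{1..n} - A \<subseteq> {1..n}" by auto
    have "real (card ({1..n} - A)) / real n = 1 - a"
      using A cA n_pos by (simp add: card_Diff_subset finite_subset a_def of_nat_diff diff_divide_distrib)
    then have "prob (F \<inter> {w\<in>space M. snd (W l (j0 + j - tau + tau) w) \<in> {1..n} - A}) \<le> (1 - a + eps1) * prob F"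
      by (intro KW_hit_le[OF l F]) (use mix[OF sub] in \<open>force simp: abs_le_iff\<close>)
    then show "prob (F \<inter> Z' j) \<le> (1 - a + eps1) * prob F" using j by (simp add: Z'_def pos_def)
  qed
  have key: "\<bar>real (card (hits s (Suc l) L w A)) - real (card (hits s l L w A)) * a\<bar> \<le> slack eps eps1 tau L"
    if w: "w \<in> ?H" "w \<notin> ?E Z (a + eps1)" "w \<notin> ?E Z' (1 - a + eps1)" for w
  proof -
    have wO: "w \<in> Om" "J s w = j0" and wsp: "w \<in> space M" using w(1) Om_space by (auto simp: cell_def)
    have h1: "real (card (hits s (Suc l) L w A)) = (\<Sum>j<L. of_bool (w \<in> AA j) * of_bool (w \<in> Z j))"
    proof -
      have "hits s (Suc l) L w A = {j\<in>{..<L}. w \<in> AA j \<and> w \<in> Z j}"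
        using wO wsp by (auto simp: hits_def AA_iff Z_def less_Suc_eq)
      then show ?thesis by (simp only: card_eq_sum finite_lessThan of_bool_conj)
    qed
    have h0: "real (card (hits s l L w A)) = (\<Sum>j<L. of_bool (w \<in> AA j))"
    proof -
      have "hits s l L w A = {j\<in>{..<L}. w \<in> AA j}" using wO by (auto simp: hits_def AA_iff)
      then show ?thesis by (simp only: card_eq_sum finite_lessThan)
    qed
    have zz: "of_bool (w \<in> Z' j) = 1 - (of_bool (w \<in> Z j) :: real)" for j
      using pos_range[OF wO(1) l, of "j0 + j"] wsp by (auto simp: Z_def Z'_def)
    have hL: "real (card (hits s l L w A)) \<le> real L"
      using card_mono[of "{..<L}" "hits s l L w A"] by (auto simp: hits_def)
    have eL: "eps1 * real (card (hits s l L w A)) \<le> eps1 * real L" using hL eps1 by (intro mult_left_mono) auto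
    have "(\<Sum>j<L. of_bool (w \<in> AA j) * (of_bool (w \<in> Z j) - (a + eps1))) =
       real (card (hits s (Suc l) L w A)) - real (card (hits s l L w A)) * a - eps1 * real (card (hits s l L w A))"
      unfolding h1 h0 by (simp only: right_diff_distrib sum_subtractf sum_distrib_right[symmetric] distrib_left mult.commute[of eps1]) simp
    then have u: "real (card (hits s (Suc l) L w A)) - real (card (hits s l L w A)) * a - eps1 * real (card (hits s l L w A)) \<le> eps * real L + real tau"
      using w wsp by simp
    have "(\<Sum>j<L. of_bool (w \<in> AA j) * (of_bool (w \<in> Z' j) - (1 - a + eps1))) =
       (\<Sum>j<L. of_bool (w \<in> AA j) * (a - eps1) - of_bool (w \<in> AA j) * of_bool (w \<in> Z j))"
      unfolding zz by (intro sum.cong refl) (simp add: algebra_simps)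
    also have "... = real (card (hits s l L w A)) * (a - eps1) - real (card (hits s (Suc l) L w A))"
      unfolding h1 h0 by (simp only: sum_subtractf sum_distrib_right)
    finally have "real (card (hits s l L w A)) * (a - eps1) - real (card (hits s (Suc l) L w A)) \<le> eps * real L + real tau"
      using w wsp by simp
    then have lo: "real (card (hits s l L w A)) * a - real (card (hits s (Suc l) L w A)) - eps1 * real (card (hits s l L w A)) \<le> eps * real L + real tau"
      by (simp add: algebra_simps)
    have "slack eps eps1 tau L = eps * real L + eps1 * real L + real tau" by (simp add: slack_def distrib_right)
    then show ?thesis unfolding abs_le_iff using u lo eL by simp
  qed
  have sub: "step_bad s eps eps1 tau L l i \<inter> ?H \<subseteq> ?E Z (a + eps1) \<union> ?E Z' (1 - a + eps1)"
  proof
    fix w assume w: "w \<in> step_bad s eps eps1 tau L l i \<inter> ?H"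
    then have "slack eps eps1 tau L < \<bar>real (card (hits s (Suc l) L w A)) - real (card (hits s l L w A)) * a\<bar>"
      by (auto simp: step_bad_def cell_def a_def)
    then show "w \<in> ?E Z (a + eps1) \<union> ?E Z' (1 - a + eps1)" using key[of w] w by (meson IntD2 UnI1 UnI2 not_le)
  qed
  obtain B1 B2 where B: "B1 \<in> events" "?E Z (a + eps1) \<subseteq> B1" "prob B1 \<le> real tau * tail_bd eps tau L * prob ?H"
    "B2 \<in> events" "?E Z' (1 - a + eps1) \<subseteq> B2" "prob B2 \<le> real tau * tail_bd eps tau L * prob ?H" using P1 P2 by blast
  have "prob (B1 \<union> B2) \<le> prob B1 + prob B2" by (rule measure_Un_le) (use B in auto)
  then have "prob (B1 \<union> B2) \<le> 2 * real tau * tail_bd eps tau L * prob ?H" using B(3,6) by simp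
  then show "\<exists>B\<in>events. step_bad s eps eps1 tau L l i \<inter> ?H \<subseteq> B \<and> prob B \<le> 2 * real tau * tail_bd eps tau L * prob ?H"
    using B sub by (intro bexI[of _ "B1 \<union> B2"]) auto
qed

text \<open>Walker by walker, the number of jobs is multiplied by the density of the set.\<close>

lemma hits_telescope:
  assumes "w \<in> Om" "\<And>l. l < d ==> w \<notin> step_bad s eps eps1 tau L l i"
  shows "\<bar>real (card (hits s d L w (lev i s w))) - real L * (real (card (lev i s w)) / real n) ^ d\<bar> \<le> real d * slack eps eps1 tau L"
proof -
  define a where "a = real (card (lev i s w)) / real n"
  define N where "N = (\<lambda>l. real (card (hits s l L w (lev i s w))))"
  have "card (lev i s w) \<le> card {1..n}" by (intro card_mono) (auto simp: lev_def)
  then have a: "0 \<le> a" "a \<le> 1" unfolding a_def using n_pos by auto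
  have slack: "0 \<le> slack eps eps1 tau L" using eps eps1 by (simp add: slack_def)
  have "\<bar>N l - real L * a ^ l\<bar> \<le> real l * slack eps eps1 tau L" if "l \<le> d" for l
    using that
  proof (induction l)
    case 0
    have "hits s 0 L w (lev i s w) = {..<L}" by (auto simp: hits_def)
    then show ?case by (simp add: N_def)
  next
    case (Suc l)
    have st: "\<bar>N (Suc l) - N l * a\<bar> \<le> slack eps eps1 tau L"
      using assms(2)[of l] assms(1) Suc.prems by (auto simp: step_bad_def N_def a_def)
    have "\<bar>N l * a - real L * a ^ Suc l\<bar> = a * \<bar>N l - real L * a ^ l\<bar>"
    proof -
      have e: "N l * a - real L * a ^ Suc l = a * (N l - real L * a ^ l)" by (simp add: algebra_simps)
      show ?thesis unfolding e abs_mult using a by simp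
    qed
    also have "... \<le> 1 * (real l * slack eps eps1 tau L)" using a Suc by (intro mult_mono) auto
    finally have "\<bar>N (Suc l) - real L * a ^ Suc l\<bar> \<le> slack eps eps1 tau L + real l * slack eps eps1 tau L" using st by linarith
    then show ?case by (simp add: distrib_right)
  qed
  from this[of d] show ?thesis by (simp add: N_def a_def)
qed

lemma no_quick_return:
  assumes "w \<in> Om" "l < d" "i < j" "j - i < rho" shows "pos l i w \<noteq> pos l j w"
proof
  assume eq: "pos l i w = pos l j w"
  have st: "W l m w \<in> G" "fst (W l (Suc m) w) = snd (W l m w)" "snd (W l (Suc m) w) \<noteq> fst (W l m w)" for m
    using Om(3)[OF assms(1)] assms(2) by (auto simp: good_def)
  have walk: "nb_walk G (\<lambda>m. pos l m w) j"
    unfolding nb_walk_def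
  proof (intro conjI allI impI)
    fix m show "(pos l m w, pos l (Suc m) w) \<in> G"
      using st(1)[of "Suc m"] st(2)[of m] unfolding pos_def by (metis prod.collapse)
    show "pos l (Suc (Suc m)) w \<noteq> pos l m w"
      using st(2)[of m] st(3)[of "Suc m"] unfolding pos_def by simp
  qed
  have "irrefl G" using graph by (simp add: regular_graph_def)
  then have "girth G \<le> enat (j - i)" by (rule nb_walk_revisit_girth[OF _ walk assms(3) order.refl eq])
  also have "... \<le> enat (2 * rho)" using assms(4) by simp
  finally show False using girth by simp
qed

text \<open>A repeat at step \<open>j\<close> falls into \<open>E1\<close> if it meets a position fixed \<open>tau\<close> steps before (the other walkers are
  fixed throughout), and into some \<open>E2 j'\<close> if walker \<open>l\<close> returns to its own position at \<open>j'\<close>. Returns within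
  \<open>rho\<close> steps do not occur.\<close>

lemma rep_bad_prob:
  assumes l: "l < d" and p2: "rep_p eps1 tau rho L \<le> 2"
  shows "rare (real tau * tail_bd eps tau L) (rep_bad s eps eps1 tau rho L l)"
proof (rule partition_state[OF s, of _ _ 0])
  show "rep_bad s eps eps1 tau rho L l \<subseteq> Om" by (auto simp: rep_bad_def)
  show "0 \<le> real tau * tail_bd eps tau L" by (simp add: tail_bd_def)
  fix j0 A
  let ?H = "cell s 0 j0 A"
  define Z where "Z = (\<lambda>j. {w\<in>space M. \<exists>p\<in>{..<j} \<times> {..<d}. pos (snd p) (j0 + fst p) w = pos l (j0 + j) w})"
  have ZK: "Z j \<in> KW l (j0 + j)" for j
    unfolding Z_def using l by (intro KW_ex pair_KW) auto
  have p0: "0 \<le> real (d * L) / real n + eps1" "0 \<le> 1 / real (k - 1) ^ rho" "0 \<le> rep_p eps1 tau rho L"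
    unfolding rep_p_def using eps1 by (auto intro!: add_nonneg_nonneg)
  have Hm: "?H \<in> KW l j0" by (rule cell_KW[OF l])
  have space_KW: "space M \<in> KW l j0"
    using sets.top[of "src (others l)"] unfolding space_src by (rule src_KW)
  let ?E = "?H \<inter> {w. eps * real L + real tau < (\<Sum>j<L. of_bool (w \<in> space M) * (of_bool (w \<in> Z j) - rep_p eps1 tau rho L))}"
  have P: "\<exists>B\<in>events. ?E \<subseteq> B \<and> prob B \<le> real tau * tail_bd eps tau L * prob ?H"
    unfolding tail_bd_def
  proof (rule walker_chernoff[OF l Hm space_KW ZK p0(3) p2 tau eps])
    fix j F assume j: "tau \<le> j" "j < L" and F: "F \<in> KW l (j0 + j - tau)"
    define b where "b = j0 + j - tau"
    have b: "b + tau = j0 + j" using j by (simp add: b_def)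
    have Fb: "F \<in> KW l b" using F by (simp add: b_def)
    have Fev: "F \<in> events" using F KW_events by blast
    define Ix where "Ix = {p\<in>{..<j} \<times> {..<d}. snd p \<noteq> l \<or> fst p \<le> j - tau}"
    have finIx: "finite Ix" by (simp add: Ix_def)
    define X where "X = (\<lambda>w. (\<lambda>p. pos (snd p) (j0 + fst p) w) ` Ix)"
    define I where "I = {j - tau<..j - rho}"
    define E1 where "E1 = F \<inter> {w\<in>Om. snd (W l (b + tau) w) \<in> X w}"
    define E2 where "E2 = (\<lambda>j'. F \<inter> {w\<in>Om. snd (W l (j0 + j' + (j - j')) w) \<in> {pos l (j0 + j') w}})"
    have vX: "{w\<in>space M. v \<in> X w} \<in> KW l b" for v
    proof -
      have "{w\<in>space M. v \<in> X w} = {w\<in>space M. \<exists>p\<in>Ix. pos (snd p) (j0 + fst p) w \<in> {v}}" by (auto simp: X_def)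
      also have "... \<in> KW l b" using l j by (intro KW_ex[OF finIx] pos_KW') (auto simp: Ix_def b_def)
      finally show ?thesis .
    qed
    have E1p: "prob E1 \<le> (real (d * L) / real n + eps1) * prob F"
      unfolding E1_def
    proof (rule KW_random_hit[OF l Fb vX _ _ p0(1)])
      fix w
      have "card (X w \<inter> {1..n}) \<le> card (X w)" by (intro card_mono) (auto simp: X_def finIx)
      also have "... \<le> card Ix" unfolding X_def by (rule card_image_le[OF finIx])
      also have "... \<le> card ({..<j} \<times> {..<d})" unfolding Ix_def by (intro card_mono) auto
      also have "... \<le> d * L" using j by simp
      finally show "card (X w \<inter> {1..n}) \<le> d * L" .
    next
      fix B e assume B: "B \<subseteq> {1..n}" "card B \<le> d * L" and e: "e \<in> G"
      have "(nb_op G ^^ tau) (\<lambda>e. of_bool (snd e \<in> B)) e \<le> real (card B) / real n + eps1"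
        using mix[OF B(1) e] by (simp add: abs_le_iff)
      also have "real (card B) / real n \<le> real (d * L) / real n" using B(2) by (intro divide_right_mono of_nat_mono) auto
      finally show "(nb_op G ^^ tau) (\<lambda>e. of_bool (snd e \<in> B)) e \<le> real (d * L) / real n + eps1" by simp
    qed
    have E2p: "prob (E2 j') \<le> 1 / real (k - 1) ^ rho * prob F" if j': "j' \<in> I" for j'
      unfolding E2_def
    proof (rule KW_random_hit[OF l _ _ _ _ p0(2), where m = 1])
      have "b \<le> j0 + j'" using j' j by (auto simp: b_def I_def)
      then show "F \<in> KW l (j0 + j')" using KW_mono Fb by blast
      show "{w\<in>space M. v \<in> {pos l (j0 + j') w}} \<in> KW l (j0 + j')" for v
      proof -
        have "{w\<in>space M. v \<in> {pos l (j0 + j') w}} = {w\<in>space M. pos l (j0 + j') w \<in> {v}}" by auto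
        then show ?thesis using pos_KW[OF l order.refl, of "j0 + j'" "{v}"] by (simp only:)
      qed
      show "card ({pos l (j0 + j') w} \<inter> {1..n}) \<le> 1" for w
        using card_mono[of "{pos l (j0 + j') w}" "{pos l (j0 + j') w} \<inter> {1..n}"] by simp
      fix B e assume B: "B \<subseteq> {1..n}" "card B \<le> 1" and e: "e \<in> G"
      have fB: "finite B" using B(1) finite_subset by blast
      have r: "rho \<le> j - j'" using j' by (auto simp: I_def)
      show "(nb_op G ^^ (j - j')) (\<lambda>e. of_bool (snd e \<in> B)) e \<le> 1 / real (k - 1) ^ rho"
      proof (cases "B = {}")
        case True
        have "(nb_op G ^^ (j - j')) (\<lambda>e. of_bool (snd e \<in> B)) e \<le> 0"
          by (rule nb_op_pow_bound[OF graph k3, of 0 _ 0]) (use True e in auto)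
        then show ?thesis using p0(2) by linarith
      next
        case False
        then have "card B = 1" using B(2) fB by (metis One_nat_def card_gt_0_iff le_antisym Suc_leI)
        then obtain v where "B = {v}" by (rule card_1_singletonE)
        then show ?thesis using nb_op_pow_le[OF graph k3 e girth r, of v] by simp
      qed
    qed
    have E1ev: "E1 \<in> events"
    proof -
      have "E1 = F \<inter> Om \<inter> (\<Union>v. {w\<in>space M. v \<in> X w} \<inter> {w\<in>space M. pos l (b + tau) w \<in> {v}})"
        using Om_space by (auto simp: E1_def pos_def)
      also have "... \<in> events"
      proof (intro sets.Int Fev Om(1) sets.countable_UN'')
        show "{w\<in>space M. v \<in> X w} \<in> events" for v using vX KW_events by blast
        show "{w\<in>space M. pos l (b + tau) w \<in> {v}} \<in> events" for v
          using pos_KW[OF l order.refl, of "b + tau" "{v}"] KW_events by blast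
      qed simp
      finally show ?thesis .
    qed
    have E2ev: "E2 j' \<in> events" for j'
    proof -
      have "E2 j' = F \<inter> Om \<inter> {w\<in>space M. pos l (j0 + j' + (j - j')) w = pos l (j0 + j') w}"
        using Om_space by (auto simp: E2_def pos_def)
      moreover have "{w\<in>space M. pos l (j0 + j' + (j - j')) w = pos l (j0 + j') w} \<in> events"
        using pair_KW[OF l l l, of "j0 + j' + (j - j')" "j0 + j' + (j - j')" "j0 + j'"] KW_events by auto
      ultimately show ?thesis using Fev Om(1) by (simp only: sets.Int)
    qed
    have sub: "F \<inter> Z j \<inter> Om \<subseteq> E1 \<union> (\<Union>j'\<in>I. E2 j')"
    proof
      fix w assume w: "w \<in> F \<inter> Z j \<inter> Om"
      then obtain j' l' where jl: "j' < j" "l' < d" "pos l' (j0 + j') w = pos l (j0 + j) w" by (auto simp: Z_def)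
      show "w \<in> E1 \<union> (\<Union>j'\<in>I. E2 j')"
      proof (cases "l' \<noteq> l \<or> j' \<le> j - tau")
        case True
        then have "(j', l') \<in> Ix" using jl by (auto simp: Ix_def)
        then have "pos l (j0 + j) w \<in> X w" unfolding X_def using jl(3) by force
        then show ?thesis using w b by (auto simp: E1_def pos_def)
      next
        case False
        then have [simp]: "l' = l" and j'': "j - tau < j'" by auto
        have "\<not> (j0 + j) - (j0 + j') < rho"
          using no_quick_return[of w l "j0 + j'" "j0 + j"] w l jl by auto
        then have "rho \<le> j - j'" by simp
        then have "j' \<le> j - rho" using jl(1) by arith
        then have "j' \<in> I" using j'' by (simp add: I_def)
        moreover have "w \<in> E2 j'" using w jl by (auto simp: E2_def pos_def)
        ultimately show ?thesis by blast
      qed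
    qed
    have Zev: "Z j \<in> events" using ZK KW_events by blast
    have finI: "finite I" by (simp add: I_def)
    have cI: "card I \<le> tau" unfolding I_def card_greaterThanAtMost using j by arith
    have "prob (F \<inter> Z j) = prob (F \<inter> Z j \<inter> Om)" using Fev Zev by (intro prob_Om[symmetric]) auto
    also have "... \<le> prob (E1 \<union> (\<Union>j'\<in>I. E2 j'))"
      by (rule finite_measure_mono[OF sub]) (intro sets.Un sets.finite_UN E1ev E2ev finI)
    also have "... \<le> prob E1 + prob (\<Union>j'\<in>I. E2 j')"
      by (rule measure_Un_le) (intro sets.finite_UN E1ev E2ev finI)+
    also have "prob (\<Union>j'\<in>I. E2 j') \<le> (\<Sum>j'\<in>I. prob (E2 j'))"
      by (rule finite_measure_subadditive_finite[OF finI]) (use E2ev in auto)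
    also have "... \<le> (\<Sum>j'\<in>I. 1 / real (k - 1) ^ rho * prob F)" by (intro sum_mono E2p)
    also have "... = real (card I) * (1 / real (k - 1) ^ rho * prob F)" by simp
    also have "... \<le> real tau * (1 / real (k - 1) ^ rho * prob F)"
      using cI by (intro mult_right_mono) auto
    finally have "prob (F \<inter> Z j) \<le> prob E1 + real tau * (1 / real (k - 1) ^ rho * prob F)" by simp
    then show "prob (F \<inter> Z j) \<le> rep_p eps1 tau rho L * prob F"
      using E1p unfolding rep_p_def by (simp add: algebra_simps)
  qed
  have eq: "rep_bad s eps eps1 tau rho L l \<inter> ?H \<subseteq> ?E"
  proof -
    have "real (card (rep_set s L l w)) - rep_p eps1 tau rho L * real L = (\<Sum>j<L. of_bool (w \<in> space M) * (of_bool (w \<in> Z j) - rep_p eps1 tau rho L))"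
      if w: "w \<in> ?H" for w
    proof -
      have wO: "w \<in> Om" "J s w = j0" and wsp: "w \<in> space M" using w Om_space by (auto simp: cell_def)
      have "rep_set s L l w = {j\<in>{..<L}. w \<in> Z j}" using wO wsp by (auto simp: rep_set_def Z_def)
      then have "real (card (rep_set s L l w)) = (\<Sum>j<L. of_bool (w \<in> Z j))" by (simp only: card_eq_sum finite_lessThan)
      then show ?thesis using wsp by (simp add: sum_subtractf mult.commute)
    qed
    then show ?thesis using Om_space by (auto simp: rep_bad_def cell_def)
  qed
  show "\<exists>B\<in>events. rep_bad s eps eps1 tau rho L l \<inter> ?H \<subseteq> B \<and> prob B \<le> real tau * tail_bd eps tau L * prob ?H"
    using P eq by blast
qed

end

end

text \<open>Truncated at \<open>m\<close>, the count depends on the first \<open>m\<close> service times only; as long as \<open>completed\<close> is at most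
  \<open>m\<close>, it agrees with \<open>completed\<close>.\<close>

definition completed_upto :: "nat => (nat => real) => nat => nat list => nat => (nat => real) => real => nat" where
  "completed_upto m T q ks v sv t = card {r. r < m \<and> r < jobs q ks v \<and> svc_end (job_arrival T q ks v) sv r \<le> t}"

lemma completed_upto_eq:
  assumes "\<And>i. 0 < sv i" "completed T q ks v sv t \<le> m"
  shows "completed T q ks v sv t = completed_upto m T q ks v sv t"
proof -
  have "{r. r < m \<and> r < jobs q ks v \<and> svc_end (job_arrival T q ks v) sv r \<le> t} = {..<completed T q ks v sv t}"
  proof (rule equalityI; rule subsetI)
    have iff: "r < completed T q ks v sv t \<longleftrightarrow> r < jobs q ks v \<and> svc_end (job_arrival T q ks v) sv r \<le> t" for r
      by (rule less_completed_iff[OF assms(1)])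
    fix r
    {
      assume "r \<in> {r. r < m \<and> r < jobs q ks v \<and> svc_end (job_arrival T q ks v) sv r \<le> t}"
      then show "r \<in> {..<completed T q ks v sv t}" using iff[of r] by blast
    next
      assume "r \<in> {..<completed T q ks v sv t}"
      then show "r \<in> {r. r < m \<and> r < jobs q ks v \<and> svc_end (job_arrival T q ks v) sv r \<le> t}"
        using iff[of r] assms(2) by simp
    }
  qed
  then show ?thesis by (simp add: completed_upto_def)
qed

lemma completed_mono: "t \<le> t' ==> completed T q ks v sv t \<le> completed T q ks v sv t'"
  using completed_take_le[of "length ks" ks t t' T q v sv] by simp

lemma elapsed_nonneg: "0 \<le> elapsed T q ks v sv m t"
  by (simp add: elapsed_def)

context pod_setup
begin

section \<open>Conditioning on the past of one server\<close>

definition "before v m = \<S> - {Service v i | i. m \<le> i}"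
definition "past s w = hlist (J s w) w"
definition "cellS s v ks m = {w\<in>Om. past s w = ks \<and> served (\<lambda>j. T j w) q0 ks (\<lambda>v m. S v m w) v s = m}"

text \<open>On the cell where the choices up to time \<open>s\<close> are \<open>ks\<close> and server \<open>v\<close> has completed \<open>m\<close> services,
  these events do not depend on service \<open>m\<close> or any later one of \<open>v\<close>.\<close>

definition "KV s v = known (\<lambda>a. src (before v (snd a))) (\<lambda>a. cellS s v (fst a) (snd a))"

lemma before_sub: "before v m \<subseteq> \<S>" by (auto simp: before_def)

lemma T_before: "T j \<in> borel_measurable (src (before v m))"
  by (rule T_measurable_src) (auto simp: before_def)

lemma S_before: "v' \<in> {1..n} ==> v' \<noteq> v \<or> i < m ==> S v' i \<in> borel_measurable (src (before v m))"
  by (rule S_measurable_src) (auto simp: before_def)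

lemma W_before: "l < d ==> W l i \<in> measurable (src (before v m)) (count_space UNIV)"
  by (rule W_measurable_src) (auto simp: before_def)

lemma completed_upto_measurable:
  assumes "\<And>j. T j \<in> borel_measurable D" "\<And>i. i < m ==> S v i \<in> borel_measurable D"
  shows "(\<lambda>w. completed_upto m (\<lambda>j. T j w) q ks v (\<lambda>i. S v i w) t) \<in> measurable D (count_space UNIV)"
  unfolding completed_upto_def
proof (rule measurable_card)
  fix r
  show "{w\<in>space D. r \<in> {r. r < m \<and> r < jobs q ks v \<and> svc_end (job_arrival (\<lambda>j. T j w) q ks v) (\<lambda>i. S v i w) r \<le> t}} \<in> sets D"
  proof (cases "r < m")
    case True
    have [measurable]: "(\<lambda>w. svc_end (job_arrival (\<lambda>j. T j w) q ks v) (\<lambda>i. S v i w) r) \<in> borel_measurable D"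
      by (rule svc_end_measurable) (use assms True in auto)
    show ?thesis by measurable
  qed simp
qed

lemma elapsed_measurable:
  assumes "\<And>j. T j \<in> borel_measurable D" "\<And>i. i < m ==> S v i \<in> borel_measurable D"
  shows "(\<lambda>w. elapsed (\<lambda>j. T j w) q ks v (\<lambda>i. S v i w) m t) \<in> borel_measurable D"
proof -
  have [measurable]: "(\<lambda>w. svc_start (job_arrival (\<lambda>j. T j w) q ks v) (\<lambda>i. S v i w) m) \<in> borel_measurable D"
    by (rule svc_start_measurable) (use assms in auto)
  show ?thesis unfolding elapsed_def by (cases "m < jobs q ks v") simp_all
qed

lemma S_pos_Om: "w \<in> Om ==> v \<in> {1..n} ==> 0 < S v i w"
  by (rule queue_path.S_pos[OF Om_path])

lemma past_eq: "w \<in> Om ==> past s w = ks \<longleftrightarrow> (\<forall>i<length ks. T i w \<le> s) \<and> s < T (length ks) w \<and> hlist (length ks) w = ks"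
  using J_eq[of w s "length ks"] by (auto simp: past_def)

text \<open>The past is revealed job by job. As long as the service number \<open>m\<close> of server \<open>v\<close> is not finished,
  nothing in it depends on that service or on later ones.\<close>

lemma past_trace:
  fixes s ks m v
  defines "t \<equiv> \<lambda>j w. if j < length ks then T j w else s"
  defines "HJ \<equiv> {w\<in>Om. (\<forall>i<length ks. T i w \<le> s) \<and> s < T (length ks) w}"
  defines "un \<equiv> \<lambda>j. {w\<in>HJ. finished v (take j ks) (t j w) w \<le> m}"
  assumes v: "v \<in> {1..n}"
  shows "j \<le> length ks ==> trace_in (src (before v m)) (un j) {w\<in>space M. hlist j w = take j ks}"
proof (rule hlist_trace)
  show "un i \<subseteq> Om" for i by (auto simp: un_def HJ_def)
  show "un (Suc j) \<subseteq> un j" if j: "Suc j \<le> length ks" for j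
  proof
    fix w assume w: "w \<in> un (Suc j)"
    have "completed (\<lambda>j. T j w) (q0 v) (take j (take (Suc j) ks)) v (\<lambda>i. S v i w) (t j w)
      \<le> finished v (take (Suc j) ks) (t (Suc j) w) w"
    proof (rule completed_take_le)
      have "w \<in> Om" "T j w \<le> s" using w j by (auto simp: un_def HJ_def)
      moreover have "T j w \<le> T (Suc j) w"
        using queue_path.T_less_iff[OF Om_path[OF \<open>w \<in> Om\<close>], of j "Suc j"] by simp
      ultimately show "t j w \<le> t (Suc j) w" using j by (auto simp: t_def)
    qed (use j in simp)
    then show "w \<in> un j" using w by (auto simp: un_def)
  qed
  show "space (src (before v m)) = space M" by (rule space_src)
  show "sets U \<subseteq> sets (src (before v m))" using U_src[of "before v m"] by (auto simp: before_def)
  show "E i \<in> borel_measurable (src (before v m))" for i by (rule E_measurable_src) (auto simp: before_def)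
  fix j assume j: "j < length ks"
  show "trace_in (src (before v m)) (un j) {w\<in>space M. W l i w = e}" if "l < d" for l i e
  proof -
    have [measurable]: "W l i \<in> measurable (src (before v m)) (count_space UNIV)" by (rule W_before[OF that])
    have "{w\<in>space (src (before v m)). W l i w = e} \<in> sets (src (before v m))" by measurable
    then show ?thesis unfolding space_src by (rule trace_in_sets)
  qed
  fix v' x and t' :: real assume v': "v' \<in> {1..n}" and t': "0 \<le> t'"
  let ?D = "src (before v m)"
  have [measurable]: "T j \<in> borel_measurable ?D" by (rule T_before)
  have Tj: "{w\<in>space M. t' < T j w} \<in> sets ?D"
  proof -
    have "{w\<in>space ?D. t' < T j w} \<in> sets ?D" by measurable
    then show ?thesis unfolding space_src .
  qed
  show "trace_in ?D (un j) {w\<in>space M. t' < T j w \<and> expl (take j ks) v' t' x w}"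
  proof (cases "v' = v")
    case False
    have Sv: "S v' i \<in> borel_measurable ?D" for i by (rule S_before) (use v' False in auto)
    have ex: "{w\<in>space M. expl (take j ks) v' t' x w} \<in> sets ?D"
      using expl_sets[OF arrived_measurable[OF T_before] completed_measurable[OF T_before Sv]] unfolding space_src .
    have "{w\<in>space M. t' < T j w \<and> expl (take j ks) v' t' x w} = {w\<in>space M. t' < T j w} \<inter> {w\<in>space M. expl (take j ks) v' t' x w}" by auto
    then show ?thesis using sets.Int[OF Tj ex] by (intro trace_in_sets) (simp only:)
  next
    case True
    have Sv: "S v i \<in> borel_measurable ?D" if "i < m" for i by (rule S_before) (use v that in auto)
    let ?e = "\<lambda>w. q0 v + arrived (\<lambda>j. T j w) (take j ks) v t' = x + completed_upto m (\<lambda>j. T j w) (q0 v) (take j ks) v (\<lambda>i. S v i w) t'"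
    have ex: "{w\<in>space M. ?e w} \<in> sets ?D"
      using expl_sets[OF arrived_measurable[OF T_before] completed_upto_measurable[OF T_before Sv]] unfolding space_src .
    have "(t' < T j w \<and> expl (take j ks) v t' x w) = (t' < T j w \<and> ?e w)" if w: "w \<in> un j" for w
    proof (cases "t' < T j w")
      case tT: True
      have pos: "0 < S v i w" for i by (rule S_pos_Om) (use w v in \<open>auto simp: un_def HJ_def\<close>)
      have "finished v (take j ks) t' w \<le> finished v (take j ks) (T j w) w"
        by (rule completed_mono) (use tT in simp)
      also have "... \<le> m" using w j by (auto simp: un_def t_def)
      finally show ?thesis using completed_upto_eq[of "\<lambda>i. S v i w"] pos by simp
    qed simp
    then have "{w\<in>space M. t' < T j w \<and> expl (take j ks) v' t' x w} \<inter> un j = ({w\<in>space M. t' < T j w} \<inter> {w\<in>space M. ?e w}) \<inter> un j"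
      unfolding True by blast
    then show ?thesis unfolding trace_in_def using sets.Int[OF Tj ex] by blast
  qed
qed

abbreviation "age v ks m s w \<equiv> elapsed (\<lambda>j. T j w) (q0 v) ks v (\<lambda>i. S v i w) m s"

lemma age_before: "v \<in> {1..n} ==> age v ks m s \<in> borel_measurable (src (before v m))"
  by (rule elapsed_measurable[OF T_before S_before]) auto

text \<open>The cell is known from the sources before service \<open>m\<close>, apart from the fact that this service is still unfinished. This is the situation
  in which memorylessness applies.\<close>

lemma cellS_form:
  assumes v: "v \<in> {1..n}"
  shows "\<exists>X\<in>sets (src (before v m)). cellS s v ks m = X \<inter> {w\<in>Om. age v ks m s w < S v m w}"
proof -
  let ?D = "src (before v m)"
  have [measurable]: "T j \<in> borel_measurable ?D" for j by (rule T_before)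
  let ?c = "\<lambda>w. finished v ks s w"
  let ?u = "\<lambda>w. completed_upto m (\<lambda>j. T j w) (q0 v) ks v (\<lambda>i. S v i w) s"
  have [measurable]: "?u \<in> measurable ?D (count_space UNIV)"
    by (rule completed_upto_measurable[OF T_before S_before]) (use v in auto)
  obtain X where X: "X \<in> sets ?D" "{w\<in>space M. hlist (length ks) w = take (length ks) ks} \<inter>
     {w\<in>{w\<in>Om. (\<forall>i<length ks. T i w \<le> s) \<and> s < T (length ks) w}. finished v (take (length ks) ks) (if length ks < length ks then T (length ks) w else s) w \<le> m}
    = X \<inter> {w\<in>{w\<in>Om. (\<forall>i<length ks. T i w \<le> s) \<and> s < T (length ks) w}. finished v (take (length ks) ks) (if length ks < length ks then T (length ks) w else s) w \<le> m}"
    using past_trace[OF v order.refl, of m ks s] unfolding trace_in_def by blast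
  have X2: "w \<in> X \<longleftrightarrow> hlist (length ks) w = ks" if "w \<in> Om" "\<forall>i<length ks. T i w \<le> s" "s < T (length ks) w" "?c w \<le> m" for w
    using that X(2) Om_space[OF that(1)] unfolding set_eq_iff by auto
  define Y where "Y = {w\<in>space ?D. (\<forall>i<length ks. T i w \<le> s) \<and> s < T (length ks) w \<and> ?u w = m}"
  have Y: "Y \<in> sets ?D" unfolding Y_def by measurable
  have "w \<in> cellS s v ks m \<longleftrightarrow> w \<in> X \<and> w \<in> Y \<and> age v ks m s w < S v m w" if w: "w \<in> Om" for w
  proof -
    have pos: "0 < S v i w" for i by (rule S_pos_Om[OF w v])
    have cu: "?c w = ?u w" if "?c w \<le> m" using completed_upto_eq[of "\<lambda>i. S v i w"] pos that by simp
    have cl: "?c w \<le> m \<longleftrightarrow> age v ks m s w < S v m w" using completed_le_iff[of "\<lambda>i. S v i w"] pos by simp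
    have Yw: "w \<in> Y \<longleftrightarrow> (\<forall>i<length ks. T i w \<le> s) \<and> s < T (length ks) w \<and> ?u w = m"
      using Om_space[OF w] by (simp add: Y_def)
    have C: "w \<in> cellS s v ks m \<longleftrightarrow> ((\<forall>i<length ks. T i w \<le> s) \<and> s < T (length ks) w \<and> hlist (length ks) w = ks) \<and> ?c w = m"
      unfolding cellS_def served_def using past_eq[OF w, of s ks] w by simp
    show ?thesis unfolding C Yw using X2[OF w] cu cl by auto
  qed
  then have "cellS s v ks m = (X \<inter> Y) \<inter> {w\<in>Om. age v ks m s w < S v m w}"
    by (auto simp: cellS_def)
  then show ?thesis using sets.Int[OF X(1) Y] by blast
qed

lemma before_events: "X \<in> sets (src (before v m)) ==> X \<in> events"
  using src_events[OF before_sub[of v m]] by blast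

lemma age_M: "v \<in> {1..n} ==> age v ks m s \<in> borel_measurable M"
  by (rule borel_src_imp[OF age_before before_sub])

lemma cellS_events: assumes v: "v \<in> {1..n}" shows "cellS s v ks m \<in> events"
proof -
  have [measurable]: "age v ks m s \<in> borel_measurable M" "S v m \<in> borel_measurable M" using age_M S_measurable v by auto
  have "{w\<in>space M. age v ks m s w < S v m w} \<in> events" by measurable
  then have "Om \<inter> {w\<in>space M. age v ks m s w < S v m w} \<in> events" using Om(1) by (intro sets.Int)
  moreover have "Om \<inter> {w\<in>space M. age v ks m s w < S v m w} = {w\<in>Om. age v ks m s w < S v m w}" using Om_space by auto
  ultimately have "{w\<in>Om. age v ks m s w < S v m w} \<in> events" by (simp only:)
  moreover obtain X where X: "X \<in> sets (src (before v m))" "cellS s v ks m = X \<inter> {w\<in>Om. age v ks m s w < S v m w}"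
    by (rule bexE[OF cellS_form[OF v]])
  ultimately show ?thesis using before_events[OF X(1)] unfolding X(2) by (intro sets.Int)
qed

lemma cellS_space: "cellS s v ks m \<subseteq> space M" using Om_space by (auto simp: cellS_def)

lemma KV_events: "KV s v \<subseteq> events"
  unfolding KV_def by (rule known_events)

lemma KV_Int: "F \<in> KV s v ==> F' \<in> KV s v ==> F \<inter> F' \<in> KV s v"
  unfolding KV_def by (rule known_Int)

lemma KV_Diff: "F \<in> KV s v ==> F' \<in> KV s v ==> F - F' \<in> KV s v"
  unfolding KV_def by (erule known_Diff) (simp_all only: space_src cellS_space)

lemma KV_D: "F \<in> KV s v ==> trace_in (src (before v m)) (cellS s v ks m) F"
  unfolding KV_def known_def by auto

lemma KV_past:
  assumes v: "v \<in> {1..n}"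
    and p: "\<And>ks m. trace_in (src (before v m)) (cellS s v ks m) {w\<in>space M. p ks w}"
  shows "{w\<in>Om. p (past s w) w} \<in> KV s v"
proof -
  let ?F = "{w\<in>Om. p (past s w) w}"
  have eq: "?F \<inter> cellS s v ks m = {w\<in>space M. p ks w} \<inter> cellS s v ks m" for ks m
    using Om_space by (auto simp: cellS_def)
  have tr: "trace_in (src (before v m)) (cellS s v ks m) ?F" for ks m
    unfolding trace_in_cong[OF eq] by (rule p)
  have "?F = (\<Union>a. ?F \<inter> cellS s v (fst a) (snd a))" by (auto simp: cellS_def)
  also have "... \<in> events"
  proof (intro sets.countable_UN'')
    fix a :: "nat list \<times> nat"
    obtain X where "X \<in> sets (src (before v (snd a)))" "?F \<inter> cellS s v (fst a) (snd a) = X \<inter> cellS s v (fst a) (snd a)"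
      using tr[of "snd a" "fst a"] unfolding trace_in_def by blast
    then show "?F \<inter> cellS s v (fst a) (snd a) \<in> events"
      using before_events cellS_events[OF v] by (metis sets.Int)
  qed simp
  finally have "?F \<in> events" .
  then show ?thesis using tr by (auto simp: KV_def known_def)
qed

lemma Om_KV: "v \<in> {1..n} ==> Om \<in> KV s v"
proof -
  assume v: "v \<in> {1..n}"
  have "{w\<in>Om. True} \<in> KV s v"
  proof (rule KV_past[OF v])
    show "trace_in (src (before v m)) (cellS s v ks m) {w\<in>space M. True}" for ks m
      using sets.top[of "src (before v m)"] unfolding space_src by (intro trace_in_sets) simp
  qed
  then show ?thesis by simp
qed

definition "fires_at s h v w \<longleftrightarrow> fire (past s w) s h v w"
definition "fires_twice_at s h v w \<longleftrightarrow> fire2 (past s w) s h v w"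
definition "FE s h v = {w\<in>Om. fires_at s h v w}"
definition "FE2 s h v = {w\<in>Om. fires_twice_at s h v w}"

lemma fires_sets:
  assumes T: "\<And>j. T j \<in> borel_measurable D" and S: "\<And>i. S v i \<in> borel_measurable D"
  shows "{w\<in>space D. fire ks s h v w} \<in> sets D"
    and "{w\<in>space D. fire2 ks s h v w} \<in> sets D"
proof -
  have [measurable]: "S v i \<in> borel_measurable D" for i by (rule S)
  have [measurable]: "(\<lambda>w. finished v ks s w) \<in> measurable D (count_space UNIV)"
    by (rule completed_measurable[OF T S])
  have [measurable]: "age v ks m s \<in> borel_measurable D" for m by (rule elapsed_measurable[OF T S])
  have e: "{w\<in>space D. fire ks s h v w} =
    (\<Union>m. {w\<in>space D. finished v ks s w = m \<and> S v m w \<le> age v ks m s w + h})"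
    by (auto simp: fires_def served_def Let_def)
  show "{w\<in>space D. fire ks s h v w} \<in> sets D"
    unfolding e by (intro sets.countable_UN'') auto
  have e2: "{w\<in>space D. fire2 ks s h v w} =
    (\<Union>m. {w\<in>space D. finished v ks s w = m \<and> S v m w \<le> age v ks m s w + h \<and> S v (Suc m) w \<le> h})"
    by (auto simp: fires_twice_def fires_def served_def Let_def)
  show "{w\<in>space D. fire2 ks s h v w} \<in> sets D"
    unfolding e2 by (intro sets.countable_UN'') auto
qed

lemma FE_KV: "v \<in> {1..n} ==> v' \<in> {1..n} ==> v' \<noteq> v ==> FE s h v' \<in> KV s v"
  unfolding FE_def fires_at_def
proof (rule KV_past)
  fix ks m assume "v' \<in> {1..n}" "v' \<noteq> v"
  then have S: "S v' i \<in> borel_measurable (src (before v m))" for i by (intro S_before) auto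
  show "trace_in (src (before v m)) (cellS s v ks m) {w\<in>space M. fire ks s h v' w}"
    using fires_sets(1)[OF T_before S] unfolding space_src by (rule trace_in_sets)
qed

lemma FE2_KV: "v \<in> {1..n} ==> v' \<in> {1..n} ==> v' \<noteq> v ==> FE2 s h v' \<in> KV s v"
  unfolding FE2_def fires_twice_at_def
proof (rule KV_past)
  fix ks m assume "v' \<in> {1..n}" "v' \<noteq> v"
  then have S: "S v' i \<in> borel_measurable (src (before v m))" for i by (intro S_before) auto
  show "trace_in (src (before v m)) (cellS s v ks m) {w\<in>space M. fire2 ks s h v' w}"
    using fires_sets(2)[OF T_before S] unfolding space_src by (rule trace_in_sets)
qed

lemma lev_KV:
  assumes v: "v \<in> {1..n}" and v': "v' \<in> {1..n}" and s: "0 \<le> s"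
  shows "{w\<in>Om. v' \<in> lev i s w} \<in> KV s v"
proof -
  have "{w\<in>Om. \<not> (\<exists>x<i. expl (past s w) v' s x w)} \<in> KV s v"
  proof (rule KV_past[OF v])
    fix ks m
    let ?D = "src (before v m)" and ?C = "cellS s v ks m"
    have tr: "trace_in ?D ?C {w\<in>space M. expl ks v' s x w}" for x
    proof (cases "v' = v")
      case False
      have Sv: "S v' i \<in> borel_measurable ?D" for i by (rule S_before) (use v' False in auto)
      show ?thesis
        using expl_sets[OF arrived_measurable[OF T_before] completed_measurable[OF T_before Sv]] unfolding space_src by (rule trace_in_sets)
    next
      case True
      have ex: "{w\<in>space M. q0 v + arrived (\<lambda>j. T j w) ks v s = x + (\<lambda>_. m) w} \<in> sets ?D"
        using expl_sets[OF arrived_measurable[OF T_before] measurable_const] unfolding space_src by simp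
      have "{w\<in>space M. expl ks v' s x w} \<inter> ?C = {w\<in>space M. q0 v + arrived (\<lambda>j. T j w) ks v s = x + (\<lambda>_. m) w} \<inter> ?C"
        unfolding True by (auto simp: cellS_def served_def)
      then show ?thesis unfolding trace_in_def using ex by blast
    qed
    have "{w\<in>space M. \<not> (\<exists>x<i. expl ks v' s x w)} = space ?D - (\<Union>x\<in>{..<i}. {w\<in>space M. expl ks v' s x w})"
      unfolding space_src by auto
    also have "trace_in ?D ?C ..."
      by (intro trace_in_compl trace_in_UN tr) (use cellS_space in \<open>auto simp only: space_src intro: countable_finite finite_lessThan\<close>)
    finally show "trace_in ?D ?C {w\<in>space M. \<not> (\<exists>x<i. expl ks v' s x w)}" .
  qed
  moreover have "{w\<in>Om. \<not> (\<exists>x<i. expl (past s w) v' s x w)} = {w\<in>Om. v' \<in> lev i s w}"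
    using lev_expl[OF _ s, of _ i] v' unfolding past_def by blast
  ultimately show ?thesis by simp
qed

text \<open>The positions visited in the next \<open>L\<close> steps, with \<open>L\<close> deterministic. Unlike the set visited in a window, it does not depend
  on how many jobs the window contains.\<close>

definition "sweep s L w = visited (\<lambda>l j. snd (W l j w)) d (J s w) (J s w + L)"

lemma sweep_KV:
  assumes v: "v \<in> {1..n}" shows "{w\<in>Om. v' \<in> sweep s L w} \<in> KV s v"
proof -
  have "{w\<in>Om. \<exists>p\<in>{..<d} \<times> {length (past s w)..<length (past s w) + L}. snd (W (fst p) (snd p) w) = v'} \<in> KV s v"
  proof (rule KV_past[OF v])
    fix ks :: "nat list" and m
    let ?D = "src (before v m)" and ?I = "{..<d} \<times> {length ks..<length ks + L}"
    have e: "{w\<in>space M. \<exists>p\<in>?I. snd (W (fst p) (snd p) w) = v'} = (\<Union>p\<in>?I. {w\<in>space M. snd (W (fst p) (snd p) w) = v'})" by blast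
    have "{w\<in>space M. snd (W (fst p) (snd p) w) = v'} \<in> sets ?D" if "p \<in> ?I" for p
    proof -
      have [measurable]: "W (fst p) (snd p) \<in> measurable ?D (count_space UNIV)" by (rule W_before) (use that in auto)
      have "{w\<in>space ?D. snd (W (fst p) (snd p) w) = v'} \<in> sets ?D" by measurable
      then show ?thesis unfolding space_src .
    qed
    then show "trace_in ?D (cellS s v ks m) {w\<in>space M. \<exists>p\<in>?I. snd (W (fst p) (snd p) w) = v'}"
      unfolding e by (intro trace_in_sets sets.finite_UN) auto
  qed
  moreover have "(\<exists>p\<in>{..<d} \<times> {length (past s w)..<length (past s w) + L}. snd (W (fst p) (snd p) w) = v') \<longleftrightarrow> v' \<in> sweep s L w" for w
  proof
    assume "v' \<in> sweep s L w"
    then obtain l j where "l < d" "j \<in> {J s w..<J s w + L}" "v' = snd (W l j w)" by (auto simp: sweep_def visited_def)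
    then show "\<exists>p\<in>{..<d} \<times> {length (past s w)..<length (past s w) + L}. snd (W (fst p) (snd p) w) = v'"
      by (intro bexI[of _ "(l, j)"]) (auto simp: past_def)
  next
    assume "\<exists>p\<in>{..<d} \<times> {length (past s w)..<length (past s w) + L}. snd (W (fst p) (snd p) w) = v'"
    then obtain p where "p \<in> {..<d} \<times> {J s w..<J s w + L}" "snd (W (fst p) (snd p) w) = v'" by (auto simp: past_def)
    then show "v' \<in> sweep s L w" unfolding sweep_def visited_def
      by (intro CollectI exI[of _ "fst p"] exI[of _ "snd p"]) auto
  qed
  ultimately show ?thesis by simp
qed

end

context pod_setup
begin

lemma server_cells:
  assumes v: "v \<in> {1..n}" and A: "A \<in> events" "A \<subseteq> Om" and B: "B \<in> events" and q: "0 \<le> q"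
    and le: "\<And>ks m. prob (A \<inter> cellS s v ks m) \<le> q * prob (B \<inter> cellS s v ks m)"
  shows "prob A \<le> q * prob B"
proof (rule prob_cells_le[where I = UNIV and C = "\<lambda>a. cellS s v (fst a) (snd a)", OF _ _ cellS_events[OF v] A(1) _ B q le])
  show "A \<subseteq> (\<Union>a. cellS s v (fst a) (snd a))" using A(2) by (auto simp: cellS_def)
qed (auto simp: disjoint_family_on_def cellS_def)

text \<open>On each cell the residual service time is a fresh exponential variable.\<close>

lemma cell_service:
  assumes v: "v \<in> {1..n}" and X: "X \<in> sets (src (before v m))" and h: "0 \<le> h"
  shows "prob (X \<inter> {w\<in>space M. age v ks m s w < S v m w \<and> S v m w \<le> age v ks m s w + h})
    = (1 - exp (- h)) * prob (X \<inter> {w\<in>space M. age v ks m s w < S v m w})"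
proof -
  let ?D = "src (before v m)"
  \<comment> \<open>the value \<open>- 1\<close> outside \<open>X\<close> removes these points from the memoryless identity\<close>
  define Y where "Y = (\<lambda>w. if w \<in> X then age v ks m s w else - 1)"
  have Xsp: "X \<subseteq> space M" using sets.sets_into_space[OF X] unfolding space_src .
  have YD: "Y \<in> borel_measurable ?D"
    unfolding Y_def by (rule measurable_If_set[OF age_before[OF v]]) (use X sets.Int_space_eq2[OF X] in auto)
  have SD: "S v m \<in> borel_measurable (src {Service v m})" by (rule S_measurable_src) simp
  have ind: "indep_var borel Y borel (S v m)"
    unfolding indep_var_eq
  proof (intro conjI)
    show "Y \<in> borel_measurable M" by (rule borel_src_imp[OF YD before_sub])
    show "S v m \<in> borel_measurable M" by (rule S_measurable[OF v])
    have sg: "sigma_sets (space M) {f -` A \<inter> space M | A. A \<in> sets borel} \<subseteq> sets (src Z)"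
      if "f \<in> borel_measurable (src Z)" for f :: "'a => real" and Z
    proof -
      have "{f -` A \<inter> space M | A. A \<in> sets borel} \<subseteq> sets (src Z)"
        using measurable_sets[OF that] unfolding space_src by blast
      from sets.sigma_sets_subset[OF this] show ?thesis unfolding space_src .
    qed
    have "indep_set (sets ?D) (sets (src {Service v m}))"
      unfolding indep_sets2_eq
    proof (intro conjI ballI)
      show "sets ?D \<subseteq> events" by (rule src_events[OF before_sub])
      show "sets (src {Service v m}) \<subseteq> events" by (rule src_events) (use v in auto)
      show "prob (a \<inter> b) = prob a * prob b" if "a \<in> sets ?D" "b \<in> sets (src {Service v m})" for a b
        by (rule src_indep[OF before_sub _ _ that]) (use v in \<open>auto simp: before_def\<close>)
    qed
    then show "indep_set (sigma_sets (space M) {Y -` A \<inter> space M | A. A \<in> sets borel})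
        (sigma_sets (space M) {S v m -` A \<inter> space M | A. A \<in> sets borel})"
      unfolding indep_set_def by (rule indep_sets_mono_sets) (use sg[OF YD] sg[OF SD] in \<open>auto split: bool.split\<close>)
  qed
  have e1: "X \<inter> {w\<in>space M. age v ks m s w < S v m w \<and> S v m w \<le> age v ks m s w + h}
      = {w\<in>space M. 0 \<le> Y w \<and> Y w < S v m w \<and> S v m w \<le> Y w + h}"
    using Xsp by (auto simp: Y_def elapsed_nonneg split: if_splits)
  have e2: "X \<inter> {w\<in>space M. age v ks m s w < S v m w} = {w\<in>space M. 0 \<le> Y w \<and> Y w < S v m w}"
    using Xsp by (auto simp: Y_def elapsed_nonneg split: if_splits)
  show ?thesis unfolding e1 e2 by (rule memoryless_indep[OF service_distributed[OF v] ind h])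
qed

lemma FE_events: assumes v: "v \<in> {1..n}" shows "FE s h v \<in> events" "FE2 s h v \<in> events"
proof -
  have S: "S v i \<in> borel_measurable M" for i by (rule S_measurable[OF v])
  have ev: "{w\<in>space M. fire ks s h v w} \<in> events"
     "{w\<in>space M. fire2 ks s h v w} \<in> events" for ks
    by (rule fires_sets[OF T_measurable S])+
  have "FE s h v = (\<Union>a. cellS s v (fst a) (snd a) \<inter> {w\<in>space M. fire (fst a) s h v w})"
    using Om_space by (auto simp: FE_def fires_at_def cellS_def)
  also have "... \<in> events" by (intro sets.countable_UN'' sets.Int cellS_events[OF v] ev) auto
  finally show "FE s h v \<in> events" .
  have "FE2 s h v = (\<Union>a. cellS s v (fst a) (snd a) \<inter> {w\<in>space M. fire2 (fst a) s h v w})"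
    using Om_space by (auto simp: FE2_def fires_twice_at_def cellS_def)
  also have "... \<in> events" by (intro sets.countable_UN'' sets.Int cellS_events[OF v] ev) auto
  finally show "FE2 s h v \<in> events" .
qed

lemma fires_cell:
  "w \<in> cellS s v ks m ==> fires_at s h v w \<longleftrightarrow> S v m w \<le> age v ks m s w + h"
  "w \<in> cellS s v ks m ==> fires_twice_at s h v w \<longleftrightarrow> S v m w \<le> age v ks m s w + h \<and> S v (Suc m) w \<le> h"
  by (auto simp: cellS_def fires_at_def fires_twice_at_def fires_twice_def fires_def Let_def served_def)

lemma KV_cell:
  assumes v: "v \<in> {1..n}" and F: "F \<in> KV s v"
  obtains X where "X \<in> sets (src (before v m))" "F \<inter> cellS s v ks m = X \<inter> {w\<in>Om. age v ks m s w < S v m w}"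
    "cellS s v ks m \<inter> X = F \<inter> cellS s v ks m"
proof -
  obtain X1 where X1: "X1 \<in> sets (src (before v m))" "F \<inter> cellS s v ks m = X1 \<inter> cellS s v ks m"
    using KV_D[OF F] unfolding trace_in_def by blast
  obtain X2 where X2: "X2 \<in> sets (src (before v m))" "cellS s v ks m = X2 \<inter> {w\<in>Om. age v ks m s w < S v m w}"
    by (rule bexE[OF cellS_form[OF v]])
  show ?thesis
    by (rule that[OF sets.Int[OF X1(1) X2(1)]]) (use X1(2) X2(2) in blast)+
qed

text \<open>Whatever is known about the past and about other servers, a server fires with the same probability. For a second service one more independent factor
  appears.\<close>

lemma fires_prob:
  assumes v: "v \<in> {1..n}" and F: "F \<in> KV s v" and h: "0 \<le> h"
  shows "prob (F \<inter> FE s h v) = (1 - exp (- h)) * prob F"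
    and "prob (F \<inter> FE2 s h v) \<le> (1 - exp (- h))^2 * prob F"
proof -
  let ?q = "1 - exp (- h)"
  have q: "0 \<le> ?q" using h by simp
  have Fev: "F \<in> events" using F KV_events by blast
  have FOm: "F \<inter> Om \<in> events" using Fev Om(1) by (rule sets.Int)
  note FE = FE_events[OF v, of s h]
  have Sm [measurable]: "S v m \<in> borel_measurable M" "age v ks m s \<in> borel_measurable M" for m ks using S_measurable[OF v] age_M[OF v] by auto
  have cell: "prob (F \<inter> FE s h v \<inter> cellS s v ks m) = ?q * prob (F \<inter> Om \<inter> cellS s v ks m) \<and>
    prob (F \<inter> FE2 s h v \<inter> cellS s v ks m) = ?q^2 * prob (F \<inter> Om \<inter> cellS s v ks m)" for ks m
  proof -
    obtain X where X: "X \<in> sets (src (before v m))" "F \<inter> cellS s v ks m = X \<inter> {w\<in>Om. age v ks m s w < S v m w}"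
      "cellS s v ks m \<inter> X = F \<inter> cellS s v ks m" by (rule KV_cell[OF v F])
    have Xev: "X \<in> events" by (rule before_events[OF X(1)])
    let ?A = "{w\<in>space M. age v ks m s w < S v m w}"
    let ?B = "{w\<in>space M. age v ks m s w < S v m w \<and> S v m w \<le> age v ks m s w + h}"
    let ?C = "{w\<in>space M. S v (Suc m) w \<le> h}"
    have ev: "?A \<in> events" "?B \<in> events" "?C \<in> events" by measurable
    have e0: "F \<inter> Om \<inter> cellS s v ks m = X \<inter> ?A \<inter> Om"
    proof -
      have "F \<inter> Om \<inter> cellS s v ks m = F \<inter> cellS s v ks m" by (auto simp: cellS_def)
      then show ?thesis unfolding X(2) using Om_space by auto
    qed
    have e1: "F \<inter> FE s h v \<inter> cellS s v ks m = X \<inter> ?B \<inter> Om"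
    proof -
      have "F \<inter> FE s h v \<inter> cellS s v ks m = F \<inter> cellS s v ks m \<inter> {w. S v m w \<le> age v ks m s w + h}"
        using fires_cell(1) by (auto simp: FE_def) (auto simp: cellS_def)
      then show ?thesis unfolding X(2) using Om_space by auto
    qed
    have e2: "F \<inter> FE2 s h v \<inter> cellS s v ks m = (X \<inter> ?B) \<inter> ?C \<inter> Om"
    proof -
      have "F \<inter> FE2 s h v \<inter> cellS s v ks m = F \<inter> cellS s v ks m \<inter> {w. S v m w \<le> age v ks m s w + h \<and> S v (Suc m) w \<le> h}"
        using fires_cell(2) by (auto simp: FE2_def) (auto simp: cellS_def)
      then show ?thesis unfolding X(2) using Om_space by auto
    qed
    have p1: "prob (X \<inter> ?B) = ?q * prob (X \<inter> ?A)" by (rule cell_service[OF v X(1) h])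
    have p2: "prob ((X \<inter> ?B) \<inter> ?C) = prob (X \<inter> ?B) * prob ?C"
    proof (rule src_indep)
      let ?Z = "insert (Service v m) (before v m)"
      have "X \<in> sets (src ?Z)" using src_mono[of "before v m" ?Z] X(1) by blast
      moreover have "?B \<in> sets (src ?Z)"
      proof -
        have [measurable]: "S v m \<in> borel_measurable (src ?Z)" by (rule S_measurable_src) simp
        have [measurable]: "age v ks m s \<in> borel_measurable (src ?Z)"
        proof (rule elapsed_measurable)
          show "T j \<in> borel_measurable (src ?Z)" for j by (rule T_measurable_src) (auto simp: before_def)
          show "S v i \<in> borel_measurable (src ?Z)" if "i < m" for i
            by (rule S_measurable_src) (use that v in \<open>auto simp: before_def\<close>)
        qed
        have "{w\<in>space (src ?Z). age v ks m s w < S v m w \<and> S v m w \<le> age v ks m s w + h} \<in> sets (src ?Z)" by measurable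
        then show ?thesis unfolding space_src .
      qed
      ultimately show "X \<inter> ?B \<in> sets (src ?Z)" by (rule sets.Int)
      have [measurable]: "S v (Suc m) \<in> borel_measurable (src {Service v (Suc m)})" by (rule S_measurable_src) simp
      have "{w\<in>space (src {Service v (Suc m)}). S v (Suc m) w \<le> h} \<in> sets (src {Service v (Suc m)})" by measurable
      then show "?C \<in> sets (src {Service v (Suc m)})" unfolding space_src .
    qed (use v in \<open>auto simp: before_def\<close>)
    have p3: "prob ?C = ?q" using exponential_distributedD_le[OF service_distributed[OF v, of "Suc m"] h] by simp
    have pO: "prob (X \<inter> ?A \<inter> Om) = prob (X \<inter> ?A)" "prob (X \<inter> ?B \<inter> Om) = prob (X \<inter> ?B)"
       "prob ((X \<inter> ?B) \<inter> ?C \<inter> Om) = prob ((X \<inter> ?B) \<inter> ?C)"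
      by (rule prob_Om; intro sets.Int Xev ev)+
    show ?thesis unfolding e0 e1 e2 pO p2 p1 p3 by (simp add: power2_eq_square)
  qed
  have le1: "prob (F \<inter> FE s h v) \<le> ?q * prob (F \<inter> Om)"
    by (rule server_cells[OF v _ _ FOm q, where s = s]) (use Fev FE cell in \<open>auto simp: FE_def\<close>)
  have le2: "prob (F \<inter> FE2 s h v) \<le> ?q^2 * prob (F \<inter> Om)"
    by (rule server_cells[OF v _ _ FOm zero_le_power2, where s = s]) (use Fev FE cell in \<open>auto simp: FE2_def\<close>)
  have le3: "prob (F \<inter> Om - FE s h v) \<le> exp (- h) * prob (F \<inter> Om)"
  proof (rule server_cells[OF v _ _ FOm])
    fix ks m
    have c: "cellS s v ks m \<in> events" by (rule cellS_events[OF v])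
    have e: "F \<inter> Om \<inter> cellS s v ks m = (F \<inter> FE s h v \<inter> cellS s v ks m) \<union> ((F \<inter> Om - FE s h v) \<inter> cellS s v ks m)"
      by (auto simp: FE_def)
    have "prob (F \<inter> Om \<inter> cellS s v ks m) = prob (F \<inter> FE s h v \<inter> cellS s v ks m) + prob ((F \<inter> Om - FE s h v) \<inter> cellS s v ks m)"
      by (subst e, rule finite_measure_Union) (use Fev FE c Om(1) in auto)
    then show "prob ((F \<inter> Om - FE s h v) \<inter> cellS s v ks m) \<le> exp (- h) * prob (F \<inter> Om \<inter> cellS s v ks m)"
      using cell[of ks m] by (simp add: algebra_simps)
  qed (use Fev FE Om(1) in auto)
  have "prob (F \<inter> Om) = prob (F \<inter> FE s h v) + prob (F \<inter> Om - FE s h v)"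
  proof -
    have e: "F \<inter> Om = (F \<inter> FE s h v) \<union> (F \<inter> Om - FE s h v)" by (auto simp: FE_def)
    show ?thesis by (subst e, rule finite_measure_Union) (use Fev FE Om(1) in auto)
  qed
  then have "prob (F \<inter> FE s h v) = ?q * prob (F \<inter> Om)" using le1 le3 by (simp add: algebra_simps)
  then show "prob (F \<inter> FE s h v) = ?q * prob F" "prob (F \<inter> FE2 s h v) \<le> ?q^2 * prob F"
    using le2 prob_Om[OF Fev] by auto
qed

section \<open>Service counts of a window\<close>

text \<open>The servers are revealed one by one. The events for other servers are known to each server, so the order does not matter.\<close>

lemma server_chernoff:
  fixes A Z :: "nat => 'a set"
  assumes A: "\<And>v v'. v \<in> {1..n} ==> v' \<in> {1..n} ==> A v' \<in> KV s v"
    and Z: "\<And>v v'. v \<in> {1..n} ==> v' \<in> {1..n} ==> v' \<noteq> v ==> Z v' \<in> KV s v"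
    and Zev: "\<And>v. v \<in> {1..n} ==> Z v \<in> events"
    and cond: "\<And>v F. v \<in> {1..n} ==> F \<in> KV s v ==> F \<subseteq> Om ==> prob (F \<inter> Z v) \<le> p * prob F"
    and p: "0 \<le> p" "p \<le> 2" and eps: "0 \<le> eps" "eps \<le> 1"
  shows "rare (exp (- (eps^2 * real n / 8))) {w\<in>Om. eps * real n < (\<Sum>v\<in>{1..n}. of_bool (w \<in> A v) * (of_bool (w \<in> Z v) - p))}"
proof -
  let ?f = "\<lambda>w. \<Sum>v\<in>{1..n}. of_bool (w \<in> A v) * (of_bool (w \<in> Z v) - p)"
  have shift: "?f w = (\<Sum>r<n. of_bool (w \<in> A (Suc r)) * (of_bool (w \<in> Z (Suc r)) - p))" for w
    by (rule sum.reindex_bij_witness[where i = Suc and j = "\<lambda>v. v - 1"]) auto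
  have Aev: "A v \<in> events" if "v \<in> {1..n}" for v using A[OF that that] KV_events by blast
  have fm [measurable]: "?f \<in> borel_measurable M"
    using Aev Zev by (intro borel_measurable_sum borel_measurable_times borel_measurable_diff borel_measurable_of_bool_mem borel_measurable_const) auto
  have "prob (Om \<inter> {w\<in>space M. eps * real n \<le> (\<Sum>r<n. of_bool (w \<in> A (Suc r)) * (of_bool (w \<in> Z (Suc r)) - p))})
      \<le> exp (- ((eps * real n)^2 / (8 * real n))) * prob Om"
  proof (rule adaptive_chernoff[where K = "\<lambda>r. KV s (Suc r)"])
    fix r assume r: "r < n"
    show "KV s (Suc r) \<subseteq> events" by (rule KV_events)
    show "A (Suc i) \<in> KV s (Suc r)" if "i \<le> r" for i using A r that by auto
    show "Z (Suc i) \<in> KV s (Suc r)" if "i < r" for i using Z r that by auto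
    show "Z (Suc r) \<in> events" using Zev r by auto
    show "prob (F \<inter> Z (Suc r)) \<le> p * prob F" if "F \<in> KV s (Suc r)" "F \<subseteq> Om \<inter> A (Suc r)" for F
      using cond[of "Suc r" F] r that by auto
    show "Om \<in> KV s (Suc r)" using Om_KV r by auto
  next
    show "eps * real n \<le> 4 * real n" using eps by (intro mult_right_mono) auto
  qed (use KV_Int KV_Diff p Om(1) eps n_pos in auto)
  also have "(eps * real n)^2 / (8 * real n) = eps^2 * real n / 8" using n_pos by (simp add: power2_eq_square)
  finally have b: "prob (Om \<inter> {w\<in>space M. eps * real n \<le> ?f w}) \<le> exp (- (eps^2 * real n / 8))" unfolding shift using Om(2) by simp
  have "{w\<in>space M. eps * real n \<le> ?f w} \<in> events" by measurable
  then have "Om \<inter> {w\<in>space M. eps * real n \<le> ?f w} \<in> events" using Om(1) by (intro sets.Int)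
  then show ?thesis by (rule rare_event[OF _ b]) (use Om_space in auto)
qed

definition "fired s h w = {v\<in>{1..n}. fires_at s h v w}"
definition "fired_twice s h w = {v\<in>{1..n}. fires_twice_at s h v w}"

lemma card_mem_sum: "X \<subseteq> {1..n} ==> real (card X) = (\<Sum>v\<in>{1..n}. of_bool (v \<in> X))"
  by (simp add: Int_absorb1 of_bool_def sum.If_cases)

context
  fixes s h eps :: real
  assumes s: "0 \<le> s" and h: "0 \<le> h" and eps: "0 \<le> eps" "eps \<le> 1"
begin

abbreviation "qh \<equiv> 1 - exp (- h)"

lemma q_range: "0 \<le> qh" "qh \<le> 1" "qh \<le> 2" "0 \<le> exp (- h)" "exp (- h) \<le> 2"
proof -
  have "exp (- h) \<le> 1" using h by simp
  then show "0 \<le> qh" "qh \<le> 1" "qh \<le> 2" "0 \<le> exp (- h)" "exp (- h) \<le> 2" using exp_ge_zero[of "- h"] by linarith+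
qed

lemma level_fires_bad:
  shows "rare (2 * exp (- (eps^2 * real n / 8))) {w\<in>Om. eps * real n < \<bar>real (card (lev i s w \<inter> fired s h w)) - qh * real (card (lev i s w))\<bar>}"
proof -
  let ?A = "\<lambda>v. {w\<in>Om. v \<in> lev i s w}"
  let ?x = "\<lambda>w. real (card (lev i s w \<inter> fired s h w)) - qh * real (card (lev i s w))"
  let ?up = "\<lambda>w. \<Sum>v\<in>{1..n}. of_bool (w \<in> ?A v) * (of_bool (w \<in> FE s h v) - qh)"
  let ?dn = "\<lambda>w. \<Sum>v\<in>{1..n}. of_bool (w \<in> ?A v) * (of_bool (w \<in> Om - FE s h v) - exp (- h))"
  have x: "?x w = (\<Sum>v\<in>{1..n}. of_bool (v \<in> lev i s w) * (of_bool (fires_at s h v w) - qh))" if "w \<in> Om" for w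
  proof -
    have "lev i s w \<subseteq> {1..n}" "lev i s w \<inter> fired s h w \<subseteq> {1..n}" by (auto simp: lev_def)
    then show ?thesis
      by (simp only: card_mem_sum sum_distrib_left sum_subtractf[symmetric])
        (intro sum.cong, auto simp: fired_def of_bool_def)
  qed
  have up: "?up w = ?x w" if "w \<in> Om" for w
    unfolding x[OF that] by (intro sum.cong) (use that in \<open>auto simp: FE_def of_bool_def\<close>)
  have dn: "?dn w = - ?x w" if "w \<in> Om" for w
    unfolding x[OF that] sum_negf[symmetric] by (intro sum.cong) (use that in \<open>auto simp: FE_def of_bool_def\<close>)
  have cu: "prob (F \<inter> FE s h v) \<le> qh * prob F" if "v \<in> {1..n}" "F \<in> KV s v" for v F
    using fires_prob(1)[OF that h] by simp
  have cd: "prob (F \<inter> (Om - FE s h v)) \<le> exp (- h) * prob F" if "v \<in> {1..n}" "F \<in> KV s v" "F \<subseteq> Om" for v F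
  proof -
    have Fev: "F \<in> events" using that KV_events by blast
    have "F = (F \<inter> FE s h v) \<union> (F \<inter> (Om - FE s h v))" using that(3) by auto
    then have "prob F = prob (F \<inter> FE s h v) + prob (F \<inter> (Om - FE s h v))"
      using finite_measure_Union[of "F \<inter> FE s h v" "F \<inter> (Om - FE s h v)"] Fev FE_events(1)[OF that(1)] Om(1) by auto
    then show ?thesis using fires_prob(1)[OF that(1,2) h] by (simp add: algebra_simps)
  qed
  have U: "rare (exp (- (eps^2 * real n / 8))) {w\<in>Om. eps * real n < ?up w}"
    by (intro server_chernoff[where s = s] lev_KV[OF _ _ s] FE_KV FE_events cu; (rule q_range eps)?; simp?)
  have D: "rare (exp (- (eps^2 * real n / 8))) {w\<in>Om. eps * real n < ?dn w}"
    by (intro server_chernoff[where s = s] lev_KV[OF _ _ s] KV_Diff Om_KV FE_KV sets.Diff Om(1) FE_events cd; (rule q_range eps)?; simp?)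
  show ?thesis
  proof (rule rare_mono[OF rare_Un[OF U D]])
    have "eps * real n < \<bar>?x w\<bar> \<longleftrightarrow> eps * real n < ?up w \<or> eps * real n < ?dn w" if "w \<in> Om" for w
      unfolding up[OF that] dn[OF that] by linarith
    then show "{w\<in>Om. eps * real n < \<bar>?x w\<bar>} \<subseteq> {w\<in>Om. eps * real n < ?up w} \<union> {w\<in>Om. eps * real n < ?dn w}" by blast
  qed simp
qed

lemma sweep_fires_bad:
  shows "rare (exp (- (eps^2 * real n / 8))) {w\<in>Om. eps * real n < real (card (sweep s L w \<inter> fired s h w)) - qh * real (card (sweep s L w \<inter> {1..n}))}"
proof -
  let ?A = "\<lambda>v. {w\<in>Om. v \<in> sweep s L w}"
  let ?x = "\<lambda>w. real (card (sweep s L w \<inter> fired s h w)) - qh * real (card (sweep s L w \<inter> {1..n}))"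
  let ?up = "\<lambda>w. \<Sum>v\<in>{1..n}. of_bool (w \<in> ?A v) * (of_bool (w \<in> FE s h v) - qh)"
  have up: "?x w = ?up w" if "w \<in> Om" for w
  proof -
    have "sweep s L w \<inter> {1..n} \<subseteq> {1..n}" "sweep s L w \<inter> fired s h w \<subseteq> {1..n}" by (auto simp: fired_def)
    then show ?thesis
      by (simp only: card_mem_sum sum_distrib_left sum_subtractf[symmetric])
        (intro sum.cong, use that in \<open>auto simp: fired_def FE_def of_bool_def\<close>)
  qed
  have B: "{w\<in>Om. eps * real n < real (card (sweep s L w \<inter> fired s h w)) - qh * real (card (sweep s L w \<inter> {1..n}))} = {w\<in>Om. eps * real n < ?up w}"
    using up by (intro Collect_cong) auto
  have cu: "prob (F \<inter> FE s h v) \<le> qh * prob F" if "v \<in> {1..n}" "F \<in> KV s v" for v F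
    using fires_prob(1)[OF that h] by simp
  show ?thesis
    unfolding B
    by (intro server_chernoff[where s = s] sweep_KV FE_KV FE_events cu; (rule q_range eps)?; simp?)
qed

lemma fires_twice_bad:
  shows "rare (exp (- (eps^2 * real n / 8))) {w\<in>Om. eps * real n < real (card (fired_twice s h w)) - qh^2 * real n}"
proof -
  let ?up = "\<lambda>w. \<Sum>v\<in>{1..n}. of_bool (w \<in> Om) * (of_bool (w \<in> FE2 s h v) - qh^2)"
  have up: "real (card (fired_twice s h w)) - qh^2 * real n = ?up w" if "w \<in> Om" for w
  proof -
    have f: "fired_twice s h w \<subseteq> {1..n}" by (auto simp: fired_twice_def)
    have "real (card (fired_twice s h w)) = (\<Sum>v\<in>{1..n}. of_bool (w \<in> FE2 s h v))"
      unfolding card_mem_sum[OF f] by (intro sum.cong) (use that in \<open>auto simp: fired_twice_def FE2_def\<close>)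
    then show ?thesis using that by (simp add: sum_subtractf mult.commute)
  qed
  have B: "{w\<in>Om. eps * real n < real (card (fired_twice s h w)) - qh^2 * real n} = {w\<in>Om. eps * real n < ?up w}"
    using up by (intro Collect_cong) auto
  have q2: "0 \<le> qh^2" "qh^2 \<le> 2" using q_range power_le_one[of qh 2] by auto
  show ?thesis
    unfolding B
    by (intro server_chernoff[where s = s] Om_KV FE2_KV FE_events fires_prob(2) h; use eps q2 in auto)
qed

end

end

context pod_setup
begin

section \<open>The number of arrivals\<close>

definition "arr_bad s eps = {w\<in>Om. eps * real n < \<bar>real (J s w) - lam * s * real n\<bar>}"

text \<open>The arrival count exceeds \<open>j\<close> iff the sum of \<open>j + 1\<close> interarrival times is at most \<open>s\<close>. The exponent \<open>u =
  \<theta> * l\<close> with \<open>\<theta> = eps / (4 * D)\<close> optimises \<open>\<theta> * eps - 2 * \<theta>\<^sup>2 * D\<close>; rounding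
  \<open>j\<close> in the lower tail costs a factor \<open>exp 1\<close>.\<close>

lemma arr_bad_rare:
  assumes s: "0 \<le> s" and eps: "0 < eps"
  shows "rare (4 * exp (- (eps^2 / (8 * (lam * s + eps)) * real n))) (arr_bad s eps)"
proof -
  define l where "l = lam * real n"
  define D where "D = lam * s + eps"
  define \<theta> where "\<theta> = eps / (4 * D)"
  define r where "r = eps^2 / (8 * D)"
  have l: "0 < l" using lam_pos n_pos by (simp add: l_def)
  have ls: "0 \<le> lam * s" using lam_pos s by simp
  have D: "0 < D" "eps \<le> D" using ls eps by (auto simp: D_def)
  have th: "0 < \<theta>" "\<theta> \<le> 1 / 4" using D eps by (auto simp: \<theta>_def field_simps)
  have sq: "\<theta>^2 \<le> \<theta> / 4" using th by (simp add: power2_eq_square mult_le_cancel_left)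
  have key: "\<theta> * eps - 2 * (\<theta>^2 * D) = r" using D by (simp add: \<theta>_def r_def power2_eq_square field_simps)
  have tail: "rare (exp (u * s - real (Suc j) * ln (1 + u / l))) {w\<in>Om. u * T j w \<le> u * s}" if u: "- l < u" for u j
  proof (rule rare_event)
    let ?B = "{w\<in>space M. u * (\<Sum>i\<in>{..j}. E i w) \<le> u * s}"
    show "?B \<in> events" by measurable
    show "{w\<in>Om. u * T j w \<le> u * s} \<subseteq> ?B" using Om_space by (auto simp: arrival_time_def)
    have "prob ?B \<le> exp (u * s) * (l / (l + u)) ^ Suc j"
      using exponential_sum_chernoff[OF l u, of "{..j}" E s] interarrival_distributed indep_vars_subset[OF indep_E]
      by (simp add: l_def)
    also have "l / (l + u) = exp (- ln (1 + u / l))"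
    proof -
      have "1 + u / l = (l + u) / l" using l by (simp add: field_simps)
      then show ?thesis using l u by (simp add: exp_minus)
    qed
    also have "exp (u * s) * exp (- ln (1 + u / l)) ^ Suc j = exp (u * s - real (Suc j) * ln (1 + u / l))"
      by (simp only: exp_of_nat_mult[symmetric] exp_add[symmetric]) (simp add: algebra_simps)
    finally show "prob ?B \<le> exp (u * s - real (Suc j) * ln (1 + u / l))" .
  qed
  have up: "rare (exp (- (r * real n))) {w\<in>Om. D * real n < real (J s w)}"
  proof -
    define y where "y = D * real n"
    define j where "j = nat \<lfloor>y\<rfloor>"
    have y0: "0 \<le> y" using D by (simp add: y_def)
    have j: "y \<le> real (Suc j)" "real j \<le> y" using y0 by (auto simp: j_def) linarith
    have u: "0 < \<theta> * l" using th l by simp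
    show ?thesis
    proof (rule rare_mono[OF tail[of "\<theta> * l" j]])
      show "- l < \<theta> * l" using u l by linarith
      show "{w\<in>Om. D * real n < real (J s w)} \<subseteq> {w\<in>Om. \<theta> * l * T j w \<le> \<theta> * l * s}"
      proof
        fix w assume w: "w \<in> {w\<in>Om. D * real n < real (J s w)}"
        then have "j < J s w" using j(2) by (simp add: y_def[symmetric])
        then show "w \<in> {w\<in>Om. \<theta> * l * T j w \<le> \<theta> * l * s}" using less_J[of w j s] w u by (simp add: mult_le_cancel_left)
      qed
      have "\<theta> - 2 * \<theta>^2 \<le> ln (1 + \<theta>)"
        using ln_one_plus_pos_lower_bound[of \<theta>] th zero_le_power2[of \<theta>] by linarith
      then have "y * (\<theta> - 2 * \<theta>^2) \<le> real (Suc j) * ln (1 + \<theta>)"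
        using th sq by (intro mult_mono[OF j(1)]) auto
      moreover have "\<theta> * l * s - y * (\<theta> - 2 * \<theta>^2) = - (real n * (\<theta> * eps - 2 * (\<theta>^2 * D)))"
        by (simp add: l_def y_def D_def algebra_simps power2_eq_square)
      ultimately show "exp (\<theta> * l * s - real (Suc j) * ln (1 + \<theta> * l / l)) \<le> exp (- (r * real n))"
        unfolding key using l by (simp add: mult.commute)
    qed
  qed
  have dn: "rare (3 * exp (- (r * real n))) {w\<in>Om. real (J s w) < (lam * s - eps) * real n}"
  proof -
    define x where "x = (lam * s - eps) * real n"
    define j where "j = nat \<lceil>x\<rceil> - 1"
    show ?thesis
    proof (cases "0 < x")
      case False
      then have "\<not> real (J s w) < x" for w using of_nat_0_le_iff[of "J s w"] by linarith
      then show ?thesis by (intro rare_event[of "{}"]) (auto simp: x_def[symmetric])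
    next
      case True
      then have "0 < \<lceil>x\<rceil>" by simp
      then have Sj: "real (Suc j) = of_int \<lceil>x\<rceil>" by (simp add: j_def of_nat_diff)
      have j: "x \<le> real (Suc j)" "real (Suc j) \<le> x + 1" unfolding Sj by linarith+
      have u: "0 < \<theta> * l" "\<theta> * l < 1 * l" using th l by (auto intro: mult_strict_right_mono)
      show ?thesis
      proof (rule rare_mono[OF tail[of "- (\<theta> * l)" j]])
        show "- l < - (\<theta> * l)" using u by simp
        show "{w\<in>Om. real (J s w) < (lam * s - eps) * real n} \<subseteq> {w\<in>Om. - (\<theta> * l) * T j w \<le> - (\<theta> * l) * s}"
          using less_J[of _ j s] j(1) u by (fastforce simp: x_def[symmetric] mult_le_cancel_left)
        have "real (Suc j) * - ln (1 - \<theta>) \<le> (x + 1) * (\<theta> + 2 * \<theta>^2)"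
          using ln_one_minus_pos_lower_bound[of \<theta>] th True by (intro mult_mono[OF j(2)]) auto
        moreover have "- (\<theta> * l * s) + (x + 1) * (\<theta> + 2 * \<theta>^2)
            = - (real n * (\<theta> * eps - 2 * (\<theta>^2 * D))) - 4 * (\<theta>^2 * eps) * real n + (\<theta> + 2 * \<theta>^2)"
          by (simp add: l_def x_def D_def algebra_simps power2_eq_square)
        moreover have "0 \<le> 4 * (\<theta>^2 * eps) * real n" using eps by simp
        moreover have "\<theta> + 2 * \<theta>^2 \<le> 1" using sq th by linarith
        ultimately have "- (\<theta> * l * s) + real (Suc j) * - ln (1 - \<theta>) \<le> 1 - real n * r"
          unfolding key by linarith
        then have "- (\<theta> * l) * s - real (Suc j) * ln (1 - \<theta>) \<le> 1 - r * real n"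
          by (simp only: mult_minus_left mult_minus_right mult.commute[of r] diff_conv_add_uminus)
        then have "exp (- (\<theta> * l) * s - real (Suc j) * ln (1 + - (\<theta> * l) / l)) \<le> exp (1 - r * real n)"
          using l by simp
        also have "... = exp 1 * exp (- (r * real n))" by (simp add: exp_diff exp_minus field_simps)
        also have "... \<le> 3 * exp (- (r * real n))" using exp_le by (intro mult_right_mono) auto
        finally show "exp (- (\<theta> * l) * s - real (Suc j) * ln (1 + - (\<theta> * l) / l)) \<le> 3 * exp (- (r * real n))" .
      qed
    qed
  qed
  have "eps * real n < \<bar>a - lam * s * real n\<bar> ==> D * real n < a \<or> a < (lam * s - eps) * real n" for a
    unfolding D_def distrib_right left_diff_distrib by linarith
  then show ?thesis
    by (intro rare_mono[OF rare_Un[OF up dn]]) (auto simp: arr_bad_def r_def D_def)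
qed

section \<open>One window\<close>

text \<open>The jobs that would join a queue of length at least \<open>i\<close> if all queues stayed as they are at the start of the window.\<close>

definition "clear s h i w = {j\<in>{J s w..<J (s + h) w}. \<forall>l<d. pos l j w \<in> lev i s w}"
definition "Rps s h w = repeats (\<lambda>l j. pos l j w) d (J s w) (J (s + h) w)"
definition "Vis s h w = visited (\<lambda>l j. pos l j w) d (J s w) (J (s + h) w)"
definition "errs s h w = card (Rps s h w) + card (Vis s h w \<inter> fired s h w) + card (fired_twice s h w)"
definition "excess K t w = (\<Sum>v\<in>{1..n}. real (Q v t w - K))"

lemma path_window:
  assumes w: "w \<in> Om" and s: "0 \<le> s" and h: "0 \<le> h"
  shows "1 \<le> i ==> \<bar>real (card (lev i (s + h) w)) - real (card (lev i s w)) - (real (card (clear s h (i - 1) w)) - real (card (clear s h i w)))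
      + (real (card (lev i s w \<inter> fired s h w)) - real (card (lev (Suc i) s w \<inter> fired s h w)))\<bar> \<le> 6 * real (errs s h w)"
    and "excess K (s + h) w \<le> excess K s w + real (card (clear s h K w)) + 2 * real (errs s h w)"
    and "s \<le> t ==> t \<le> s + h ==> \<bar>real (card (lev i t w)) - real (card (lev i s w))\<bar> \<le> real (J (s + h) w - J s w) + real (card (fired s h w))"
    and "s \<le> t ==> t \<le> s + h ==> excess K t w \<le> excess K s w + real (J (s + h) w - J s w)"
proof -
  note QP = Om_path[OF w]
  have past: "past s w = map (\<lambda>i. c i w) [0..<arrival_count (\<lambda>j. T j w) s]" by (simp add: past_def J_def)
  have Prange: "l < d ==> snd (W l j w) \<in> {1..n}" for l j using queue_path.P_range[OF QP] by simp
  have c: "clear s h i w = {j\<in>{arrival_count (\<lambda>j. T j w) s..<arrival_count (\<lambda>j. T j w) (s + h)}. \<forall>l<d. i \<le> Q (snd (W l j w)) s w}" for i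
  proof -
    have m: "pos l j w \<in> lev i s w \<longleftrightarrow> i \<le> Q (snd (W l j w)) s w" if "l < d" for l j
      using Prange[OF that, of j] by (simp add: lev_def pos_def)
    show ?thesis unfolding clear_def J_def using m by auto
  qed
  have le: "lev i t w = {v\<in>{1..n}. i \<le> Q v t w}" for i t by (simp add: lev_def)
  have lf: "lev i s w \<inter> fired s h w = {v\<in>{1..n}. i \<le> Q v s w \<and> fires (\<lambda>j. T j w) q0 (map (\<lambda>i. c i w) [0..<arrival_count (\<lambda>j. T j w) s]) (\<lambda>v m. S v m w) s h v}" for i
    by (auto simp: lev_def fired_def fires_at_def past)
  have f: "fired s h w = {v\<in>{1..n}. fires (\<lambda>j. T j w) q0 (map (\<lambda>i. c i w) [0..<arrival_count (\<lambda>j. T j w) s]) (\<lambda>v m. S v m w) s h v}"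
    by (auto simp: fired_def fires_at_def past)
  have vf: "Vis s h w \<inter> fired s h w = {v\<in>visited (\<lambda>l j. snd (W l j w)) d (arrival_count (\<lambda>j. T j w) s) (arrival_count (\<lambda>j. T j w) (s + h)).
      fires (\<lambda>j. T j w) q0 (map (\<lambda>i. c i w) [0..<arrival_count (\<lambda>j. T j w) s]) (\<lambda>v m. S v m w) s h v}"
    unfolding f Vis_def J_def pos_def visited_def using Prange by auto
  have er: "errs s h w = queue_path.err n d (\<lambda>j. T j w) (\<lambda>j. c j w) q0 (\<lambda>v m. S v m w) (\<lambda>l j. snd (W l j w)) s h"
    unfolding queue_path.err_def[OF QP s h] errs_def vf by (simp add: Rps_def J_def pos_def fired_twice_def fires_twice_at_def past)
  show "1 \<le> i ==> \<bar>real (card (lev i (s + h) w)) - real (card (lev i s w)) - (real (card (clear s h (i - 1) w)) - real (card (clear s h i w)))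
      + (real (card (lev i s w \<inter> fired s h w)) - real (card (lev (Suc i) s w \<inter> fired s h w)))\<bar> \<le> 6 * real (errs s h w)"
    unfolding er lf c unfolding le by (rule queue_path.window_level[OF QP s h])
  show "excess K (s + h) w \<le> excess K s w + real (card (clear s h K w)) + 2 * real (errs s h w)"
    unfolding excess_def er c by (rule queue_path.window_tail[OF QP s h])
  assume t: "s \<le> t" "t \<le> s + h"
  show "\<bar>real (card (lev i t w)) - real (card (lev i s w))\<bar> \<le> real (J (s + h) w - J s w) + real (card (fired s h w))"
    using queue_path.within_window(1)[OF QP s h t, of i] unfolding le f J_def by simp
  show "excess K t w \<le> excess K s w + real (J (s + h) w - J s w)"
    using queue_path.within_window(2)[OF QP s h t, of K] unfolding excess_def J_def by simp
qed

lemma Q_start: "w \<in> Om ==> v \<in> {1..n} ==> Q v 0 w = q0 v"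
  by (rule queue_path.Q_0[OF Om_path])

text \<open>Markov's inequality for the number of jobs in the system, which is at most the initial number plus the arrivals.\<close>

lemma mass_bound:
  assumes w: "w \<in> Om" and s: "0 \<le> s"
  shows "real K * real (card (lev K s w)) \<le> (\<Sum>v\<in>{1..n}. real (q0 v)) + real (J s w)"
proof -
  have "real K * real (card (lev K s w)) = (\<Sum>v\<in>lev K s w. real K)" by simp
  also have "... \<le> (\<Sum>v\<in>lev K s w. real (Q v s w))" by (intro sum_mono) (auto simp: lev_def)
  also have "... \<le> (\<Sum>v\<in>{1..n}. real (Q v s w))" by (intro sum_mono2) (auto simp: lev_def)
  also have "... = excess 0 (0 + s) w" by (simp add: excess_def)
  also have "... \<le> excess 0 0 w + real (J (0 + s) w - J 0 w)"
    by (rule path_window(4)[OF w]) (use s in auto)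
  also have "excess 0 0 w = (\<Sum>v\<in>{1..n}. real (q0 v))" unfolding excess_def using Q_start[OF w] by (intro sum.cong) auto
  finally show ?thesis by simp
qed

end

text \<open>Six times the bound on \<open>errs\<close>, twice that of \<open>clear_count\<close> and twice that of \<open>fired_level\<close>.\<close>

definition win_C :: "nat => real" where "win_C d = 6 * (real d)^2 + 54 * real d + 48"

text \<open>The sum of the failure probabilities of the events in \<open>win_bad\<close>, with all tolerances equal to \<open>h\<close> for the walkers and
  \<open>h\<^sup>2\<close> otherwise.\<close>

definition window_bound :: "real => nat => real => real => nat => nat => nat => nat => real" where
  "window_bound lam d s h K n tau L =
    4 * exp (- (h^4 / (8 * (lam * s + h^2)) * real n)) + 4 * exp (- (h^4 / (8 * (lam * (s + h) + h^2)) * real n))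
    + real (Suc (Suc K)) * (2 * exp (- (h^4 * real n / 8))) + exp (- (h^4 * real n / 8)) + exp (- (h^4 * real n / 8))
    + real (Suc (Suc K)) * (real d * (2 * real tau * exp (- (h^2 * real L / (8 * real tau)))))
    + real d * (real tau * exp (- (h^2 * real L / (8 * real tau))))"

lemma combine_abs:
  fixes a b c1 c2 f1 f2 e x y :: real
  assumes "\<bar>a - b - (c1 - c2) + (f1 - f2)\<bar> \<le> e" "\<bar>c1 - c1'\<bar> \<le> x" "\<bar>c2 - c2'\<bar> \<le> x" "\<bar>f1 - f1'\<bar> \<le> y" "\<bar>f2 - f2'\<bar> \<le> y"
  shows "\<bar>a - b - (c1' - c2') + (f1' - f2')\<bar> \<le> e + 2 * x + 2 * y"
  using assms by linarith

context pod_setup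
begin

definition "win_bad s h tau rho L I = arr_bad s (h^2) \<union> arr_bad (s + h) (h^2)
  \<union> (\<Union>i\<in>{..I}. {w\<in>Om. h^2 * real n < \<bar>real (card (lev i s w \<inter> fired s h w)) - (1 - exp (- h)) * real (card (lev i s w))\<bar>})
  \<union> {w\<in>Om. h^2 * real n < real (card (sweep s L w \<inter> fired s h w)) - (1 - exp (- h)) * real (card (sweep s L w \<inter> {1..n}))}
  \<union> {w\<in>Om. h^2 * real n < real (card (fired_twice s h w)) - (1 - exp (- h))^2 * real n}
  \<union> (\<Union>i\<in>{..I}. \<Union>l\<in>{..<d}. step_bad s h h tau L l i)
  \<union> (\<Union>l\<in>{..<d}. rep_bad s h h tau rho L l)"

context
  fixes s h :: real and tau rho L :: nat
  assumes s: "0 \<le> s" and h: "0 < h" "h \<le> 1" and tau: "0 < tau" "tau \<le> L"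
    and mix: "\<And>B e. B \<subseteq> {1..n} ==> e \<in> G ==>
      \<bar>(nb_op G ^^ tau) (\<lambda>e. of_bool (snd e \<in> B)) e - real (card B) / real n\<bar> \<le> h"
    and girth: "enat (2 * rho) < girth G"
begin

lemma win_bad_rare:
  assumes "rep_p h tau rho L \<le> 2"
  shows "rare (window_bound lam d s h K n tau L) (win_bad s h tau rho L (Suc K))"
proof -
  have d0: "0 \<le> h" using h by simp
  have d2: "0 \<le> h^2" "h^2 \<le> 1" "0 < h^2" using h power_le_one[of h 2] by auto
  have d4: "(h^2)^2 = h^4" by (simp add: power_mult[symmetric])
  have sh: "0 \<le> s + h" using s h by simp
  note st = step_bad_prob[OF s tau d0 h(2) d0 h(2) mix girth, unfolded tail_bd_def]
  note rp = rep_bad_prob[OF s tau d0 h(2) d0 h(2) mix girth _ assms, unfolded tail_bd_def]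
  have "rare (real (card {..<d}) * p) (\<Union>l\<in>{..<d}. A l)" if "\<And>l. l < d ==> rare p (A l)" for p and A :: "nat => 'a set"
    by (rule rare_UN) (use that in auto)
  note walkers_UN = this[unfolded card_lessThan]
  have levels_UN: "rare (real (Suc (Suc K)) * p) (\<Union>i\<in>{..Suc K}. A i)" if "\<And>i. rare p (A i)" for p and A :: "nat => 'a set"
    using rare_UN[OF finite_atMost[of "Suc K"] that] by simp
  show ?thesis
    unfolding win_bad_def window_bound_def
    by (intro rare_Un arr_bad_rare[OF s d2(3), unfolded d4] arr_bad_rare[OF sh d2(3), unfolded d4]
      levels_UN level_fires_bad[OF s d0 d2(1,2), unfolded d4] sweep_fires_bad[OF s d0 d2(1,2), unfolded d4]
      fires_twice_bad[OF s d0 d2(1,2), unfolded d4] walkers_UN st rp)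
qed

lemma rate_bounds: "0 \<le> 1 - exp (- h)" "1 - exp (- h) \<le> h" "h - h^2 \<le> 1 - exp (- h)"
proof -
  show "0 \<le> 1 - exp (- h)" using h by simp
  show "1 - exp (- h) \<le> h" using exp_ge_add_one_self[of "- h"] by linarith
  have "(1 + h) * exp (- h) \<le> exp h * exp (- h)" using exp_ge_add_one_self[of h] by (intro mult_right_mono) auto
  then have "(1 + h) * exp (- h) \<le> 1" by (simp add: exp_minus)
  moreover have "1 \<le> (1 + h) * (1 - h + h^2)"
  proof -
    have "(1 + h) * (1 - h + h^2) = 1 + h^3" by (simp add: algebra_simps power2_eq_square power3_eq_cube)
    then show ?thesis using h by simp
  qed
  ultimately have "(1 + h) * exp (- h) \<le> (1 + h) * (1 - h + h^2)" by linarith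
  then have "exp (- h) \<le> 1 - h + h^2" using h by (simp add: mult_le_cancel_left)
  then show "h - h^2 \<le> 1 - exp (- h)" by linarith
qed

context
  fixes w I
  assumes lam1: "lam \<le> 1" and L: "real L \<le> lam * h * real n" "lam * h * real n \<le> real L + 1"
    and small: "real tau \<le> h^2 * real n" "1 \<le> h^2 * real n" "real tau * (1 / real (k - 1) ^ rho) \<le> h"
    and w: "w \<in> Om" and ok: "w \<notin> win_bad s h tau rho L I"
begin

abbreviation "quad \<equiv> h^2 * real n"
abbreviation "ratio i t \<equiv> real (card (lev i t w)) / real n"

lemma u0: "0 \<le> quad" by simp

lemma L_le: "real L \<le> h * real n" "h * real L \<le> quad"
proof -
  have "lam * (h * real n) \<le> 1 * (h * real n)" using lam1 h by (intro mult_right_mono) auto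
  then show 1: "real L \<le> h * real n" using L(1) by (simp add: mult.assoc)
  then have "h * real L \<le> h * (h * real n)" using h by (intro mult_left_mono) auto
  then show "h * real L \<le> quad" by (simp add: power2_eq_square)
qed

lemma arrivals: "\<bar>real (J s w) - lam * s * real n\<bar> \<le> quad" "\<bar>real (J (s + h) w) - lam * (s + h) * real n\<bar> \<le> quad"
  using ok w unfolding win_bad_def arr_bad_def by (auto simp: not_less)

lemma J_le: "J s w \<le> J (s + h) w"
  using queue_path.J_mono[OF Om_path[OF w], of s "s + h"] h by (simp add: J_def)

lemma window_jobs: "\<bar>real (J (s + h) w - J s w) - real L\<bar> \<le> 3 * quad" "real (J (s + h) w - J s w) \<le> h * real n + 3 * quad"
proof -
  have "lam * (s + h) * real n = lam * s * real n + lam * h * real n" by (simp add: algebra_simps)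
  then show 1: "\<bar>real (J (s + h) w - J s w) - real L\<bar> \<le> 3 * quad"
    using arrivals of_nat_diff[OF J_le, where 'a = real] L small(2) by linarith
  then show "real (J (s + h) w - J s w) \<le> h * real n + 3 * quad" using L_le(1) by linarith
qed

lemma lev_le: "0 \<le> ratio i t" "ratio i t \<le> 1"
proof -
  have "card (lev i t w) \<le> card {1..n}" by (intro card_mono) (auto simp: lev_def)
  then show "0 \<le> ratio i t" "ratio i t \<le> 1" using n_pos by auto
qed

lemma p_n: "real (card (lev i t w)) = ratio i t * real n" using n_pos by simp

lemma fired_level: "i \<le> I ==> \<bar>real (card (lev i s w \<inter> fired s h w)) - h * (ratio i s * real n)\<bar> \<le> 2 * quad"
proof -
  assume i: "i \<le> I"
  let ?q = "1 - exp (- h)"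
  have 1: "\<bar>real (card (lev i s w \<inter> fired s h w)) - ?q * (ratio i s * real n)\<bar> \<le> quad"
    using ok w i unfolding win_bad_def p_n[symmetric] by (auto simp: not_less)
  have pn: "0 \<le> ratio i s * real n" "ratio i s * real n \<le> 1 * real n" using lev_le[of i s] by (intro mult_nonneg_nonneg mult_right_mono; simp)+
  have "\<bar>h - ?q\<bar> * (ratio i s * real n) \<le> h^2 * (1 * real n)"
  proof (rule mult_mono)
    show "\<bar>h - ?q\<bar> \<le> h^2" using rate_bounds by linarith
  qed (rule pn zero_le_power2)+
  then have "\<bar>(h - ?q) * (ratio i s * real n)\<bar> \<le> quad" using pn(1) by (simp add: abs_mult)
  then have "\<bar>h * (ratio i s * real n) - ?q * (ratio i s * real n)\<bar> \<le> quad" by (simp only: left_diff_distrib)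
  then show ?thesis using 1 by linarith
qed

text \<open>The window contains a random number of jobs, but \<open>L\<close> is within \<open>O(h\<^sup>2 * n)\<close> of it, so the first \<open>L\<close> jobs
  after \<open>s\<close> decide.\<close>

lemma clear_count: "i \<le> I ==> \<bar>real (card (clear s h i w)) - lam * h * real n * ratio i s ^ d\<bar> \<le> (3 * real d + 4) * quad"
proof -
  assume i: "i \<le> I"
  let ?A = "lev i s w" and ?m = "J (s + h) w - J s w"
  have d0: "0 \<le> h" using h by simp
  have nb: "w \<notin> step_bad s h h tau L l i" if "l < d" for l using ok i that unfolding win_bad_def by auto
  have h: "\<bar>real (card (hits s d L w ?A)) - real L * ratio i s ^ d\<bar> \<le> real d * slack h h tau L"
    by (rule hits_telescope[OF s tau d0 h(2) d0 h(2) mix girth w nb])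
  have "slack h h tau L \<le> 3 * quad" unfolding slack_def using L_le(2) small(1) by (simp add: algebra_simps)
  then have sl: "real d * slack h h tau L \<le> real d * (3 * quad)" by (intro mult_left_mono) auto
  have cl: "\<bar>real (card (clear s h i w)) - real (card (hits s d L w ?A))\<bar> \<le> \<bar>real ?m - real L\<bar>"
  proof -
    define X where "X = (\<lambda>m. {j\<in>{..<m}. \<forall>l<d. pos l (J s w + j) w \<in> ?A})"
    have "clear s h i w = (\<lambda>j. J s w + j) ` X ?m"
    proof (rule equalityI; rule subsetI)
      fix j assume j: "j \<in> clear s h i w"
      then have "j = J s w + (j - J s w)" "j - J s w \<in> X ?m" by (auto simp: clear_def X_def)
      then show "j \<in> (\<lambda>j. J s w + j) ` X ?m" by (rule image_eqI)
    qed (auto simp: clear_def X_def)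
    then have c1: "card (clear s h i w) = card (X ?m)" by (simp add: card_image inj_on_def)
    have c2: "hits s d L w ?A = X L" by (simp add: hits_def X_def)
    have step: "card (X a) \<le> card (X b) \<and> card (X b) \<le> card (X a) + (b - a)" if "a \<le> b" for a b
    proof
      show "card (X a) \<le> card (X b)" using that by (intro card_mono) (auto simp: X_def)
      have "card (X b) \<le> card (X a \<union> {a..<b})" by (intro card_mono) (auto simp: X_def)
      also have "... \<le> card (X a) + card {a..<b}" by (rule card_Un_le)
      finally show "card (X b) \<le> card (X a) + (b - a)" by simp
    qed
    show ?thesis unfolding c1 c2
    proof (cases "L \<le> ?m")
      case True
      then show "\<bar>real (card (X ?m)) - real (card (X L))\<bar> \<le> \<bar>real ?m - real L\<bar>" using step[OF True] by linarith
    next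
      case False
      then show "\<bar>real (card (X ?m)) - real (card (X L))\<bar> \<le> \<bar>real ?m - real L\<bar>" using step[of ?m L] by linarith
    qed
  qed
  have pd: "0 \<le> ratio i s ^ d" "ratio i s ^ d \<le> 1" using lev_le by (auto simp: power_le_one)
  have "\<bar>real L * ratio i s ^ d - lam * h * real n * ratio i s ^ d\<bar> = \<bar>real L - lam * h * real n\<bar> * ratio i s ^ d"
    using pd(1) by (simp add: left_diff_distrib[symmetric] abs_mult)
  also have "... \<le> quad * 1" using L small(2) pd by (intro mult_mono) auto
  finally have "\<bar>real L * ratio i s ^ d - lam * h * real n * ratio i s ^ d\<bar> \<le> quad" by simp
  moreover have "(3 * real d + 4) * quad = real d * (3 * quad) + 4 * quad" by (simp add: algebra_simps)
  ultimately show ?thesis using h sl cl window_jobs(1) by linarith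
qed

lemma repeats_count: "real (card (Rps s h w)) \<le> ((real d)^2 + 4 * real d + 3) * quad"
proof -
  let ?m = "J (s + h) w - J s w"
  have d0: "0 \<le> h" using h by simp
  have sub: "Rps s h w \<subseteq> (\<Union>l\<in>{..<d}. (\<lambda>j. J s w + j) ` rep_set s L l w) \<union> {J s w + L..<J s w + ?m}"
  proof
    fix j assume j: "j \<in> Rps s h w"
    then obtain l j' l' where jl: "J s w \<le> j" "j < J (s + h) w" "l < d" "J s w \<le> j'" "j' < j" "l' < d" "pos l' j' w = pos l j w"
      unfolding Rps_def repeats_def by auto
    show "j \<in> (\<Union>l\<in>{..<d}. (\<lambda>j. J s w + j) ` rep_set s L l w) \<union> {J s w + L..<J s w + ?m}"
    proof (cases "j < J s w + L")
      case True
      have "\<exists>i'<j - J s w. \<exists>l'<d. pos l' (J s w + i') w = pos l (J s w + (j - J s w)) w"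
        using jl by (intro exI[of _ "j' - J s w"] conjI exI[of _ l']) auto
      then have "j - J s w \<in> rep_set s L l w" using True jl(1) by (auto simp: rep_set_def)
      moreover have "j = J s w + (j - J s w)" using jl(1) by simp
      ultimately show ?thesis using jl(3) by blast
    qed (use jl in auto)
  qed
  have fin: "finite (rep_set s L l w)" for l by (simp add: rep_set_def)
  have "card (Rps s h w) \<le> card (\<Union>l\<in>{..<d}. (\<lambda>j. J s w + j) ` rep_set s L l w) + card {J s w + L..<J s w + ?m}"
    by (rule order.trans[OF card_mono[OF _ sub] card_Un_le]) (use fin in auto)
  also have "card (\<Union>l\<in>{..<d}. (\<lambda>j. J s w + j) ` rep_set s L l w) \<le> (\<Sum>l\<in>{..<d}. card ((\<lambda>j. J s w + j) ` rep_set s L l w))"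
    by (rule card_UN_le) simp
  also have "... \<le> (\<Sum>l\<in>{..<d}. card (rep_set s L l w))" by (intro sum_mono card_image_le fin)
  finally have c: "real (card (Rps s h w)) \<le> (\<Sum>l\<in>{..<d}. real (card (rep_set s L l w))) + real (?m - L)"
    by (simp add: of_nat_sum[symmetric] of_nat_add[symmetric] del: of_nat_sum of_nat_add)
  have ml: "real (?m - L) \<le> 3 * quad" using window_jobs(1) u0 by linarith
  have "real (card (rep_set s L l w)) \<le> (real d + 4) * quad" if l: "l < d" for l
  proof -
    have "w \<notin> rep_bad s h h tau rho L l" using ok l unfolding win_bad_def by auto
    then have 1: "real (card (rep_set s L l w)) \<le> rep_p h tau rho L * real L + h * real L + real tau"
      using w unfolding rep_bad_def by (auto simp: not_less)
    have "real (d * L) / real n \<le> real d * h"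
      using L_le(1) n_pos by (simp add: divide_le_eq mult.assoc mult_left_mono)
    then have "rep_p h tau rho L \<le> (real d + 2) * h" unfolding rep_p_def using small(3) by (simp add: algebra_simps)
    then have "rep_p h tau rho L * real L \<le> (real d + 2) * h * real L" by (intro mult_right_mono) auto
    also have "... = (real d + 2) * (h * real L)" by simp
    also have "... \<le> (real d + 2) * quad" using L_le(2) by (intro mult_left_mono) auto
    finally have 2: "rep_p h tau rho L * real L \<le> (real d + 2) * quad" .
    have "(real d + 4) * quad = (real d + 2) * quad + 2 * quad" by (simp add: algebra_simps)
    then show ?thesis using 1 2 L_le(2) small(1) by linarith
  qed
  then have "(\<Sum>l\<in>{..<d}. real (card (rep_set s L l w))) \<le> (\<Sum>l\<in>{..<d}. (real d + 4) * quad)" by (intro sum_mono) auto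
  also have "... = real d * (real d + 4) * quad" by simp
  finally have "real (card (Rps s h w)) \<le> real d * (real d + 4) * quad + 3 * quad" using c ml by linarith
  also have "... = ((real d)^2 + 4 * real d + 3) * quad" by (simp add: algebra_simps power2_eq_square)
  finally show ?thesis .
qed

lemma visited_fired_count: "real (card (Vis s h w \<inter> fired s h w)) \<le> (4 * real d + 1) * quad"
proof -
  let ?m = "J (s + h) w - J s w"
  let ?X = "(\<lambda>(l, j). pos l j w) ` ({..<d} \<times> {J s w + L..<J s w + ?m})"
  let ?q = "1 - exp (- h)"
  have d0: "0 \<le> h" using h by simp
  have finf: "finite (fired s h w)" by (simp add: fired_def)
  have sub: "Vis s h w \<inter> fired s h w \<subseteq> (sweep s L w \<inter> fired s h w) \<union> ?X"
  proof
    fix v assume v: "v \<in> Vis s h w \<inter> fired s h w"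
    then obtain l j where lj: "l < d" "J s w \<le> j" "j < J (s + h) w" "v = pos l j w" unfolding Vis_def visited_def by auto
    show "v \<in> (sweep s L w \<inter> fired s h w) \<union> ?X"
    proof (cases "j < J s w + L")
      case True
      then have "v \<in> sweep s L w" unfolding sweep_def visited_def using lj by (auto simp: pos_def)
      then show ?thesis using v by blast
    next
      case False
      then have "v \<in> ?X" unfolding lj(4) using lj by (intro image_eqI[of _ _ "(l, j)"]) auto
      then show ?thesis by blast
    qed
  qed
  have "card (Vis s h w \<inter> fired s h w) \<le> card (sweep s L w \<inter> fired s h w) + card ?X"
    by (rule order.trans[OF card_mono[OF _ sub] card_Un_le]) (use finf in auto)
  also have "card ?X \<le> card ({..<d} \<times> {J s w + L..<J s w + ?m})" by (rule card_image_le) simp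
  also have "... = d * (?m - L)" by simp
  finally have c: "real (card (Vis s h w \<inter> fired s h w)) \<le> real (card (sweep s L w \<inter> fired s h w)) + real d * real (?m - L)"
    by (simp add: of_nat_mult[symmetric] of_nat_add[symmetric] del: of_nat_mult of_nat_add)
  have "real (?m - L) \<le> 3 * quad" using window_jobs(1) u0 by linarith
  then have ml: "real d * real (?m - L) \<le> real d * (3 * quad)" by (intro mult_left_mono) auto
  have 1: "real (card (sweep s L w \<inter> fired s h w)) \<le> ?q * real (card (sweep s L w \<inter> {1..n})) + quad"
    using ok w unfolding win_bad_def by (auto simp: not_less)
  have "card (sweep s L w \<inter> {1..n}) \<le> card ((\<lambda>(l, j). pos l j w) ` ({..<d} \<times> {J s w..<J s w + L}))"
  proof (rule card_mono)
    show "sweep s L w \<inter> {1..n} \<subseteq> (\<lambda>(l, j). pos l j w) ` ({..<d} \<times> {J s w..<J s w + L})"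
      unfolding sweep_def visited_def by (auto simp: pos_def image_iff)
  qed simp
  also have "... \<le> card ({..<d} \<times> {J s w..<J s w + L})" by (rule card_image_le) simp
  finally have "card (sweep s L w \<inter> {1..n}) \<le> d * L" by simp
  then have "real (card (sweep s L w \<inter> {1..n})) \<le> real d * real L" by (simp add: of_nat_mult[symmetric] del: of_nat_mult)
  then have "?q * real (card (sweep s L w \<inter> {1..n})) \<le> h * (real d * real L)"
    using rate_bounds d0 by (intro mult_mono) auto
  also have "... = real d * (h * real L)" by simp
  also have "... \<le> real d * quad" using L_le(2) by (intro mult_left_mono) auto
  finally have 2: "?q * real (card (sweep s L w \<inter> {1..n})) \<le> real d * quad" .
  have "(4 * real d + 1) * quad = real d * quad + quad + real d * (3 * quad)" by (simp add: algebra_simps)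
  then show ?thesis using c ml 1 2 by linarith
qed

lemma twice_count: "real (card (fired_twice s h w)) \<le> 2 * quad"
proof -
  have "real (card (fired_twice s h w)) - (1 - exp (- h))^2 * real n \<le> quad"
    using ok w unfolding win_bad_def by (auto simp: not_less)
  moreover have "(1 - exp (- h))^2 * real n \<le> quad"
    using rate_bounds by (intro mult_right_mono power_mono) auto
  ultimately show ?thesis by linarith
qed

lemma errs_count: "real (errs s h w) \<le> ((real d)^2 + 8 * real d + 6) * quad"
proof -
  have "real (errs s h w) \<le> ((real d)^2 + 4 * real d + 3) * quad + (4 * real d + 1) * quad + 2 * quad"
    using repeats_count visited_fired_count twice_count unfolding errs_def of_nat_add by linarith
  then show ?thesis by (simp add: algebra_simps)
qed

lemma step_level:
  assumes i: "1 \<le> i" "Suc i \<le> I"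
  shows "\<bar>ratio i (s + h) - ratio i s - h * (lam * (ratio (i - 1) s ^ d - ratio i s ^ d) - (ratio i s - ratio (i + 1) s))\<bar> \<le> win_C d * h^2"
proof -
  have d0: "0 \<le> h" using h by simp
  note W = path_window(1)[OF w s d0 i(1)]
  note C1 = clear_count[of "i - 1"] clear_count[of i]
  note F1 = fired_level[of i] fired_level[of "Suc i"]
  let ?E = "ratio i (s + h) * real n - ratio i s * real n - (lam * h * real n * ratio (i - 1) s ^ d - lam * h * real n * ratio i s ^ d)
     + (h * (ratio i s * real n) - h * (ratio (Suc i) s * real n))"
  have win: "win_C d * quad = 6 * (((real d)^2 + 8 * real d + 6) * quad) + 2 * ((3 * real d + 4) * quad) + 4 * quad"
    by (simp add: win_C_def algebra_simps)
  have "\<bar>?E\<bar> \<le> win_C d * quad"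
  proof -
    have "\<bar>?E\<bar> \<le> 6 * real (errs s h w) + 2 * ((3 * real d + 4) * quad) + 2 * (2 * quad)"
      unfolding p_n[symmetric]
      by (rule combine_abs[OF W C1(1) C1(2) F1(1)[unfolded p_n[symmetric]] F1(2)[unfolded p_n[symmetric]]]) (use i in auto)
    then show ?thesis unfolding win using errs_count by linarith
  qed
  also have "?E = real n * (ratio i (s + h) - ratio i s - h * (lam * (ratio (i - 1) s ^ d - ratio i s ^ d) - (ratio i s - ratio (i + 1) s)))"
    using n_pos by (simp add: algebra_simps del: times_divide_eq_right times_divide_eq_left)
  finally have "real n * \<bar>ratio i (s + h) - ratio i s - h * (lam * (ratio (i - 1) s ^ d - ratio i s ^ d) - (ratio i s - ratio (i + 1) s))\<bar> \<le> real n * (win_C d * h^2)"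
    by (simp add: abs_mult mult_ac)
  then show ?thesis using n_pos by (simp add: mult_le_cancel_left)
qed

lemma step_tail:
  assumes K: "K \<le> I"
  shows "excess K (s + h) w \<le> excess K s w + h * (ratio K s * real n) + win_C d * quad"
proof -
  have d0: "0 \<le> h" using h by simp
  have pd: "ratio K s ^ d \<le> ratio K s ^ 1" using lev_le d_pos by (intro power_decreasing) auto
  have "lam * h * real n * ratio K s ^ d \<le> 1 * h * real n * ratio K s"
    using lam1 lam_pos h lev_le pd by (intro mult_mono) auto
  moreover have "win_C d * quad = 2 * (((real d)^2 + 8 * real d + 6) * quad) + (3 * real d + 4) * quad + (4 * (real d)^2 + 35 * real d + 32) * quad"
    by (simp add: win_C_def algebra_simps)
  moreover have "0 \<le> (4 * (real d)^2 + 35 * real d + 32) * quad" by (intro mult_nonneg_nonneg) auto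
  moreover have "1 * h * real n * ratio K s = h * (ratio K s * real n)" by (simp add: mult_ac)
  ultimately show ?thesis using path_window(2)[OF w s d0, of K] clear_count[OF K] errs_count by linarith
qed

lemma within_level:
  assumes t: "s \<le> t" "t \<le> s + h"
  shows "\<bar>ratio i t - ratio i s\<bar> \<le> win_C d * h" and "excess K t w \<le> excess K s w + win_C d * h * real n"
proof -
  have d0: "0 \<le> h" using h by simp
  have ud: "quad \<le> h * real n" using h by (intro mult_right_mono) (auto simp: power2_eq_square mult_le_cancel_left1)
  have f: "lev 0 s w \<inter> fired s h w = fired s h w" "lev 0 s w = {1..n}" by (auto simp: lev_def fired_def)
  have r1: "ratio 0 s = 1" using n_pos by (simp add: f)
  then have fc: "real (card (fired s h w)) \<le> h * real n + 2 * quad" using fired_level[of 0, unfolded f(1) r1] by linarith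
  have C: "7 * (h * real n) \<le> win_C d * (h * real n)"
  proof (rule mult_right_mono)
    have "0 \<le> (real d)^2" "0 \<le> real d" by auto
    then show "7 \<le> win_C d" unfolding win_C_def by linarith
  qed (use d0 in simp)
  have "\<bar>real (card (lev i t w)) - real (card (lev i s w))\<bar> \<le> win_C d * (h * real n)"
    using path_window(3)[OF w s d0 t, of i] window_jobs(2) fc ud C by linarith
  then have "\<bar>real (card (lev i t w)) - real (card (lev i s w))\<bar> / real n \<le> win_C d * (h * real n) / real n"
    by (rule divide_right_mono) simp
  then show "\<bar>ratio i t - ratio i s\<bar> \<le> win_C d * h" using n_pos by (simp add: abs_divide diff_divide_distrib[symmetric])
  have "real (J (s + h) w - J s w) \<le> win_C d * (h * real n)" using window_jobs(2) ud C mult_nonneg_nonneg[OF d0 of_nat_0_le_iff[of n]] by linarith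
  then show "excess K t w \<le> excess K s w + win_C d * h * real n" using path_window(4)[OF w s d0 t, of K] by (simp add: mult.assoc)
qed

text \<open>A level \<open>K\<close> is reached by a proportion of order \<open>1 / K\<close> only, uniformly in bounded time.\<close>

lemma level_markov: "real K * ratio K s \<le> (\<Sum>v\<in>{1..n}. real (q0 v)) / real n + s + 1"
proof -
  have "real K * (ratio K s * real n) \<le> (\<Sum>v\<in>{1..n}. real (q0 v)) + real (J s w)"
    using mass_bound[OF w s, of K] unfolding p_n[symmetric] .
  also have "real (J s w) \<le> lam * s * real n + quad" using arrivals(1) by linarith
  also have "lam * s * real n \<le> 1 * s * real n" using lam1 s by (intro mult_right_mono) auto
  also have "quad \<le> 1 * real n" using h by (intro mult_right_mono) (auto simp: power_le_one)
  finally have "real K * ratio K s * real n \<le> (\<Sum>v\<in>{1..n}. real (q0 v)) + s * real n + real n"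
    by (simp only: mult.assoc[symmetric] mult_1_left add.assoc[symmetric])
  then have "real K * ratio K s * real n / real n \<le> ((\<Sum>v\<in>{1..n}. real (q0 v)) + s * real n + real n) / real n"
    by (rule divide_right_mono) simp
  moreover have n0: "real n \<noteq> 0" using n_pos by simp
  ultimately show ?thesis by (simp only: add_divide_distrib nonzero_mult_div_cancel_right[OF n0] divide_self[OF n0])
qed

end

end

end

section \<open>The fluid limit for a path with good windows\<close>

definition drift :: "real => nat => (nat => real) => nat => real" where
  "drift lam d y i = lam * (y (i - 1) ^ d - y i ^ d) - (y i - y (i + 1))"

text \<open>What the limit argument needs from a window starting at \<open>s\<close>: an Euler step with quadratic error, a bound on the tail mass
  \<open>R\<close> above level \<open>K\<close>, small oscillation inside the window, and few queues at level \<open>K\<close>.\<close>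

definition window_ok :: "real => nat => real => real => real => real => nat => (real => nat => real) => (real => real) => bool" where
  "window_ok lam d C B s h K X R \<longleftrightarrow>
     (\<forall>i. 1 \<le> i \<longrightarrow> i \<le> K \<longrightarrow> \<bar>X (s + h) i - X s i - h * drift lam d (X s) i\<bar> \<le> C * h^2) \<and>
     R (s + h) \<le> R s + h * X s K + C * h^2 \<and>
     (\<forall>t. s \<le> t \<longrightarrow> t \<le> s + h \<longrightarrow> (\<forall>i. \<bar>X t i - X s i\<bar> \<le> C * h) \<and> R t \<le> R s + C * h) \<and>
     real K * X s K \<le> B"

definition wdev :: "(real => nat => real) => (real => nat => real) => nat => nat => real" where
  "wdev x X K m = (\<Sum>i\<in>{1..K}. (1 / 2) ^ i * \<bar>X (real m / real K) i - x (real m / real K) i\<bar>)"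

lemma power_lipschitz:
  fixes a b :: real
  assumes "a \<in> {0..1}" "b \<in> {0..1}" shows "\<bar>a ^ d - b ^ d\<bar> \<le> real d * \<bar>a - b\<bar>"
  using norm_power_diff[of a b d] assms by simp

lemma drift_lipschitz:
  assumes lam: "0 \<le> lam" "lam \<le> 1" and y: "\<And>j. y j \<in> {0..1}" and z: "\<And>j. z j \<in> {0..1}"
  shows "\<bar>drift lam d y i - drift lam d z i\<bar> \<le>
    real d * \<bar>y (i - 1) - z (i - 1)\<bar> + (real d + 1) * \<bar>y i - z i\<bar> + \<bar>y (i + 1) - z (i + 1)\<bar>"
proof -
  have p: "\<bar>lam * (y j ^ d - z j ^ d)\<bar> \<le> real d * \<bar>y j - z j\<bar>" for j
  proof -
    have "\<bar>lam * (y j ^ d - z j ^ d)\<bar> = lam * \<bar>y j ^ d - z j ^ d\<bar>" using lam by (simp add: abs_mult)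
    also have "... \<le> 1 * (real d * \<bar>y j - z j\<bar>)" using lam power_lipschitz[OF y z] by (intro mult_mono) auto
    finally show ?thesis by simp
  qed
  have "drift lam d y i - drift lam d z i = lam * (y (i - 1) ^ d - z (i - 1) ^ d) - lam * (y i ^ d - z i ^ d)
      - (y i - z i) + (y (i + 1) - z (i + 1))"
    by (simp add: drift_def algebra_simps)
  moreover have "\<bar>a1 - a2 - a3 + a4\<bar> \<le> \<bar>a1\<bar> + \<bar>a2\<bar> + \<bar>a3\<bar> + \<bar>a4\<bar>" for a1 a2 a3 a4 :: real by linarith
  ultimately have "\<bar>drift lam d y i - drift lam d z i\<bar> \<le> \<bar>lam * (y (i - 1) ^ d - z (i - 1) ^ d)\<bar> + \<bar>lam * (y i ^ d - z i ^ d)\<bar>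
      + \<bar>y i - z i\<bar> + \<bar>y (i + 1) - z (i + 1)\<bar>" by (simp only:)
  then show ?thesis using p[of "i - 1"] p[of i] unfolding distrib_right mult_1_left by linarith
qed

lemma drift_bound:
  assumes lam: "0 \<le> lam" "lam \<le> 1" and y: "\<And>j. y j \<in> {0..1}"
  shows "\<bar>drift lam d y i\<bar> \<le> 2"
proof -
  have "y j ^ d \<in> {0..1}" for j using y[of j] by (auto simp: power_le_one)
  from this[of "i - 1"] this[of i] have "\<bar>y (i - 1) ^ d - y i ^ d\<bar> \<le> 1" unfolding atLeastAtMost_iff by linarith
  then have "lam * \<bar>y (i - 1) ^ d - y i ^ d\<bar> \<le> 1 * 1" using lam by (intro mult_mono) auto
  then have "\<bar>lam * (y (i - 1) ^ d - y i ^ d)\<bar> \<le> 1" using lam by (simp add: abs_mult)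
  moreover have "\<bar>y i - y (i + 1)\<bar> \<le> 1" using y[of i] y[of "i + 1"] unfolding atLeastAtMost_iff by linarith
  ultimately show ?thesis unfolding drift_def by linarith
qed

lemma discrete_gronwall:
  fixes a :: "nat => real"
  assumes step: "\<And>j. j < m ==> a (Suc j) \<le> (1 + c) * a j + b" and c: "0 \<le> c" and b: "0 \<le> b"
  shows "a m \<le> (1 + c) ^ m * (a 0 + real m * b)"
  using step
proof (induction m)
  case (Suc m)
  have "a (Suc m) \<le> (1 + c) * a m + b" using Suc.prems by simp
  also have "... \<le> (1 + c) * ((1 + c) ^ m * (a 0 + real m * b)) + (1 + c) ^ Suc m * b"
  proof (intro add_mono mult_left_mono)
    have "1 * b \<le> (1 + c) ^ Suc m * b" using c b by (intro mult_right_mono one_le_power) auto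
    then show "b \<le> (1 + c) ^ Suc m * b" by simp
  qed (use Suc c in auto)
  also have "... = (1 + c) ^ Suc m * (a 0 + real (Suc m) * b)" by (simp add: algebra_simps)
  finally show ?case .
qed simp

context
  fixes lam :: real and d :: nat and x :: "real => nat => real"
  assumes lam: "0 < lam" "lam \<le> 1" and fluid: "fluid_solution lam d x"
begin

lemma fluid_range: "0 \<le> t ==> x t i \<in> {0..1}"
  using fluid by (auto simp: fluid_solution_def)

lemma fluid_mvt:
  assumes "1 \<le> i" "0 \<le> a" "a < b"
  shows "\<exists>\<xi>\<in>{a<..<b}. x b i - x a i = drift lam d (x \<xi>) i * (b - a)"
proof -
  have "((\<lambda>s. x s i) has_derivative (\<lambda>y. drift lam d (x t) i * y)) (at t within {a..b})" if "a \<le> t" "t \<le> b" for t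
  proof -
    have "((\<lambda>s. x s i) has_real_derivative drift lam d (x t) i) (at t within {0..})"
      using fluid assms that by (simp add: fluid_solution_def drift_def)
    then have "((\<lambda>s. x s i) has_real_derivative drift lam d (x t) i) (at t within {a..b})"
      by (rule DERIV_subset) (use assms in auto)
    then show ?thesis by (simp add: has_field_derivative_def)
  qed
  from mvt_simple[OF assms(3) this] show ?thesis by blast
qed

lemma fluid_lipschitz:
  assumes "0 \<le> a" "a \<le> b" shows "\<bar>x b i - x a i\<bar> \<le> 2 * (b - a)"
proof (cases "i = 0 \<or> a = b")
  case True
  then show ?thesis using fluid assms by (auto simp: fluid_solution_def)
next
  case False
  then obtain \<xi> where xi: "\<xi> \<in> {a<..<b}" "x b i - x a i = drift lam d (x \<xi>) i * (b - a)"
    using fluid_mvt[of i a b] assms by auto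
  have "\<bar>drift lam d (x \<xi>) i\<bar> \<le> 2"
    by (rule drift_bound) (use lam fluid_range xi assms in auto)
  then have "\<bar>drift lam d (x \<xi>) i\<bar> * (b - a) \<le> 2 * (b - a)" using assms by (intro mult_right_mono) auto
  then show ?thesis unfolding xi(2) abs_mult using assms by simp
qed

text \<open>The solution itself makes an Euler step with quadratic error, since it is Lipschitz.\<close>

lemma fluid_window:
  assumes i: "1 \<le> i" and s: "0 \<le> s" and h: "0 < h"
  shows "\<bar>x (s + h) i - x s i - h * drift lam d (x s) i\<bar> \<le> (4 * real d + 4) * h^2"
proof -
  obtain \<xi> where xi: "\<xi> \<in> {s<..<s + h}" "x (s + h) i - x s i = drift lam d (x \<xi>) i * (s + h - s)"
    using fluid_mvt[of i s "s + h"] assms by auto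
  have r: "x \<xi> j \<in> {0..1}" "x s j \<in> {0..1}" for j using fluid_range xi s by auto
  have l: "\<bar>x \<xi> j - x s j\<bar> \<le> 2 * h" for j using fluid_lipschitz[of s \<xi> j] xi s by auto
  have "\<bar>drift lam d (x \<xi>) i - drift lam d (x s) i\<bar> \<le>
    real d * \<bar>x \<xi> (i - 1) - x s (i - 1)\<bar> + (real d + 1) * \<bar>x \<xi> i - x s i\<bar> + \<bar>x \<xi> (i + 1) - x s (i + 1)\<bar>"
    by (rule drift_lipschitz) (use lam r in auto)
  also have "... \<le> real d * (2 * h) + (real d + 1) * (2 * h) + 2 * h"
    by (intro add_mono mult_left_mono l) auto
  also have "... = (4 * real d + 4) * h" by (simp add: algebra_simps)
  finally have "h * \<bar>drift lam d (x \<xi>) i - drift lam d (x s) i\<bar> \<le> h * ((4 * real d + 4) * h)"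
    using h by (intro mult_left_mono) auto
  moreover have "x (s + h) i - x s i - h * drift lam d (x s) i = h * (drift lam d (x \<xi>) i - drift lam d (x s) i)"
    unfolding xi(2) by (simp add: algebra_simps)
  ultimately show ?thesis using h by (simp add: abs_mult power2_eq_square mult_ac)
qed

context
  fixes X :: "real => nat => real" and R :: "real => real" and C B :: real and K M :: nat
  assumes K: "0 < K" and X01: "\<And>t i. 0 \<le> t ==> X t i \<in> {0..1}" and X0: "\<And>t. 0 \<le> t ==> X t 0 = 1" and C: "0 \<le> C"
    and win: "\<And>m. m \<le> M ==> window_ok lam d C B (real m / real K) (1 / real K) K X R"
begin

abbreviation "grid m \<equiv> real m / real K"
abbreviation "dev m i \<equiv> \<bar>X (grid m) i - x (grid m) i\<bar>"

lemma grid_Suc: "grid (Suc m) = grid m + 1 / real K"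
  by (simp add: add_divide_distrib)

lemma dev_step:
  assumes m: "m \<le> M" and i: "1 \<le> i" "i \<le> K"
  shows "dev (Suc m) i \<le> dev m i + 1 / real K * (real d * dev m (i - 1) + (real d + 1) * dev m i + dev m (i + 1))
     + (C + 4 * real d + 4) * (1 / real K)^2"
proof -
  define h where "h = 1 / real K"
  define s where "s = grid m"
  have d0: "0 < h" using K by (simp add: h_def)
  have s0: "0 \<le> s" by (simp add: s_def)
  have g: "grid (Suc m) = s + h" unfolding grid_Suc s_def h_def ..
  have 1: "\<bar>X (s + h) i - X s i - h * drift lam d (X s) i\<bar> \<le> C * h^2"
    using win[OF m] i unfolding window_ok_def s_def h_def by blast
  have 2: "\<bar>x (s + h) i - x s i - h * drift lam d (x s) i\<bar> \<le> (4 * real d + 4) * h^2"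
    by (rule fluid_window[OF i(1) s0 d0])
  let ?L = "real d * \<bar>X s (i - 1) - x s (i - 1)\<bar> + (real d + 1) * \<bar>X s i - x s i\<bar> + \<bar>X s (i + 1) - x s (i + 1)\<bar>"
  have "\<bar>drift lam d (X s) i - drift lam d (x s) i\<bar> \<le> ?L"
    by (rule drift_lipschitz) (use lam X01[OF s0] fluid_range[OF s0] in auto)
  then have "h * \<bar>drift lam d (X s) i - drift lam d (x s) i\<bar> \<le> h * ?L" using d0 by (intro mult_left_mono) auto
  then have 3: "\<bar>h * drift lam d (X s) i - h * drift lam d (x s) i\<bar> \<le> h * ?L"
    using d0 by (simp add: right_diff_distrib[symmetric] abs_mult)
  have e: "(C + 4 * real d + 4) * h^2 = C * h^2 + (4 * real d + 4) * h^2" by (simp add: algebra_simps)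
  have "\<bar>X (s + h) i - x (s + h) i\<bar> \<le> \<bar>X s i - x s i\<bar> + h * ?L + (C + 4 * real d + 4) * h^2"
  proof -
    have "\<bar>a' - b'\<bar> \<le> \<bar>a - b\<bar> + l + (p + q)"
      if "\<bar>a' - a - u\<bar> \<le> p" "\<bar>b' - b - v\<bar> \<le> q" "\<bar>u - v\<bar> \<le> l" for a a' b b' u v p q l :: real
      using that by linarith
    from this[OF 1 2 3] show ?thesis unfolding e .
  qed
  then show ?thesis unfolding g by (simp only: s_def h_def)
qed

text \<open>The derivative at level \<open>i\<close> involves level \<open>i + 1\<close>, so the levels up to \<open>K\<close> do not form a closed system. With
  the weights \<open>2\<^sup>-\<^sup>i\<close> the coupling costs a factor \<open>2\<close>, and the cut at \<open>K\<close> only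
  \<open>2\<^sup>-\<^sup>K\<close>.\<close>

lemma wdev_step:
  assumes m: "m \<le> M"
  shows "wdev x X K (Suc m) \<le> (1 + (2 * real d + 3) * (1 / real K)) * wdev x X K m + 1 / real K * ((1 / 2) ^ K + (C + 4 * real d + 4) * (1 / real K))"
proof -
  define h where "h = 1 / real K"
  define w where "w = (\<lambda>i. (1 / 2 :: real) ^ i)"
  define C' where "C' = C + 4 * real d + 4"
  have d0: "0 \<le> h" by (simp add: h_def)
  have w0: "0 \<le> w i" for i by (simp add: w_def)
  have C'0: "0 \<le> C'" using C by (simp add: C'_def)
  have Y0: "0 \<le> wdev x X K m" unfolding wdev_def by (intro sum_nonneg) auto
  have "wdev x X K (Suc m) \<le> (\<Sum>i\<in>{1..K}. w i * (dev m i + h * (real d * dev m (i - 1) + (real d + 1) * dev m i + dev m (i + 1)) + C' * h^2))"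
    unfolding wdev_def w_def[symmetric] C'_def h_def
    by (intro sum_mono mult_left_mono dev_step m) (auto simp: w_def)
  also have "... = wdev x X K m + h * (real d * (\<Sum>i\<in>{1..K}. w i * dev m (i - 1)) + (real d + 1) * wdev x X K m + (\<Sum>i\<in>{1..K}. w i * dev m (i + 1)))
      + C' * h^2 * (\<Sum>i\<in>{1..K}. w i)"
    unfolding wdev_def w_def[symmetric] by (simp add: sum.distrib sum_distrib_left distrib_left mult_ac)
  also have "... \<le> wdev x X K m + h * (real d * wdev x X K m + (real d + 1) * wdev x X K m + (2 * wdev x X K m + w K)) + C' * h^2 * 1"
  proof (intro add_mono mult_left_mono order.refl)
    have "(\<Sum>i\<in>{1..K}. w i * dev m (i - 1)) = (\<Sum>i\<in>{0..<K}. w (Suc i) * dev m i)"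
      by (rule sum.reindex_bij_witness[where i = Suc and j = "\<lambda>i. i - 1"]) auto
    also have "... \<le> (\<Sum>i\<in>{0..K}. w i * dev m i)"
      by (intro order.trans[OF sum_mono sum_mono2] mult_right_mono) (auto simp: w_def)
    also have "... = wdev x X K m"
    proof -
      have "dev m 0 = 0" using X0[of "grid m"] fluid by (simp add: fluid_solution_def)
      then show ?thesis unfolding wdev_def w_def[symmetric] by (subst sum.atLeast_Suc_atMost) auto
    qed
    finally show "(\<Sum>i\<in>{1..K}. w i * dev m (i - 1)) \<le> wdev x X K m" .
    have "(\<Sum>i\<in>{1..K}. w i * dev m (i + 1)) = (\<Sum>i\<in>{2..Suc K}. 2 * w i * dev m i)"
      by (rule sum.reindex_bij_witness[where j = Suc and i = "\<lambda>i. i - 1"]) (auto simp: w_def)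
    also have "... \<le> (\<Sum>i\<in>{1..Suc K}. 2 * w i * dev m i)" by (intro sum_mono2) (auto simp: w_def)
    also have "... = 2 * wdev x X K m + w K * dev m (Suc K)"
      unfolding wdev_def w_def[symmetric] by (simp add: sum_distrib_left w_def mult_ac)
    also have "dev m (Suc K) \<le> 1"
    proof -
      have "0 \<le> grid m" by simp
      from X01[OF this, of "Suc K"] fluid_range[OF this, of "Suc K"] show ?thesis unfolding atLeastAtMost_iff by linarith
    qed
    then have "2 * wdev x X K m + w K * dev m (Suc K) \<le> 2 * wdev x X K m + w K * 1" using w0 by (intro add_mono mult_left_mono) auto
    finally show "(\<Sum>i\<in>{1..K}. w i * dev m (i + 1)) \<le> 2 * wdev x X K m + w K" by simp
    have "(\<Sum>i\<in>{1..K}. w i) = 1 - w K" by (induction K) (auto simp: w_def)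
    then show "(\<Sum>i\<in>{1..K}. w i) \<le> 1" using w0[of K] by linarith
  qed (use d0 C'0 in auto)
  also have "... = (1 + (2 * real d + 3) * h) * wdev x X K m + h * (w K + C' * h)"
    by (simp add: algebra_simps power2_eq_square)
  finally show ?thesis unfolding h_def w_def C'_def .
qed

lemma wdev_bound:
  assumes m: "m \<le> Suc M"
  shows "wdev x X K m \<le> exp ((2 * real d + 3) * grid m) * (wdev x X K 0 + grid m * ((1 / 2) ^ K + (C + 4 * real d + 4) / real K))"
proof -
  let ?c = "(2 * real d + 3) * (1 / real K)" and ?e = "(1 / 2) ^ K + (C + 4 * real d + 4) * (1 / real K)"
  have e0: "0 \<le> ?e" using C by (intro add_nonneg_nonneg mult_nonneg_nonneg) auto
  have Y0: "0 \<le> wdev x X K 0" unfolding wdev_def by (intro sum_nonneg) auto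
  have "wdev x X K m \<le> (1 + ?c) ^ m * (wdev x X K 0 + real m * (1 / real K * ?e))"
  proof (rule discrete_gronwall)
    show "wdev x X K (Suc j) \<le> (1 + ?c) * wdev x X K j + 1 / real K * ?e" if "j < m" for j
      by (rule wdev_step) (use that m in simp)
    show "0 \<le> ?c" by (intro mult_nonneg_nonneg add_nonneg_nonneg) auto
    show "0 \<le> 1 / real K * ?e" by (rule mult_nonneg_nonneg[OF _ e0]) simp
  qed
  also have "... \<le> exp ?c ^ m * (wdev x X K 0 + real m * (1 / real K * ?e))"
  proof (intro mult_right_mono power_mono exp_ge_add_one_self)
    show "0 \<le> 1 + ?c" by (intro mult_nonneg_nonneg add_nonneg_nonneg) auto
    have "0 \<le> real m * (1 / real K * ?e)" by (intro mult_nonneg_nonneg[OF _ mult_nonneg_nonneg[OF _ e0]]) auto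
    then show "0 \<le> wdev x X K 0 + real m * (1 / real K * ?e)" using Y0 by linarith
  qed
  also have "exp ?c ^ m = exp ((2 * real d + 3) * grid m)" by (simp add: exp_of_nat_mult[symmetric] mult_ac)
  finally show ?thesis by simp
qed

lemma grid_find:
  assumes "0 \<le> t" "t * real K \<le> real M"
  obtains m where "m \<le> M" "grid m \<le> t" "t \<le> grid m + 1 / real K"
proof
  let ?m = "nat \<lfloor>t * real K\<rfloor>"
  have tK: "0 \<le> t * real K" using assms by simp
  have m: "real ?m \<le> t * real K" "t * real K \<le> real ?m + 1" using tK by linarith+
  then have "real ?m \<le> real M" using assms by linarith
  then show "?m \<le> M" by simp
  show "grid ?m \<le> t" using m(1) K by (simp add: pos_divide_le_eq)
  have "t \<le> (real ?m + 1) / real K" using m(2) K by (simp add: pos_le_divide_eq)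
  then show "t \<le> grid ?m + 1 / real K" by (simp add: add_divide_distrib)
qed

lemma coordinate_bound:
  assumes t: "0 \<le> t" "t * real K \<le> real M" and i: "1 \<le> i" "i \<le> K" and T: "t \<le> T"
  shows "\<bar>X t i - x t i\<bar> \<le> 2 ^ i * exp ((2 * real d + 3) * T) * (wdev x X K 0 + T * ((1 / 2) ^ K + (C + 4 * real d + 4) / real K)) + (C + 2) / real K"
proof -
  obtain m where m: "m \<le> M" "grid m \<le> t" "t \<le> grid m + 1 / real K" by (rule grid_find[OF t])
  let ?e = "(1 / 2) ^ K + (C + 4 * real d + 4) / real K"
  have e0: "0 \<le> ?e" using C by (intro add_nonneg_nonneg divide_nonneg_nonneg) auto
  have Y0: "0 \<le> wdev x X K 0" unfolding wdev_def by (intro sum_nonneg) auto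
  have g0: "0 \<le> grid m" by simp
  have gT: "grid m \<le> T" using m T by linarith
  have "(1 / 2) ^ i * dev m i \<le> wdev x X K m" unfolding wdev_def by (rule member_le_sum) (use i in auto)
  then have "2 ^ i * ((1 / 2) ^ i * dev m i) \<le> 2 ^ i * wdev x X K m" by (rule mult_left_mono) simp
  then have "dev m i \<le> 2 ^ i * wdev x X K m" by (simp add: mult.assoc[symmetric] power_mult_distrib[symmetric])
  also have "... \<le> 2 ^ i * (exp ((2 * real d + 3) * grid m) * (wdev x X K 0 + grid m * ?e))"
    by (intro mult_left_mono wdev_bound) (use m in auto)
  also have "... \<le> 2 ^ i * (exp ((2 * real d + 3) * T) * (wdev x X K 0 + T * ?e))"
  proof (intro mult_left_mono mult_mono)
    have "(2 * real d + 3) * grid m \<le> (2 * real d + 3) * T" by (rule mult_left_mono[OF gT]) simp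
    then show "exp ((2 * real d + 3) * grid m) \<le> exp ((2 * real d + 3) * T)" by (simp only: exp_le_cancel_iff)
    show "wdev x X K 0 + grid m * ?e \<le> wdev x X K 0 + T * ?e" using mult_right_mono[OF gT e0] by linarith
    show "0 \<le> wdev x X K 0 + grid m * ?e" using mult_nonneg_nonneg[OF g0 e0] Y0 by linarith
  qed simp_all
  finally have 1: "dev m i \<le> 2 ^ i * exp ((2 * real d + 3) * T) * (wdev x X K 0 + T * ?e)" by (simp add: mult.assoc)
  have 2: "\<bar>X t i - X (grid m) i\<bar> \<le> C * (1 / real K)" using win[OF m(1)] m unfolding window_ok_def by blast
  have 3: "\<bar>x t i - x (grid m) i\<bar> \<le> 2 * (1 / real K)" using fluid_lipschitz[OF g0 m(2), of i] m(3) by simp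
  have e: "(C + 2) / real K = C * (1 / real K) + 2 * (1 / real K)" by (simp add: add_divide_distrib)
  show ?thesis unfolding e using 1 2 3 by linarith
qed

text \<open>Each of the about \<open>T * K\<close> windows adds at most \<open>(B + C) / K\<^sup>2\<close>: a window of length \<open>1 / K\<close> brings
  arrivals above level \<open>K\<close> at a rate at most \<open>B / K\<close>.\<close>

lemma tail_bound:
  assumes t: "0 \<le> t" "t * real K \<le> real M" and T: "t \<le> T" and B0: "0 \<le> B"
  shows "R t \<le> R 0 + (T * (B + C) + C) / real K"
proof -
  obtain m where m: "m \<le> M" "grid m \<le> t" "t \<le> grid m + 1 / real K" by (rule grid_find[OF t])
  have step: "R (grid (Suc j)) \<le> R (grid j) + 1 / real K * ((B + C) / real K)" if "j \<le> M" for j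
  proof -
    have w: "R (grid j + 1 / real K) \<le> R (grid j) + 1 / real K * X (grid j) K + C * (1 / real K)^2" "real K * X (grid j) K \<le> B"
      using win[OF that] unfolding window_ok_def by blast+
    have "X (grid j) K \<le> B / real K" using w(2) K by (simp add: pos_le_divide_eq mult.commute)
    then have "1 / real K * X (grid j) K \<le> 1 / real K * (B / real K)" by (intro mult_left_mono) auto
    moreover have "1 / real K * ((B + C) / real K) = 1 / real K * (B / real K) + C * (1 / real K)^2"
      by (simp add: power2_eq_square add_divide_distrib distrib_left)
    ultimately show ?thesis unfolding grid_Suc using w(1) by linarith
  qed
  have "R (grid j) \<le> R 0 + real j * (1 / real K * ((B + C) / real K))" if "j \<le> Suc M" for j
    using that
  proof (induction j)
    case (Suc j)
    define z where "z = 1 / real K * ((B + C) / real K)"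
    have "R (grid (Suc j)) \<le> R (grid j) + z" using step[of j] Suc.prems unfolding z_def by simp
    moreover have "R (grid j) \<le> R 0 + real j * z" using Suc unfolding z_def by simp
    moreover have "real (Suc j) * z = real j * z + z" by (simp add: distrib_right)
    ultimately show ?case unfolding z_def[symmetric] by linarith
  qed simp
  from this[of m] have "R (grid m) \<le> R 0 + grid m * ((B + C) / real K)" using m by simp
  also have "grid m * ((B + C) / real K) \<le> T * ((B + C) / real K)"
    using m T B0 C by (intro mult_right_mono) auto
  finally have 1: "R (grid m) \<le> R 0 + T * ((B + C) / real K)" by simp
  have 2: "R t \<le> R (grid m) + C * (1 / real K)" using win[OF m(1)] m unfolding window_ok_def by blast
  have "(T * (B + C) + C) / real K = T * ((B + C) / real K) + C * (1 / real K)"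
    by (simp only: add_divide_distrib[of "T * (B + C)" C] times_divide_eq_right mult_1_right)
  then show ?thesis using 1 2 by linarith
qed

end

end

section \<open>Convergence of the paths\<close>

lemma eventually_along: "eventually P (along N) \<longleftrightarrow> (\<forall>\<^sub>F n in sequentially. n \<in> N \<longrightarrow> P n)"
  by (simp add: along_def eventually_inf_principal)

lemma along_nontrivial: "infinite N ==> along N \<noteq> bot"
proof
  assume N: "infinite N" "along N = bot"
  then have "eventually (\<lambda>_. False) (along N)" by simp
  then obtain m where "\<forall>n\<ge>m. n \<notin> N" by (auto simp: eventually_along eventually_sequentially)
  moreover obtain n where "n > m" "n \<in> N" using N(1) by (meson infinite_nat_iff_unbounded)
  ultimately show False by auto
qed

lemma l1_partial:
  assumes "l1_norm a \<le> ennreal e" "0 \<le> e" shows "(\<Sum>i\<in>I. \<bar>a i\<bar>) \<le> e"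
proof (cases "finite I")
  case True
  have "(\<Sum>i\<in>I. ennreal \<bar>a i\<bar>) \<le> (\<Sum>i. ennreal \<bar>a i\<bar>)"
    by (rule sum_le_suminf) (use True in auto)
  moreover have "(\<Sum>i\<in>I. ennreal \<bar>a i\<bar>) = ennreal (\<Sum>i\<in>I. \<bar>a i\<bar>)" by (rule sum_ennreal) simp
  ultimately have "ennreal (\<Sum>i\<in>I. \<bar>a i\<bar>) \<le> ennreal e"
    using assms(1) unfolding l1_norm_def by (metis order.trans)
  then show ?thesis using assms(2) by simp
qed (use assms in simp)

lemma l1_norm_le:
  assumes "\<And>J. (\<Sum>i<J. \<bar>a i\<bar>) \<le> e" shows "l1_norm a \<le> ennreal e"
  unfolding l1_norm_def
proof (rule suminf_le_const)
  fix J show "(\<Sum>i<J. ennreal \<bar>a i\<bar>) \<le> ennreal e" using assms[of J] by (simp add: ennreal_leI)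
qed simp

lemma eventually_small:
  fixes f :: "nat => real"
  assumes "f \<longlonglongrightarrow> 0" "0 < e" shows "\<forall>\<^sub>F K in sequentially. f K < e"
  using order_tendstoD(2)[OF assms] .

text \<open>The parameter \<open>K\<close> is both the inverse window length and the level at which queues are cut. It is fixed while \<open>n\<close> tends to
  infinity and chosen large in the end. The tail of \<open>x t\<close> at positive times inherits the bound of the approximating systems.\<close>

theorem fluid_convergence:
  fixes X :: "nat => real => nat => real" and R :: "nat => nat => real => real" and C T lam :: real
  assumes lam: "0 < lam" "lam \<le> 1" and fluid: "fluid_solution lam d x"
    and N: "infinite N" and T: "0 < T" and C: "0 \<le> C"
    and X01: "\<And>n t i. n \<in> N ==> 0 \<le> t ==> X n t i \<in> {0..1}" and X0: "\<And>n t. n \<in> N ==> 0 \<le> t ==> X n t 0 = 1"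
    and R: "\<And>n t K. n \<in> N ==> 0 \<le> t ==> \<exists>J. R n K t = (\<Sum>i\<in>{K<..J}. X n t i)"
      "\<And>n t K J. n \<in> N ==> 0 \<le> t ==> (\<Sum>i\<in>{K<..J}. X n t i) \<le> R n K t"
    and win: "\<And>K m. K0 \<le> K ==> \<forall>\<^sub>F n in along N. window_ok lam d C (R n 0 0 + real m / real K + 1) (real m / real K) (1 / real K) K (X n) (R n K)"
    and init: "((\<lambda>n. l1_norm (\<lambda>i. X n 0 i - x 0 i)) \<longlongrightarrow> 0) (along N)" and fin: "l1_norm (x 0) < \<infinity>"
  shows "((\<lambda>n. SUP t\<in>{0..T}. l1_norm (\<lambda>i. X n t i - x t i)) \<longlongrightarrow> 0) (along N)"
proof -
  define B0 where "B0 = enn2real (l1_norm (x 0))"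
  have B0: "0 \<le> B0" "l1_norm (x 0) \<le> ennreal B0" using fin by (auto simp: B0_def)
  have x0: "0 \<le> x 0 i" for i using fluid_range[OF lam fluid, of 0 i] by auto
  have xsum: "(\<Sum>i\<in>I. x 0 i) \<le> B0" for I using l1_partial[OF B0(2,1), of I] x0 by simp
  have xs: "summable (x 0)"
    by (rule summableI_nonneg_bounded[of _ B0]) (use x0 xsum in auto)
  define xt where "xt = (\<lambda>K. \<Sum>i. x 0 (i + Suc K))"
  have xt_le: "(\<Sum>i\<in>{K<..J}. x 0 i) \<le> xt K" for K J
  proof -
    have "(\<Sum>i\<in>{K<..J}. x 0 i) = (\<Sum>i<J - K. x 0 (i + Suc K))"
      by (rule sum.reindex_bij_witness[where j = "\<lambda>i. i - Suc K" and i = "\<lambda>i. i + Suc K"]) auto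
    also have "... \<le> xt K" unfolding xt_def
      by (rule sum_le_suminf) (use x0 summable_ignore_initial_segment[OF xs, of "Suc K"] in auto)
    finally show ?thesis .
  qed
  have xt_lim: "xt \<longlonglongrightarrow> 0"
  proof -
    have xt_eq: "xt = (\<lambda>K. suminf (x 0) - (\<Sum>i<Suc K. x 0 i))"
      unfolding xt_def by (intro ext suminf_minus_initial_segment[OF xs])
    have "(\<lambda>K. suminf (x 0) - (\<Sum>i<Suc K. x 0 i)) \<longlonglongrightarrow> suminf (x 0) - suminf (x 0)"
      by (intro tendsto_diff tendsto_const LIMSEQ_Suc summable_LIMSEQ xs)
    then show ?thesis unfolding xt_eq by (simp only: diff_self)
  qed
  have inN: "\<forall>\<^sub>F n in along N. n \<in> N" by (simp add: eventually_along)
  have start: "\<forall>\<^sub>F n in along N. l1_norm (\<lambda>i. X n 0 i - x 0 i) \<le> ennreal e" if "0 < e" for e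
    using order_tendstoD(2)[OF init, of "ennreal e"] that by (auto elim!: eventually_mono)
  have R0: "R n K 0 \<le> xt K + e" if "n \<in> N" "l1_norm (\<lambda>i. X n 0 i - x 0 i) \<le> ennreal e" "0 \<le> e" for n K e
  proof -
    have "\<exists>J. R n K 0 = (\<Sum>i\<in>{K<..J}. X n 0 i)" by (rule R(1)) (use that in auto)
    then obtain J where J: "R n K 0 = (\<Sum>i\<in>{K<..J}. X n 0 i)" by blast
    have "(\<Sum>i\<in>{K<..J}. X n 0 i) \<le> (\<Sum>i\<in>{K<..J}. x 0 i + \<bar>X n 0 i - x 0 i\<bar>)" by (intro sum_mono) auto
    also have "... \<le> xt K + e" unfolding sum.distrib by (intro add_mono xt_le l1_partial that)
    finally show ?thesis unfolding J .
  qed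
  \<comment> \<open>the last window may reach beyond \<open>T\<close> by at most \<open>1\<close>\<close>
  define B where "B = B0 + 1 + (T + 1) + 1"
  define c where "c = 2 * real d + 3"
  have start1: "\<forall>\<^sub>F n in along N. l1_norm (\<lambda>i. X n 0 i - x 0 i) \<le> ennreal 1" by (rule start) simp
  have mass: "\<forall>\<^sub>F n in along N. R n 0 0 \<le> B0 + 1"
    using inN start1
  proof eventually_elim
    case (elim n)
    have "R n 0 0 \<le> xt 0 + 1" by (rule R0) (use elim in auto)
    moreover have "xt 0 \<le> B0" unfolding xt_def
    proof (rule suminf_le_const)
      show "summable (\<lambda>i. x 0 (i + Suc 0))" by (rule summable_ignore_initial_segment[OF xs])
      fix J
      have "(\<Sum>i<J. x 0 (i + Suc 0)) = (\<Sum>i\<in>{1..J}. x 0 i)"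
        by (rule sum.reindex_bij_witness[where i = "\<lambda>i. i - 1" and j = Suc]) auto
      then show "(\<Sum>i<J. x 0 (i + Suc 0)) \<le> B0" using xsum by simp
    qed
    ultimately show ?case by simp
  qed
  have windows: "\<forall>\<^sub>F n in along N. \<forall>m\<le>nat \<lceil>T * real K\<rceil>. window_ok lam d C B (real m / real K) (1 / real K) K (X n) (R n K)"
    if K: "K0 \<le> K" "0 < K" for K
  proof -
    have "\<forall>\<^sub>F n in along N. \<forall>m\<in>{..nat \<lceil>T * real K\<rceil>}. window_ok lam d C (R n 0 0 + real m / real K + 1) (real m / real K) (1 / real K) K (X n) (R n K)"
      by (intro eventually_ball_finite ballI win K) simp
    with mass show ?thesis
    proof eventually_elim
      case (elim n)
      show ?case
      proof (intro allI impI)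
        fix m assume m: "m \<le> nat \<lceil>T * real K\<rceil>"
        moreover have "0 \<le> T * real K" using T by simp
        ultimately have "real m \<le> T * real K + 1" by linarith
        also have "... \<le> T * real K + real K" using K by simp
        finally have "real m \<le> (T + 1) * real K" by (simp add: distrib_right)
        then have "real m / real K \<le> T + 1" using K by (simp add: pos_divide_le_eq)
        then have "R n 0 0 + real m / real K + 1 \<le> B" using elim(1) unfolding B_def by linarith
        moreover have "window_ok lam d C (R n 0 0 + real m / real K + 1) (real m / real K) (1 / real K) K (X n) (R n K)"
          using elim(2) m by blast
        ultimately show "window_ok lam d C B (real m / real K) (1 / real K) K (X n) (R n K)"
          unfolding window_ok_def by (meson order.trans)
      qed
    qed
  qed
  have horizon: "t * real K \<le> real (nat \<lceil>T * real K\<rceil>)" if "t \<le> T" for t K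
  proof -
    have "t * real K \<le> T * real K" using that by (intro mult_right_mono) auto
    then show ?thesis by linarith
  qed
  \<comment> \<open>each coordinate converges, with \<open>K\<close> large enough that the deterministic error is below \<open>e / 2\<close>\<close>
  have coord: "\<forall>\<^sub>F n in along N. \<forall>t\<in>{0..T}. \<bar>X n t i - x t i\<bar> \<le> e" if e: "0 < e" for i e
  proof (cases "i = 0")
    case True
    show ?thesis using inN
    proof eventually_elim
      case (elim n)
      then show ?case using X0[OF elim] fluid e True by (auto simp: fluid_solution_def)
    qed
  next
    case False
    define a where "a = 2 ^ i * exp (c * T)"
    have a: "0 < a" by (simp add: a_def)
    have "(\<lambda>K. a * (T * ((1 / 2) ^ K + (C + 4 * real d + 4) / real K)) + (C + 2) / real K) \<longlonglongrightarrow> a * (T * (0 + 0)) + 0"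
      by (intro tendsto_intros LIMSEQ_realpow_zero lim_const_over_n) auto
    then have "(\<lambda>K. a * (T * ((1 / 2) ^ K + (C + 4 * real d + 4) / real K)) + (C + 2) / real K) \<longlonglongrightarrow> 0" by simp
    from eventually_small[OF this, of "e / 2"] obtain K1 where K1:
      "\<And>K. K1 \<le> K ==> a * (T * ((1 / 2) ^ K + (C + 4 * real d + 4) / real K)) + (C + 2) / real K < e / 2"
      using e by (auto simp: eventually_sequentially)
    define K where "K = Max {K0, K1, i, 1}"
    have K: "K0 \<le> K" "K1 \<le> K" "i \<le> K" "0 < K" by (auto simp: K_def less_Suc_eq_le)
    have e2: "0 < e / (2 * a)" using a e by simp
    show ?thesis using windows[OF K(1,4)] inN start[OF e2]
    proof eventually_elim
      case (elim n)
      have wd: "wdev x (X n) K 0 \<le> e / (2 * a)"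
      proof -
        have "wdev x (X n) K 0 \<le> (\<Sum>i\<in>{1..K}. 1 * \<bar>X n 0 i - x 0 i\<bar>)"
          unfolding wdev_def by (intro sum_mono) (simp add: mult_left_le_one_le power_le_one)
        also have "... \<le> e / (2 * a)" using l1_partial[OF elim(3), of "{1..K}"] e2 by simp
        finally show ?thesis .
      qed
      show ?case
      proof
        fix t assume t: "t \<in> {0..T}"
        have "\<bar>X n t i - x t i\<bar> \<le> 2 ^ i * exp ((2 * real d + 3) * T) * (wdev x (X n) K 0 + T * ((1 / 2) ^ K + (C + 4 * real d + 4) / real K)) + (C + 2) / real K"
        proof (rule coordinate_bound[where X = "X n" and R = "R n K" and B = B and M = "nat \<lceil>T * real K\<rceil>", OF lam fluid K(4) _ _ C])
          show "window_ok lam d C B (real m / real K) (1 / real K) K (X n) (R n K)" if "m \<le> nat \<lceil>T * real K\<rceil>" for m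
            using elim(1) that by blast
          show "t * real K \<le> real (nat \<lceil>T * real K\<rceil>)" by (rule horizon) (use t in simp)
        qed (use X01[OF elim(2)] X0[OF elim(2)] t K False in auto)
        also have "... = a * wdev x (X n) K 0 + (a * (T * ((1 / 2) ^ K + (C + 4 * real d + 4) / real K)) + (C + 2) / real K)"
          by (simp add: a_def c_def algebra_simps)
        also have "a * wdev x (X n) K 0 \<le> a * (e / (2 * a))" using wd a by (intro mult_left_mono) auto
        also have "a * (e / (2 * a)) = e / 2" using a by simp
        finally show "\<bar>X n t i - x t i\<bar> \<le> e" using K1[OF K(2)] by linarith
      qed
    qed
  qed
  \<comment> \<open>the tails are uniformly small: they are so at time \<open>0\<close> and hardly grow\<close>
  have tail: "\<forall>\<^sub>F n in along N. \<forall>t\<in>{0..T}. R n K t \<le> xt K + (T * (B + C) + C) / real K + e"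
    if K: "K0 \<le> K" "0 < K" and e: "0 < e" for K e
    using windows[OF K] inN start[OF e]
  proof eventually_elim
    case (elim n)
    show ?case
    proof
      fix t assume t: "t \<in> {0..T}"
      have "R n K t \<le> R n K 0 + (T * (B + C) + C) / real K"
      proof (rule tail_bound[where X = "X n" and R = "R n K" and B = B and M = "nat \<lceil>T * real K\<rceil>", OF lam fluid K(2) _ _ C])
        show "window_ok lam d C B (real m / real K) (1 / real K) K (X n) (R n K)" if "m \<le> nat \<lceil>T * real K\<rceil>" for m
          using elim(1) that by blast
        show "t * real K \<le> real (nat \<lceil>T * real K\<rceil>)" by (rule horizon) (use t in simp)
        show "0 \<le> B" using B0 T by (simp add: B_def)
      qed (use X01[OF elim(2)] X0[OF elim(2)] t in auto)
      also have "R n K 0 \<le> xt K + e" by (rule R0) (use elim e in auto)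
      finally show "R n K t \<le> xt K + (T * (B + C) + C) / real K + e" by simp
    qed
  qed
  have xtail: "(\<Sum>i\<in>{K<..J}. x t i) \<le> xt K + (T * (B + C) + C) / real K"
    if K: "K0 \<le> K" "0 < K" and t: "t \<in> {0..T}" for K J t
  proof (rule field_le_epsilon)
    fix e :: real assume e: "0 < e"
    define e' where "e' = e / (2 * (real J + 1))"
    have e': "0 < e'" using e by (simp add: e'_def)
    have "\<forall>\<^sub>F n in along N. \<forall>i\<in>{..J}. \<forall>t\<in>{0..T}. \<bar>X n t i - x t i\<bar> \<le> e'"
      by (intro eventually_ball_finite ballI coord e') simp
    moreover have e2: "0 < e / 2" using e by simp
    ultimately have "\<forall>\<^sub>F n in along N. n \<in> N \<and> (\<forall>i\<in>{..J}. \<forall>t\<in>{0..T}. \<bar>X n t i - x t i\<bar> \<le> e') \<and>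
       (\<forall>t\<in>{0..T}. R n K t \<le> xt K + (T * (B + C) + C) / real K + e / 2)"
      using inN tail[OF K e2] by (auto elim: eventually_elim2 intro: eventually_conj)
    then obtain n where n: "n \<in> N" "\<forall>i\<in>{..J}. \<forall>t\<in>{0..T}. \<bar>X n t i - x t i\<bar> \<le> e'"
      "\<forall>t\<in>{0..T}. R n K t \<le> xt K + (T * (B + C) + C) / real K + e / 2"
      using eventually_happens'[OF along_nontrivial[OF N]] by blast
    have "(\<Sum>i\<in>{K<..J}. x t i) \<le> (\<Sum>i\<in>{K<..J}. X n t i + e')"
    proof (rule sum_mono)
      fix i assume "i \<in> {K<..J}"
      then have "\<bar>X n t i - x t i\<bar> \<le> e'" using n(2) t by auto
      then show "x t i \<le> X n t i + e'" by linarith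
    qed
    also have "... = (\<Sum>i\<in>{K<..J}. X n t i) + real (J - K) * e'" by (simp add: sum.distrib)
    also have "(\<Sum>i\<in>{K<..J}. X n t i) \<le> R n K t" using R(2)[OF n(1)] t by auto
    also have "real (J - K) * e' \<le> (real J + 1) * e'" using e' by (intro mult_right_mono) auto
    also have "(real J + 1) * e' = e / 2" by (simp add: e'_def field_simps)
    finally show "(\<Sum>i\<in>{K<..J}. x t i) \<le> xt K + (T * (B + C) + C) / real K + e" using n(3) t by fastforce
  qed
  have small: "\<forall>\<^sub>F n in along N. \<forall>t\<in>{0..T}. l1_norm (\<lambda>i. X n t i - x t i) \<le> ennreal e" if e: "0 < e" for e
  proof -
    have "(\<lambda>K. xt K + (T * (B + C) + C) / real K) \<longlonglongrightarrow> 0 + 0"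
      by (intro tendsto_add xt_lim lim_const_over_n)
    then have "(\<lambda>K. xt K + (T * (B + C) + C) / real K) \<longlonglongrightarrow> 0" by simp
    from eventually_small[OF this, of "e / 4"] obtain K1 where K1: "\<And>K. K1 \<le> K ==> xt K + (T * (B + C) + C) / real K < e / 4"
      using e by (auto simp: eventually_sequentially)
    define K where "K = Max {K0, K1, 1}"
    have K: "K0 \<le> K" "K1 \<le> K" "0 < K" by (auto simp: K_def less_Suc_eq_le)
    define e' where "e' = e / (4 * (real K + 1))"
    have e': "0 < e'" "(real K + 1) * e' = e / 4" using e by (auto simp: e'_def field_simps)
    have e4: "0 < e / 4" using e by simp
    have "\<forall>\<^sub>F n in along N. \<forall>i\<in>{..K}. \<forall>t\<in>{0..T}. \<bar>X n t i - x t i\<bar> \<le> e'"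
      by (intro eventually_ball_finite ballI coord e') simp
    then show ?thesis using inN tail[OF K(1,3) e4]
    proof eventually_elim
      case (elim n)
      show ?case
      proof (intro ballI l1_norm_le)
        fix t J assume t: "t \<in> {0..T}"
        have "(\<Sum>i<J. \<bar>X n t i - x t i\<bar>) \<le> (\<Sum>i\<in>{..K} \<union> {K<..J}. \<bar>X n t i - x t i\<bar>)"
          by (rule sum_mono2) auto
        also have "... = (\<Sum>i\<in>{..K}. \<bar>X n t i - x t i\<bar>) + (\<Sum>i\<in>{K<..J}. \<bar>X n t i - x t i\<bar>)"
          by (rule sum.union_disjoint) auto
        also have "(\<Sum>i\<in>{..K}. \<bar>X n t i - x t i\<bar>) \<le> (\<Sum>i\<in>{..K}. e')"
          by (intro sum_mono) (use elim(1) t in auto)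
        also have "... = e / 4" using e'(2) by (simp add: add.commute)
        also have "(\<Sum>i\<in>{K<..J}. \<bar>X n t i - x t i\<bar>) \<le> (\<Sum>i\<in>{K<..J}. X n t i + x t i)"
        proof (rule sum_mono)
          fix i
          have "0 \<le> X n t i" "0 \<le> x t i" using X01[OF elim(2), of t i] fluid_range[OF lam fluid, of t i] t by auto
          then show "\<bar>X n t i - x t i\<bar> \<le> X n t i + x t i" by linarith
        qed
        also have "... = (\<Sum>i\<in>{K<..J}. X n t i) + (\<Sum>i\<in>{K<..J}. x t i)" by (rule sum.distrib)
        finally have "(\<Sum>i<J. \<bar>X n t i - x t i\<bar>) \<le> e / 4 + (\<Sum>i\<in>{K<..J}. X n t i) + (\<Sum>i\<in>{K<..J}. x t i)" by simp
        moreover have "(\<Sum>i\<in>{K<..J}. X n t i) \<le> R n K t" using R(2)[OF elim(2)] t by auto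
        moreover have "R n K t \<le> xt K + (T * (B + C) + C) / real K + e / 4" using elim(3) t by blast
        moreover note xtail[OF K(1,3) t, of J] K1[OF K(2)]
        moreover have "s \<le> e" if "s \<le> e / 4 + a + b" "a \<le> r" "r \<le> y + z + e / 4" "b \<le> y + z" "y + z < e / 4" for s a b r y z :: real
          using that by linarith
        ultimately show "(\<Sum>i<J. \<bar>X n t i - x t i\<bar>) \<le> e" by blast
      qed
    qed
  qed
  show ?thesis
  proof (rule order_tendstoI)
    fix a :: ennreal assume a: "0 < a"
    obtain e where e: "0 < e" "ennreal e < a"
    proof -
      obtain b where b: "0 < b" "b < a" using dense[OF a] by blast
      have "b < \<infinity>" using order.strict_trans2[OF b(2) top_greatest] unfolding infinity_ennreal_def .
      then show ?thesis using b by (intro that[of "enn2real b"]) (auto simp: enn2real_positive_iff)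
    qed
    show "\<forall>\<^sub>F n in along N. (SUP t\<in>{0..T}. l1_norm (\<lambda>i. X n t i - x t i)) < a"
      using small[OF e(1)]
    proof eventually_elim
      case (elim n)
      have "(SUP t\<in>{0..T}. l1_norm (\<lambda>i. X n t i - x t i)) \<le> ennreal e" using elim by (intro SUP_least) auto
      then show ?case using e(2) by (rule order.strict_trans1)
    qed
  qed (simp add: not_less_zero)
qed

section \<open>Almost all windows are good\<close>

definition mean_excess :: "nat => (nat => nat) => nat => real" where
  "mean_excess n q K = (\<Sum>v\<in>{1..n}. real (q v - K)) / real n"

lemma queue_proportion_range: "queue_proportion n q i \<in> {0..1}"
proof -
  have "card {v\<in>{1..n}. i \<le> q v} \<le> card {1..n}" by (intro card_mono) auto
  then show ?thesis by (auto simp: queue_proportion_def divide_le_eq_1)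
qed

lemma queue_proportion_0: "0 < n ==> queue_proportion n q 0 = 1"
proof -
  have "{v\<in>{1..n}. 0 \<le> q v} = {1..n}" by auto
  then show "0 < n ==> queue_proportion n q 0 = 1" by (simp add: queue_proportion_def)
qed

lemma sum_levels: "(\<Sum>i\<in>{K<..J}. queue_proportion n q i) = (\<Sum>v\<in>{1..n}. real (min J (q v) - K)) / real n"
proof -
  have "real (card {v\<in>{1..n}. i \<le> q v}) = (\<Sum>v\<in>{1..n}. of_bool (i \<le> q v))" for i
    by (simp add: Int_def of_bool_def sum.If_cases)
  then have "(\<Sum>i\<in>{K<..J}. queue_proportion n q i) = (\<Sum>i\<in>{K<..J}. \<Sum>v\<in>{1..n}. of_bool (i \<le> q v)) / real n"
    by (simp add: queue_proportion_def sum_divide_distrib)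
  also have "(\<Sum>i\<in>{K<..J}. \<Sum>v\<in>{1..n}. of_bool (i \<le> q v)) = (\<Sum>v\<in>{1..n}. \<Sum>i\<in>{K<..J}. of_bool (i \<le> q v) :: real)"
    by (rule sum.swap)
  also have "... = (\<Sum>v\<in>{1..n}. real (min J (q v) - K))"
  proof (intro sum.cong refl)
    fix v
    have "{K<..J} \<inter> {i. i \<le> q v} = {K<..min J (q v)}" by auto
    then have c: "card ({K<..J} \<inter> {i. i \<le> q v}) = min J (q v) - K" by simp
    show "(\<Sum>i\<in>{K<..J}. of_bool (i \<le> q v)) = real (min J (q v) - K)"
      unfolding c[symmetric] by (simp add: of_bool_def sum.If_cases)
  qed
  finally show ?thesis .
qed

lemma mean_excess_levels: "\<exists>J. mean_excess n q K = (\<Sum>i\<in>{K<..J}. queue_proportion n q i)"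
proof
  show "mean_excess n q K = (\<Sum>i\<in>{K<..Max (q ` {1..n})}. queue_proportion n q i)"
    unfolding sum_levels mean_excess_def by (intro arg_cong2[where f = "(/)"] sum.cong refl) (simp add: min_absorb2)
qed

lemma levels_le_mean_excess: "(\<Sum>i\<in>{K<..J}. queue_proportion n q i) \<le> mean_excess n q K"
  unfolding sum_levels mean_excess_def by (intro divide_right_mono sum_mono of_nat_mono) auto

context pod_setup
begin

text \<open>The passage from rates to proportions: outside one event of small probability, which also contains the null set of irregular paths, the window is good
  for the deterministic argument.\<close>

lemma window_event:
  fixes s h :: real and tau rho L K :: nat
  assumes s: "0 \<le> s" and h: "0 < h" "h \<le> 1" and tau: "0 < tau" "tau \<le> L"
    and mix: "\<And>B e. B \<subseteq> {1..n} ==> e \<in> G ==>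
      \<bar>(nb_op G ^^ tau) (\<lambda>e. of_bool (snd e \<in> B)) e - real (card B) / real n\<bar> \<le> h"
    and girth: "enat (2 * rho) < girth G"
    and lam1: "lam \<le> 1" and L: "real L \<le> lam * h * real n" "lam * h * real n \<le> real L + 1"
    and small: "real tau \<le> h^2 * real n" "1 \<le> h^2 * real n" "real tau * (1 / real (k - 1) ^ rho) \<le> h"
    and dh: "(real d + 2) * h \<le> 2"
  shows "\<exists>A\<in>events. prob A \<le> window_bound lam d s h K n tau L \<and>
    (\<forall>w\<in>space M - A. window_ok lam d (win_C d) (mean_excess n (\<lambda>v. Q v 0 w) 0 + s + 1) s h K
       (\<lambda>t i. queue_proportion n (\<lambda>v. Q v t w) i) (\<lambda>t. mean_excess n (\<lambda>v. Q v t w) K)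
       \<and> (\<forall>v\<in>{1..n}. Q v 0 w = q0 v))"
proof -
  have "rep_p h tau rho L \<le> 2"
  proof -
    have "lam * (h * real n) \<le> 1 * (h * real n)" using lam1 h by (intro mult_right_mono) auto
    then have "real L \<le> h * real n" using L(1) by (simp add: mult.assoc)
    then have "real (d * L) / real n \<le> real d * h" using n_pos by (simp add: divide_le_eq mult.assoc mult_left_mono)
    then show ?thesis unfolding rep_p_def using small(3) dh by (simp add: algebra_simps)
  qed
  from win_bad_rare[OF s h tau mix girth this, of K] obtain B where
    B: "B \<in> events" "win_bad s h tau rho L (Suc K) \<subseteq> B" "prob B \<le> window_bound lam d s h K n tau L"
    unfolding rare_def by auto
  define A where "A = B \<union> (space M - Om)"
  have Om0: "space M - Om \<in> events" "prob (space M - Om) = 0" using Om by (auto simp: prob_compl)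
  have A: "A \<in> events" unfolding A_def using B Om0 by auto
  have "prob A \<le> prob B + prob (space M - Om)"
    unfolding A_def by (rule measure_Un_le) (use B Om0 in auto)
  then have P: "prob A \<le> window_bound lam d s h K n tau L" using B(3) Om0(2) by linarith
  have ok: "window_ok lam d (win_C d) (mean_excess n (\<lambda>v. Q v 0 w) 0 + s + 1) s h K
       (\<lambda>t i. queue_proportion n (\<lambda>v. Q v t w) i) (\<lambda>t. mean_excess n (\<lambda>v. Q v t w) K)
       \<and> (\<forall>v\<in>{1..n}. Q v 0 w = q0 v)" if "w \<in> space M - A" for w
  proof -
    have w: "w \<in> Om" and nb: "w \<notin> win_bad s h tau rho L (Suc K)" using that B(2) by (auto simp: A_def)
    note H = s h tau mix girth lam1 L small w nb
    have qp: "queue_proportion n (\<lambda>v. Q v t w) i = real (card (lev i t w)) / real n" for t i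
      by (simp add: queue_proportion_def lev_def)
    have me: "mean_excess n (\<lambda>v. Q v t w) K = excess K t w / real n" for t K
      by (simp add: mean_excess_def excess_def)
    have e0: "excess 0 0 w = (\<Sum>v\<in>{1..n}. real (q0 v))"
      unfolding excess_def using Q_start[OF w] by (intro sum.cong) auto
    have n0: "real n \<noteq> 0" "0 < real n" using n_pos by auto
    show ?thesis
      unfolding window_ok_def qp me
    proof (intro conjI allI impI ballI)
      fix i assume "1 \<le> i" "i \<le> K"
      then show "\<bar>real (card (lev i (s + h) w)) / real n - real (card (lev i s w)) / real n -
         h * drift lam d (\<lambda>i. real (card (lev i s w)) / real n) i\<bar> \<le> win_C d * h^2"
        unfolding drift_def by (intro step_level[OF H]) auto
    next
      have "excess K (s + h) w \<le> excess K s w + h * (real (card (lev K s w)) / real n * real n) + win_C d * (h^2 * real n)"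
        by (rule step_tail[OF H le_SucI[OF order.refl]])
      then have "excess K (s + h) w / real n \<le> (excess K s w + h * (real (card (lev K s w)) / real n * real n) + win_C d * (h^2 * real n)) / real n"
        by (rule divide_right_mono) simp
      also have "... = excess K s w / real n + h * (real (card (lev K s w)) / real n) + win_C d * h^2"
        by (simp only: add_divide_distrib mult.assoc[symmetric] nonzero_mult_div_cancel_right[OF n0(1)])
      finally show "excess K (s + h) w / real n \<le> excess K s w / real n + h * (real (card (lev K s w)) / real n) + win_C d * h^2" .
    next
      fix t i assume t: "s \<le> t" "t \<le> s + h"
      show "\<bar>real (card (lev i t w)) / real n - real (card (lev i s w)) / real n\<bar> \<le> win_C d * h"
        by (rule within_level(1)[OF H t])
    next
      fix t assume t: "s \<le> t" "t \<le> s + h"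
      have "excess K t w / real n \<le> (excess K s w + win_C d * h * real n) / real n"
        by (rule divide_right_mono[OF within_level(2)[OF H t] of_nat_0_le_iff])
      then show "excess K t w / real n \<le> excess K s w / real n + win_C d * h"
        by (simp only: add_divide_distrib nonzero_mult_div_cancel_right[OF n0(1)])
    next
      show "real K * (real (card (lev K s w)) / real n) \<le> excess 0 0 w / real n + s + 1"
        unfolding e0 by (rule level_markov[OF H])
    qed (use Q_start[OF w] in auto)
  qed
  show ?thesis using A P ok by (intro bexI[of _ A]) auto
qed

end

text \<open>The squared logarithm suffices for mixing at any exponential rate, and it is below every power of \<open>n\<close>, as the failure probabilities and
  the girth need. The number is even because the contraction takes two steps.\<close>

definition mix_time :: "nat => nat" where
  "mix_time n = 2 * (nat \<lceil>(ln (real n))^2\<rceil> + 1)"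

lemma mix_time_bounds: "2 * (ln (real n))^2 \<le> real (mix_time n)" "real (mix_time n) \<le> 2 * (ln (real n))^2 + 4" "0 < mix_time n"
proof -
  define y where "y = nat \<lceil>(ln (real n))^2\<rceil>"
  have y: "real (nat \<lceil>z\<rceil>) \<le> z + 1" if "0 \<le> z" for z :: real using that by linarith
  have "(ln (real n))^2 \<le> real y" unfolding y_def by (rule real_nat_ceiling_ge)
  moreover have "real y \<le> (ln (real n))^2 + 1" unfolding y_def by (rule y) simp
  moreover have m: "mix_time n = 2 * (y + 1)" by (simp add: mix_time_def y_def)
  ultimately show "2 * (ln (real n))^2 \<le> real (mix_time n)" "real (mix_time n) \<le> 2 * (ln (real n))^2 + 4" "0 < mix_time n"
    unfolding m by simp_all
qed

lemma summable_exp_neg: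
  fixes c :: real assumes "0 < c" shows "summable (\<lambda>n. exp (- (c * real n)))"
proof -
  have "exp (- c) < 1" using assms by simp
  then have "summable (\<lambda>n. exp (- c) ^ n)" by (intro summable_geometric) simp
  then show ?thesis by (simp add: exp_of_nat_mult[symmetric] mult.commute)
qed

lemma summable_walk_bound:
  fixes lam h :: real
  assumes lam: "0 < lam" and h: "0 < h"
  shows "summable (\<lambda>n. real (mix_time n) * exp (- (h^2 * real (nat \<lfloor>lam * h * real n\<rfloor>) / (8 * real (mix_time n)))))"
proof (rule summable_comparison_test_ev)
  define a where "a = lam * h"
  define b where "b = h^2"
  have ab: "0 < a" "0 < b" using lam h by (auto simp: a_def b_def)
  have ev: "\<forall>\<^sub>F n in sequentially. (2 * (ln (real n))^2 + 4) * exp (- (b * (a * real n - 1) / (8 * (2 * (ln (real n))^2 + 4)))) \<le> real n powr - 2"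
    using ab by real_asymp
  show "\<forall>\<^sub>F n in sequentially. norm (real (mix_time n) * exp (- (h^2 * real (nat \<lfloor>lam * h * real n\<rfloor>) / (8 * real (mix_time n))))) \<le> real n powr - 2"
    using ev eventually_ge_at_top[of "nat \<lceil>1 / a\<rceil>"]
  proof eventually_elim
    case (elim n)
    note m = mix_time_bounds[of n]
    have "1 / a \<le> real n" using elim(2) by linarith
    then have an: "0 \<le> a * real n - 1" using ab by (simp add: pos_divide_le_eq mult.commute)
    have fl: "a * real n - 1 \<le> real (nat \<lfloor>lam * h * real n\<rfloor>)" unfolding a_def by linarith
    have "b * (a * real n - 1) / (8 * (2 * (ln (real n))^2 + 4)) \<le> h^2 * real (nat \<lfloor>lam * h * real n\<rfloor>) / (8 * real (mix_time n))"
      unfolding b_def using fl an m ab by (intro frac_le mult_left_mono) auto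
    then have "exp (- (h^2 * real (nat \<lfloor>lam * h * real n\<rfloor>) / (8 * real (mix_time n)))) \<le> exp (- (b * (a * real n - 1) / (8 * (2 * (ln (real n))^2 + 4))))"
      by simp
    then have "real (mix_time n) * exp (- (h^2 * real (nat \<lfloor>lam * h * real n\<rfloor>) / (8 * real (mix_time n))))
      \<le> (2 * (ln (real n))^2 + 4) * exp (- (b * (a * real n - 1) / (8 * (2 * (ln (real n))^2 + 4))))"
      using m by (intro mult_mono) auto
    then show ?case using elim(1) by simp
  qed
  show "summable (\<lambda>n. real n powr - 2)" by (simp add: summable_real_powr_iff)
qed

lemma window_bound_summable:
  assumes lam: "0 < lam" and s: "0 \<le> s" and h: "0 < h"
  shows "summable (\<lambda>n. window_bound lam d s h K n (mix_time n) (nat \<lfloor>lam * h * real n\<rfloor>))"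
proof -
  have ls: "0 \<le> lam * s" "0 \<le> lam * (s + h)" using lam s h by auto
  have p: "0 < h^4 / (8 * (lam * s + h^2))" "0 < h^4 / (8 * (lam * (s + h) + h^2))" "0 < h^4 / 8"
    using ls h by (auto intro!: divide_pos_pos add_nonneg_pos)
  have e: "summable (\<lambda>n. exp (- (h^4 * real n / 8)))" using summable_exp_neg[OF p(3)] by simp
  have w: "summable (\<lambda>n. 2 * real (mix_time n) * exp (- (h^2 * real (nat \<lfloor>lam * h * real n\<rfloor>) / (8 * real (mix_time n)))))"
    using summable_mult[OF summable_walk_bound[OF lam h], of 2] by (simp only: mult.assoc)
  show ?thesis unfolding window_bound_def
    by (intro summable_add summable_mult summable_exp_neg[OF p(1)] summable_exp_neg[OF p(2)] e w summable_walk_bound[OF lam h])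
qed

lemma expander_mixing:
  assumes ex: "expander_sequence N k \<theta> G" and k: "3 \<le> k" and h: "0 < h"
  shows "\<forall>\<^sub>F n in along N. \<forall>B e. B \<subseteq> {1..n} \<longrightarrow> e \<in> G n \<longrightarrow>
    \<bar>(nb_op (G n) ^^ mix_time n) (\<lambda>e. of_bool (snd e \<in> B)) e - real (card B) / real n\<bar> \<le> h"
proof -
  \<comment> \<open>strictly between \<open>\<theta>\<close> and \<open>k\<close>, and nonnegative: a bound for all large \<open>n\<close>\<close>
  define \<theta>' where "\<theta>' = (max \<theta> 0 + real k) / 2"
  define r where "r = \<theta>' / real k"
  have th: "\<theta> < \<theta>'" "0 \<le> \<theta>'" "\<theta>' < real k" using ex k by (auto simp: expander_sequence_def \<theta>'_def)
  have r: "0 \<le> r" "r < 1" "r * real k = \<theta>'" using th k by (auto simp: r_def)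
  define \<gamma> where "\<gamma> = 1 - (1 - r^2)^2 / 32"
  have r2: "0 \<le> r^2" "r^2 < 1" using r by (auto simp: power_less_one_iff abs_square_less_1)
  have g: "0 < \<gamma>" "\<gamma> < 1"
  proof -
    have "(1 - r^2)^2 \<le> 1" using r2 by (intro power_le_one) auto
    moreover have "0 < (1 - r^2)^2" using r2 by simp
    ultimately show "0 < \<gamma>" "\<gamma> < 1" by (auto simp: \<gamma>_def)
  qed
  define \<eta> where "\<eta> = - ln \<gamma>"
  have \<eta>: "0 < \<eta>" using g by (simp add: \<eta>_def)
  have lim: "\<forall>\<^sub>F n in sequentially. sqrt (real n * real k * exp (- \<eta> * (ln (real n))^2)) \<le> h"
  proof -
    have "((\<lambda>n. sqrt (real n * real k * exp (- \<eta> * (ln (real n))^2))) \<longlongrightarrow> 0) sequentially"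
    proof -
      have "((\<lambda>n. real n * exp (- \<eta> * (ln (real n))^2)) \<longlongrightarrow> 0) sequentially" using \<eta> by real_asymp
      then have "((\<lambda>n. sqrt (real k * (real n * exp (- \<eta> * (ln (real n))^2)))) \<longlongrightarrow> sqrt (real k * 0)) sequentially"
        by (intro tendsto_intros)
      then show ?thesis by (simp add: mult_ac)
    qed
    then show ?thesis using h by (auto dest!: order_tendstoD(2)[of _ _ _ h] elim!: eventually_mono)
  qed
  have "\<forall>\<^sub>F n in along N. ereal (second_eigenvalue n (G n)) < ereal \<theta>'"
  proof (rule Limsup_lessD)
    show "Limsup (along N) (\<lambda>n. ereal (second_eigenvalue n (G n))) < ereal \<theta>'"
      using ex th(1) unfolding expander_sequence_def by (meson ereal_less(2) less_ereal.simps(1) order.strict_trans1)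
  qed
  moreover have "\<forall>\<^sub>F n in along N. n \<in> N \<and> 2 \<le> n \<and> sqrt (real n * real k * exp (- \<eta> * (ln (real n))^2)) \<le> h"
    unfolding eventually_along using lim eventually_ge_at_top[of 2] by eventually_elim auto
  ultimately show ?thesis
  proof eventually_elim
    case (elim n)
    have graph: "regular_graph n k (G n)" using ex elim by (auto simp: expander_sequence_def)
    have se: "0 \<le> second_eigenvalue n (G n)" "second_eigenvalue n (G n) < \<theta>'"
      using elim by (auto simp: second_eigenvalue_def)
    have gap: "(\<Sum>v\<in>{1..n}. (\<Sum>w\<in>G n `` {v}. f w)^2) \<le> (r * real k)^2 * (\<Sum>v\<in>{1..n}. (f v)^2)"
      if "(\<Sum>v\<in>{1..n}. f v) = 0" for f
    proof -
      have "(\<Sum>v\<in>{1..n}. (\<Sum>w\<in>G n `` {v}. f w)^2) \<le> (second_eigenvalue n (G n))^2 * (\<Sum>v\<in>{1..n}. (f v)^2)"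
        by (rule adjacency_contraction[OF graph]) (use elim se th that in auto)
      also have "... \<le> (r * real k)^2 * (\<Sum>v\<in>{1..n}. (f v)^2)"
        unfolding r(3) using se by (intro mult_right_mono power_mono sum_nonneg) auto
      finally show ?thesis .
    qed
    show ?case
    proof (intro allI impI)
      fix B e assume B: "B \<subseteq> {1..n}" and e: "e \<in> G n"
      define m where "m = nat \<lceil>(ln (real n))^2\<rceil> + 1"
      have mt: "mix_time n = 2 * m" by (simp add: mix_time_def m_def)
      have "\<bar>(nb_op (G n) ^^ (2 * m)) (\<lambda>e. of_bool (snd e \<in> B)) e - real (card B) / real n\<bar> \<le> sqrt (real n * real k * \<gamma> ^ m)"
        unfolding \<gamma>_def by (rule nb_op_mixing[OF graph k r(1,2) _ gap B e]) (use elim in auto)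
      also have "... \<le> sqrt (real n * real k * exp (- \<eta> * (ln (real n))^2))"
      proof (intro real_sqrt_le_mono mult_left_mono)
        have m: "(ln (real n))^2 \<le> real m" using mix_time_bounds(1)[of n] unfolding mt by simp
        have "\<gamma> ^ m = exp (- \<eta> * real m)" using g by (simp add: \<eta>_def exp_of_nat2_mult)
        also have "... \<le> exp (- \<eta> * (ln (real n))^2)" using m \<eta> by simp
        finally show "\<gamma> ^ m \<le> exp (- \<eta> * (ln (real n))^2)" .
      qed simp
      also have "... \<le> h" using elim by blast
      finally show "\<bar>(nb_op (G n) ^^ mix_time n) (\<lambda>e. of_bool (snd e \<in> B)) e - real (card B) / real n\<bar> \<le> h"
        unfolding mt .
    qed
  qed
qed

text \<open>The girth condition enters as \<open>n powr (- \<alpha>)\<close>, which beats the squared logarithm.\<close>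

lemma walk_scales:
  assumes \<alpha>: "0 < \<alpha>" and k: "3 \<le> k" and lam: "0 < lam" and h: "0 < h"
  shows "\<forall>\<^sub>F n in sequentially. mix_time n \<le> nat \<lfloor>lam * h * real n\<rfloor> \<and> real (mix_time n) \<le> h^2 * real n \<and> 1 \<le> h^2 * real n
    \<and> real (mix_time n) * (1 / real (k - 1) ^ nat \<lceil>\<alpha> * log (real (k - 1)) (real n)\<rceil>) \<le> h"
proof -
  define a where "a = lam * h"
  define b where "b = h^2"
  have ab: "0 < a" "0 < b" using lam h by (auto simp: a_def b_def)
  have "\<forall>\<^sub>F n in sequentially. 2 * (ln (real n))^2 + 4 \<le> a * real n - 1" using ab by real_asymp
  moreover have "\<forall>\<^sub>F n in sequentially. 2 * (ln (real n))^2 + 4 \<le> b * real n" using ab by real_asymp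
  moreover have "\<forall>\<^sub>F n in sequentially. 1 \<le> b * real n" using ab by real_asymp
  moreover have "\<forall>\<^sub>F n in sequentially. (2 * (ln (real n))^2 + 4) * real n powr - \<alpha> \<le> h" using \<alpha> h by real_asymp
  ultimately show ?thesis using eventually_ge_at_top[of 1]
  proof eventually_elim
    case (elim n)
    note m = mix_time_bounds[of n]
    define rho where "rho = nat \<lceil>\<alpha> * log (real (k - 1)) (real n)\<rceil>"
    have k1: "1 < real (k - 1)" using k by simp
    have "real n powr \<alpha> = real (k - 1) powr (\<alpha> * log (real (k - 1)) (real n))"
      using k1 elim(5) by (simp add: powr_powr[symmetric] mult.commute[of \<alpha>])
    also have "... \<le> real (k - 1) powr real rho" using k1 unfolding rho_def by (intro powr_mono) (auto intro: real_nat_ceiling_ge)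
    also have "... = real (k - 1) ^ rho" using k1 by (simp add: powr_realpow)
    finally have pw: "real n powr \<alpha> \<le> real (k - 1) ^ rho" .
    have kn: "0 < real (k - 1) ^ rho" "0 < real n powr \<alpha>" using k1 elim(5) by auto
    have "1 / real (k - 1) ^ rho \<le> 1 / real n powr \<alpha>" by (rule divide_left_mono[OF pw zero_le_one mult_pos_pos[OF kn]])
    then have "1 / real (k - 1) ^ rho \<le> real n powr - \<alpha>" by (simp add: powr_minus_divide)
    then have "real (mix_time n) * (1 / real (k - 1) ^ rho) \<le> (2 * (ln (real n))^2 + 4) * real n powr - \<alpha>"
      using m by (intro mult_mono) auto
    then have 4: "real (mix_time n) * (1 / real (k - 1) ^ rho) \<le> h" using elim(4) by linarith
    have "real (mix_time n) \<le> real (nat \<lfloor>lam * h * real n\<rfloor>)" using m(2) elim(1) unfolding a_def by linarith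
    then have "mix_time n \<le> nat \<lfloor>lam * h * real n\<rfloor>" by simp
    moreover have "real (mix_time n) \<le> h^2 * real n" "1 \<le> h^2 * real n" using m(2) elim(2,3) unfolding b_def by linarith+
    ultimately show ?case using 4 unfolding rho_def by blast
  qed
qed

section \<open>The theorem\<close>

abbreviation "window_at lam d q0 Q s K n w \<equiv>
  window_ok lam d (win_C d) (mean_excess n (q0 n) 0 + s + 1) s (1 / real K) K
    (\<lambda>t. queue_proportion n (\<lambda>v. Q n v t w)) (\<lambda>t. mean_excess n (\<lambda>v. Q n v t w) K)"

text \<open>Borel-Cantelli over \<open>n\<close>, for one fixed window. The condition on \<open>K\<close> makes the window short enough for \<open>rep_p\<close>,
  the bound on the repeat probability, to be at most \<open>2\<close>, as the exponential inequality requires.\<close>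

lemma almost_all_windows:
  fixes M :: "'a measure" and lam \<theta> \<alpha> s :: real and d k K :: nat and q0 :: "nat => nat => nat"
  assumes lam: "0 < lam" "lam \<le> 1" and d: "0 < d" and k: "3 \<le> k" and N: "0 \<notin> N"
    and expander: "expander_sequence N k \<theta> G"
    and girth: "0 < \<alpha>" "\<forall>\<^sub>F n in along N. enat (2 * nat \<lceil>\<alpha> * log (real (k - 1)) (real n)\<rceil> + 1) < girth (G n)"
    and prob: "prob_space M"
    and system: "\<And>n. n \<in> N ==> nbrw_pod_system M lam d n (G n) (E n) (S n) (W n) (U n) (c n) (Q n)"
    and initial: "\<And>n v. n \<in> N ==> v \<in> {1..n} ==> AE w in M. Q n v 0 w = q0 n v"
    and s: "0 \<le> s" and K: "d + 2 \<le> K"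
  shows "AE w in M. \<forall>\<^sub>F n in along N. window_at lam d q0 Q s K n w"
proof -
  interpret prob_space M by (rule prob)
  define h where "h = 1 / real K"
  define L where "L = (\<lambda>n. nat \<lfloor>lam * h * real n\<rfloor>)"
  define ok where "ok = (\<lambda>n w. window_ok lam d (win_C d) (mean_excess n (q0 n) 0 + s + 1) s h K
     (\<lambda>t i. queue_proportion n (\<lambda>v. Q n v t w) i) (\<lambda>t. mean_excess n (\<lambda>v. Q n v t w) K))"
  define b where "b = (\<lambda>n. window_bound lam d s h K n (mix_time n) (L n))"
  have h: "0 < h" "h \<le> 1" using K by (auto simp: h_def)
  have dh: "(real d + 2) * h \<le> 2"
  proof -
    have "real d + 2 \<le> real K" using K by linarith
    then have "(real d + 2) * h \<le> real K * h" using h by (intro mult_right_mono) auto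
    also have "real K * h = 1" using K by (simp add: h_def)
    finally show ?thesis by simp
  qed
  have scales: "\<forall>\<^sub>F n in along N. mix_time n \<le> nat \<lfloor>lam * h * real n\<rfloor> \<and> real (mix_time n) \<le> h^2 * real n \<and> 1 \<le> h^2 * real n
    \<and> real (mix_time n) * (1 / real (k - 1) ^ nat \<lceil>\<alpha> * log (real (k - 1)) (real n)\<rceil>) \<le> h"
    unfolding eventually_along using walk_scales[OF girth(1) k lam(1) h(1)] by eventually_elim blast
  have "\<forall>\<^sub>F n in along N. n \<in> N \<longrightarrow> (\<exists>A\<in>events. prob A \<le> b n \<and> (\<forall>w\<in>space M - A. ok n w))"
    using expander_mixing[OF expander k h(1)] girth(2) scales
  proof eventually_elim
    case (elim n)
    show ?case
    proof
      assume n: "n \<in> N"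
      have n0: "0 < n" using N n by (metis gr0I)
      interpret P: pod_setup M lam d n "G n" "E n" "S n" "W n" "U n" "c n" "Q n" k "q0 n"
      proof (intro pod_setup.intro pod_setup_axioms.intro)
        show "nbrw_pod_system M lam d n (G n) (E n) (S n) (W n) (U n) (c n) (Q n)" by (rule system[OF n])
        show "regular_graph n k (G n)" using expander n by (simp add: expander_sequence_def)
        show "AE w in M. Q n v 0 w = q0 n v" if "v \<in> {1..n}" for v by (rule initial[OF n that])
      qed (use lam d k n0 in auto)
      define rho where "rho = nat \<lceil>\<alpha> * log (real (k - 1)) (real n)\<rceil>"
      have "enat (2 * rho) < girth (G n)"
        using elim(2) unfolding rho_def[symmetric] by (rule order.strict_trans[rotated]) simp
      moreover have "real (L n) \<le> lam * h * real n" "lam * h * real n \<le> real (L n) + 1"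
      proof -
        have "0 \<le> lam * h * real n" using lam h by simp
        then show "real (L n) \<le> lam * h * real n" "lam * h * real n \<le> real (L n) + 1" unfolding L_def by linarith+
      qed
      moreover have "real (mix_time n) \<le> h^2 * real n" "1 \<le> h^2 * real n" "real (mix_time n) * (1 / real (k - 1) ^ rho) \<le> h" "mix_time n \<le> L n"
        using elim(3) unfolding L_def rho_def by blast+
      moreover have "\<bar>(nb_op (G n) ^^ mix_time n) (\<lambda>e. of_bool (snd e \<in> B)) e - real (card B) / real n\<bar> \<le> h"
        if "B \<subseteq> {1..n}" "e \<in> G n" for B e using elim(1) that by blast
      ultimately obtain A where A: "A \<in> events" "prob A \<le> b n"
        "\<And>w. w \<in> space M - A ==> window_ok lam d (win_C d) (mean_excess n (\<lambda>v. Q n v 0 w) 0 + s + 1) s h K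
       (\<lambda>t i. queue_proportion n (\<lambda>v. Q n v t w) i) (\<lambda>t. mean_excess n (\<lambda>v. Q n v t w) K)
       \<and> (\<forall>v\<in>{1..n}. Q n v 0 w = q0 n v)"
        using P.window_event[OF s h mix_time_bounds(3), of n "L n" rho K] lam(2) dh unfolding b_def by blast
      have "ok n w" if "w \<in> space M - A" for w
      proof -
        have "mean_excess n (\<lambda>v. Q n v 0 w) 0 = mean_excess n (q0 n) 0"
          using A(3)[OF that] by (simp add: mean_excess_def)
        then show ?thesis using A(3)[OF that] unfolding ok_def by simp
      qed
      then show "\<exists>A\<in>events. prob A \<le> b n \<and> (\<forall>w\<in>space M - A. ok n w)" using A(1,2) by blast
    qed
  qed
  then have "\<forall>\<^sub>F n in sequentially. n \<in> N \<longrightarrow> (\<exists>A\<in>events. prob A \<le> b n \<and> (\<forall>w\<in>space M - A. ok n w))"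
    unfolding eventually_along by eventually_elim blast
  then obtain n0 where n0: "\<And>n. n0 \<le> n ==> n \<in> N ==> \<exists>A\<in>events. prob A \<le> b n \<and> (\<forall>w\<in>space M - A. ok n w)"
    by (auto simp: eventually_sequentially)
  then obtain A where A: "\<And>n. n0 \<le> n ==> n \<in> N ==> A n \<in> events \<and> prob (A n) \<le> b n \<and> (\<forall>w\<in>space M - A n. ok n w)"
    by metis
  define A' where "A' = (\<lambda>n. if n0 \<le> n \<and> n \<in> N then A n else {})"
  have A'ev: "A' n \<in> events" for n using A by (auto simp: A'_def)
  have b0: "0 \<le> b n" for n unfolding b_def window_bound_def by (intro add_nonneg_nonneg mult_nonneg_nonneg) auto
  have "summable (\<lambda>n. prob (A' n))"
  proof (rule summable_comparison_test)
    show "summable b" unfolding b_def L_def by (rule window_bound_summable[OF lam(1) s h(1)])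
    show "\<exists>m. \<forall>n\<ge>m. norm (prob (A' n)) \<le> b n" using A b0 by (auto simp: A'_def)
  qed
  then have "AE w in M. \<forall>\<^sub>F n in sequentially. w \<in> space M - A' n"
    by (intro borel_cantelli_AE1 A'ev) (auto simp: emeasure_eq_measure)
  then show ?thesis
  proof eventually_elim
    case (elim w)
    then have "\<forall>\<^sub>F n in along N. ok n w" unfolding eventually_along using eventually_ge_at_top[of n0]
    proof eventually_elim
      case (elim n)
      then show ?case using A[of n] by (auto simp: A'_def split: if_splits)
    qed
    then show ?case unfolding ok_def h_def .
  qed
qed

theorem theorem1:
  fixes M :: "'a measure"
    and lam \<theta> \<alpha> :: real and d k :: nat and N :: "nat set"
    and G :: "nat \<Rightarrow> (nat \<times> nat) set"
    and E :: "nat \<Rightarrow> nat \<Rightarrow> 'a \<Rightarrow> real"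
    and S :: "nat \<Rightarrow> nat \<Rightarrow> nat \<Rightarrow> 'a \<Rightarrow> real"
    and W :: "nat \<Rightarrow> nat \<Rightarrow> nat \<Rightarrow> 'a \<Rightarrow> nat \<times> nat"
    and U :: "nat \<Rightarrow> 'a measure"
    and c :: "nat \<Rightarrow> nat \<Rightarrow> 'a \<Rightarrow> nat"
    and Q :: "nat \<Rightarrow> nat \<Rightarrow> real \<Rightarrow> 'a \<Rightarrow> nat"
    and q0 :: "nat \<Rightarrow> nat \<Rightarrow> nat"
    and x :: "real \<Rightarrow> nat \<Rightarrow> real"
  assumes lam: "0 < lam" "lam < 1" and d: "2 \<le> d" and k: "3 \<le> k"
    and N: "infinite N" "0 \<notin> N"
    and expander: "expander_sequence N k \<theta> G"
    and girth: "0 < \<alpha>"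
      "\<forall>\<^sub>F n in along N. enat (2 * nat \<lceil>\<alpha> * log (real (k - 1)) (real n)\<rceil> + 1) < girth (G n)"
    and prob: "prob_space M"
    and system: "\<And>n. n \<in> N \<Longrightarrow> nbrw_pod_system M lam d n (G n) (E n) (S n) (W n) (U n) (c n) (Q n)"
    and fluid: "fluid_solution lam d x"
    and walkers_uniform: "\<And>n. n \<in> N \<Longrightarrow> prob_space.uniform_start M (G n) d (W n)"
    and initial_deterministic: "\<And>n v. n \<in> N \<Longrightarrow> v \<in> {1..n} \<Longrightarrow> AE \<omega> in M. Q n v 0 \<omega> = q0 n v"
    and initial_limit: "((\<lambda>n. l1_norm (\<lambda>i. queue_proportion n (q0 n) i - x 0 i)) \<longlongrightarrow> 0) (along N)"
    and initial_finite: "l1_norm (x 0) < \<infinity>"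
  shows "\<forall>T>0. AE \<omega> in M.
    ((\<lambda>n. SUP t\<in>{0..T}. l1_norm (\<lambda>i. queue_proportion n (\<lambda>v. Q n v t \<omega>) i - x t i)) \<longlongrightarrow> 0) (along N)"
proof (intro allI impI)
  fix T :: real assume T: "0 < T"
  have "AE w in M. \<forall>K m. d + 2 \<le> K \<longrightarrow> (\<forall>\<^sub>F n in along N. window_at lam d q0 Q (real m / real K) K n w)"
    unfolding AE_all_countable
  proof (intro allI)
    fix K m
    show "AE w in M. d + 2 \<le> K \<longrightarrow> (\<forall>\<^sub>F n in along N. window_at lam d q0 Q (real m / real K) K n w)"
    proof (cases "d + 2 \<le> K")
      case True
      have "AE w in M. \<forall>\<^sub>F n in along N. window_at lam d q0 Q (real m / real K) K n w"
        by (rule almost_all_windows[OF lam(1) less_imp_le[OF lam(2)] _ k N(2) expander girth prob system initial_deterministic _ True])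
          (use d in auto)
      then show ?thesis by eventually_elim simp
    qed simp
  qed
  moreover have "AE w in M. \<forall>n\<in>N. \<forall>v\<in>{1..n}. Q n v 0 w = q0 n v"
    using initial_deterministic by (simp add: AE_ball_countable countable_finite del: atLeastAtMost_iff)
  ultimately show "AE w in M. ((\<lambda>n. SUP t\<in>{0..T}. l1_norm (\<lambda>i. queue_proportion n (\<lambda>v. Q n v t w) i - x t i)) \<longlongrightarrow> 0) (along N)"
  proof eventually_elim
    case (elim w)
    have q: "queue_proportion n (\<lambda>v. Q n v 0 w) i = queue_proportion n (q0 n) i"
      "mean_excess n (\<lambda>v. Q n v 0 w) K = mean_excess n (q0 n) K" if "n \<in> N" for n i K
    proof -
      have "{v\<in>{1..n}. i \<le> Q n v 0 w} = {v\<in>{1..n}. i \<le> q0 n v}" using elim(2) that by auto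
      then show "queue_proportion n (\<lambda>v. Q n v 0 w) i = queue_proportion n (q0 n) i" by (simp only: queue_proportion_def)
      show "mean_excess n (\<lambda>v. Q n v 0 w) K = mean_excess n (q0 n) K"
        using elim(2) that by (simp add: mean_excess_def)
    qed
    have inN: "\<forall>\<^sub>F n in along N. n \<in> N" by (simp add: eventually_along)
    show ?case
    proof (rule fluid_convergence[where X = "\<lambda>n t i. queue_proportion n (\<lambda>v. Q n v t w) i" and R = "\<lambda>n K t. mean_excess n (\<lambda>v. Q n v t w) K"
          and C = "win_C d" and ?K0.0 = "d + 2", OF lam(1) less_imp_le[OF lam(2)] fluid N(1) T _ queue_proportion_range _ _ levels_le_mean_excess _ _ initial_finite])
      show "0 \<le> win_C d" unfolding win_C_def by (intro add_nonneg_nonneg mult_nonneg_nonneg) auto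
      show "queue_proportion n (\<lambda>v. Q n v t w) 0 = 1" if "n \<in> N" for n t
        using queue_proportion_0[of n] that N(2) by (metis gr0I)
      show "\<exists>J. mean_excess n (\<lambda>v. Q n v t w) K = (\<Sum>i\<in>{K<..J}. queue_proportion n (\<lambda>v. Q n v t w) i)" for n t K
        by (rule mean_excess_levels)
      show "\<forall>\<^sub>F n in along N. window_ok lam d (win_C d) (mean_excess n (\<lambda>v. Q n v 0 w) 0 + real m / real K + 1) (real m / real K) (1 / real K) K
          (\<lambda>t i. queue_proportion n (\<lambda>v. Q n v t w) i) (\<lambda>t. mean_excess n (\<lambda>v. Q n v t w) K)" if "d + 2 \<le> K" for K m
        using elim(1)[rule_format, OF that, of m] inN
      proof eventually_elim
        case (elim n)
        then show ?case using q(2)[of n 0] by simp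
      qed
      have "((\<lambda>n. l1_norm (\<lambda>i. queue_proportion n (\<lambda>v. Q n v 0 w) i - x 0 i)) \<longlongrightarrow> 0) (along N) \<longleftrightarrow>
        ((\<lambda>n. l1_norm (\<lambda>i. queue_proportion n (q0 n) i - x 0 i)) \<longlongrightarrow> 0) (along N)"
        by (rule tendsto_cong) (use inN in \<open>eventually_elim, simp add: q\<close>)
      then show "((\<lambda>n. l1_norm (\<lambda>i. queue_proportion n (\<lambda>v. Q n v 0 w) i - x 0 i)) \<longlongrightarrow> 0) (along N)"
        using initial_limit by blast
    qed
  qed
qed

end
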